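(* Let $X$ be a normal algebraic variety over $k$ with function field $K(X)$, let $D$ be a simple normal crossing divisor on $X$, and for every prime divisor $P$ in the support of $D$ choose a unit $h_P\in\kappa(P)^*$. Then the map $\mathcal W\colon K(X)^2\setminus\{(0,0)\}\to\mathrm{Div}(X)$ given by $$\mathcal W(f,g)_P=\begin{cases}\min\{\mathrm{ord}_P(f),\mathrm{ord}_P(g)\}+1,& P\in\mathrm{supp}(D)\text{ and }(f/g)(P)=h_P,\\ \min\{\mathrm{ord}_P(f),\mathrm{ord}_P(g)\},&\text{else,}\end{cases}$$ for all prime divisors $P$ of $X$, defines a Weil decoration.
   Context: Conventions: $k$ is an algebraically closed field of characteristic $0$. A normal algebraic variety over $k$ is a normal, separated, integral scheme of finite type over $k$. Write $K=K(X)$. $\mathrm{Div}(X)$ is the group of Weil divisors; $D_P$ denotes the coefficient of $D\in\mathrm{Div}(X)$ at a prime divisor $P$; $D\ge D'$ means $D-D'$ is effective; $D\wedge D'$ has coefficients $\min\{D_P,D'_P\}$. "$P\in\mathrm{supp}(D)$" means that $P$ is one of the prime components of $D$. $\mathrm{ord}_P$ is the valuation of the discrete valuation ring $\mathcal O_{X,P}$ (local ring at the generic point of $P$), with $\mathrm{ord}_P(0)=\infty$, and $\kappa(P)=\mathcal O_{X,P}/\mathfrak m_{X,P}$. For $f\in K$ the value $f(P)\in\kappa(P)\cup\{\infty\}$ is the residue class of $f$ if $f\in\mathcal O_{X,P}$, and $\infty$ otherwise; for $f\neq0$, $f/0$ has value $\infty$. A formal value $\infty$, larger than every divisor, is adjoined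 to $\mathrm{Div}(X)$, and $\mathrm{div}(0)=\infty$. A pre-Weil decoration on a finite-dimensional $K$-vector space $\mathcal V$ is a map $\mathcal W\colon\mathcal V\to\mathrm{Div}(X)\cup\{\infty\}$ with: (W0) $\mathcal W(v)=\infty$ iff $v=0$; (W1) $\mathcal W(f v)=\mathrm{div}(f)+\mathcal W(v)$ for all $f\in K$, $v\in\mathcal V$; (W2) $\mathcal W(v+v')\ge\mathcal W(v)\wedge\mathcal W(v')$. A map given only on $\mathcal V\setminus\{0\}$ is extended by $\mathcal W(0)=\infty$. Its associated sheaf is $\mathcal O_X(\mathcal W)(U)=\{v\in\mathcal V\mid\mathcal W(v)|_U\ge0\}$. A Weil decoration is a pre-Weil decoration whose associated sheaf is coherent. *)

theory Defs
  imports
    "HOL-Algebra.Algebra"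
    "HOL-Analysis.Abstract_Topology"
    "HOL-Library.Extended"
    "HOL-Library.Extended_Nat"
    "HOL-Library.Function_Algebras"
begin

section \<open>Commutative algebra\<close>

definition local_ring :: "'a ring \<Rightarrow> bool" where
  "local_ring R \<longleftrightarrow> cring R \<and> (\<exists>!M. maximalideal M R)"

definition max_ideal :: "'a ring \<Rightarrow> 'a set" where
  "max_ideal R = (THE M. maximalideal M R)"

definition residue_ring_of :: "'a ring \<Rightarrow> 'a set ring" where
  "residue_ring_of R = R Quot (max_ideal R)"

definition krull_dim :: "'a ring \<Rightarrow> enat" where
  "krull_dim R = Sup {enat n |n. \<exists>p. (\<forall>i\<le>n. primeideal (p i) R) \<and> (\<forall>i<n. p i \<subset> p (Suc i))}"

definition regular_system_of_parameters :: "'a ring \<Rightarrow> nat \<Rightarrow> (nat \<Rightarrow> 'a) \<Rightarrow> bool" where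
  "regular_system_of_parameters R d x \<longleftrightarrow>
     local_ring R \<and> noetherian_ring R \<and> krull_dim R = enat d \<and>
     x \<in> {..<d} \<rightarrow> carrier R \<and> max_ideal R = Idl\<^bsub>R\<^esub> (x ` {..<d})"

definition char_zero :: "'a ring \<Rightarrow> bool" where
  "char_zero R \<longleftrightarrow> (\<forall>n::nat. n > 0 \<longrightarrow> add_pow R n \<one>\<^bsub>R\<^esub> \<noteq> \<zero>\<^bsub>R\<^esub>)"

text \<open>The fraction \<open>a / s\<close> in the localization of \<open>R\<close> at the prime ideal \<open>P\<close>, as an equivalence
  class of pairs.\<close>

definition fraction :: "'a ring \<Rightarrow> 'a set \<Rightarrow> 'a \<Rightarrow> 'a \<Rightarrow> ('a \<times> 'a) set" where
  "fraction R P a s =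
     {(b, t). b \<in> carrier R \<and> t \<in> carrier R - P \<and>
        (\<exists>u\<in>carrier R - P. u \<otimes>\<^bsub>R\<^esub> (a \<otimes>\<^bsub>R\<^esub> t \<ominus>\<^bsub>R\<^esub> b \<otimes>\<^bsub>R\<^esub> s) = \<zero>\<^bsub>R\<^esub>)}"

definition localization :: "'a ring \<Rightarrow> 'a set \<Rightarrow> ('a \<times> 'a) set ring" where
  "localization R P =
     \<lparr>carrier = {fraction R P a s |a s. a \<in> carrier R \<and> s \<in> carrier R - P},
      monoid.mult = (\<lambda>x y. \<Union>(a, s)\<in>x. \<Union>(b, t)\<in>y. fraction R P (a \<otimes>\<^bsub>R\<^esub> b) (s \<otimes>\<^bsub>R\<^esub> t)),
      monoid.one = fraction R P \<one>\<^bsub>R\<^esub> \<one>\<^bsub>R\<^esub>,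
      ring.zero = fraction R P \<zero>\<^bsub>R\<^esub> \<one>\<^bsub>R\<^esub>,
      ring.add = (\<lambda>x y. \<Union>(a, s)\<in>x. \<Union>(b, t)\<in>y.
               fraction R P (a \<otimes>\<^bsub>R\<^esub> t \<oplus>\<^bsub>R\<^esub> b \<otimes>\<^bsub>R\<^esub> s) (s \<otimes>\<^bsub>R\<^esub> t))\<rparr>"

abbreviation fraction_field :: "'a ring \<Rightarrow> ('a \<times> 'a) set ring" where
  "fraction_field R \<equiv> localization R {\<zero>\<^bsub>R\<^esub>}"

definition integrally_closed_domain :: "'a ring \<Rightarrow> bool" where
  "integrally_closed_domain R \<longleftrightarrow> domain R \<and>
     (let F = fraction_field R; \<iota> = (\<lambda>r. fraction R {\<zero>\<^bsub>R\<^esub>} r \<one>\<^bsub>R\<^esub>) in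
      \<forall>x\<in>carrier F. \<forall>(n::nat) c.
        c \<in> {..<n} \<rightarrow> carrier R \<and>
        x [^]\<^bsub>F\<^esub> n \<oplus>\<^bsub>F\<^esub> (\<Oplus>\<^bsub>F\<^esub>i\<in>{..<n}. \<iota> (c i) \<otimes>\<^bsub>F\<^esub> x [^]\<^bsub>F\<^esub> i) = \<zero>\<^bsub>F\<^esub>
        \<longrightarrow> x \<in> \<iota> ` carrier R)"


section \<open>Locally ringed spaces\<close>

record ('x, 'a) rspace =
  topol :: "'x topology"
  sections :: "'x set \<Rightarrow> 'a ring"
  restr :: "'x set \<Rightarrow> 'x set \<Rightarrow> 'a \<Rightarrow> 'a"

text \<open>\<open>restr \<XX> U V\<close> is the restriction map from \<open>U\<close> to \<open>V \<subseteq> U\<close>. The sheaf axioms for the empty cover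
  force the sections over the empty set to be the zero ring.\<close>

locale ringed_space =
  fixes \<XX> :: "('x, 'a) rspace"
  assumes cring_sections: "openin (topol \<XX>) U \<Longrightarrow> cring (sections \<XX> U)"
    and restr_hom: "\<lbrakk>openin (topol \<XX>) U; openin (topol \<XX>) V; V \<subseteq> U\<rbrakk>
        \<Longrightarrow> restr \<XX> U V \<in> ring_hom (sections \<XX> U) (sections \<XX> V)"
    and restr_id: "\<lbrakk>openin (topol \<XX>) U; s \<in> carrier (sections \<XX> U)\<rbrakk> \<Longrightarrow> restr \<XX> U U s = s"
    and restr_comp: "\<lbrakk>openin (topol \<XX>) U; openin (topol \<XX>) V; openin (topol \<XX>) W; W \<subseteq> V; V \<subseteq> U;
          s \<in> carrier (sections \<XX> U)\<rbrakk> \<Longrightarrow> restr \<XX> V W (restr \<XX> U V s) = restr \<XX> U W s"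
    and locality: "\<lbrakk>\<And>U. U \<in> \<U> \<Longrightarrow> openin (topol \<XX>) U;
          s \<in> carrier (sections \<XX> (\<Union>\<U>)); t \<in> carrier (sections \<XX> (\<Union>\<U>));
          \<And>U. U \<in> \<U> \<Longrightarrow> restr \<XX> (\<Union>\<U>) U s = restr \<XX> (\<Union>\<U>) U t\<rbrakk> \<Longrightarrow> s = t"
    and gluing: "\<lbrakk>\<And>U. U \<in> \<U> \<Longrightarrow> openin (topol \<XX>) U;
          \<And>U. U \<in> \<U> \<Longrightarrow> \<sigma> U \<in> carrier (sections \<XX> U);
          \<And>U V. \<lbrakk>U \<in> \<U>; V \<in> \<U>\<rbrakk> \<Longrightarrow> restr \<XX> U (U \<inter> V) (\<sigma> U) = restr \<XX> V (U \<inter> V) (\<sigma> V)\<rbrakk>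
        \<Longrightarrow> \<exists>t\<in>carrier (sections \<XX> (\<Union>\<U>)). \<forall>U\<in>\<U>. restr \<XX> (\<Union>\<U>) U t = \<sigma> U"

definition germ :: "('x, 'a) rspace \<Rightarrow> 'x \<Rightarrow> 'x set \<Rightarrow> 'a \<Rightarrow> ('x set \<times> 'a) set" where
  "germ \<XX> x U s =
     {(V, t). openin (topol \<XX>) V \<and> x \<in> V \<and> t \<in> carrier (sections \<XX> V) \<and>
        (\<exists>W. openin (topol \<XX>) W \<and> x \<in> W \<and> W \<subseteq> U \<inter> V \<and> restr \<XX> U W s = restr \<XX> V W t)}"

definition stalk :: "('x, 'a) rspace \<Rightarrow> 'x \<Rightarrow> ('x set \<times> 'a) set ring" where
  "stalk \<XX> x =
     \<lparr>carrier = {germ \<XX> x U s |U s. openin (topol \<XX>) U \<and> x \<in> U \<and> s \<in> carrier (sections \<XX> U)},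
      monoid.mult = (\<lambda>A B. \<Union>(U, s)\<in>A. \<Union>(V, t)\<in>B.
        germ \<XX> x (U \<inter> V) (restr \<XX> U (U \<inter> V) s \<otimes>\<^bsub>sections \<XX> (U \<inter> V)\<^esub> restr \<XX> V (U \<inter> V) t)),
      monoid.one = germ \<XX> x (topspace (topol \<XX>)) \<one>\<^bsub>sections \<XX> (topspace (topol \<XX>))\<^esub>,
      ring.zero = germ \<XX> x (topspace (topol \<XX>)) \<zero>\<^bsub>sections \<XX> (topspace (topol \<XX>))\<^esub>,
      ring.add = (\<lambda>A B. \<Union>(U, s)\<in>A. \<Union>(V, t)\<in>B.
        germ \<XX> x (U \<inter> V) (restr \<XX> U (U \<inter> V) s \<oplus>\<^bsub>sections \<XX> (U \<inter> V)\<^esub> restr \<XX> V (U \<inter> V) t))\<rparr>"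

locale locally_ringed_space = ringed_space +
  assumes local_stalks: "x \<in> topspace (topol \<XX>) \<Longrightarrow> local_ring (stalk \<XX> x)"

record ('x, 'a, 'y, 'b) rmorphism =
  pt :: "'x \<Rightarrow> 'y"
  pull :: "'y set \<Rightarrow> 'b \<Rightarrow> 'a"

definition preimage :: "('x, 'a) rspace \<Rightarrow> ('x, 'a, 'y, 'b) rmorphism \<Rightarrow> 'y set \<Rightarrow> 'x set" where
  "preimage \<XX> f V = {x \<in> topspace (topol \<XX>). pt f x \<in> V}"

definition stalk_map ::
    "('x, 'a) rspace \<Rightarrow> ('x, 'a, 'y, 'b) rmorphism \<Rightarrow> 'x \<Rightarrow> ('y set \<times> 'b) set \<Rightarrow> ('x set \<times> 'a) set" where
  "stalk_map \<XX> f x A = (\<Union>(V, s)\<in>A. germ \<XX> x (preimage \<XX> f V) (pull f V s))"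

definition lrs_morphism ::
    "('x, 'a) rspace \<Rightarrow> ('y, 'b) rspace \<Rightarrow> ('x, 'a, 'y, 'b) rmorphism \<Rightarrow> bool" where
  "lrs_morphism \<XX> Y f \<longleftrightarrow>
     continuous_map (topol \<XX>) (topol Y) (pt f) \<and>
     (\<forall>V. openin (topol Y) V \<longrightarrow> pull f V \<in> ring_hom (sections Y V) (sections \<XX> (preimage \<XX> f V))) \<and>
     (\<forall>V W. openin (topol Y) V \<and> openin (topol Y) W \<and> W \<subseteq> V \<longrightarrow>
        (\<forall>s\<in>carrier (sections Y V).
           pull f W (restr Y V W s) = restr \<XX> (preimage \<XX> f V) (preimage \<XX> f W) (pull f V s))) \<and>
     (\<forall>x\<in>topspace (topol \<XX>). \<forall>A\<in>max_ideal (stalk Y (pt f x)). stalk_map \<XX> f x A \<in> max_ideal (stalk \<XX> x))"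

definition lrs_isomorphism ::
    "('x, 'a) rspace \<Rightarrow> ('y, 'b) rspace \<Rightarrow> ('x, 'a, 'y, 'b) rmorphism \<Rightarrow> bool" where
  "lrs_isomorphism \<XX> Y f \<longleftrightarrow>
     lrs_morphism \<XX> Y f \<and> homeomorphic_map (topol \<XX>) (topol Y) (pt f) \<and>
     (\<forall>V. openin (topol Y) V \<longrightarrow>
        bij_betw (pull f V) (carrier (sections Y V)) (carrier (sections \<XX> (preimage \<XX> f V))))"

definition open_subspace :: "('x, 'a) rspace \<Rightarrow> 'x set \<Rightarrow> ('x, 'a) rspace" where
  "open_subspace \<XX> U = \<XX>\<lparr>topol := subtopology (topol \<XX>) U\<rparr>"


section \<open>Schemes\<close>

definition prime_spectrum :: "'a ring \<Rightarrow> 'a set set" where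
  "prime_spectrum R = {P. primeideal P R}"

definition zariski_topology :: "'a ring \<Rightarrow> 'a set topology" where
  "zariski_topology R = topology (\<lambda>U. \<exists>S\<subseteq>carrier R. U = {P \<in> prime_spectrum R. \<not> S \<subseteq> P})"

lemma openin_zariski_topology:
  assumes "cring R"
  shows "openin (zariski_topology R) U \<longleftrightarrow> (\<exists>S\<subseteq>carrier R. U = {P \<in> prime_spectrum R. \<not> S \<subseteq> P})"
proof -
  interpret cring R by fact
  define N where "N S = {P \<in> prime_spectrum R. \<not> S \<subseteq> P}" for S
  have inter: "\<exists>ST\<subseteq>carrier R. N S \<inter> N T = N ST" if S: "S \<subseteq> carrier R" and T: "T \<subseteq> carrier R" for S T
  proof (intro exI conjI)
    let ?ST = "(\<lambda>(s, t). s \<otimes>\<^bsub>R\<^esub> t) ` (S \<times> T)"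
    show "?ST \<subseteq> carrier R" using S T by auto
    have "\<not> ?ST \<subseteq> P \<longleftrightarrow> \<not> S \<subseteq> P \<and> \<not> T \<subseteq> P" if "primeideal P R" for P
    proof -
      interpret P: primeideal P R by fact
      have "s \<otimes>\<^bsub>R\<^esub> t \<in> P \<longleftrightarrow> s \<in> P \<or> t \<in> P" if "s \<in> S" "t \<in> T" for s t
        using that S T P.I_prime P.I_l_closed P.I_r_closed by blast
      then show ?thesis by fastforce
    qed
    then show "N S \<inter> N T = N ?ST"
      unfolding N_def prime_spectrum_def by blast
  qed
  have union: "\<exists>S\<subseteq>carrier R. \<Union>\<U> = N S" if opens: "\<forall>U\<in>\<U>. \<exists>S\<subseteq>carrier R. U = N S" for \<U>
  proof (intro exI conjI)
    let ?SS = "\<Union>{S. S \<subseteq> carrier R \<and> N S \<in> \<U>}"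
    show "?SS \<subseteq> carrier R" by blast
    show "\<Union>\<U> = N ?SS"
    proof (intro subset_antisym subsetI)
      fix P assume "P \<in> \<Union>\<U>"
      then obtain S where "S \<subseteq> carrier R" "N S \<in> \<U>" "P \<in> N S" using opens by (metis UnionE)
      then show "P \<in> N ?SS" unfolding N_def by blast
    next
      fix P assume "P \<in> N ?SS"
      then obtain S where "N S \<in> \<U>" "\<not> S \<subseteq> P" "P \<in> prime_spectrum R" unfolding N_def by blast
      then have "P \<in> N S" unfolding N_def by simp
      then show "P \<in> \<Union>\<U>" using \<open>N S \<in> \<U>\<close> by (rule UnionI[rotated])
    qed
  qed
  have "istopology (\<lambda>U. \<exists>S\<subseteq>carrier R. U = N S)"
    unfolding istopology_def
  proof (intro conjI allI impI)
    fix U V assume "\<exists>S\<subseteq>carrier R. U = N S" "\<exists>S\<subseteq>carrier R. V = N S"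
    then show "\<exists>S\<subseteq>carrier R. U \<inter> V = N S" using inter by (elim exE conjE) simp
  next
    fix \<U> assume "\<forall>U\<in>\<U>. \<exists>S\<subseteq>carrier R. U = N S"
    then show "\<exists>S\<subseteq>carrier R. \<Union>\<U> = N S" by (rule union)
  qed
  then show ?thesis
    unfolding zariski_topology_def N_def by (simp add: topology_inverse')
qed

definition Spec :: "'a ring \<Rightarrow> ('a set, 'a set \<Rightarrow> ('a \<times> 'a) set) rspace" where
  "Spec R =
     \<lparr>topol = zariski_topology R,
      sections = (\<lambda>U.
        \<lparr>carrier = {s \<in> (\<Pi>\<^sub>E P\<in>U. carrier (localization R P)).
           \<forall>P\<in>U. \<exists>V a f. openin (zariski_topology R) V \<and> P \<in> V \<and> V \<subseteq> U \<and>
             a \<in> carrier R \<and> f \<in> carrier R \<and> (\<forall>Q\<in>V. f \<notin> Q \<and> s Q = fraction R Q a f)},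
         monoid.mult = (\<lambda>s t. \<lambda>P\<in>U. s P \<otimes>\<^bsub>localization R P\<^esub> t P),
         monoid.one = (\<lambda>P\<in>U. \<one>\<^bsub>localization R P\<^esub>),
         ring.zero = (\<lambda>P\<in>U. \<zero>\<^bsub>localization R P\<^esub>),
         ring.add = (\<lambda>s t. \<lambda>P\<in>U. s P \<oplus>\<^bsub>localization R P\<^esub> t P)\<rparr>),
      restr = (\<lambda>U V s. restrict s V)\<rparr>"

text \<open>A ring \<open>R\<close> whose spectrum is isomorphic to \<open>U\<close> is isomorphic to the ring of sections over \<open>U\<close>,
  so it is no loss to take \<open>R\<close> over the same type.\<close>

definition affine_open :: "('x, 'a) rspace \<Rightarrow> 'x set \<Rightarrow> bool" where
  "affine_open \<XX> U \<longleftrightarrow> openin (topol \<XX>) U \<and>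
     (\<exists>(R :: 'a ring) f. cring R \<and> lrs_isomorphism (open_subspace \<XX> U) (Spec R) f)"

definition scheme :: "('x, 'a) rspace \<Rightarrow> bool" where
  "scheme \<XX> \<longleftrightarrow> locally_ringed_space \<XX> \<and> (\<forall>x\<in>topspace (topol \<XX>). \<exists>U. x \<in> U \<and> affine_open \<XX> U)"

definition integral_scheme :: "('x, 'a) rspace \<Rightarrow> bool" where
  "integral_scheme \<XX> \<longleftrightarrow> scheme \<XX> \<and> topspace (topol \<XX>) \<noteq> {} \<and>
     (\<forall>U. openin (topol \<XX>) U \<and> U \<noteq> {} \<longrightarrow> domain (sections \<XX> U))"

definition normal_scheme :: "('x, 'a) rspace \<Rightarrow> bool" where
  "normal_scheme \<XX> \<longleftrightarrow> scheme \<XX> \<and> (\<forall>x\<in>topspace (topol \<XX>). integrally_closed_domain (stalk \<XX> x))"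

text \<open>The diagonal is a closed immersion, read off on the affine charts
  \<open>Spec (\<O>(U) \<otimes> \<O>(V))\<close> of the fibre product of \<open>\<XX>\<close> with itself over an affine base: the preimage
  \<open>U \<inter> V\<close> of each chart is affine and \<open>\<O>(U) \<otimes> \<O>(V) \<rightarrow> \<O>(U \<inter> V)\<close> is surjective. Over which
  affine base the tensor product is formed does not affect surjectivity.\<close>

definition separated_scheme :: "('x, 'a) rspace \<Rightarrow> bool" where
  "separated_scheme \<XX> \<longleftrightarrow> scheme \<XX> \<and>
     (\<forall>U V. affine_open \<XX> U \<and> affine_open \<XX> V \<longrightarrow> affine_open \<XX> (U \<inter> V) \<and>
        (\<forall>t\<in>carrier (sections \<XX> (U \<inter> V)). \<exists>(n::nat) a b.
           a \<in> {..<n} \<rightarrow> carrier (sections \<XX> U) \<and> b \<in> {..<n} \<rightarrow> carrier (sections \<XX> V) \<and>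
           t = (\<Oplus>\<^bsub>sections \<XX> (U \<inter> V)\<^esub>i\<in>{..<n}.
                  restr \<XX> U (U \<inter> V) (a i) \<otimes>\<^bsub>sections \<XX> (U \<inter> V)\<^esub> restr \<XX> V (U \<inter> V) (b i))))"

text \<open>The ring homomorphism \<open>k \<rightarrow> \<O>(U)\<close> induced by a morphism \<open>\<pi>\<close> from \<open>\<XX>\<close> to \<open>Spec k\<close>.\<close>

definition scalar_map ::
    "'k ring \<Rightarrow> ('x, 'a) rspace \<Rightarrow> ('x, 'a, 'k set, 'k set \<Rightarrow> ('k \<times> 'k) set) rmorphism \<Rightarrow>
     'x set \<Rightarrow> 'k \<Rightarrow> 'a" where
  "scalar_map k \<XX> \<pi> U c =
     restr \<XX> (topspace (topol \<XX>)) U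
       (pull \<pi> (prime_spectrum k) (\<lambda>P\<in>prime_spectrum k. fraction k P c \<one>\<^bsub>k\<^esub>))"

definition finite_type_over ::
    "'k ring \<Rightarrow> ('x, 'a) rspace \<Rightarrow> ('x, 'a, 'k set, 'k set \<Rightarrow> ('k \<times> 'k) set) rmorphism \<Rightarrow> bool" where
  "finite_type_over k \<XX> \<pi> \<longleftrightarrow>
     (\<exists>\<U>. finite \<U> \<and> \<Union>\<U> = topspace (topol \<XX>) \<and>
        (\<forall>U\<in>\<U>. affine_open \<XX> U \<and>
           (\<exists>S\<subseteq>carrier (sections \<XX> U). finite S \<and>
              generate_ring (sections \<XX> U) (scalar_map k \<XX> \<pi> U ` carrier k \<union> S)
                = carrier (sections \<XX> U))))"

definition normal_variety ::
    "'k ring \<Rightarrow> ('x, 'a) rspace \<Rightarrow> ('x, 'a, 'k set, 'k set \<Rightarrow> ('k \<times> 'k) set) rmorphism \<Rightarrow> bool" where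
  "normal_variety k \<XX> \<pi> \<longleftrightarrow>
     integral_scheme \<XX> \<and> separated_scheme \<XX> \<and> normal_scheme \<XX> \<and>
     lrs_morphism \<XX> (Spec k) \<pi> \<and> finite_type_over k \<XX> \<pi>"


section \<open>Weil divisors\<close>

definition irreducible_closed :: "'x topology \<Rightarrow> 'x set \<Rightarrow> bool" where
  "irreducible_closed T Z \<longleftrightarrow> closedin T Z \<and> Z \<noteq> {} \<and>
     (\<forall>A B. closedin T A \<and> closedin T B \<and> Z \<subseteq> A \<union> B \<longrightarrow> Z \<subseteq> A \<or> Z \<subseteq> B)"

definition codim :: "'x topology \<Rightarrow> 'x set \<Rightarrow> enat" where
  "codim T Z = Sup {enat n |n. \<exists>C. C 0 = Z \<and> (\<forall>i\<le>n. irreducible_closed T (C i)) \<and>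
     (\<forall>i<n. C i \<subset> C (Suc i))}"

definition generic_point :: "('x, 'a) rspace \<Rightarrow> 'x set \<Rightarrow> 'x" where
  "generic_point \<XX> Z = (THE z. z \<in> topspace (topol \<XX>) \<and> Abstract_Topology.closure_of (topol \<XX>) {z} = Z)"

text \<open>Prime divisors are represented by their underlying closed subsets.\<close>

definition prime_divisor :: "('x, 'a) rspace \<Rightarrow> 'x set \<Rightarrow> bool" where
  "prime_divisor \<XX> P \<longleftrightarrow> irreducible_closed (topol \<XX>) P \<and> codim (topol \<XX>) P = 1"

definition weil_divisors :: "('x, 'a) rspace \<Rightarrow> ('x set \<Rightarrow> int) set" where
  "weil_divisors \<XX> = {D. (\<forall>P. D P \<noteq> 0 \<longrightarrow> prime_divisor \<XX> P) \<and> finite {P. D P \<noteq> 0}}"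

definition supp :: "('x set \<Rightarrow> int) \<Rightarrow> 'x set set" where
  "supp D = {P. D P \<noteq> 0}"

definition function_field :: "('x, 'a) rspace \<Rightarrow> ('x set \<times> 'a) set ring" where
  "function_field \<XX> = stalk \<XX> (generic_point \<XX> (topspace (topol \<XX>)))"

definition section_to_K :: "('x, 'a) rspace \<Rightarrow> 'x set \<Rightarrow> 'a \<Rightarrow> ('x set \<times> 'a) set" where
  "section_to_K \<XX> U s = germ \<XX> (generic_point \<XX> (topspace (topol \<XX>))) U s"

definition stalk_to_K :: "('x, 'a) rspace \<Rightarrow> ('x set \<times> 'a) set \<Rightarrow> ('x set \<times> 'a) set" where
  "stalk_to_K \<XX> A = (\<Union>(U, s)\<in>A. section_to_K \<XX> U s)"

definition local_ring_at :: "('x, 'a) rspace \<Rightarrow> 'x set \<Rightarrow> ('x set \<times> 'a) set ring" where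
  "local_ring_at \<XX> P = stalk \<XX> (generic_point \<XX> P)"

definition residue_field_at :: "('x, 'a) rspace \<Rightarrow> 'x set \<Rightarrow> ('x set \<times> 'a) set set ring" where
  "residue_field_at \<XX> P = residue_ring_of (local_ring_at \<XX> P)"

text \<open>A nonzero \<open>f\<close> has order \<open>n\<close> along \<open>P\<close> if \<open>f = u t\<^sup>n\<close> for a unit \<open>u\<close> and a uniformizer \<open>t\<close>
  of the discrete valuation ring at \<open>P\<close>.\<close>

definition ord :: "('x, 'a) rspace \<Rightarrow> 'x set \<Rightarrow> ('x set \<times> 'a) set \<Rightarrow> int extended" where
  "ord \<XX> P f =
     (let K = function_field \<XX>; R = local_ring_at \<XX> P in
      if f = \<zero>\<^bsub>K\<^esub> then Pinf
      else Fin (THE n::int. \<exists>t\<in>carrier R. \<exists>u\<in>Units R. max_ideal R = PIdl\<^bsub>R\<^esub> t \<and>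
                  f = stalk_to_K \<XX> u \<otimes>\<^bsub>K\<^esub> (stalk_to_K \<XX> t) [^]\<^bsub>K\<^esub> n))"

text \<open>The value of a rational function along \<open>P\<close>; \<open>None\<close> stands for the value \<open>\<infinity>\<close>.\<close>

definition value_at ::
    "('x, 'a) rspace \<Rightarrow> 'x set \<Rightarrow> ('x set \<times> 'a) set \<Rightarrow> ('x set \<times> 'a) set set option" where
  "value_at \<XX> P f =
     (let R = local_ring_at \<XX> P in
      if f \<in> stalk_to_K \<XX> ` carrier R
      then Some (max_ideal R +>\<^bsub>R\<^esub> (THE a. a \<in> carrier R \<and> stalk_to_K \<XX> a = f))
      else None)"

definition quotient_value_at ::
    "('x, 'a) rspace \<Rightarrow> 'x set \<Rightarrow> ('x set \<times> 'a) set \<Rightarrow> ('x set \<times> 'a) set \<Rightarrow>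
     ('x set \<times> 'a) set set option" where
  "quotient_value_at \<XX> P f g =
     (let K = function_field \<XX> in
      if g = \<zero>\<^bsub>K\<^esub> then None else value_at \<XX> P (f \<otimes>\<^bsub>K\<^esub> inv\<^bsub>K\<^esub> g))"

text \<open>\<open>Div(\<XX>) \<union> {\<infinity>}\<close> is the following subset of \<^typ>\<open>('x set \<Rightarrow> int) extended\<close>, with \<open>Pinf\<close> in the role
  of \<open>\<infinity>\<close>; the library order, sum and infimum on this type are the coefficientwise ones.\<close>

definition extended_divisors :: "('x, 'a) rspace \<Rightarrow> ('x set \<Rightarrow> int) extended set" where
  "extended_divisors \<XX> = insert Pinf (Fin ` weil_divisors \<XX>)"

definition fin_part :: "int extended \<Rightarrow> int" where
  "fin_part e = (case e of Fin n \<Rightarrow> n | _ \<Rightarrow> 0)"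

definition principal_divisor ::
    "('x, 'a) rspace \<Rightarrow> ('x set \<times> 'a) set \<Rightarrow> ('x set \<Rightarrow> int) extended" where
  "principal_divisor \<XX> f =
     (if f = \<zero>\<^bsub>function_field \<XX>\<^esub> then Pinf
      else Fin (\<lambda>P. if prime_divisor \<XX> P then fin_part (ord \<XX> P f) else 0))"

text \<open>At every point \<open>x\<close> of \<open>D\<close> the local ring is regular and \<open>D\<close> is cut out near \<open>x\<close> by
  a product \<open>y\<^sub>1 \<cdots> y\<^sub>r\<close> of members of a regular system of parameters. In particular \<open>D\<close> is reduced,
  and \<open>\<XX>\<close> is regular along \<open>D\<close> but possibly not elsewhere.\<close>

definition snc_divisor :: "('x, 'a) rspace \<Rightarrow> ('x set \<Rightarrow> int) \<Rightarrow> bool" where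
  "snc_divisor \<XX> D \<longleftrightarrow> D \<in> weil_divisors \<XX> \<and>
     (\<forall>x\<in>\<Union>(supp D). \<exists>d r y.
        regular_system_of_parameters (stalk \<XX> x) d y \<and> 1 \<le> r \<and> r \<le> d \<and>
        (\<forall>P. prime_divisor \<XX> P \<and> x \<in> P \<longrightarrow>
           ord \<XX> P (stalk_to_K \<XX> (\<Otimes>\<^bsub>stalk \<XX> x\<^esub>i\<in>{..<r}. y i)) = Fin (D P)))"


section \<open>Coherent sheaves\<close>

text \<open>The ring multiplication and unit contained in the record type of modules play no role and are
  left unspecified below.\<close>

record ('x, 'a, 'm) mod_sheaf =
  msections :: "'x set \<Rightarrow> ('a, 'm) module"
  mrestr :: "'x set \<Rightarrow> 'x set \<Rightarrow> 'm \<Rightarrow> 'm"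

locale sheaf_of_modules = ringed_space \<XX>
  for \<XX> :: "('x, 'a) rspace" and F :: "('x, 'a, 'm) mod_sheaf" +
  assumes module_sections: "openin (topol \<XX>) U \<Longrightarrow> Module.module (sections \<XX> U) (msections F U)"
    and mrestr_closed: "\<lbrakk>openin (topol \<XX>) U; openin (topol \<XX>) V; V \<subseteq> U; s \<in> carrier (msections F U)\<rbrakk>
        \<Longrightarrow> mrestr F U V s \<in> carrier (msections F V)"
    and mrestr_add: "\<lbrakk>openin (topol \<XX>) U; openin (topol \<XX>) V; V \<subseteq> U;
          s \<in> carrier (msections F U); t \<in> carrier (msections F U)\<rbrakk>
        \<Longrightarrow> mrestr F U V (s \<oplus>\<^bsub>msections F U\<^esub> t) = mrestr F U V s \<oplus>\<^bsub>msections F V\<^esub> mrestr F U V t"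
    and mrestr_smult: "\<lbrakk>openin (topol \<XX>) U; openin (topol \<XX>) V; V \<subseteq> U;
          a \<in> carrier (sections \<XX> U); s \<in> carrier (msections F U)\<rbrakk>
        \<Longrightarrow> mrestr F U V (a \<odot>\<^bsub>msections F U\<^esub> s) = restr \<XX> U V a \<odot>\<^bsub>msections F V\<^esub> mrestr F U V s"
    and mrestr_id: "\<lbrakk>openin (topol \<XX>) U; s \<in> carrier (msections F U)\<rbrakk> \<Longrightarrow> mrestr F U U s = s"
    and mrestr_comp: "\<lbrakk>openin (topol \<XX>) U; openin (topol \<XX>) V; openin (topol \<XX>) W; W \<subseteq> V; V \<subseteq> U;
          s \<in> carrier (msections F U)\<rbrakk> \<Longrightarrow> mrestr F V W (mrestr F U V s) = mrestr F U W s"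
    and mlocality: "\<lbrakk>\<And>U. U \<in> \<U> \<Longrightarrow> openin (topol \<XX>) U;
          s \<in> carrier (msections F (\<Union>\<U>)); t \<in> carrier (msections F (\<Union>\<U>));
          \<And>U. U \<in> \<U> \<Longrightarrow> mrestr F (\<Union>\<U>) U s = mrestr F (\<Union>\<U>) U t\<rbrakk> \<Longrightarrow> s = t"
    and mgluing: "\<lbrakk>\<And>U. U \<in> \<U> \<Longrightarrow> openin (topol \<XX>) U;
          \<And>U. U \<in> \<U> \<Longrightarrow> \<sigma> U \<in> carrier (msections F U);
          \<And>U V. \<lbrakk>U \<in> \<U>; V \<in> \<U>\<rbrakk> \<Longrightarrow> mrestr F U (U \<inter> V) (\<sigma> U) = mrestr F V (U \<inter> V) (\<sigma> V)\<rbrakk>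
        \<Longrightarrow> \<exists>t\<in>carrier (msections F (\<Union>\<U>)). \<forall>U\<in>\<U>. mrestr F (\<Union>\<U>) U t = \<sigma> U"

text \<open>The image of \<open>a\<close> under the map \<open>\<O>(V)\<^sup>n \<rightarrow> F(V)\<close> given by sections \<open>s\<close> of \<open>F\<close> over \<open>U \<supseteq> V\<close>.\<close>

definition lin_comb ::
    "('x, 'a, 'm) mod_sheaf \<Rightarrow> 'x set \<Rightarrow> nat \<Rightarrow> (nat \<Rightarrow> 'm) \<Rightarrow> 'x set \<Rightarrow> (nat \<Rightarrow> 'a) \<Rightarrow> 'm" where
  "lin_comb F U n s V a = (\<Oplus>\<^bsub>msections F V\<^esub>i\<in>{..<n}. a i \<odot>\<^bsub>msections F V\<^esub> mrestr F U V (s i))"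

definition generated_over ::
    "('x, 'a) rspace \<Rightarrow> ('x, 'a, 'm) mod_sheaf \<Rightarrow> 'x set \<Rightarrow> nat \<Rightarrow> (nat \<Rightarrow> 'm) \<Rightarrow> bool" where
  "generated_over \<XX> F U n s \<longleftrightarrow>
     (\<forall>V t x. openin (topol \<XX>) V \<and> V \<subseteq> U \<and> t \<in> carrier (msections F V) \<and> x \<in> V \<longrightarrow>
        (\<exists>W a. openin (topol \<XX>) W \<and> x \<in> W \<and> W \<subseteq> V \<and> a \<in> {..<n} \<rightarrow> carrier (sections \<XX> W) \<and>
           mrestr F V W t = lin_comb F U n s W a))"

definition finite_type_sheaf :: "('x, 'a) rspace \<Rightarrow> ('x, 'a, 'm) mod_sheaf \<Rightarrow> bool" where
  "finite_type_sheaf \<XX> F \<longleftrightarrow>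
     (\<forall>x\<in>topspace (topol \<XX>). \<exists>U n s. openin (topol \<XX>) U \<and> x \<in> U \<and>
        s \<in> {..<n} \<rightarrow> carrier (msections F U) \<and> generated_over \<XX> F U n s)"

text \<open>The kernel of the morphism from the free module of rank \<open>n\<close> on \<open>U\<close> to the restriction of
  \<open>F\<close> to \<open>U\<close> given by \<open>s\<close>.\<close>

definition relation_sheaf ::
    "('x, 'a) rspace \<Rightarrow> ('x, 'a, 'm) mod_sheaf \<Rightarrow> 'x set \<Rightarrow> nat \<Rightarrow> (nat \<Rightarrow> 'm) \<Rightarrow>
     ('x, 'a, nat \<Rightarrow> 'a) mod_sheaf" where
  "relation_sheaf \<XX> F U n s =
     \<lparr>msections = (\<lambda>V.
        \<lparr>carrier = {a \<in> {..<n} \<rightarrow>\<^sub>E carrier (sections \<XX> V). lin_comb F U n s V a = \<zero>\<^bsub>msections F V\<^esub>},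
         monoid.mult = undefined, monoid.one = undefined,
         ring.zero = (\<lambda>i\<in>{..<n}. \<zero>\<^bsub>sections \<XX> V\<^esub>),
         ring.add = (\<lambda>a b. \<lambda>i\<in>{..<n}. a i \<oplus>\<^bsub>sections \<XX> V\<^esub> b i),
         smult = (\<lambda>c a. \<lambda>i\<in>{..<n}. c \<otimes>\<^bsub>sections \<XX> V\<^esub> a i)\<rparr>),
      mrestr = (\<lambda>V W a. \<lambda>i\<in>{..<n}. restr \<XX> V W (a i))\<rparr>"

definition coherent :: "('x, 'a) rspace \<Rightarrow> ('x, 'a, 'm) mod_sheaf \<Rightarrow> bool" where
  "coherent \<XX> F \<longleftrightarrow> sheaf_of_modules \<XX> F \<and> finite_type_sheaf \<XX> F \<and>
     (\<forall>U n s. openin (topol \<XX>) U \<and> s \<in> {..<n} \<rightarrow> carrier (msections F U) \<longrightarrow>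
        finite_type_sheaf (open_subspace \<XX> U) (relation_sheaf \<XX> F U n s))"


section \<open>Weil decorations\<close>

definition finite_dim_vector_space :: "'b ring \<Rightarrow> ('b, 'v) module \<Rightarrow> bool" where
  "finite_dim_vector_space K V \<longleftrightarrow> Ring.field K \<and> Module.module K V \<and>
     (\<exists>(n::nat) b. b \<in> {..<n} \<rightarrow> carrier V \<and>
        (\<forall>v\<in>carrier V. \<exists>c\<in>{..<n} \<rightarrow> carrier K. v = (\<Oplus>\<^bsub>V\<^esub>i\<in>{..<n}. c i \<odot>\<^bsub>V\<^esub> b i)))"

definition pre_weil_decoration ::
    "('x, 'a) rspace \<Rightarrow> (('x set \<times> 'a) set, 'v) module \<Rightarrow> ('v \<Rightarrow> ('x set \<Rightarrow> int) extended) \<Rightarrow> bool" where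
  "pre_weil_decoration \<XX> V W \<longleftrightarrow>
     finite_dim_vector_space (function_field \<XX>) V \<and>
     W \<in> carrier V \<rightarrow> extended_divisors \<XX> \<and>
     (\<forall>v\<in>carrier V. W v = Pinf \<longleftrightarrow> v = \<zero>\<^bsub>V\<^esub>) \<and>
     (\<forall>f\<in>carrier (function_field \<XX>). \<forall>v\<in>carrier V. W (f \<odot>\<^bsub>V\<^esub> v) = principal_divisor \<XX> f + W v) \<and>
     (\<forall>v\<in>carrier V. \<forall>w\<in>carrier V. W (v \<oplus>\<^bsub>V\<^esub> w) \<ge> inf (W v) (W w))"

definition nonneg_on ::
    "('x, 'a) rspace \<Rightarrow> 'x set \<Rightarrow> ('x set \<Rightarrow> int) extended \<Rightarrow> bool" where
  "nonneg_on \<XX> U d \<longleftrightarrow>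
     (case d of Fin D \<Rightarrow> \<forall>P. prime_divisor \<XX> P \<and> P \<inter> U \<noteq> {} \<longrightarrow> 0 \<le> D P
              | Pinf \<Rightarrow> True | Minf \<Rightarrow> False)"

text \<open>The defining formula applies to nonempty open sets; as for every sheaf, the module of sections
  over the empty set is zero.\<close>

definition decoration_sheaf ::
    "('x, 'a) rspace \<Rightarrow> (('x set \<times> 'a) set, 'v) module \<Rightarrow> ('v \<Rightarrow> ('x set \<Rightarrow> int) extended) \<Rightarrow>
     ('x, 'a, 'v) mod_sheaf" where
  "decoration_sheaf \<XX> V W =
     \<lparr>msections = (\<lambda>U.
        \<lparr>carrier = (if U = {} then {\<zero>\<^bsub>V\<^esub>} else {v \<in> carrier V. nonneg_on \<XX> U (W v)}),
         monoid.mult = undefined, monoid.one = undefined,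
         ring.zero = \<zero>\<^bsub>V\<^esub>,
         ring.add = (\<lambda>v w. v \<oplus>\<^bsub>V\<^esub> w),
         smult = (\<lambda>a v. if U = {} then \<zero>\<^bsub>V\<^esub> else section_to_K \<XX> U a \<odot>\<^bsub>V\<^esub> v)\<rparr>),
      mrestr = (\<lambda>U U' v. if U' = {} then \<zero>\<^bsub>V\<^esub> else v)\<rparr>"

definition weil_decoration ::
    "('x, 'a) rspace \<Rightarrow> (('x set \<times> 'a) set, 'v) module \<Rightarrow> ('v \<Rightarrow> ('x set \<Rightarrow> int) extended) \<Rightarrow> bool" where
  "weil_decoration \<XX> V W \<longleftrightarrow> pre_weil_decoration \<XX> V W \<and> coherent \<XX> (decoration_sheaf \<XX> V W)"

definition plane :: "'b ring \<Rightarrow> ('b, 'b \<times> 'b) module" where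
  "plane K =
     \<lparr>carrier = carrier K \<times> carrier K,
      monoid.mult = undefined, monoid.one = undefined,
      ring.zero = (\<zero>\<^bsub>K\<^esub>, \<zero>\<^bsub>K\<^esub>),
      ring.add = (\<lambda>(f, g) (f', g'). (f \<oplus>\<^bsub>K\<^esub> f', g \<oplus>\<^bsub>K\<^esub> g')),
      smult = (\<lambda>c (f, g). (c \<otimes>\<^bsub>K\<^esub> f, c \<otimes>\<^bsub>K\<^esub> g))\<rparr>"

definition snc_decoration ::
    "('x, 'a) rspace \<Rightarrow> ('x set \<Rightarrow> int) \<Rightarrow> ('x set \<Rightarrow> ('x set \<times> 'a) set set) \<Rightarrow>
     ('x set \<times> 'a) set \<times> ('x set \<times> 'a) set \<Rightarrow> ('x set \<Rightarrow> int) extended" where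
  "snc_decoration \<XX> D h = (\<lambda>(f, g).
     if (f, g) = \<zero>\<^bsub>plane (function_field \<XX>)\<^esub> then Pinf
     else Fin (\<lambda>P.
       if prime_divisor \<XX> P then
         (if P \<in> supp D \<and> quotient_value_at \<XX> P f g = Some (h P)
          then fin_part (min (ord \<XX> P f) (ord \<XX> P g)) + 1
          else fin_part (min (ord \<XX> P f) (ord \<XX> P g)))
       else 0))"

end

theory Submission
  imports Defs
begin

text \<open>Choose for every component \<open>P\<close> of \<open>D\<close> a lift \<open>H\<close> of \<open>h\<^sub>P\<close> to the discrete valuation ring at \<open>P\<close>.
  Then \<open>\<W>(f, g)\<^sub>P = min (ord g + 1) (ord (f - H g))\<close>, so that every coefficient of \<open>\<W>\<close> is a minimum of
  valuations of linear forms. This yields the axioms of a pre-Weil decoration.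

  For coherence let \<open>U\<close> be an affine open set and \<open>A = \<O>(U)\<close>, a Noetherian ring. For a nonzero \<open>d \<in> A\<close>
  vanishing along the components of \<open>D\<close> that meet \<open>U\<close>, the coordinates of \<open>d v\<close>, for \<open>v\<close> a section over \<open>U\<close>,
  have no poles; by normality (algebraic Hartogs) they lie in \<open>A\<close>. So the sections over \<open>U\<close> form a
  submodule of \<open>d\<^sup>-\<^sup>1 A\<^sup>2\<close> and are finitely generated. A section \<open>t\<close> near \<open>y \<in> U\<close> has negative
  coefficients only along finitely many prime divisors of \<open>U\<close>, none of them through \<open>y\<close>, so \<open>b t\<close> is a section over \<open>U\<close>
  for some \<open>b \<in> A\<close> that is a unit at \<open>y\<close>. Hence the same generators work on all of \<open>U\<close>. Relations between
  finitely many sections are treated in the same way inside \<open>A\<^sup>n\<close>.\<close>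

section \<open>Ideals of subrings\<close>

text \<open>Rings of regular functions are treated as subrings of the function field, as in \<open>R\<lparr>carrier := A\<rparr>\<close>.\<close>

context cring
begin

lemma subring_is_cring:
  assumes "subring A R"
  shows "cring (R\<lparr>carrier := A\<rparr>)"
proof -
  interpret A: ring "R\<lparr>carrier := A\<rparr>" by (rule subring_is_ring[OF assms])
  show ?thesis
    using subringE(1)[OF assms] by unfold_locales (auto simp: subset_iff m_comm)
qed

lemma ideal_subringI:
  assumes A: "subring A R" and I: "I \<subseteq> A" "\<zero> \<in> I" "\<And>x y. \<lbrakk>x \<in> I; y \<in> I\<rbrakk> \<Longrightarrow> x \<oplus> y \<in> I"
    "\<And>a x. \<lbrakk>a \<in> A; x \<in> I\<rbrakk> \<Longrightarrow> a \<otimes> x \<in> I"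
  shows "ideal I (R\<lparr>carrier := A\<rparr>)"
proof -
  interpret A: cring "R\<lparr>carrier := A\<rparr>" by (rule subring_is_cring[OF A])
  show ?thesis
  proof (rule idealI[OF A.ring_axioms])
    have "\<ominus>\<^bsub>R\<lparr>carrier := A\<rparr>\<^esub> x \<in> I" if "x \<in> I" for x
    proof -
      have "\<ominus>\<^bsub>R\<lparr>carrier := A\<rparr>\<^esub> \<one> \<in> A" "x \<in> A" "x \<in> carrier R"
        using A.a_inv_closed[of \<one>] subringE(1,3)[OF A] that I(1) by auto
      then show ?thesis using I(4)[OF _ that] A.l_minus[of \<one> x] subringE(3)[OF A] by force
    qed
    then show "subgroup I (add_monoid (R\<lparr>carrier := A\<rparr>))"
      by (intro A.add.subgroupI) (use I in auto)
    show "x \<otimes>\<^bsub>R\<lparr>carrier := A\<rparr>\<^esub> a \<in> I" if "a \<in> I" "x \<in> carrier (R\<lparr>carrier := A\<rparr>)" for a x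
      using that I(4) by simp
    then show "a \<otimes>\<^bsub>R\<lparr>carrier := A\<rparr>\<^esub> x \<in> I" if "a \<in> I" "x \<in> carrier (R\<lparr>carrier := A\<rparr>)" for a x
      using that A.m_comm[of a x] I(1) by auto
  qed
qed

lemma ideal_subringE:
  assumes A: "subring A R" and I: "ideal I (R\<lparr>carrier := A\<rparr>)"
  shows "I \<subseteq> A" "I \<subseteq> carrier R" "\<zero> \<in> I" "\<And>x y. \<lbrakk>x \<in> I; y \<in> I\<rbrakk> \<Longrightarrow> x \<oplus> y \<in> I"
    "\<And>a x. \<lbrakk>a \<in> A; x \<in> I\<rbrakk> \<Longrightarrow> a \<otimes> x \<in> I" "\<And>x y. \<lbrakk>x \<in> I; y \<in> I\<rbrakk> \<Longrightarrow> x \<ominus> y \<in> I"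
proof -
  interpret I: ideal I "R\<lparr>carrier := A\<rparr>" by (rule I)
  show "I \<subseteq> A" using I.a_subset by simp
  then show IR: "I \<subseteq> carrier R" using subringE(1)[OF A] by blast
  show "\<zero> \<in> I" using additive_subgroup.zero_closed[OF I.additive_subgroup_axioms] by simp
  show add: "x \<oplus> y \<in> I" if "x \<in> I" "y \<in> I" for x y
    using additive_subgroup.a_closed[OF I.additive_subgroup_axioms that] by simp
  show mult: "a \<otimes> x \<in> I" if "a \<in> A" "x \<in> I" for a x using I.I_l_closed[of x a] that by simp
  show "x \<ominus> y \<in> I" if "x \<in> I" "y \<in> I" for x y
  proof -
    have "(\<ominus> \<one>) \<otimes> y = \<ominus> y" using that IR by (simp add: l_minus subset_iff)
    then show ?thesis
      using add[OF that(1) mult[OF subringE(5)[OF A subringE(3)[OF A]] that(2)]] by (simp add: a_minus_def)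
  qed
qed

lemma primeideal_subring_iff:
  assumes A: "subring A R"
  shows "primeideal p (R\<lparr>carrier := A\<rparr>) \<longleftrightarrow>
    ideal p (R\<lparr>carrier := A\<rparr>) \<and> \<one> \<notin> p \<and> (\<forall>a\<in>A. \<forall>b\<in>A. a \<otimes> b \<in> p \<longrightarrow> a \<in> p \<or> b \<in> p)"
proof -
  have "A \<noteq> p \<longleftrightarrow> \<one> \<notin> p" if "ideal p (R\<lparr>carrier := A\<rparr>)"
    using ideal.one_imp_carrier[OF that] subringE(3)[OF A] by auto
  then show ?thesis
    using subring_is_cring[OF A] by (auto simp: primeideal_def primeideal_axioms_def)
qed

lemma Units_subring_iff:
  assumes A: "subring A R"
  shows "u \<in> Units (R\<lparr>carrier := A\<rparr>) \<longleftrightarrow> u \<in> A \<and> (\<exists>w\<in>A. u \<otimes> w = \<one>)"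
  using subringE(1)[OF A] m_comm by (auto simp: Units_def subset_iff)

end

lemma noetherian_ring_hom_image:
  assumes "cring R" "cring S" and h: "h \<in> ring_hom R S" and N: "noetherian_ring R"
  shows "noetherian_ring (S\<lparr>carrier := h ` carrier R\<rparr>)"
proof -
  let ?T = "S\<lparr>carrier := h ` carrier R\<rparr>"
  interpret ring_hom_cring R S h using assms by (simp add: ring_hom_cring_def ring_hom_cring_axioms_def)
  interpret T: ring ?T by (rule ring.img_is_ring)
  interpret T: ring_hom_ring R ?T h
    by (rule ring_hom_ringI2[OF R.ring_axioms T.ring_axioms]) (use h in \<open>auto simp: ring_hom_def\<close>)
  show ?thesis
  proof (rule T.noetherian_ringI)
    fix I assume I: "ideal I ?T"
    have IT: "I \<subseteq> h ` carrier R" using additive_subgroup.a_subset[OF ideal.axioms(1)[OF I]] by simp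
    define pre where "pre J = {r \<in> carrier R. h r \<in> J}" for J
    obtain G where G: "G \<subseteq> carrier R" "finite G" "pre I = Idl\<^bsub>R\<^esub> G"
      using noetherian_ring.finetely_gen[OF N T.ideal_vimage[OF I]] unfolding pre_def by blast
    have hG: "h ` G \<subseteq> I" "h ` G \<subseteq> carrier ?T"
      using R.genideal_self[OF G(1)] G by (auto simp: pre_def)
    have "Idl\<^bsub>R\<^esub> G \<subseteq> pre (Idl\<^bsub>?T\<^esub> (h ` G))"
      unfolding pre_def using G(1) T.genideal_self[OF hG(2)]
      by (intro R.genideal_minimal T.ideal_vimage T.genideal_ideal) auto
    then have "I \<subseteq> Idl\<^bsub>?T\<^esub> (h ` G)" using IT G(3) by (auto simp: pre_def)
    then have "I = Idl\<^bsub>?T\<^esub> (h ` G)" using T.genideal_minimal[OF I hG(1)] by blast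
    then show "\<exists>A\<subseteq>carrier ?T. finite A \<and> I = Idl\<^bsub>?T\<^esub> A" using G(2) hG(2) by blast
  qed
qed

lemma (in field) noetherian_ring_field: "noetherian_ring R"
proof (rule noetherian_ringI)
  fix I assume "ideal I R"
  then have "I = Idl {\<zero>} \<or> I = Idl {\<one>}" using all_ideals genideal_zero genideal_one by blast
  then show "\<exists>A\<subseteq>carrier R. finite A \<and> I = Idl A"
    by (metis empty_subsetI finite.simps insert_subset one_closed zero_closed)
qed

lemma (in noetherian_ring) ex_maximal_ideal:
  assumes "\<A> \<noteq> {}" "\<And>I. I \<in> \<A> \<Longrightarrow> ideal I R"
  obtains M where "M \<in> \<A>" "\<And>I. \<lbrakk>I \<in> \<A>; M \<subseteq> I\<rbrakk> \<Longrightarrow> I = M"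
proof -
  have "\<exists>M\<in>\<A>. \<forall>I\<in>\<A>. M \<subseteq> I \<longrightarrow> I = M"
  proof (rule subset_Zorn_nonempty[OF assms(1)])
    fix \<C> assume C: "\<C> \<noteq> {}" "subset.chain \<A> \<C>"
    then have "subset.chain {I. ideal I R} \<C>" using assms(2) unfolding subset_chain_def by blast
    then have "\<Union>\<C> \<in> \<C>" by (rule ideal_chain_is_trivial[OF C(1)])
    then show "\<Union>\<C> \<in> \<A>" using C(2) unfolding subset_chain_def by blast
  qed
  then show ?thesis using that by blast
qed

section \<open>Finitely generated modules\<close>

definition finitely_generated :: "('a, 'b) ring_scheme \<Rightarrow> ('a, 'm, 'c) module_scheme \<Rightarrow> 'm set \<Rightarrow> bool" where
  "finitely_generated R M N \<longleftrightarrow>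
     (\<exists>S. finite S \<and> S \<subseteq> N \<and> (\<forall>L. submodule L R M \<and> S \<subseteq> L \<longrightarrow> N \<subseteq> L))"

lemma finitely_generatedE:
  assumes "finitely_generated R M N"
  obtains S where "finite S" "S \<subseteq> N" "\<And>L. \<lbrakk>submodule L R M; S \<subseteq> L\<rbrakk> \<Longrightarrow> N \<subseteq> L"
  using assms unfolding finitely_generated_def by (elim exE conjE) (rule that, assumption, assumption, blast)

context module
begin

lemma submodule_zero: "submodule N R M \<Longrightarrow> \<zero>\<^bsub>M\<^esub> \<in> N"
  using submodule.axioms(1) subgroup.one_closed by fastforce

lemma submodule_Int:
  assumes "submodule N R M" "submodule L R M"
  shows "submodule (N \<inter> L) R M"
  using submoduleE[OF assms(1)] submoduleE[OF assms(2)] submodule_zero assms by (intro submoduleI) auto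

lemma submodule_combinations:
  assumes g: "g \<in> {..<m::nat} \<rightarrow> carrier M"
  shows "submodule {\<Oplus>\<^bsub>M\<^esub>j\<in>{..<m}. c j \<odot>\<^bsub>M\<^esub> g j |c. c \<in> {..<m} \<rightarrow> carrier R} R M" (is "submodule ?L R M")
proof -
  have L: "v \<in> ?L" if "c \<in> {..<m} \<rightarrow> carrier R" "v = (\<Oplus>\<^bsub>M\<^esub>j\<in>{..<m}. c j \<odot>\<^bsub>M\<^esub> g j)" for v c using that by blast
  have cg: "(\<lambda>j. c j \<odot>\<^bsub>M\<^esub> g j) \<in> {..<m} \<rightarrow> carrier M" if "c \<in> {..<m} \<rightarrow> carrier R" for c using that g by auto
  have smult: "a \<odot>\<^bsub>M\<^esub> v \<in> ?L" if a: "a \<in> carrier R" and v: "v \<in> ?L" for a v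
  proof -
    obtain c where c: "c \<in> {..<m} \<rightarrow> carrier R" "v = (\<Oplus>\<^bsub>M\<^esub>j\<in>{..<m}. c j \<odot>\<^bsub>M\<^esub> g j)" using v by blast
    have "a \<odot>\<^bsub>M\<^esub> v = (\<Oplus>\<^bsub>M\<^esub>j\<in>{..<m}. a \<odot>\<^bsub>M\<^esub> (c j \<odot>\<^bsub>M\<^esub> g j))"
      unfolding c(2) by (rule finsum_smult_ldistr[OF _ a cg[OF c(1)]]) simp
    also have "\<dots> = (\<Oplus>\<^bsub>M\<^esub>j\<in>{..<m}. (a \<otimes> c j) \<odot>\<^bsub>M\<^esub> g j)"
      by (rule M.finsum_cong') (use a c(1) g in \<open>auto simp: smult_assoc1 Pi_iff\<close>)
    finally show ?thesis by (rule L[rotated]) (use a c(1) in auto)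
  qed
  show ?thesis
  proof (rule submoduleI)
    show sub: "?L \<subseteq> carrier M" using cg by auto
    have "\<zero>\<^bsub>M\<^esub> = (\<Oplus>\<^bsub>M\<^esub>j\<in>{..<m}. \<zero> \<odot>\<^bsub>M\<^esub> g j)"
      using g by (intro M.add.finprod_one_eqI[symmetric]) (auto simp: Pi_iff)
    then show "\<zero>\<^bsub>M\<^esub> \<in> ?L" by (rule L[rotated]) simp
    show "\<ominus>\<^bsub>M\<^esub> v \<in> ?L" if "v \<in> ?L" for v
    proof -
      have "\<ominus>\<^bsub>M\<^esub> v = (\<ominus> \<one>) \<odot>\<^bsub>M\<^esub> v" using subsetD[OF sub that] smult_l_minus[of \<one> v] by simp
      then show ?thesis using smult[OF R.a_inv_closed[OF one_closed] that] by (simp only:)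
    qed
    fix v w assume "v \<in> ?L" "w \<in> ?L"
    then obtain c d where c: "c \<in> {..<m} \<rightarrow> carrier R" "v = (\<Oplus>\<^bsub>M\<^esub>j\<in>{..<m}. c j \<odot>\<^bsub>M\<^esub> g j)"
      and d: "d \<in> {..<m} \<rightarrow> carrier R" "w = (\<Oplus>\<^bsub>M\<^esub>j\<in>{..<m}. d j \<odot>\<^bsub>M\<^esub> g j)" by blast
    have "v \<oplus>\<^bsub>M\<^esub> w = (\<Oplus>\<^bsub>M\<^esub>j\<in>{..<m}. c j \<odot>\<^bsub>M\<^esub> g j \<oplus>\<^bsub>M\<^esub> d j \<odot>\<^bsub>M\<^esub> g j)"
      unfolding c(2) d(2) by (rule M.finsum_addf[OF cg[OF c(1)] cg[OF d(1)], symmetric])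
    also have "\<dots> = (\<Oplus>\<^bsub>M\<^esub>j\<in>{..<m}. (c j \<oplus> d j) \<odot>\<^bsub>M\<^esub> g j)"
      by (rule M.finsum_cong') (use c(1) d(1) g in \<open>auto simp: smult_l_distr Pi_iff\<close>)
    finally show "v \<oplus>\<^bsub>M\<^esub> w \<in> ?L" by (rule L[rotated]) (use c(1) d(1) in auto)
  qed (rule smult)
qed

lemma generator_in_combinations:
  assumes g: "g \<in> {..<m::nat} \<rightarrow> carrier M" and k: "k < m"
  shows "g k \<in> {\<Oplus>\<^bsub>M\<^esub>j\<in>{..<m}. c j \<odot>\<^bsub>M\<^esub> g j |c. c \<in> {..<m} \<rightarrow> carrier R}"
proof -
  have "(\<Oplus>\<^bsub>M\<^esub>j\<in>{..<m}. (if k = j then \<one> else \<zero>) \<odot>\<^bsub>M\<^esub> g j) = (\<Oplus>\<^bsub>M\<^esub>j\<in>{..<m}. if k = j then g j else \<zero>\<^bsub>M\<^esub>)"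
    using g by (intro M.finsum_cong') (auto simp: Pi_iff)
  also have "\<dots> = g k" using M.add.finprod_singleton[of k "{..<m}" g] k g by auto
  finally have "g k = (\<Oplus>\<^bsub>M\<^esub>j\<in>{..<m}. (if k = j then \<one> else \<zero>) \<odot>\<^bsub>M\<^esub> g j)" ..
  then show ?thesis by (intro CollectI exI[of _ "\<lambda>j. if k = j then \<one> else \<zero>"]) auto
qed

lemma finitely_generated_combinations:
  assumes N: "N \<subseteq> carrier M" and fg: "finitely_generated R M N"
  obtains m :: nat and g where "g \<in> {..<m} \<rightarrow> N"
    "\<And>v. v \<in> N \<Longrightarrow> \<exists>c\<in>{..<m} \<rightarrow> carrier R. v = (\<Oplus>\<^bsub>M\<^esub>j\<in>{..<m}. c j \<odot>\<^bsub>M\<^esub> g j)"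
proof -
  obtain S where S: "finite S" "S \<subseteq> N" "\<And>L. \<lbrakk>submodule L R M; S \<subseteq> L\<rbrakk> \<Longrightarrow> N \<subseteq> L"
    by (rule finitely_generatedE[OF fg], rule that)
  obtain xs where xs: "set xs = S" using finite_list[OF S(1)] by blast
  define m where "m = length xs"
  have gN: "(!) xs \<in> {..<m} \<rightarrow> N" using xs S(2) by (auto simp: m_def)
  then have g: "(!) xs \<in> {..<m} \<rightarrow> carrier M" using N by blast
  have "S \<subseteq> {\<Oplus>\<^bsub>M\<^esub>j\<in>{..<m}. c j \<odot>\<^bsub>M\<^esub> xs ! j |c. c \<in> {..<m} \<rightarrow> carrier R}"
  proof
    fix v assume "v \<in> S"
    then obtain k where "k < m" "v = xs ! k" using xs by (auto simp: in_set_conv_nth m_def)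
    then show "v \<in> {\<Oplus>\<^bsub>M\<^esub>j\<in>{..<m}. c j \<odot>\<^bsub>M\<^esub> xs ! j |c. c \<in> {..<m} \<rightarrow> carrier R}"
      using generator_in_combinations[OF g] by simp
  qed
  from S(3)[OF submodule_combinations[OF g] this] show ?thesis by (intro that[OF gN]) blast
qed

lemma finitely_generated_by_kernel:
  fixes \<phi> :: "'c \<Rightarrow> 'a"
  assumes R: "noetherian_ring R" and N: "submodule N R M"
    and \<phi>: "\<phi> \<in> N \<rightarrow> carrier R" "\<And>x y. \<lbrakk>x \<in> N; y \<in> N\<rbrakk> \<Longrightarrow> \<phi> (x \<oplus>\<^bsub>M\<^esub> y) = \<phi> x \<oplus> \<phi> y"
      "\<And>a x. \<lbrakk>a \<in> carrier R; x \<in> N\<rbrakk> \<Longrightarrow> \<phi> (a \<odot>\<^bsub>M\<^esub> x) = a \<otimes> \<phi> x"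
    and ker: "finitely_generated R M {x \<in> N. \<phi> x = \<zero>}"
  shows "finitely_generated R M N"
proof -
  note submod = submoduleE[OF N]
  have image_ideal: "ideal (\<phi> ` L) R" if L: "submodule L R M" "L \<subseteq> N" for L
  proof (rule ideal_subringI[OF carrier_is_subring, simplified])
    note submod_L = submoduleE[OF L(1)]
    show "\<phi> ` L \<subseteq> carrier R" using \<phi>(1) L(2) by blast
    have "\<phi> \<zero>\<^bsub>M\<^esub> = \<zero>"
      using \<phi>(3)[of \<zero> "\<zero>\<^bsub>M\<^esub>"] \<phi>(1) submodule_zero[OF N] smult_l_null[of "\<zero>\<^bsub>M\<^esub>"] by (auto simp: Pi_iff)
    then show "\<zero> \<in> \<phi> ` L" using submodule_zero[OF L(1)] by force
    show "x \<oplus> y \<in> \<phi> ` L" if "x \<in> \<phi> ` L" "y \<in> \<phi> ` L" for x y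
      using that submod_L(5) L(2) \<phi>(2)[symmetric] by (auto simp: subset_iff)
    show "a \<otimes> x \<in> \<phi> ` L" if "a \<in> carrier R" "x \<in> \<phi> ` L" for a x
      using that submod_L(4) L(2) \<phi>(3)[symmetric] by (auto simp: subset_iff)
  qed
  obtain G where G: "G \<subseteq> carrier R" "finite G" "\<phi> ` N = Idl G"
    using noetherian_ring.finetely_gen[OF R image_ideal[OF N subset_refl]] by blast
  obtain T where T: "finite T" "T \<subseteq> N" "G = \<phi> ` T"
    using finite_subset_image[OF G(2), of \<phi> N] genideal_self[OF G(1)] G(3) by auto
  obtain S where S: "finite S" "S \<subseteq> {x \<in> N. \<phi> x = \<zero>}"
    "\<And>L. \<lbrakk>submodule L R M; S \<subseteq> L\<rbrakk> \<Longrightarrow> {x \<in> N. \<phi> x = \<zero>} \<subseteq> L" by (rule finitely_generatedE[OF ker], rule that)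
  have "N \<subseteq> L" if L: "submodule L R M" "S \<union> T \<subseteq> L" for L
  proof
    fix v assume v: "v \<in> N"
    note submod_L = submoduleE[OF L(1)]
    have "Idl G \<subseteq> \<phi> ` (N \<inter> L)"
      using T(2,3) L(2) by (intro genideal_minimal image_ideal submodule_Int[OF N L(1)]) auto
    then obtain w where w: "w \<in> N" "w \<in> L" "\<phi> v = \<phi> w" using v G(3) by blast
    have carrier: "v \<in> carrier M" "w \<in> carrier M" "\<ominus>\<^bsub>M\<^esub> w \<in> N" using submod(1,3) v w(1) by auto
    have "\<phi> (\<ominus>\<^bsub>M\<^esub> w) = \<ominus> \<phi> w"
      using \<phi>(3)[of "\<ominus> \<one>" w] \<phi>(1) w(1) carrier smult_l_minus[of \<one> w] by (auto simp: l_minus Pi_iff)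
    then have "\<phi> (v \<oplus>\<^bsub>M\<^esub> \<ominus>\<^bsub>M\<^esub> w) = \<zero>" using \<phi>(1,2) v w carrier by (auto simp: R.r_neg Pi_iff)
    then have "v \<oplus>\<^bsub>M\<^esub> \<ominus>\<^bsub>M\<^esub> w \<in> L" using S(3)[OF L(1)] L(2) submod(5) v carrier(3) by blast
    from submod_L(5)[OF this w(2)] show "v \<in> L" using carrier by (simp add: M.a_assoc M.l_neg)
  qed
  moreover have "finite (S \<union> T)" "S \<union> T \<subseteq> N" using S T by auto
  ultimately show ?thesis unfolding finitely_generated_def by blast
qed

lemma finitely_generated_by_coordinates:
  fixes \<phi> :: "nat \<Rightarrow> 'c \<Rightarrow> 'a"
  assumes R: "noetherian_ring R"
  shows "\<lbrakk>submodule N R M;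
    \<And>i x. \<lbrakk>i < n; x \<in> N\<rbrakk> \<Longrightarrow> \<phi> i x \<in> carrier R;
    \<And>i x y. \<lbrakk>i < n; x \<in> N; y \<in> N\<rbrakk> \<Longrightarrow> \<phi> i (x \<oplus>\<^bsub>M\<^esub> y) = \<phi> i x \<oplus> \<phi> i y;
    \<And>i a x. \<lbrakk>i < n; a \<in> carrier R; x \<in> N\<rbrakk> \<Longrightarrow> \<phi> i (a \<odot>\<^bsub>M\<^esub> x) = a \<otimes> \<phi> i x;
    \<And>x. \<lbrakk>x \<in> N; \<forall>i<n. \<phi> i x = \<zero>\<rbrakk> \<Longrightarrow> x = \<zero>\<^bsub>M\<^esub>\<rbrakk> \<Longrightarrow> finitely_generated R M N"
proof (induction n arbitrary: N)
  case 0
  then have "N \<subseteq> {\<zero>\<^bsub>M\<^esub>}" by auto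
  then show ?case unfolding finitely_generated_def using submodule_zero by (intro exI[of _ "{}"]) auto
next
  case (Suc n)
  note submod = submoduleE[OF Suc.prems(1)]
  let ?N0 = "{x \<in> N. \<phi> n x = \<zero>}"
  have "submodule ?N0 R M"
  proof (rule submoduleI)
    show "?N0 \<subseteq> carrier M" using submod(1) by blast
    show "\<zero>\<^bsub>M\<^esub> \<in> ?N0"
      using Suc.prems(2)[of n "\<zero>\<^bsub>M\<^esub>"] Suc.prems(4)[of n \<zero> "\<zero>\<^bsub>M\<^esub>"] submodule_zero[OF Suc.prems(1)]
        smult_l_null[of "\<zero>\<^bsub>M\<^esub>"] by simp
    show smult: "a \<odot>\<^bsub>M\<^esub> x \<in> ?N0" if "a \<in> carrier R" "x \<in> ?N0" for a x using that submod(4) Suc.prems(4) by auto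
    show "\<ominus>\<^bsub>M\<^esub> x \<in> ?N0" if "x \<in> ?N0" for x
      using smult[OF _ that, of "\<ominus> \<one>"] smult_l_minus[of \<one> x] that submod(1) by auto
    show "x \<oplus>\<^bsub>M\<^esub> y \<in> ?N0" if "x \<in> ?N0" "y \<in> ?N0" for x y using that submod(5) Suc.prems(3) by auto
  qed
  then have "finitely_generated R M ?N0"
    by (rule Suc.IH) (use Suc.prems in \<open>auto simp: less_Suc_eq\<close>)
  then show ?case
    by (intro finitely_generated_by_kernel[OF R Suc.prems(1), where \<phi> = "\<phi> n"]) (use Suc.prems(2-4) in auto)
qed

lemma Units_smult_eq_combination:
  assumes A: "finite A" and b: "b \<in> Units R" and v: "v \<in> carrier M" and c: "c \<in> A \<rightarrow> carrier R"
    and g: "g \<in> A \<rightarrow> carrier M"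
    and eq: "b \<odot>\<^bsub>M\<^esub> v = (\<Oplus>\<^bsub>M\<^esub>j\<in>A. c j \<odot>\<^bsub>M\<^esub> g j)"
  shows "v = (\<Oplus>\<^bsub>M\<^esub>j\<in>A. (inv b \<otimes> c j) \<odot>\<^bsub>M\<^esub> g j)"
proof -
  have "v = inv b \<odot>\<^bsub>M\<^esub> (b \<odot>\<^bsub>M\<^esub> v)" using b v by (simp add: smult_assoc1[symmetric] R.Units_closed)
  also have "\<dots> = (\<Oplus>\<^bsub>M\<^esub>j\<in>A. inv b \<odot>\<^bsub>M\<^esub> (c j \<odot>\<^bsub>M\<^esub> g j))"
    unfolding eq by (rule finsum_smult_ldistr[OF A]) (use b c g in auto)
  also have "\<dots> = (\<Oplus>\<^bsub>M\<^esub>j\<in>A. (inv b \<otimes> c j) \<odot>\<^bsub>M\<^esub> g j)"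
    by (rule M.finsum_cong') (use b c g in \<open>auto simp: smult_assoc1 Pi_iff\<close>)
  finally show ?thesis .
qed

lemma restrict_scalars:
  assumes A: "subring A R"
  shows "module (R\<lparr>carrier := A\<rparr>) M"
proof (rule moduleI[OF subring_is_cring[OF A] M.abelian_group_axioms])
qed (use subringE(1)[OF A] in \<open>auto simp: subset_iff smult_l_distr smult_r_distr smult_assoc1\<close>)

end

definition free_module :: "'b ring \<Rightarrow> nat \<Rightarrow> ('b, nat \<Rightarrow> 'b) module" where
  "free_module K n =
     \<lparr>carrier = {..<n} \<rightarrow>\<^sub>E carrier K, monoid.mult = undefined, monoid.one = undefined,
      ring.zero = (\<lambda>i\<in>{..<n}. \<zero>\<^bsub>K\<^esub>), ring.add = (\<lambda>a b. \<lambda>i\<in>{..<n}. a i \<oplus>\<^bsub>K\<^esub> b i),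
      smult = (\<lambda>c a. \<lambda>i\<in>{..<n}. c \<otimes>\<^bsub>K\<^esub> a i)\<rparr>"

lemma free_module_simps:
  "carrier (free_module K n) = {..<n} \<rightarrow>\<^sub>E carrier K" "\<zero>\<^bsub>free_module K n\<^esub> = (\<lambda>i\<in>{..<n}. \<zero>\<^bsub>K\<^esub>)"
  "a \<oplus>\<^bsub>free_module K n\<^esub> b = (\<lambda>i\<in>{..<n}. a i \<oplus>\<^bsub>K\<^esub> b i)" "c \<odot>\<^bsub>free_module K n\<^esub> a = (\<lambda>i\<in>{..<n}. c \<otimes>\<^bsub>K\<^esub> a i)"
  unfolding free_module_def by simp_all

lemma free_module_is_module:
  assumes "cring K"
  shows "Module.module K (free_module K n)"
proof -
  interpret K: cring K by fact
  let ?F = "free_module K n"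
  have ext: "x = y" if "x \<in> carrier ?F" "y \<in> carrier ?F" "\<And>i. i < n \<Longrightarrow> x i = y i" for x y
    using that unfolding free_module_simps by (intro PiE_ext[of x "{..<n}" "\<lambda>_. carrier K" y]) auto
  have mem: "x i \<in> carrier K" if "x \<in> carrier ?F" "i < n" for x i using that unfolding free_module_simps by auto
  have closed: "\<zero>\<^bsub>?F\<^esub> \<in> carrier ?F" "\<And>x y. \<lbrakk>x \<in> carrier ?F; y \<in> carrier ?F\<rbrakk> \<Longrightarrow> x \<oplus>\<^bsub>?F\<^esub> y \<in> carrier ?F"
    "\<And>c x. \<lbrakk>c \<in> carrier K; x \<in> carrier ?F\<rbrakk> \<Longrightarrow> c \<odot>\<^bsub>?F\<^esub> x \<in> carrier ?F"
    unfolding free_module_simps by (auto simp: PiE_iff)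
  have apply_simps: "\<zero>\<^bsub>?F\<^esub> i = \<zero>\<^bsub>K\<^esub>" "(x \<oplus>\<^bsub>?F\<^esub> y) i = x i \<oplus>\<^bsub>K\<^esub> y i" "(c \<odot>\<^bsub>?F\<^esub> x) i = c \<otimes>\<^bsub>K\<^esub> x i"
    if "i < n" for x y c i using that unfolding free_module_simps by simp_all
  show ?thesis
  proof (rule moduleI[OF K.cring_axioms])
    show "abelian_group ?F"
    proof (rule abelian_groupI)
      fix x assume x: "x \<in> carrier ?F"
      then have "(\<ominus>\<^bsub>K\<^esub> \<one>\<^bsub>K\<^esub>) \<odot>\<^bsub>?F\<^esub> x \<oplus>\<^bsub>?F\<^esub> x = \<zero>\<^bsub>?F\<^esub>"
        by (intro ext) (simp_all add: closed apply_simps mem K.l_minus K.l_neg)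
      then show "\<exists>y\<in>carrier ?F. y \<oplus>\<^bsub>?F\<^esub> x = \<zero>\<^bsub>?F\<^esub>" using closed(3)[OF _ x] by blast
    qed (rule closed ext | simp add: closed apply_simps mem K.a_ac)+
  qed (rule closed ext | simp add: closed apply_simps mem K.l_distr K.r_distr K.m_assoc)+
qed

lemma plane_simps: "carrier (plane K) = carrier K \<times> carrier K" "\<zero>\<^bsub>plane K\<^esub> = (\<zero>\<^bsub>K\<^esub>, \<zero>\<^bsub>K\<^esub>)"
  "v \<oplus>\<^bsub>plane K\<^esub> w = (fst v \<oplus>\<^bsub>K\<^esub> fst w, snd v \<oplus>\<^bsub>K\<^esub> snd w)" "c \<odot>\<^bsub>plane K\<^esub> v = (c \<otimes>\<^bsub>K\<^esub> fst v, c \<otimes>\<^bsub>K\<^esub> snd v)"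
  unfolding plane_def by (simp_all split: prod.split)

lemma plane_is_module:
  assumes "cring K"
  shows "Module.module K (plane K)"
proof -
  interpret K: cring K by fact
  show ?thesis
  proof (rule moduleI[OF K.cring_axioms])
    show "abelian_group (plane K)"
    proof (rule abelian_groupI)
      show "\<exists>y\<in>carrier (plane K). y \<oplus>\<^bsub>plane K\<^esub> x = \<zero>\<^bsub>plane K\<^esub>" if "x \<in> carrier (plane K)" for x
        using that by (intro bexI[of _ "(\<ominus>\<^bsub>K\<^esub> fst x, \<ominus>\<^bsub>K\<^esub> snd x)"]) (auto simp: plane_simps K.l_neg)
    qed (simp_all add: plane_simps mem_Times_iff K.a_ac)
  qed (simp_all add: plane_simps mem_Times_iff K.l_distr K.r_distr K.m_assoc)
qed

lemma finite_dim_vector_space_plane: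
  assumes "field K"
  shows "finite_dim_vector_space K (plane K)"
  unfolding finite_dim_vector_space_def
proof (intro conjI exI ballI)
  interpret K: field K by fact
  show "Module.module K (plane K)" by (rule plane_is_module[OF K.cring_axioms])
  then interpret M: Module.module K "plane K" .
  show "field K" by fact
  let ?b = "\<lambda>i::nat. if i = 0 then (\<one>\<^bsub>K\<^esub>, \<zero>\<^bsub>K\<^esub>) else (\<zero>\<^bsub>K\<^esub>, \<one>\<^bsub>K\<^esub>)"
  show "?b \<in> {..<2} \<rightarrow> carrier (plane K)" by (auto simp: plane_simps)
  fix v assume v: "v \<in> carrier (plane K)"
  let ?c = "\<lambda>i::nat. if i = 0 then fst v else snd v"
  have two: "{..<2} = insert 0 (insert (1::nat) {})" by auto
  have "(\<Oplus>\<^bsub>plane K\<^esub>i\<in>{..<2}. ?c i \<odot>\<^bsub>plane K\<^esub> ?b i) =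
      ?c 0 \<odot>\<^bsub>plane K\<^esub> ?b 0 \<oplus>\<^bsub>plane K\<^esub> (?c 1 \<odot>\<^bsub>plane K\<^esub> ?b 1 \<oplus>\<^bsub>plane K\<^esub> \<zero>\<^bsub>plane K\<^esub>)"
    unfolding two using v by (subst M.finsum_insert, (auto simp: plane_simps)[4])+ (auto simp: plane_simps)
  also have "\<dots> = v" using v by (auto simp: plane_simps)
  finally have "v = (\<Oplus>\<^bsub>plane K\<^esub>i\<in>{..<2}. ?c i \<odot>\<^bsub>plane K\<^esub> ?b i)" ..
  then show "\<exists>c\<in>{..<2} \<rightarrow> carrier K. v = (\<Oplus>\<^bsub>plane K\<^esub>i\<in>{..<2}. c i \<odot>\<^bsub>plane K\<^esub> ?b i)"
    using v by (intro bexI[of _ ?c]) (auto simp: plane_simps)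
qed

section \<open>Noetherian rings\<close>

context domain
begin

primrec poly_values :: "'a set \<Rightarrow> 'a \<Rightarrow> nat \<Rightarrow> 'a set" where
  "poly_values B s 0 = {\<zero>}"
| "poly_values B s (Suc n) = {c \<otimes> s [^] n \<oplus> p |c p. c \<in> B \<and> p \<in> poly_values B s n}"

definition leading_coeffs :: "'a set \<Rightarrow> 'a \<Rightarrow> 'a set \<Rightarrow> nat \<Rightarrow> 'a set" where
  "leading_coeffs B s I n = {b \<in> B. \<exists>p\<in>poly_values B s n. b \<otimes> s [^] n \<oplus> p \<in> I}"

context
  fixes B s assumes B: "subring B R" and s: "s \<in> carrier R"
begin

private lemma B_carrier: "b \<in> B \<Longrightarrow> b \<in> carrier R"
  using subringE(1)[OF B] by blast

lemma poly_values_carrier: "poly_values B s n \<subseteq> carrier R"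
  by (induction n) (use B_carrier s in auto)

lemma poly_values_zero: "\<zero> \<in> poly_values B s n"
proof (induction n)
  case (Suc n)
  have "\<zero> = \<zero> \<otimes> s [^] n \<oplus> \<zero>" using s by simp
  then show ?case using Suc subringE(2)[OF B] by auto
qed simp

lemma poly_values_add:
  "\<lbrakk>p \<in> poly_values B s n; q \<in> poly_values B s n\<rbrakk> \<Longrightarrow> p \<oplus> q \<in> poly_values B s n"
proof (induction n arbitrary: p q)
  case (Suc n)
  then obtain c p' d q' where p: "p = c \<otimes> s [^] n \<oplus> p'" "c \<in> B" "p' \<in> poly_values B s n"
    and q: "q = d \<otimes> s [^] n \<oplus> q'" "d \<in> B" "q' \<in> poly_values B s n" by auto
  have "c \<in> carrier R" "d \<in> carrier R" "p' \<in> carrier R" "q' \<in> carrier R" "s [^] n \<in> carrier R"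
    using p q B_carrier poly_values_carrier s by auto
  then have "p \<oplus> q = (c \<oplus> d) \<otimes> s [^] n \<oplus> (p' \<oplus> q')" unfolding p q by algebra
  then show ?case using Suc.IH[OF p(3) q(3)] subringE(7)[OF B p(2) q(2)] by auto
qed simp

lemma poly_values_smult: "\<lbrakk>b \<in> B; p \<in> poly_values B s n\<rbrakk> \<Longrightarrow> b \<otimes> p \<in> poly_values B s n"
proof (induction n arbitrary: p)
  case (Suc n)
  then obtain c q where p: "p = c \<otimes> s [^] n \<oplus> q" "c \<in> B" "q \<in> poly_values B s n" by auto
  have "b \<in> carrier R" "c \<in> carrier R" "q \<in> carrier R" "s [^] n \<in> carrier R"
    using p Suc.prems(1) B_carrier poly_values_carrier s by auto
  then have "b \<otimes> p = (b \<otimes> c) \<otimes> s [^] n \<oplus> b \<otimes> q" unfolding p by algebra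
  then show ?case using Suc.IH[OF Suc.prems(1) p(3)] subringE(6)[OF B Suc.prems(1) p(2)] by auto
qed (use B_carrier in simp)

lemma poly_values_minus:
  assumes "p \<in> poly_values B s n" "q \<in> poly_values B s n"
  shows "p \<ominus> q \<in> poly_values B s n"
proof -
  have "(\<ominus> \<one>) \<otimes> q = \<ominus> q" using assms(2) poly_values_carrier by (simp add: l_minus subset_iff)
  then show ?thesis
    using poly_values_add[OF assms(1) poly_values_smult[OF subringE(5)[OF B subringE(3)[OF B]] assms(2)]]
    by (simp add: a_minus_def)
qed

lemma poly_values_mono:
  assumes "m \<le> n"
  shows "poly_values B s m \<subseteq> poly_values B s n"
  using assms
proof (induction n rule: dec_induct)
  case (step n)
  have "p = \<zero> \<otimes> s [^] n \<oplus> p" if "p \<in> poly_values B s n" for p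
    using that poly_values_carrier s by (simp add: subset_iff)
  then show ?case using step.IH subringE(2)[OF B] by auto
qed simp

lemma poly_values_times:
  "p \<in> poly_values B s n \<Longrightarrow> s \<otimes> p \<in> poly_values B s (Suc n)"
proof (induction n arbitrary: p)
  case 0
  then show ?case using s poly_values_zero[of "Suc 0"] by (auto simp del: poly_values.simps(2))
next
  case (Suc n)
  then obtain c q where p: "p = c \<otimes> s [^] n \<oplus> q" "c \<in> B" "q \<in> poly_values B s n" by auto
  have "c \<in> carrier R" "q \<in> carrier R" "s [^] n \<in> carrier R"
    using p B_carrier poly_values_carrier s by auto
  then have "s \<otimes> p = c \<otimes> (s [^] n \<otimes> s) \<oplus> s \<otimes> q" unfolding p using s by algebra
  also have "\<dots> = c \<otimes> s [^] Suc n \<oplus> s \<otimes> q" by simp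
  finally show ?case using p(2) Suc.IH[OF p(3)] poly_values.simps(2)[of B s "Suc n"] by blast
qed

lemma simple_extension_eq_poly_values: "simple_extension B s = (\<Union>n. poly_values B s n)"
proof (intro subset_antisym subsetI)
  fix x assume "x \<in> simple_extension B s"
  then show "x \<in> (\<Union>n. poly_values B s n)"
  proof induction
    case (lin k b)
    then obtain n where k: "k \<in> poly_values B s n" by blast
    have "b \<otimes> s [^] (0::nat) \<oplus> \<zero> \<in> poly_values B s (Suc 0)" using lin(2) by auto
    then have "b \<in> poly_values B s (Suc n)"
      using B_carrier[OF lin(2)] poly_values_mono[of "Suc 0" "Suc n"] by auto
    moreover have "k \<otimes> s = s \<otimes> k" using k poly_values_carrier s by (intro m_comm) auto
    ultimately have "k \<otimes> s \<oplus> b \<in> poly_values B s (Suc n)"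
      using poly_values_add[OF poly_values_times[OF k]] by simp
    then show ?case by blast
  qed (auto intro: exI[of _ 0])
next
  note ext_subring = subringE[OF simple_extension_is_subring[OF B s]]
  have mem: "s \<in> simple_extension B s" "B \<subseteq> simple_extension B s"
    using simple_extension_mem[OF B s] simple_extension_incl[OF subringE(1)[OF B] s] by auto
  have pow: "s [^] n \<in> simple_extension B s" for n :: nat by (induction n) (use ext_subring mem in auto)
  have "poly_values B s n \<subseteq> simple_extension B s" for n
  proof (induction n)
    case (Suc n)
    show ?case
    proof
      fix x assume "x \<in> poly_values B s (Suc n)"
      then obtain c p where "x = c \<otimes> s [^] n \<oplus> p" "c \<in> B" "p \<in> poly_values B s n" by auto
      then show "x \<in> simple_extension B s"
        using ext_subring(7)[OF ext_subring(6)[OF subsetD[OF mem(2)] pow] subsetD[OF Suc]] by simp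
    qed
  qed (use ext_subring in simp)
  then show "x \<in> simple_extension B s" if "x \<in> (\<Union>n. poly_values B s n)" for x using that by blast
qed

lemma leading_coeffs_ideal:
  assumes I: "ideal I (R\<lparr>carrier := simple_extension B s\<rparr>)"
  shows "ideal (leading_coeffs B s I n) (R\<lparr>carrier := B\<rparr>)"
proof (rule ideal_subringI[OF B])
  note I' = ideal_subringE[OF simple_extension_is_subring[OF B s] I]
  have power: "s [^] n \<in> carrier R" using s by simp
  show "leading_coeffs B s I n \<subseteq> B" unfolding leading_coeffs_def by blast
  have "\<zero> \<otimes> s [^] n \<oplus> \<zero> \<in> I" using power I'(3) by simp
  then show "\<zero> \<in> leading_coeffs B s I n"
    using poly_values_zero subringE(2)[OF B] unfolding leading_coeffs_def by blast
  fix b assume "b \<in> leading_coeffs B s I n"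
  then obtain p where b: "b \<in> B" "p \<in> poly_values B s n" "b \<otimes> s [^] n \<oplus> p \<in> I"
    unfolding leading_coeffs_def by blast
  have bp_carrier: "b \<in> carrier R" "p \<in> carrier R" using b B_carrier poly_values_carrier by auto
  show "b \<oplus> c \<in> leading_coeffs B s I n" if leading: "c \<in> leading_coeffs B s I n" for c
  proof -
    obtain q where c: "c \<in> B" "q \<in> poly_values B s n" "c \<otimes> s [^] n \<oplus> q \<in> I"
      using leading unfolding leading_coeffs_def by blast
    have "c \<in> carrier R" "q \<in> carrier R" using c B_carrier poly_values_carrier by auto
    then have "(b \<otimes> s [^] n \<oplus> p) \<oplus> (c \<otimes> s [^] n \<oplus> q) = (b \<oplus> c) \<otimes> s [^] n \<oplus> (p \<oplus> q)"
      using bp_carrier power by algebra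
    then have "(b \<oplus> c) \<otimes> s [^] n \<oplus> (p \<oplus> q) \<in> I" using I'(4)[OF b(3) c(3)] by simp
    then show ?thesis
      using subringE(7)[OF B b(1) c(1)] poly_values_add[OF b(2) c(2)] unfolding leading_coeffs_def by blast
  qed
  show "a \<otimes> b \<in> leading_coeffs B s I n" if a: "a \<in> B" for a
  proof -
    have "a \<otimes> (b \<otimes> s [^] n \<oplus> p) = (a \<otimes> b) \<otimes> s [^] n \<oplus> a \<otimes> p" using B_carrier[OF a] bp_carrier power by algebra
    moreover have "a \<in> simple_extension B s" using a simple_extension_incl[OF subringE(1)[OF B] s] by blast
    from I'(5)[OF this b(3)] have "a \<otimes> (b \<otimes> s [^] n \<oplus> p) \<in> I" .
    ultimately have "(a \<otimes> b) \<otimes> s [^] n \<oplus> a \<otimes> p \<in> I" by simp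
    then show ?thesis
      using subringE(6)[OF B a b(1)] poly_values_smult[OF a b(2)] unfolding leading_coeffs_def by blast
  qed
qed

lemma leading_coeffs_mono:
  assumes I: "ideal I (R\<lparr>carrier := simple_extension B s\<rparr>)" and "m \<le> n"
  shows "leading_coeffs B s I m \<subseteq> leading_coeffs B s I n"
  using \<open>m \<le> n\<close>
proof (induction n rule: dec_induct)
  case (step n)
  have "leading_coeffs B s I n \<subseteq> leading_coeffs B s I (Suc n)"
  proof
    fix b assume "b \<in> leading_coeffs B s I n"
    then obtain p where b: "b \<in> B" "p \<in> poly_values B s n" "b \<otimes> s [^] n \<oplus> p \<in> I"
      unfolding leading_coeffs_def by blast
    have "b \<in> carrier R" "p \<in> carrier R" "s [^] n \<in> carrier R" using b B_carrier poly_values_carrier s by auto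
    then have "s \<otimes> (b \<otimes> s [^] n \<oplus> p) = b \<otimes> (s [^] n \<otimes> s) \<oplus> s \<otimes> p" using s by algebra
    moreover have "s \<otimes> (b \<otimes> s [^] n \<oplus> p) \<in> I"
      using ideal_subringE(5)[OF simple_extension_is_subring[OF B s] I simple_extension_mem[OF B s] b(3)] .
    ultimately have "b \<otimes> s [^] Suc n \<oplus> s \<otimes> p \<in> I" by simp
    then show "b \<in> leading_coeffs B s I (Suc n)"
      using b(1) poly_values_times[OF b(2)] unfolding leading_coeffs_def by blast
  qed
  then show ?case using step.IH by blast
qed simp

lemma ideal_subset_by_leading_coeffs:
  assumes I: "ideal I (R\<lparr>carrier := simple_extension B s\<rparr>)"
    and J: "ideal J (R\<lparr>carrier := simple_extension B s\<rparr>)"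
    and subset: "J \<subseteq> I" and leading: "\<And>n. leading_coeffs B s I n \<subseteq> leading_coeffs B s J n"
  shows "I \<subseteq> J"
proof -
  note I' = ideal_subringE[OF simple_extension_is_subring[OF B s] I]
  note J' = ideal_subringE[OF simple_extension_is_subring[OF B s] J]
  have "x \<in> J" if "x \<in> poly_values B s n" "x \<in> I" for x n
    using that
  proof (induction n arbitrary: x)
    case 0
    then show ?case using J'(3) by simp
  next
    case (Suc n)
    obtain c p where x: "x = c \<otimes> s [^] n \<oplus> p" "c \<in> B" "p \<in> poly_values B s n" using Suc.prems(1) by auto
    then have "c \<in> leading_coeffs B s I n" using Suc.prems(2) unfolding leading_coeffs_def by blast
    then obtain q where q: "q \<in> poly_values B s n" "c \<otimes> s [^] n \<oplus> q \<in> J"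
      using leading unfolding leading_coeffs_def by blast
    let ?y = "c \<otimes> s [^] n \<oplus> q"
    have carrier: "c \<in> carrier R" "p \<in> carrier R" "q \<in> carrier R" "s [^] n \<in> carrier R"
      using x q B_carrier poly_values_carrier s by auto
    have "x \<ominus> ?y = p \<ominus> q" unfolding x(1) using carrier by algebra
    then have "x \<ominus> ?y \<in> J"
      using Suc.IH[of "x \<ominus> ?y"] poly_values_minus[OF x(3) q(1)] I'(6)[OF Suc.prems(2) subsetD[OF subset q(2)]]
      by simp
    then have "(x \<ominus> ?y) \<oplus> ?y \<in> J" using J'(4) q(2) by blast
    moreover have "(x \<ominus> ?y) \<oplus> ?y = x" unfolding x(1) using carrier by algebra
    ultimately show ?case by simp
  qed
  then show ?thesis using I'(1) unfolding simple_extension_eq_poly_values by blast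
qed

lemma leading_coeffs_generators:
  assumes N: "noetherian_ring (R\<lparr>carrier := B\<rparr>)" and I: "ideal I (R\<lparr>carrier := simple_extension B s\<rparr>)"
  obtains T where "finite T" "T \<subseteq> I"
    "\<And>J. \<lbrakk>ideal J (R\<lparr>carrier := simple_extension B s\<rparr>); T \<subseteq> J\<rbrakk> \<Longrightarrow> leading_coeffs B s I n \<subseteq> leading_coeffs B s J n"
proof -
  let ?B = "R\<lparr>carrier := B\<rparr>"
  interpret RB: noetherian_ring ?B by (rule N)
  obtain S where S: "S \<subseteq> B" "finite S" "leading_coeffs B s I n = Idl\<^bsub>?B\<^esub> S"
    using RB.finetely_gen[OF leading_coeffs_ideal[OF I, of n]] by auto
  have "\<forall>b\<in>S. \<exists>p\<in>poly_values B s n. b \<otimes> s [^] n \<oplus> p \<in> I"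
    using RB.genideal_self[of S] S(1,3) unfolding leading_coeffs_def by auto
  then obtain p where p: "\<And>b. b \<in> S \<Longrightarrow> p b \<in> poly_values B s n" "\<And>b. b \<in> S \<Longrightarrow> b \<otimes> s [^] n \<oplus> p b \<in> I"
    by metis
  show ?thesis
  proof (rule that)
    show "finite ((\<lambda>b. b \<otimes> s [^] n \<oplus> p b) ` S)" "(\<lambda>b. b \<otimes> s [^] n \<oplus> p b) ` S \<subseteq> I" using S(2) p(2) by auto
    fix J assume J: "ideal J (R\<lparr>carrier := simple_extension B s\<rparr>)" "(\<lambda>b. b \<otimes> s [^] n \<oplus> p b) ` S \<subseteq> J"
    then have "S \<subseteq> leading_coeffs B s J n" using S(1) p(1) unfolding leading_coeffs_def by blast
    then show "leading_coeffs B s I n \<subseteq> leading_coeffs B s J n"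
      unfolding S(3) by (rule RB.genideal_minimal[OF leading_coeffs_ideal[OF J(1)]])
  qed
qed

lemma leading_coeffs_stable:
  assumes N: "noetherian_ring (R\<lparr>carrier := B\<rparr>)" and I: "ideal I (R\<lparr>carrier := simple_extension B s\<rparr>)"
  obtains N where "\<And>n. leading_coeffs B s I n \<subseteq> leading_coeffs B s I N"
proof -
  let ?\<C> = "range (leading_coeffs B s I)"
  have "leading_coeffs B s I m \<subseteq> leading_coeffs B s I n \<or> leading_coeffs B s I n \<subseteq> leading_coeffs B s I m"
    for m n
    using leading_coeffs_mono[OF I, of m n] leading_coeffs_mono[OF I, of n m] by (meson nle_le)
  then have "subset.chain {I. ideal I (R\<lparr>carrier := B\<rparr>)} ?\<C>"
    using leading_coeffs_ideal[OF I] by (auto simp: subset_chain_def)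
  then have "\<Union>?\<C> \<in> ?\<C>" by (intro noetherian_ring.ideal_chain_is_trivial[OF N]) auto
  then show ?thesis using that by blast
qed

theorem noetherian_ring_simple_extension:
  assumes N: "noetherian_ring (R\<lparr>carrier := B\<rparr>)"
  shows "noetherian_ring (R\<lparr>carrier := simple_extension B s\<rparr>)"
proof -
  let ?C = "R\<lparr>carrier := simple_extension B s\<rparr>"
  interpret C: ring ?C by (rule subring_is_ring[OF simple_extension_is_subring[OF B s]])
  show ?thesis
  proof (rule C.noetherian_ringI)
    fix I assume I: "ideal I ?C"
    obtain N where stable: "\<And>n. leading_coeffs B s I n \<subseteq> leading_coeffs B s I N"
      by (rule leading_coeffs_stable[OF N I], rule that)
    have "\<exists>T. finite T \<and> T \<subseteq> I \<and> (\<forall>J. ideal J ?C \<and> T \<subseteq> J \<longrightarrow> leading_coeffs B s I n \<subseteq> leading_coeffs B s J n)"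
      for n
      by (rule leading_coeffs_generators[OF N I, of n]) blast
    then obtain T where T: "\<And>n. finite (T n)" "\<And>n. T n \<subseteq> I"
      "\<And>n J. \<lbrakk>ideal J ?C; T n \<subseteq> J\<rbrakk> \<Longrightarrow> leading_coeffs B s I n \<subseteq> leading_coeffs B s J n" by metis
    define G where "G = (\<Union>n\<le>N. T n)"
    have G_subset: "G \<subseteq> I" and G_finite: "finite G" using T(1,2) unfolding G_def by auto
    then have G_carrier: "G \<subseteq> carrier ?C" using additive_subgroup.a_subset[OF ideal.axioms(1)[OF I]] by blast
    note J = C.genideal_ideal[OF G_carrier]
    have small: "leading_coeffs B s I n \<subseteq> leading_coeffs B s (Idl\<^bsub>?C\<^esub> G) n" if "n \<le> N" for n
      using C.genideal_self[OF G_carrier] that by (intro T(3)[OF J]) (auto simp: G_def)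
    have "leading_coeffs B s I n \<subseteq> leading_coeffs B s (Idl\<^bsub>?C\<^esub> G) n" for n
    proof (cases "n \<le> N")
      case False
      then have "leading_coeffs B s (Idl\<^bsub>?C\<^esub> G) N \<subseteq> leading_coeffs B s (Idl\<^bsub>?C\<^esub> G) n"
        by (intro leading_coeffs_mono[OF J]) simp
      then show ?thesis using small[OF order_refl] stable[of n] by blast
    qed (rule small)
    then have "I \<subseteq> Idl\<^bsub>?C\<^esub> G"
      by (rule ideal_subset_by_leading_coeffs[OF I J C.genideal_minimal[OF I G_subset]])
    then show "\<exists>A\<subseteq>carrier ?C. finite A \<and> I = Idl\<^bsub>?C\<^esub> A"
      using C.genideal_minimal[OF I G_subset] G_carrier G_finite by blast
  qed
qed

end

lemma noetherian_ring_finite_extension: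
  assumes B: "subring B R" "noetherian_ring (R\<lparr>carrier := B\<rparr>)" and "set xs \<subseteq> carrier R"
  shows "noetherian_ring (R\<lparr>carrier := finite_extension B xs\<rparr>)"
  using assms(3)
proof (induction xs)
  case (Cons x xs)
  then show ?case
    using noetherian_ring_simple_extension[OF finite_extension_is_subring[OF B(1)], of xs x] by simp
qed (use B in simp)

theorem noetherian_ring_finite_type:
  assumes "finite S" "S \<subseteq> carrier R" "subring B R" "noetherian_ring (R\<lparr>carrier := B\<rparr>)"
    and gen: "generate_ring R (B \<union> S) = carrier R"
  shows "noetherian_ring R"
proof -
  obtain xs where xs: "set xs = S" using finite_list[OF assms(1)] by blast
  then have xsR: "set xs \<subseteq> carrier R" using assms(2) by simp
  have BR: "B \<subseteq> carrier R" by (rule subringE(1)[OF assms(3)])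
  have "generate_ring R (B \<union> S) \<subseteq> finite_extension B xs"
    using finite_extension_is_subring[OF assms(3) xsR] finite_extension_incl[OF BR xsR]
      finite_extension_mem[OF assms(3) xsR] xs BR assms(2)
    by (intro generate_ring_min_subring1) auto
  then have "finite_extension B xs = carrier R"
    using gen finite_extension_in_carrier[OF BR xsR] by blast
  then show ?thesis using noetherian_ring_finite_extension[OF assms(3,4) xsR] by simp
qed

end

context cring
begin

definition denominators :: "'a set \<Rightarrow> 'a \<Rightarrow> 'a set" where
  "denominators A f = {r \<in> A. r \<otimes> f \<in> A}"

lemma denominators_ideal:
  assumes A: "subring A R" and f: "f \<in> carrier R"
  shows "ideal (denominators A f) (R\<lparr>carrier := A\<rparr>)"
  using subringE(1,2,6,7)[OF A] f
  by (intro ideal_subringI[OF A]) (auto simp: denominators_def l_distr m_assoc subset_iff)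

lemma ex_primeideal_denominators:
  assumes A: "subring A R" and N: "noetherian_ring (R\<lparr>carrier := A\<rparr>)" and f: "f \<in> carrier R" "f \<notin> A"
  obtains c where "c \<in> A" "c \<otimes> f \<notin> A" "primeideal (denominators A (c \<otimes> f)) (R\<lparr>carrier := A\<rparr>)"
proof -
  note Ac = subsetD[OF subringE(1)[OF A]]
  let ?\<A> = "(\<lambda>c. denominators A (c \<otimes> f)) ` {c \<in> A. c \<otimes> f \<notin> A}"
  have "\<one> \<otimes> f \<notin> A" "\<one> \<in> A" using f subringE(3)[OF A] by auto
  then have nonempty: "?\<A> \<noteq> {}" by blast
  have ideals: "ideal I (R\<lparr>carrier := A\<rparr>)" if "I \<in> ?\<A>" for I
    using that denominators_ideal[OF A] Ac f(1) by auto
  obtain M where M: "M \<in> ?\<A>" "\<And>I. \<lbrakk>I \<in> ?\<A>; M \<subseteq> I\<rbrakk> \<Longrightarrow> I = M"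
    by (rule noetherian_ring.ex_maximal_ideal[OF N nonempty ideals], assumption, rule that)
  then obtain c where c: "c \<in> A" "c \<otimes> f \<notin> A" "M = denominators A (c \<otimes> f)" by blast
  have "a \<in> M \<or> b \<in> M" if ab: "a \<in> A" "b \<in> A" "a \<otimes> b \<in> M" for a b
  proof (rule disjCI)
    assume "b \<notin> M"
    have carrier: "a \<in> carrier R" "b \<in> carrier R" "c \<in> carrier R" using ab c Ac by auto
    have bcf: "b \<otimes> (c \<otimes> f) = (b \<otimes> c) \<otimes> f" using carrier f by algebra
    have "M \<subseteq> denominators A ((b \<otimes> c) \<otimes> f)"
    proof
      fix r assume r: "r \<in> M"
      then have "r \<otimes> ((b \<otimes> c) \<otimes> f) = b \<otimes> (r \<otimes> (c \<otimes> f))"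
        using carrier f(1) Ac[of r] unfolding c(3) denominators_def by (simp add: m_ac)
      then show "r \<in> denominators A ((b \<otimes> c) \<otimes> f)"
        using r subringE(6)[OF A ab(2)] unfolding c(3) denominators_def by auto
    qed
    moreover have "(b \<otimes> c) \<otimes> f \<notin> A" using \<open>b \<notin> M\<close> ab(2) bcf unfolding c(3) denominators_def by auto
    ultimately have "denominators A ((b \<otimes> c) \<otimes> f) = M" using subringE(6)[OF A ab(2) c(1)] by (intro M(2)) auto
    moreover have "a \<otimes> ((b \<otimes> c) \<otimes> f) = (a \<otimes> b) \<otimes> (c \<otimes> f)" using carrier f by algebra
    then have "a \<in> denominators A ((b \<otimes> c) \<otimes> f)" using ab unfolding c(3) denominators_def by simp
    ultimately show "a \<in> M" by simp
  qed
  moreover have "\<one> \<notin> M" using c Ac f(1) unfolding denominators_def by simp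
  ultimately have "primeideal M (R\<lparr>carrier := A\<rparr>)"
    unfolding primeideal_subring_iff[OF A] using ideals[OF M(1)] by blast
  then show ?thesis using that c by blast
qed

end

definition contains_minimal_primes :: "('a, 'b) ring_scheme \<Rightarrow> 'a set \<Rightarrow> 'a set set \<Rightarrow> bool" where
  "contains_minimal_primes R I F \<longleftrightarrow>
     (\<forall>p\<in>F. primeideal p R \<and> I \<subseteq> p) \<and> (\<forall>q. primeideal q R \<and> I \<subseteq> q \<longrightarrow> (\<exists>p\<in>F. p \<subseteq> q))"

lemma contains_minimal_primesD:
  assumes "contains_minimal_primes R I F"
  shows "\<And>p. p \<in> F \<Longrightarrow> primeideal p R" "\<And>p. p \<in> F \<Longrightarrow> I \<subseteq> p"
    "\<And>q. \<lbrakk>primeideal q R; I \<subseteq> q\<rbrakk> \<Longrightarrow> \<exists>p\<in>F. p \<subseteq> q"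
  using assms unfolding contains_minimal_primes_def by simp_all

lemma (in ring) contains_minimal_primes_Un:
  assumes I: "I \<subseteq> carrier R" and ab: "a \<in> carrier R" "b \<in> carrier R" "a \<otimes> b \<in> I"
    and F: "contains_minimal_primes R (Idl (insert a I)) F"
    and G: "contains_minimal_primes R (Idl (insert b I)) G"
  shows "contains_minimal_primes R I (F \<union> G)"
proof -
  have Idl_insert_subset: "Idl (insert x I) \<subseteq> q \<longleftrightarrow> x \<in> q \<and> I \<subseteq> q" if "x \<in> carrier R" "primeideal q R" for x q
    using Idl_subset_ideal[OF primeideal.axioms(1)[OF that(2)], of "insert x I"] that(1) I by simp
  have "primeideal p R \<and> I \<subseteq> p" if p: "p \<in> F \<union> G" for p
  proof -
    have prime: "primeideal p R"
      using p contains_minimal_primesD(1)[OF F] contains_minimal_primesD(1)[OF G] by blast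
    moreover have "Idl (insert a I) \<subseteq> p \<or> Idl (insert b I) \<subseteq> p"
      using p contains_minimal_primesD(2)[OF F] contains_minimal_primesD(2)[OF G] by blast
    ultimately show ?thesis using Idl_insert_subset[OF ab(1) prime] Idl_insert_subset[OF ab(2) prime] by blast
  qed
  moreover have "\<exists>p\<in>F \<union> G. p \<subseteq> q" if q: "primeideal q R" "I \<subseteq> q" for q
  proof -
    have "a \<in> q \<or> b \<in> q" using primeideal.I_prime[OF q(1) ab(1,2)] ab(3) q(2) by blast
    then have "Idl (insert a I) \<subseteq> q \<or> Idl (insert b I) \<subseteq> q"
      using Idl_insert_subset[OF ab(1) q(1)] Idl_insert_subset[OF ab(2) q(1)] q(2) by simp
    then show ?thesis
      using contains_minimal_primesD(3)[OF F q(1)] contains_minimal_primesD(3)[OF G q(1)] by blast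
  qed
  ultimately show ?thesis unfolding contains_minimal_primes_def by blast
qed

lemma (in noetherian_ring) finitely_many_minimal_primes:
  assumes R: "cring R" and I: "ideal I R"
  shows "\<exists>F. finite F \<and> contains_minimal_primes R I F" (is "?good I")
proof (rule ccontr)
  assume "\<not> ?good I"
  then have nonempty: "{I. ideal I R \<and> \<not> ?good I} \<noteq> {}" using I by blast
  obtain M where M: "M \<in> {I. ideal I R \<and> \<not> ?good I}"
    "\<And>J. \<lbrakk>J \<in> {I. ideal I R \<and> \<not> ?good I}; M \<subseteq> J\<rbrakk> \<Longrightarrow> J = M"
    by (rule ex_maximal_ideal[OF nonempty], simp, rule that)
  then have ideal: "ideal M R" and bad: "\<And>F. finite F \<Longrightarrow> \<not> contains_minimal_primes R M F" by auto
  have MR: "M \<subseteq> carrier R" using additive_subgroup.a_subset[OF ideal.axioms(1)[OF ideal]] .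
  have "\<not> primeideal M R" using bad[of "{M}"] unfolding contains_minimal_primes_def by auto
  moreover have "carrier R \<noteq> M"
  proof
    assume "carrier R = M"
    then have "\<not> M \<subseteq> q" if "primeideal q R" for q
      using primeideal.I_notcarr[OF that] additive_subgroup.a_subset[OF ideal.axioms(1)[OF primeideal.axioms(1)[OF that]]] by blast
    then show False using bad[of "{}"] unfolding contains_minimal_primes_def by simp
  qed
  ultimately obtain a b where ab: "a \<in> carrier R" "b \<in> carrier R" "a \<otimes> b \<in> M" "a \<notin> M" "b \<notin> M"
    using primeidealI[OF ideal R] by blast
  have larger: "?good (Idl (insert x M))" if x: "x \<in> carrier R" "x \<notin> M" for x
    using M(2)[of "Idl (insert x M)"] genideal_ideal[of "insert x M"] genideal_self[of "insert x M"] x MR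
    by auto
  then obtain F G where "finite F" "contains_minimal_primes R (Idl (insert a M)) F"
      "finite G" "contains_minimal_primes R (Idl (insert b M)) G"
    using larger[OF ab(1,4)] larger[OF ab(2,5)] by blast
  then show False using bad[of "F \<union> G"] contains_minimal_primes_Un[OF MR ab(1-3)] by blast
qed

section \<open>Discrete valuation rings in a field\<close>

context field
begin

lemma mem_units_of_iff: "x \<in> carrier (units_of R) \<longleftrightarrow> x \<in> carrier R \<and> x \<noteq> \<zero>"
  using field_Units by (simp add: units_of_carrier)

lemma int_pow_units_of:
  assumes "x \<in> Units R"
  shows "x [^]\<^bsub>units_of R\<^esub> (n::int) = x [^] n"
  using units_of_inv[OF Units_pow_closed[OF assms]]
  by (subst (1 2) int_pow_def2) (simp add: units_of_pow[OF assms] del: pow_nat)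

lemma int_pow_nonzero:
  assumes "x \<in> carrier R" "x \<noteq> \<zero>"
  shows "x [^] (n::int) \<in> carrier R" "x [^] n \<noteq> \<zero>"
  using group.int_pow_closed[OF units_group, of x n] assms field_Units
  by (auto simp: int_pow_units_of mem_units_of_iff)

lemma int_pow_add:
  assumes "x \<in> carrier R" "x \<noteq> \<zero>"
  shows "x [^] (m + n :: int) = x [^] m \<otimes> x [^] n"
  using group.int_pow_mult[OF units_group, of x m n] assms field_Units
  by (simp add: int_pow_units_of mem_units_of_iff units_of_mult)

lemma int_pow_m_distrib:
  assumes "x \<in> carrier R" "x \<noteq> \<zero>" "y \<in> carrier R" "y \<noteq> \<zero>"
  shows "(x \<otimes> y) [^] (n :: int) = x [^] n \<otimes> y [^] n"
  using comm_group.int_pow_distrib[OF units_comm_group, of x y n] assms field_Units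
  by (simp add: int_pow_units_of mem_units_of_iff units_of_mult integral_iff)

lemma Units_subring_subgroup:
  assumes Q: "subring Q R"
  shows "subgroup (Units (R\<lparr>carrier := Q\<rparr>)) (units_of R)"
proof (rule group.subgroupI[OF units_group])
  interpret Q: cring "R\<lparr>carrier := Q\<rparr>" by (rule subring_is_cring[OF Q])
  show sub: "Units (R\<lparr>carrier := Q\<rparr>) \<subseteq> carrier (units_of R)"
    using subringE(1)[OF Q] by (auto simp: Units_subring_iff[OF Q] subset_iff mem_units_of_iff)
  show "Units (R\<lparr>carrier := Q\<rparr>) \<noteq> {}" using Q.Units_one_closed by auto
  show "inv\<^bsub>units_of R\<^esub> u \<in> Units (R\<lparr>carrier := Q\<rparr>)" if u: "u \<in> Units (R\<lparr>carrier := Q\<rparr>)" for u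
  proof -
    obtain w where w: "u \<in> Q" "w \<in> Q" "u \<otimes> w = \<one>" using u unfolding Units_subring_iff[OF Q] by blast
    have carrier: "u \<in> carrier R" "w \<in> carrier R" using w subringE(1)[OF Q] by auto
    have "inv\<^bsub>units_of R\<^esub> u = w"
      using comm_inv_char[OF carrier w(3)] units_of_inv[of u] sub u units_of_carrier[of R] by auto
    then show ?thesis using w m_comm[OF carrier] unfolding Units_subring_iff[OF Q] by auto
  qed
  show "u \<otimes>\<^bsub>units_of R\<^esub> w \<in> Units (R\<lparr>carrier := Q\<rparr>)"
    if "u \<in> Units (R\<lparr>carrier := Q\<rparr>)" "w \<in> Units (R\<lparr>carrier := Q\<rparr>)" for u w
    using Q.Units_m_closed[OF that] by (simp add: units_of_mult)
qed

lemma Units_subringE: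
  assumes Q: "subring Q R"
  shows "\<And>u. u \<in> Units (R\<lparr>carrier := Q\<rparr>) \<Longrightarrow> u \<in> Q"
    "\<And>u. u \<in> Units (R\<lparr>carrier := Q\<rparr>) \<Longrightarrow> u \<in> carrier R"
    "\<And>u. u \<in> Units (R\<lparr>carrier := Q\<rparr>) \<Longrightarrow> u \<noteq> \<zero>"
    "\<And>u. u \<in> Units (R\<lparr>carrier := Q\<rparr>) \<Longrightarrow> inv u \<in> Units (R\<lparr>carrier := Q\<rparr>)"
    "\<And>u w. \<lbrakk>u \<in> Units (R\<lparr>carrier := Q\<rparr>); w \<in> Units (R\<lparr>carrier := Q\<rparr>)\<rbrakk> \<Longrightarrow> u \<otimes> w \<in> Units (R\<lparr>carrier := Q\<rparr>)"
    "\<one> \<in> Units (R\<lparr>carrier := Q\<rparr>)"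
    "\<And>u n. u \<in> Units (R\<lparr>carrier := Q\<rparr>) \<Longrightarrow> u [^] (n::int) \<in> Units (R\<lparr>carrier := Q\<rparr>)"
proof -
  interpret U: subgroup "Units (R\<lparr>carrier := Q\<rparr>)" "units_of R" by (rule Units_subring_subgroup[OF Q])
  fix u assume u: "u \<in> Units (R\<lparr>carrier := Q\<rparr>)"
  then have uU: "u \<in> Units R" using U.subset by (auto simp: units_of_carrier)
  show "u \<in> Q" using u unfolding Units_subring_iff[OF Q] by blast
  show "u \<in> carrier R" "u \<noteq> \<zero>" using uU field_Units by auto
  show "inv u \<in> Units (R\<lparr>carrier := Q\<rparr>)" using U.m_inv_closed[OF u] by (simp add: units_of_inv[OF uU])
  show "u [^] (n::int) \<in> Units (R\<lparr>carrier := Q\<rparr>)" for n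
    using group.subgroup_int_pow_closed[OF units_group U.subgroup_axioms u]
    by (simp add: int_pow_units_of[OF uU])
  show "u \<otimes> w \<in> Units (R\<lparr>carrier := Q\<rparr>)" if "w \<in> Units (R\<lparr>carrier := Q\<rparr>)" for w
    using U.m_closed[OF u that] by (simp add: units_of_mult)
next
  show "\<one> \<in> Units (R\<lparr>carrier := Q\<rparr>)"
    using subgroup.one_closed[OF Units_subring_subgroup[OF Q]] by (simp add: units_of_one)
qed

lemma subring_div_unit:
  assumes Q: "subring Q R" and b: "b \<in> Units (R\<lparr>carrier := Q\<rparr>)" and c: "c \<in> carrier R" "b \<otimes> c \<in> Q"
  shows "c \<in> Q"
proof -
  note U = Units_subringE[OF Q]
  have "inv b \<otimes> b = \<one>" using U(2,3)[OF b] field_Units by (intro Units_l_inv) auto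
  then have "inv b \<otimes> (b \<otimes> c) = c" using U(2)[OF U(4)[OF b]] U(2)[OF b] c(1) by (simp add: m_assoc[symmetric])
  then show ?thesis using subringE(6)[OF Q U(1)[OF U(4)[OF b]] c(2)] by simp
qed

lemma Units_subring_factor:
  assumes Q: "subring Q R" and ab: "a \<in> Q" "b \<in> Q" "a \<otimes> b \<in> Units (R\<lparr>carrier := Q\<rparr>)"
  shows "a \<in> Units (R\<lparr>carrier := Q\<rparr>)"
proof -
  obtain w where w: "w \<in> Q" "a \<otimes> b \<otimes> w = \<one>" using ab(3) unfolding Units_subring_iff[OF Q] by blast
  then have "a \<otimes> (b \<otimes> w) = \<one>" using ab subringE(1)[OF Q] by (simp add: m_assoc subset_iff)
  then show ?thesis using ab(1) subringE(6)[OF Q ab(2) w(1)] unfolding Units_subring_iff[OF Q] by blast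
qed

definition integrally_closed_subring :: "'a set \<Rightarrow> bool" where
  "integrally_closed_subring Q \<longleftrightarrow> (\<forall>x\<in>carrier R. \<forall>n. x [^] n \<in> poly_values Q x n \<longrightarrow> x \<in> Q)"

lemma poly_values_mult_stable_ideal:
  assumes Q: "subring Q R" and I: "ideal I (R\<lparr>carrier := Q\<rparr>)"
    and x: "x \<in> carrier R" "\<And>a. a \<in> I \<Longrightarrow> x \<otimes> a \<in> I" and b: "b \<in> I" and p: "p \<in> poly_values Q x n"
  shows "p \<otimes> b \<in> I"
proof -
  note I' = ideal_subringE[OF Q I]
  have b_carrier: "b \<in> carrier R" using b I'(2) by blast
  have pow: "x [^] n \<otimes> b \<in> I" for n :: nat
  proof (induction n)
    case (Suc n)
    have "x [^] Suc n \<otimes> b = x \<otimes> (x [^] n \<otimes> b)" using b_carrier x(1) by (simp add: m_ac)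
    then show ?case using x(2)[OF Suc] by simp
  qed (use b b_carrier in simp)
  show ?thesis
    using p
  proof (induction n arbitrary: p)
    case (Suc n)
    then obtain c q where p: "p = c \<otimes> x [^] n \<oplus> q" "c \<in> Q" "q \<in> poly_values Q x n" by auto
    have "c \<in> carrier R" "q \<in> carrier R" "x [^] n \<in> carrier R"
      using p subringE(1)[OF Q] poly_values_carrier[OF Q x(1)] x(1) by auto
    then have "p \<otimes> b = c \<otimes> (x [^] n \<otimes> b) \<oplus> q \<otimes> b" unfolding p using b_carrier by algebra
    then show ?case using I'(4)[OF I'(5)[OF p(2) pow] Suc.IH[OF p(3)]] by simp
  qed (use I'(3) b_carrier in simp)
qed

lemma integral_if_stabilizes_ideal:
  assumes Q: "subring Q R" and N: "noetherian_ring (R\<lparr>carrier := Q\<rparr>)"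
    and I: "ideal I (R\<lparr>carrier := Q\<rparr>)" and x: "x \<in> carrier R" "\<And>a. a \<in> I \<Longrightarrow> x \<otimes> a \<in> I"
    and b: "b \<in> I" "b \<noteq> \<zero>"
  shows "\<exists>n. x [^] n \<in> poly_values Q x n"
proof -
  note I' = ideal_subringE[OF Q I]
  have b_carrier: "b \<in> carrier R" using b(1) I'(2) by blast
  define J where "J n = (\<lambda>p. p \<otimes> b) ` poly_values Q x n" for n
  have ideal: "ideal (J n) (R\<lparr>carrier := Q\<rparr>)" for n
  proof (rule ideal_subringI[OF Q])
    note poly_carrier = subsetD[OF poly_values_carrier[OF Q x(1)]]
    show "J n \<subseteq> Q" using poly_values_mult_stable_ideal[OF Q I x b(1)] I'(1) unfolding J_def by blast
    show "\<zero> \<in> J n" using poly_values_zero[OF Q x(1), of n] b_carrier unfolding J_def by force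
    show "y \<oplus> z \<in> J n" if "y \<in> J n" "z \<in> J n" for y z
      using that poly_values_add[OF Q x(1)] poly_carrier b_carrier
      unfolding J_def by (auto simp: l_distr[symmetric])
    show "a \<otimes> y \<in> J n" if "a \<in> Q" "y \<in> J n" for a y
      using that poly_values_smult[OF Q x(1)] poly_carrier b_carrier subringE(1)[OF Q]
      unfolding J_def by (auto simp: m_assoc[symmetric] subset_iff)
  qed
  have "J m \<subseteq> J n \<or> J n \<subseteq> J m" for m n
    using poly_values_mono[OF Q x(1), of m n] poly_values_mono[OF Q x(1), of n m]
    unfolding J_def by (meson image_mono nle_le)
  then have "subset.chain {I. ideal I (R\<lparr>carrier := Q\<rparr>)} (range J)"
    using ideal by (auto simp: subset_chain_def)
  then have "\<Union>(range J) \<in> range J" by (intro noetherian_ring.ideal_chain_is_trivial[OF N]) auto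
  then obtain n where n: "\<Union>(range J) = J n" by blast
  have "x [^] n = \<one> \<otimes> x [^] n \<oplus> \<zero>" using x(1) by simp
  then have "x [^] n \<in> poly_values Q x (Suc n)"
    using poly_values_zero[OF Q x(1)] subringE(3)[OF Q] by auto
  then have "x [^] n \<otimes> b \<in> \<Union>(range J)" unfolding J_def by blast
  then obtain p where p: "p \<in> poly_values Q x n" "x [^] n \<otimes> b = p \<otimes> b" unfolding n J_def by blast
  then have "x [^] n = p"
    using m_rcancel[OF b(2) b_carrier, of "x [^] n" p] x(1) poly_values_carrier[OF Q x(1)] by auto
  then show ?thesis using p(1) by blast
qed

lemma nonunits_principal:
  assumes Q: "subring Q R" and x: "x \<in> carrier R" "\<And>a. a \<in> Q - Units (R\<lparr>carrier := Q\<rparr>) \<Longrightarrow> x \<otimes> a \<in> Q"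
    and s: "s \<in> Q - Units (R\<lparr>carrier := Q\<rparr>)" "x \<otimes> s \<in> Units (R\<lparr>carrier := Q\<rparr>)"
  shows "Q - Units (R\<lparr>carrier := Q\<rparr>) = PIdl\<^bsub>R\<lparr>carrier := Q\<rparr>\<^esub> s"
proof (intro subset_antisym subsetI)
  note Qc = subsetD[OF subringE(1)[OF Q]]
  obtain w where w: "w \<in> Q" "x \<otimes> s \<otimes> w = \<one>" using s(2) unfolding Units_subring_iff[OF Q] by blast
  have carrier: "s \<in> carrier R" "w \<in> carrier R" using s(1) w(1) Qc by auto
  fix a assume a: "a \<in> Q - Units (R\<lparr>carrier := Q\<rparr>)"
  have "a = (x \<otimes> s \<otimes> w) \<otimes> a" unfolding w(2) using a Qc by simp
  also have "\<dots> = (w \<otimes> (x \<otimes> a)) \<otimes> s" using a Qc carrier x(1) by (simp add: m_ac)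
  finally show "a \<in> PIdl\<^bsub>R\<lparr>carrier := Q\<rparr>\<^esub> s"
    using subringE(6)[OF Q w(1) x(2)[OF a]] unfolding cgenideal_def by auto
next
  fix y assume "y \<in> PIdl\<^bsub>R\<lparr>carrier := Q\<rparr>\<^esub> s"
  then obtain a where a: "a \<in> Q" "y = a \<otimes> s" unfolding cgenideal_def by auto
  then have "y = s \<otimes> a" using s(1) subringE(1)[OF Q] by (simp add: m_comm subset_iff)
  then show "y \<in> Q - Units (R\<lparr>carrier := Q\<rparr>)"
    using Units_subring_factor[OF Q _ a(1)] subringE(6)[OF Q _ a(1)] s(1) by auto
qed

text \<open>Multiplication by \<open>x\<close> cannot map the maximal ideal \<open>\<mm>\<close> into itself, since \<open>x\<close> would be integral
  over \<open>Q\<close>. So \<open>x s\<close> is a unit for some \<open>s \<in> \<mm>\<close>.\<close>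

lemma ex_uniformizer:
  assumes Q: "subring Q R" and N: "noetherian_ring (R\<lparr>carrier := Q\<rparr>)" and closed: "integrally_closed_subring Q"
    and local: "ideal (Q - Units (R\<lparr>carrier := Q\<rparr>)) (R\<lparr>carrier := Q\<rparr>)"
    and x: "x \<in> carrier R" "x \<notin> Q" "\<And>a. a \<in> Q - Units (R\<lparr>carrier := Q\<rparr>) \<Longrightarrow> x \<otimes> a \<in> Q"
    and b: "b \<in> Q - Units (R\<lparr>carrier := Q\<rparr>)" "b \<noteq> \<zero>"
  obtains t where "t \<in> Q" "t \<noteq> \<zero>" "Q - Units (R\<lparr>carrier := Q\<rparr>) = PIdl\<^bsub>R\<lparr>carrier := Q\<rparr>\<^esub> t"
proof -
  have "\<not> (\<forall>a\<in>Q - Units (R\<lparr>carrier := Q\<rparr>). x \<otimes> a \<in> Q - Units (R\<lparr>carrier := Q\<rparr>))"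
    using integral_if_stabilizes_ideal[OF Q N local x(1) _ b] closed x(1,2)
    unfolding integrally_closed_subring_def by blast
  then obtain s where s: "s \<in> Q - Units (R\<lparr>carrier := Q\<rparr>)" "x \<otimes> s \<in> Units (R\<lparr>carrier := Q\<rparr>)"
    using x(3) by blast
  have "s \<noteq> \<zero>" using Units_subringE(3)[OF Q s(2)] x(1) by auto
  then show ?thesis using that nonunits_principal[OF Q x(1,3) s] s(1) by blast
qed

end

locale discrete_valuation_subring = field R for R (structure) +
  fixes Q t
  assumes subring: "subring Q R" and noetherian: "noetherian_ring (R\<lparr>carrier := Q\<rparr>)"
    and uniformizer: "t \<in> Q" "t \<noteq> \<zero>" "Q - Units (R\<lparr>carrier := Q\<rparr>) = PIdl\<^bsub>R\<lparr>carrier := Q\<rparr>\<^esub> t"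
    and fractions: "f \<in> carrier R \<Longrightarrow> \<exists>b\<in>Q. b \<noteq> \<zero> \<and> b \<otimes> f \<in> Q"
begin

abbreviation \<U> :: "'a set" where
  "\<U> \<equiv> Units (R\<lparr>carrier := Q\<rparr>)"

lemmas unit = Units_subringE[OF subring]

lemma Q_carrier: "a \<in> Q \<Longrightarrow> a \<in> carrier R"
  using subringE(1)[OF subring] by blast

lemma t_carrier: "t \<in> carrier R"
  by (rule Q_carrier[OF uniformizer(1)])

lemmas t_pow_nonzero = int_pow_nonzero[OF t_carrier uniformizer(2)]
lemmas t_pow_add = int_pow_add[OF t_carrier uniformizer(2)]

lemma t_pow_nonneg:
  assumes "0 \<le> n"
  shows "t [^] (n::int) \<in> Q"
proof -
  have "t [^] (k::nat) \<in> Q" for k by (induction k) (use subringE(3,6)[OF subring] uniformizer(1) in auto)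
  then show ?thesis using assms by (subst int_pow_def2) (simp del: pow_nat)
qed

lemma nonunit_iff: "a \<in> Q - \<U> \<longleftrightarrow> (\<exists>r\<in>Q. a = t \<otimes> r)"
  unfolding uniformizer(3) cgenideal_def using m_comm t_carrier Q_carrier by auto

lemma factorization_subring:
  assumes a: "a \<in> Q" "a \<noteq> \<zero>"
  shows "\<exists>n::nat. \<exists>u\<in>\<U>. a = u \<otimes> t [^] n"
proof (rule ccontr)
  let ?Q = "R\<lparr>carrier := Q\<rparr>"
  interpret Q: cring ?Q by (rule subring_is_cring[OF subring])
  assume bad: "\<not> ?thesis"
  define B where "B = {a \<in> Q. a \<noteq> \<zero> \<and> \<not> (\<exists>n::nat. \<exists>u\<in>\<U>. a = u \<otimes> t [^] n)}"
  have nonempty: "(\<lambda>b. PIdl\<^bsub>?Q\<^esub> b) ` B \<noteq> {}" using a bad unfolding B_def by blast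
  obtain M where M: "M \<in> (\<lambda>b. PIdl\<^bsub>?Q\<^esub> b) ` B" "\<And>I. \<lbrakk>I \<in> (\<lambda>b. PIdl\<^bsub>?Q\<^esub> b) ` B; M \<subseteq> I\<rbrakk> \<Longrightarrow> I = M"
    by (rule noetherian_ring.ex_maximal_ideal[OF noetherian nonempty], use Q.cgenideal_ideal
      in \<open>force simp: B_def\<close>, rule that)
  then obtain b where b: "b \<in> B" "M = PIdl\<^bsub>?Q\<^esub> b" by blast
  then have bQ: "b \<in> Q" "b \<noteq> \<zero>" unfolding B_def by auto
  have "b = b \<otimes> t [^] (0::nat)" using Q_carrier[OF bQ(1)] by simp
  then have "b \<in> Q - \<U>" using b(1) bQ(1) unfolding B_def by blast
  then obtain c where c: "c \<in> Q" "b = t \<otimes> c" unfolding nonunit_iff by blast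
  have carrier: "c \<in> carrier R" "b \<in> carrier R" "c \<noteq> \<zero>" using Q_carrier c bQ t_carrier by auto
  have "c \<in> B"
  proof (rule ccontr)
    assume "c \<notin> B"
    then obtain n :: nat and u where u: "u \<in> \<U>" "c = u \<otimes> t [^] n" using c(1) carrier(3) unfolding B_def by blast
    then have "b = u \<otimes> t [^] Suc n" using unit(2)[OF u(1)] t_carrier c(2) by (simp add: m_ac)
    then show False using b(1) u(1) unfolding B_def by blast
  qed
  moreover have "PIdl\<^bsub>?Q\<^esub> b \<subseteq> PIdl\<^bsub>?Q\<^esub> c"
    using Q.cgenideal_minimal[OF Q.cgenideal_ideal, of c b] c uniformizer(1) by (auto simp: cgenideal_def)
  ultimately have "PIdl\<^bsub>?Q\<^esub> c = PIdl\<^bsub>?Q\<^esub> b" using M(2) b(2) by blast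
  then obtain r where r: "r \<in> Q" "c = r \<otimes> b"
    using Q.cgenideal_self[of c] c(1) by (auto simp: cgenideal_def)
  then have "c \<otimes> (t \<otimes> r) = c \<otimes> \<one>" using c(2) carrier t_carrier Q_carrier by (simp add: m_ac)
  then have "t \<otimes> r = \<one>" using m_lcancel[OF carrier(3,1)] t_carrier Q_carrier r(1) by auto
  then show False using nonunit_iff[of \<one>] r(1) unit(6) by auto
qed

lemma factorization:
  assumes f: "f \<in> carrier R" "f \<noteq> \<zero>"
  shows "\<exists>n::int. \<exists>u\<in>\<U>. f = u \<otimes> t [^] n"
proof -
  obtain b where b: "b \<in> Q" "b \<noteq> \<zero>" "b \<otimes> f \<in> Q" using fractions[OF f(1)] by blast
  have b_carrier: "b \<in> carrier R" by (rule Q_carrier[OF b(1)])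
  have "b \<otimes> f \<noteq> \<zero>" using b(2) f b_carrier integral_iff by auto
  then obtain m u where u: "u \<in> \<U>" "b \<otimes> f = u \<otimes> t [^] (m::nat)" using factorization_subring[OF b(3)] by blast
  obtain n w where w: "w \<in> \<U>" "b = w \<otimes> t [^] (n::nat)" using factorization_subring[OF b(1,2)] by blast
  have carrier: "u \<in> carrier R" "w \<in> carrier R" "inv w \<in> carrier R" using unit(2,4) u(1) w(1) by auto
  have winv: "w \<otimes> inv w = \<one>" using carrier unit(3)[OF w(1)] field_Units by (intro Units_r_inv) auto
  let ?g = "(u \<otimes> inv w) \<otimes> t [^] (int m - int n)"
  have t_pow_carrier: "t [^] (int m - int n) \<in> carrier R" "t [^] int n \<in> carrier R" using t_pow_nonzero by auto
  have "b \<otimes> ?g = (w \<otimes> inv w) \<otimes> u \<otimes> (t [^] int n \<otimes> t [^] (int m - int n))"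
    unfolding w(2) int_pow_int[symmetric] using carrier t_pow_carrier by algebra
  also have "t [^] int n \<otimes> t [^] (int m - int n) = t [^] int m"
    using t_pow_add[of "int n" "int m - int n"] by simp
  also have "(w \<otimes> inv w) \<otimes> u \<otimes> t [^] int m = b \<otimes> f"
    unfolding winv u(2) int_pow_int using carrier t_carrier by simp
  finally have "?g = f" using m_lcancel[OF b(2) b_carrier] f(1) carrier t_pow_carrier by auto
  then show ?thesis using unit(5)[OF u(1) unit(4)[OF w(1)]] by blast
qed

lemma t_pow_less_neq:
  fixes m n :: int
  assumes uw: "u \<in> \<U>" "w \<in> \<U>" and "m < n"
  shows "u \<otimes> t [^] m \<noteq> w \<otimes> t [^] n"
proof
  assume eq: "u \<otimes> t [^] m = w \<otimes> t [^] n"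
  define k where "k = n - m - 1"
  have k: "k \<ge> 0" "n = m + (1 + k)" using \<open>m < n\<close> unfolding k_def by auto
  have carrier: "u \<in> carrier R" "w \<in> carrier R" "t [^] m \<in> carrier R" "t [^] k \<in> carrier R"
    using unit(2) uw t_pow_nonzero by auto
  have "t [^] (1::int) = t" using int_pow_int[of R t 1] t_carrier by simp
  then have "t [^] m \<otimes> u = t [^] m \<otimes> (t \<otimes> (w \<otimes> t [^] k))"
    using eq carrier t_carrier unfolding k(2) t_pow_add by (simp add: m_ac)
  then have "u = t \<otimes> (w \<otimes> t [^] k)"
    using m_lcancel[OF t_pow_nonzero(2)[of m] carrier(3)] carrier t_carrier by auto
  moreover have "w \<otimes> t [^] k \<in> Q" using subringE(6)[OF subring unit(1)[OF uw(2)] t_pow_nonneg[OF k(1)]] .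
  ultimately show False using nonunit_iff[of u] uw(1) by blast
qed

definition val :: "'a \<Rightarrow> int" where
  "val f = (THE n. \<exists>u\<in>\<U>. f = u \<otimes> t [^] n)"

lemma val_eqI:
  assumes "u \<in> \<U>" "f = u \<otimes> t [^] (n::int)"
  shows "val f = n"
  unfolding val_def
proof (rule the_equality)
  show "m = n" if "\<exists>w\<in>\<U>. f = w \<otimes> t [^] m" for m
    using that assms t_pow_less_neq[of _ u m n] t_pow_less_neq[of u _ n m] by (metis linorder_neqE)
qed (use assms in blast)

lemma val_factorization:
  assumes "f \<in> carrier R" "f \<noteq> \<zero>"
  obtains u where "u \<in> \<U>" "f = u \<otimes> t [^] val f"
proof -
  obtain n u where u: "u \<in> \<U>" "f = u \<otimes> t [^] (n::int)" using factorization[OF assms] by blast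
  then show ?thesis using that[of u] val_eqI[OF u] by simp
qed

lemma val_mult:
  assumes f: "f \<in> carrier R" "f \<noteq> \<zero>" and g: "g \<in> carrier R" "g \<noteq> \<zero>"
  shows "val (f \<otimes> g) = val f + val g"
proof -
  obtain u w where u: "u \<in> \<U>" "f = u \<otimes> t [^] val f" and w: "w \<in> \<U>" "g = w \<otimes> t [^] val g"
    using val_factorization f g by metis
  have carrier: "u \<in> carrier R" "w \<in> carrier R" "t [^] val f \<in> carrier R" "t [^] val g \<in> carrier R"
    using unit(2) u(1) w(1) t_pow_nonzero by auto
  have "f \<otimes> g = (u \<otimes> t [^] val f) \<otimes> (w \<otimes> t [^] val g)" using u(2) w(2) by simp
  also have "\<dots> = (u \<otimes> w) \<otimes> t [^] (val f + val g)" unfolding t_pow_add using carrier by algebra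
  finally show ?thesis by (rule val_eqI[OF unit(5)[OF u(1) w(1)]])
qed

lemma val_nonneg_iff:
  assumes f: "f \<in> carrier R" "f \<noteq> \<zero>"
  shows "0 \<le> val f \<longleftrightarrow> f \<in> Q"
proof
  assume "0 \<le> val f"
  moreover obtain u where u: "u \<in> \<U>" "f = u \<otimes> t [^] val f" by (rule val_factorization[OF f])
  ultimately have "u \<otimes> t [^] val f \<in> Q" using subringE(6)[OF subring unit(1) t_pow_nonneg] by blast
  then show "f \<in> Q" using u(2) by simp
next
  assume "f \<in> Q"
  then obtain n u where "u \<in> \<U>" "f = u \<otimes> t [^] (n::nat)" using factorization_subring f by blast
  then have "val f = int n" using val_eqI[of u f "int n"] by (simp add: int_pow_int)
  then show "0 \<le> val f" by simp
qed

lemma val_pos_iff: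
  assumes f: "f \<in> carrier R" "f \<noteq> \<zero>"
  shows "1 \<le> val f \<longleftrightarrow> f \<in> Q - \<U>"
proof -
  obtain u where u: "u \<in> \<U>" "f = u \<otimes> t [^] val f" by (rule val_factorization[OF f])
  have "val f = 0 \<longleftrightarrow> f \<in> \<U>"
  proof
    assume "val f = 0"
    then show "f \<in> \<U>" using u unit(2)[OF u(1)] by simp
  next
    assume "f \<in> \<U>"
    then show "val f = 0" using val_eqI[of f f 0] f(1) by simp
  qed
  moreover have "1 \<le> val f \<longleftrightarrow> 0 \<le> val f \<and> val f \<noteq> 0" by auto
  ultimately show ?thesis using val_nonneg_iff[OF f] by blast
qed

lemma val_ge_iff:
  assumes f: "f \<in> carrier R" "f \<noteq> \<zero>"
  shows "n \<le> val f \<longleftrightarrow> (\<exists>a\<in>Q. f = a \<otimes> t [^] n)"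
proof
  assume n: "n \<le> val f"
  obtain u where u: "u \<in> \<U>" "f = u \<otimes> t [^] val f" by (rule val_factorization[OF f])
  have carrier: "u \<in> carrier R" "t [^] (val f - n) \<in> carrier R" "t [^] n \<in> carrier R"
    using unit(2)[OF u(1)] t_pow_nonzero by auto
  have "t [^] val f = t [^] (val f - n) \<otimes> t [^] n" using t_pow_add[of "val f - n" n] by simp
  then have "f = (u \<otimes> t [^] (val f - n)) \<otimes> t [^] n" using u(2) carrier by (simp add: m_assoc)
  moreover have "u \<otimes> t [^] (val f - n) \<in> Q"
    using subringE(6)[OF subring unit(1)[OF u(1)] t_pow_nonneg] n by simp
  ultimately show "\<exists>a\<in>Q. f = a \<otimes> t [^] n" by blast
next
  assume "\<exists>a\<in>Q. f = a \<otimes> t [^] n"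
  then obtain a where a: "a \<in> Q" "f = a \<otimes> t [^] n" by blast
  have "a \<noteq> \<zero>" using a(2) f(2) t_pow_nonzero by auto
  moreover have "val (t [^] n) = n" using val_eqI[OF unit(6), of "t [^] n" n] t_pow_nonzero(1)[of n] by simp
  ultimately show "n \<le> val f"
    using val_mult[OF Q_carrier[OF a(1)] _ t_pow_nonzero] val_nonneg_iff[OF Q_carrier[OF a(1)]] a by simp
qed

lemma val_add:
  assumes f: "f \<in> carrier R" "f \<noteq> \<zero>" and g: "g \<in> carrier R" "g \<noteq> \<zero>" and "f \<oplus> g \<noteq> \<zero>"
    and n: "n \<le> val f" "n \<le> val g"
  shows "n \<le> val (f \<oplus> g)"
proof -
  obtain a b where ab: "a \<in> Q" "f = a \<otimes> t [^] n" "b \<in> Q" "g = b \<otimes> t [^] n"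
    using n val_ge_iff[OF f] val_ge_iff[OF g] by blast
  then have "f \<oplus> g = (a \<oplus> b) \<otimes> t [^] n" using Q_carrier t_pow_nonzero by (simp add: l_distr)
  then show ?thesis
    using val_ge_iff[OF a_closed[OF f(1) g(1)] \<open>f \<oplus> g \<noteq> \<zero>\<close>] subringE(7)[OF subring ab(1,3)] by blast
qed

lemma val_uniformizer_power:
  assumes t': "t' \<in> Q" "Q - \<U> = PIdl\<^bsub>R\<lparr>carrier := Q\<rparr>\<^esub> t'" and u: "u \<in> \<U>"
  shows "val (u \<otimes> t' [^] (n::int)) = n"
proof -
  interpret Q: cring "R\<lparr>carrier := Q\<rparr>" by (rule subring_is_cring[OF subring])
  have "t' \<in> Q - \<U>" using Q.cgenideal_self[of t'] t' by simp
  then obtain a where a: "a \<in> Q" "t' = t \<otimes> a" unfolding nonunit_iff by blast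
  have "t \<in> PIdl\<^bsub>R\<lparr>carrier := Q\<rparr>\<^esub> t'" using Q.cgenideal_self[of t] uniformizer t'(2) by simp
  then obtain b where b: "b \<in> Q" "t = b \<otimes> t'" unfolding cgenideal_def by auto
  have carrier: "a \<in> carrier R" "b \<in> carrier R" using a(1) b(1) Q_carrier by auto
  have "t \<otimes> (a \<otimes> b) = t \<otimes> \<one>" using b(2) carrier t_carrier unfolding a(2) by (simp add: m_ac)
  then have "a \<otimes> b = \<one>" using m_lcancel[OF uniformizer(2) t_carrier] carrier by auto
  then have aU: "a \<in> \<U>" using a(1) b(1) unfolding Units_subring_iff[OF subring] by blast
  have "t' [^] n = t [^] n \<otimes> a [^] n"
    unfolding a(2) by (rule int_pow_m_distrib[OF t_carrier uniformizer(2) carrier(1) unit(3)[OF aU]])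
  then have "u \<otimes> t' [^] n = (u \<otimes> a [^] n) \<otimes> t [^] n"
    using unit(2)[OF u] unit(2)[OF unit(7)[OF aU]] t_pow_nonzero by (simp add: m_ac)
  then show ?thesis by (rule val_eqI[OF unit(5)[OF u unit(7)[OF aU]]])
qed

end

section \<open>Local rings\<close>

context cring
begin

lemma nonunit_in_maximalideal:
  assumes a: "a \<in> carrier R - Units R"
  obtains M where "maximalideal M R" "a \<in> M"
proof -
  let ?\<A> = "{I. ideal I R \<and> a \<in> I \<and> \<one> \<notin> I}"
  have "\<one> \<notin> PIdl a" using a m_comm unfolding cgenideal_def Units_def by auto
  then have "PIdl a \<in> ?\<A>" using cgenideal_ideal cgenideal_self a by blast
  then have "\<exists>M\<in>?\<A>. \<forall>I\<in>?\<A>. M \<subseteq> I \<longrightarrow> I = M"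
  proof (rule subset_Zorn_nonempty[OF ex_in_conv[THEN iffD1, OF exI]])
    fix \<C> assume \<C>: "\<C> \<noteq> {}" "subset.chain ?\<A> \<C>"
    then have "subset.chain {I. ideal I R} \<C>" by (auto simp: subset_chain_def)
    from chain_Union_is_ideal[OF this] show "\<Union>\<C> \<in> ?\<A>" using \<C> by (auto simp: subset_chain_def)
  qed
  then obtain M where M: "ideal M R" "a \<in> M" "\<one> \<notin> M" "\<And>I. \<lbrakk>ideal I R; a \<in> I; \<one> \<notin> I; M \<subseteq> I\<rbrakk> \<Longrightarrow> I = M" by blast
  have "maximalideal M R"
  proof (rule maximalidealI[OF M(1)])
    show "J = M \<or> J = carrier R" if "ideal J R" "M \<subseteq> J" for J
      using M(4)[OF that(1) _ _ that(2)] M(2) that ideal.one_imp_carrier[OF that(1)] by blast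
  qed (use M(3) one_closed in blast)
  then show ?thesis using that M(2) by blast
qed

lemma maximalideal_disjoint_Units: "maximalideal M R \<Longrightarrow> M \<inter> Units R = {}"
  using ideal.I_l_closed[of M R] ideal.one_imp_carrier[of M R] maximalideal.axioms(1)[of M R]
    maximalideal.I_notcarr[of M R]
    Units_l_inv Units_inv_closed by (metis disjoint_iff)

end

lemma maximalideal_max_ideal:
  assumes "local_ring R"
  shows "maximalideal (max_ideal R) R"
  unfolding max_ideal_def by (rule theI') (use assms in \<open>simp add: local_ring_def\<close>)

lemma max_ideal_eq_nonunits:
  assumes "local_ring R"
  shows "max_ideal R = carrier R - Units R"
proof -
  interpret cring R using assms unfolding local_ring_def by blast
  note M = maximalideal_max_ideal[OF assms]
  have "max_ideal R \<subseteq> carrier R"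
    using additive_subgroup.a_subset[OF ideal.axioms(1)[OF maximalideal.axioms(1)[OF M]]] .
  moreover have "a \<in> max_ideal R" if a: "a \<in> carrier R - Units R" for a
  proof -
    obtain N where "maximalideal N R" "a \<in> N" by (rule nonunit_in_maximalideal[OF a])
    then show ?thesis using assms M unfolding local_ring_def by blast
  qed
  ultimately show ?thesis using maximalideal_disjoint_Units[OF M] by blast
qed

context ring_hom_cring
begin

lemma hom_image_subring: "subring (h ` carrier R) S"
  using ring_hom_ring.img_is_subring[OF ring_hom_ringI2[OF R.ring_axioms S.ring_axioms homh]
    R.carrier_is_subring] .

lemma hom_image_ideal:
  assumes "ideal I R"
  shows "ideal (h ` I) (S\<lparr>carrier := h ` carrier R\<rparr>)"
proof (rule S.ideal_subringI[OF hom_image_subring])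
  interpret I: ideal I R by (rule assms)
  show "h ` I \<subseteq> h ` carrier R" using I.a_subset by blast
  show "\<zero>\<^bsub>S\<^esub> \<in> h ` I" using imageI[OF I.zero_closed, of h] by simp
  show "x \<oplus>\<^bsub>S\<^esub> y \<in> h ` I" if "x \<in> h ` I" "y \<in> h ` I" for x y
  proof -
    obtain a b where ab: "a \<in> I" "b \<in> I" "x = h a" "y = h b" using \<open>x \<in> h ` I\<close> \<open>y \<in> h ` I\<close> by blast
    then have "x \<oplus>\<^bsub>S\<^esub> y = h (a \<oplus> b)" using I.a_subset by (auto simp: subset_iff)
    then show ?thesis using I.a_closed[OF ab(1,2)] by blast
  qed
  show "a \<otimes>\<^bsub>S\<^esub> x \<in> h ` I" if "a \<in> h ` carrier R" "x \<in> h ` I" for a x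
  proof -
    obtain r b where rb: "r \<in> carrier R" "b \<in> I" "a = h r" "x = h b"
      using \<open>a \<in> h ` carrier R\<close> \<open>x \<in> h ` I\<close> by blast
    then have "a \<otimes>\<^bsub>S\<^esub> x = h (r \<otimes> b)" using I.a_subset by (auto simp: subset_iff)
    then show ?thesis using I.I_l_closed[OF rb(2,1)] by blast
  qed
qed

lemma hom_image_cgenideal:
  assumes "a \<in> carrier R"
  shows "h ` (PIdl a) = PIdl\<^bsub>S\<lparr>carrier := h ` carrier R\<rparr>\<^esub> (h a)"
  using assms unfolding cgenideal_def by force

lemma hom_image_Units:
  assumes "inj_on h (carrier R)"
  shows "Units (S\<lparr>carrier := h ` carrier R\<rparr>) = h ` Units R"
proof (intro subset_antisym subsetI)
  fix y assume "y \<in> h ` Units R"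
  then obtain a where a: "a \<in> Units R" "y = h a" by blast
  then have "h a \<otimes>\<^bsub>S\<^esub> h (inv a) = \<one>\<^bsub>S\<^esub>" using hom_mult[of a "inv a"] R.Units_closed by (auto simp del: hom_mult)
  then show "y \<in> Units (S\<lparr>carrier := h ` carrier R\<rparr>)"
    using a R.Units_closed unfolding S.Units_subring_iff[OF hom_image_subring] by blast
next
  fix y assume "y \<in> Units (S\<lparr>carrier := h ` carrier R\<rparr>)"
  then obtain a b where ab: "a \<in> carrier R" "b \<in> carrier R" "y = h a" "h a \<otimes>\<^bsub>S\<^esub> h b = \<one>\<^bsub>S\<^esub>"
    unfolding S.Units_subring_iff[OF hom_image_subring] by blast
  then have "a \<otimes> b = \<one>" using inj_onD[OF assms, of "a \<otimes> b" \<one>] by simp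
  then have "a \<in> Units R" using ab R.m_comm[of b a] unfolding Units_def by auto
  then show "y \<in> h ` Units R" using ab(3) by blast
qed

end

section \<open>Stalks and localizations\<close>

lemma UN_pairs_eqI:
  assumes "(u, s) \<in> A" "(v, t) \<in> B"
    and "\<And>u' s' v' t'. \<lbrakk>(u', s') \<in> A; (v', t') \<in> B\<rbrakk> \<Longrightarrow> G u' s' v' t' = G u s v t"
  shows "(\<Union>(u, s)\<in>A. \<Union>(v, t)\<in>B. G u s v t) = G u s v t"
  using assms by fast

context ringed_space
begin

abbreviation open_set :: "'x set \<Rightarrow> bool" where "open_set \<equiv> openin (topol \<XX>)"

lemma germ_self:
  assumes "open_set U" "x \<in> U" "s \<in> carrier (sections \<XX> U)"
  shows "(U, s) \<in> germ \<XX> x U s"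
  using assms unfolding germ_def by blast

lemma restr_closed:
  assumes "open_set U" "open_set V" "V \<subseteq> U" "s \<in> carrier (sections \<XX> U)"
  shows "restr \<XX> U V s \<in> carrier (sections \<XX> V)"
  by (rule ring_hom_closed[OF restr_hom[OF assms(1-3)] assms(4)])

lemma germ_subset:
  assumes U: "open_set U" "s \<in> carrier (sections \<XX> U)" and V: "open_set V" "t \<in> carrier (sections \<XX> V)"
    and W: "open_set W" "x \<in> W" "W \<subseteq> U" "W \<subseteq> V" "restr \<XX> U W s = restr \<XX> V W t"
  shows "germ \<XX> x U s \<subseteq> germ \<XX> x V t"
proof
  fix z assume "z \<in> germ \<XX> x U s"
  then obtain V' t' W' where z: "z = (V', t')" "open_set V'" "x \<in> V'" "t' \<in> carrier (sections \<XX> V')"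
    and W': "open_set W'" "x \<in> W'" "W' \<subseteq> U \<inter> V'" "restr \<XX> U W' s = restr \<XX> V' W' t'"
    unfolding germ_def by blast
  let ?W = "W \<inter> W'"
  have open_W: "open_set ?W" using W W' by blast
  have "restr \<XX> V ?W t = restr \<XX> W ?W (restr \<XX> V W t)"
    using restr_comp[OF V(1) W(1) open_W _ W(4) V(2)] by simp
  also have "\<dots> = restr \<XX> U ?W s"
    unfolding W(5)[symmetric] using restr_comp[OF U(1) W(1) open_W _ W(3) U(2)] by simp
  also have "\<dots> = restr \<XX> W' ?W (restr \<XX> U W' s)" using restr_comp[OF U(1) W'(1) open_W _ _ U(2)] W'(3) by simp
  also have "\<dots> = restr \<XX> V' ?W t'" unfolding W'(4) using restr_comp[OF z(2) W'(1) open_W _ _ z(4)] W'(3) by simp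
  finally have eq: "restr \<XX> V ?W t = restr \<XX> V' ?W t'" .
  have "?W \<subseteq> V \<inter> V'" "x \<in> ?W" using W W' by auto
  then show "z \<in> germ \<XX> x V t" unfolding germ_def z(1) using z open_W eq by blast
qed

lemma germ_eqI:
  assumes U: "open_set U" "s \<in> carrier (sections \<XX> U)" and V: "open_set V" "t \<in> carrier (sections \<XX> V)"
    and W: "open_set W" "x \<in> W" "W \<subseteq> U" "W \<subseteq> V" "restr \<XX> U W s = restr \<XX> V W t"
  shows "germ \<XX> x U s = germ \<XX> x V t"
  using germ_subset[OF assms] germ_subset[OF V U W(1,2,4,3) W(5)[symmetric]] by (rule subset_antisym)

lemma germ_eqD:
  assumes "germ \<XX> x U s = germ \<XX> x V t" "open_set V" "x \<in> V" "t \<in> carrier (sections \<XX> V)"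
  shows "\<exists>W. open_set W \<and> x \<in> W \<and> W \<subseteq> U \<inter> V \<and> restr \<XX> U W s = restr \<XX> V W t"
proof -
  have "(V, t) \<in> germ \<XX> x U s" using germ_self[OF assms(2-4)] assms(1) by simp
  then show ?thesis unfolding germ_def by simp
qed

lemma germ_restr:
  assumes "open_set U" "open_set V" "V \<subseteq> U" "x \<in> V" "s \<in> carrier (sections \<XX> U)"
  shows "germ \<XX> x V (restr \<XX> U V s) = germ \<XX> x U s"
proof (rule germ_eqI[OF assms(2) restr_closed[OF assms(1-3,5)] assms(1,5) assms(2,4) subset_refl assms(3)])
  show "restr \<XX> V V (restr \<XX> U V s) = restr \<XX> U V s"
    by (rule restr_id[OF assms(2) restr_closed[OF assms(1-3,5)]])
qed

lemma germ_memE: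
  assumes "(V, t) \<in> germ \<XX> x U s"
  obtains W where "open_set V" "x \<in> V" "t \<in> carrier (sections \<XX> V)"
    "open_set W" "x \<in> W" "W \<subseteq> U" "W \<subseteq> V" "restr \<XX> U W s = restr \<XX> V W t"
  using assms unfolding germ_def by blast

lemma restr_eq_subset:
  assumes "open_set U" "s \<in> carrier (sections \<XX> U)" "open_set V" "t \<in> carrier (sections \<XX> V)"
    and "open_set W" "W \<subseteq> U" "W \<subseteq> V" "restr \<XX> U W s = restr \<XX> V W t" and "open_set W'" "W' \<subseteq> W"
  shows "restr \<XX> U W' s = restr \<XX> V W' t"
  using restr_comp[of U W W' s] restr_comp[of V W W' t] assms by simp

lemma restr_op_Int:
  assumes op: "\<And>V a b. \<lbrakk>open_set V; a \<in> carrier (sections \<XX> V); b \<in> carrier (sections \<XX> V)\<rbrakk>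
      \<Longrightarrow> opr V a b \<in> carrier (sections \<XX> V)"
    and op_restr: "\<And>V W a b. \<lbrakk>open_set V; open_set W; W \<subseteq> V; a \<in> carrier (sections \<XX> V); b \<in> carrier (sections \<XX> V)\<rbrakk>
      \<Longrightarrow> restr \<XX> V W (opr V a b) = opr W (restr \<XX> V W a) (restr \<XX> V W b)"
    and U: "open_set U" "s \<in> carrier (sections \<XX> U)" and V: "open_set V" "t \<in> carrier (sections \<XX> V)"
  shows "opr (U \<inter> V) (restr \<XX> U (U \<inter> V) s) (restr \<XX> V (U \<inter> V) t) \<in> carrier (sections \<XX> (U \<inter> V))"
    and "\<lbrakk>open_set W; W \<subseteq> U; W \<subseteq> V\<rbrakk> \<Longrightarrow>
      restr \<XX> (U \<inter> V) W (opr (U \<inter> V) (restr \<XX> U (U \<inter> V) s) (restr \<XX> V (U \<inter> V) t)) =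
      opr W (restr \<XX> U W s) (restr \<XX> V W t)"
proof -
  have open_UV: "open_set (U \<inter> V)" using U(1) V(1) by blast
  have restricted: "restr \<XX> U (U \<inter> V) s \<in> carrier (sections \<XX> (U \<inter> V))"
    "restr \<XX> V (U \<inter> V) t \<in> carrier (sections \<XX> (U \<inter> V))"
    using restr_closed open_UV U V by auto
  then show "opr (U \<inter> V) (restr \<XX> U (U \<inter> V) s) (restr \<XX> V (U \<inter> V) t) \<in> carrier (sections \<XX> (U \<inter> V))"
    by (rule op[OF open_UV])
  assume W: "open_set W" "W \<subseteq> U" "W \<subseteq> V"
  have "restr \<XX> (U \<inter> V) W (restr \<XX> U (U \<inter> V) s) = restr \<XX> U W s"
    "restr \<XX> (U \<inter> V) W (restr \<XX> V (U \<inter> V) t) = restr \<XX> V W t"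
    using restr_comp[OF U(1) open_UV W(1) _ _ U(2)] restr_comp[OF V(1) open_UV W(1) _ _ V(2)] W by auto
  then show "restr \<XX> (U \<inter> V) W (opr (U \<inter> V) (restr \<XX> U (U \<inter> V) s) (restr \<XX> V (U \<inter> V) t)) =
      opr W (restr \<XX> U W s) (restr \<XX> V W t)"
    using op_restr[OF open_UV W(1) _ restricted] W by simp
qed

lemma stalk_op:
  assumes op: "\<And>V a b. \<lbrakk>open_set V; a \<in> carrier (sections \<XX> V); b \<in> carrier (sections \<XX> V)\<rbrakk>
      \<Longrightarrow> opr V a b \<in> carrier (sections \<XX> V)"
    and op_restr: "\<And>V W a b. \<lbrakk>open_set V; open_set W; W \<subseteq> V; a \<in> carrier (sections \<XX> V); b \<in> carrier (sections \<XX> V)\<rbrakk>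
      \<Longrightarrow> restr \<XX> V W (opr V a b) = opr W (restr \<XX> V W a) (restr \<XX> V W b)"
    and U: "open_set U" "x \<in> U" "s \<in> carrier (sections \<XX> U)"
    and V: "open_set V" "x \<in> V" "t \<in> carrier (sections \<XX> V)"
  shows "(\<Union>(U, s)\<in>germ \<XX> x U s. \<Union>(V, t)\<in>germ \<XX> x V t.
      germ \<XX> x (U \<inter> V) (opr (U \<inter> V) (restr \<XX> U (U \<inter> V) s) (restr \<XX> V (U \<inter> V) t))) =
    germ \<XX> x (U \<inter> V) (opr (U \<inter> V) (restr \<XX> U (U \<inter> V) s) (restr \<XX> V (U \<inter> V) t))"
proof (rule UN_pairs_eqI[OF germ_self[OF U] germ_self[OF V]])
  fix U' s' V' t' assume s': "(U', s') \<in> germ \<XX> x U s" and t': "(V', t') \<in> germ \<XX> x V t"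
  obtain W1 where W1: "open_set U'" "x \<in> U'" "s' \<in> carrier (sections \<XX> U')" "open_set W1" "x \<in> W1" "W1 \<subseteq> U"
    "W1 \<subseteq> U'"
    "restr \<XX> U W1 s = restr \<XX> U' W1 s'" by (rule germ_memE[OF s'])
  obtain W2 where W2: "open_set V'" "x \<in> V'" "t' \<in> carrier (sections \<XX> V')" "open_set W2" "x \<in> W2" "W2 \<subseteq> V"
    "W2 \<subseteq> V'"
    "restr \<XX> V W2 t = restr \<XX> V' W2 t'" by (rule germ_memE[OF t'])
  define W where "W = W1 \<inter> W2"
  have W: "open_set W" "x \<in> W" "W \<subseteq> U" "W \<subseteq> V" "W \<subseteq> U'" "W \<subseteq> V'" using W1 W2 unfolding W_def by auto
  have "restr \<XX> U W s = restr \<XX> U' W s'"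
    using restr_eq_subset[OF U(1,3) W1(1,3,4,6,7,8) W(1)] unfolding W_def by simp
  moreover have "restr \<XX> V W t = restr \<XX> V' W t'"
    using restr_eq_subset[OF V(1,3) W2(1,3,4,6,7,8) W(1)] unfolding W_def by simp
  moreover note restr_op_Int[where opr = opr, OF op op_restr W1(1,3) W2(1,3)]
    restr_op_Int[where opr = opr, OF op op_restr U(1,3) V(1,3)]
  moreover have "open_set (U' \<inter> V')" "open_set (U \<inter> V)" using W1(1) W2(1) U(1) V(1) by blast+
  ultimately show "germ \<XX> x (U' \<inter> V') (opr (U' \<inter> V') (restr \<XX> U' (U' \<inter> V') s') (restr \<XX> V' (U' \<inter> V') t')) =
    germ \<XX> x (U \<inter> V) (opr (U \<inter> V) (restr \<XX> U (U \<inter> V) s) (restr \<XX> V (U \<inter> V) t))"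
    using W by (intro germ_eqI[where W = W]) auto
qed

lemma stalk_mult:
  assumes "open_set U" "x \<in> U" "s \<in> carrier (sections \<XX> U)"
    and "open_set V" "x \<in> V" "t \<in> carrier (sections \<XX> V)"
  shows "germ \<XX> x U s \<otimes>\<^bsub>stalk \<XX> x\<^esub> germ \<XX> x V t =
    germ \<XX> x (U \<inter> V) (restr \<XX> U (U \<inter> V) s \<otimes>\<^bsub>sections \<XX> (U \<inter> V)\<^esub> restr \<XX> V (U \<inter> V) t)"
proof -
  have "monoid (sections \<XX> V)" if "open_set V" for V
    using cring_sections[OF that] by (simp add: cring_def ring_def)
  then show ?thesis
    unfolding stalk_def monoid.simps
    by (intro stalk_op[OF _ _ assms]) (auto simp: monoid.m_closed ring_hom_mult[OF restr_hom])
qed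

lemma stalk_add:
  assumes "open_set U" "x \<in> U" "s \<in> carrier (sections \<XX> U)"
    and "open_set V" "x \<in> V" "t \<in> carrier (sections \<XX> V)"
  shows "germ \<XX> x U s \<oplus>\<^bsub>stalk \<XX> x\<^esub> germ \<XX> x V t =
    germ \<XX> x (U \<inter> V) (restr \<XX> U (U \<inter> V) s \<oplus>\<^bsub>sections \<XX> (U \<inter> V)\<^esub> restr \<XX> V (U \<inter> V) t)"
proof -
  have "ring (sections \<XX> V)" if "open_set V" for V
    using cring_sections[OF that] by (simp add: cring_def)
  then show ?thesis
    unfolding stalk_def ring.simps
    by (intro stalk_op[OF _ _ assms]) (auto simp: ring.ring_simprules(1) ring_hom_add[OF restr_hom])
qed

lemma stalk_carrier:
  "carrier (stalk \<XX> x) = {germ \<XX> x U s |U s. open_set U \<and> x \<in> U \<and> s \<in> carrier (sections \<XX> U)}"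
  unfolding stalk_def by simp

lemma stalk_carrierE:
  assumes "A \<in> carrier (stalk \<XX> x)"
  obtains U s where "open_set U" "x \<in> U" "s \<in> carrier (sections \<XX> U)" "A = germ \<XX> x U s"
  using assms unfolding stalk_carrier by blast

lemma stalk_common_representatives:
  assumes A: "A \<in> carrier (stalk \<XX> x)" and B: "B \<in> carrier (stalk \<XX> x)"
  obtains W s t where "open_set W" "x \<in> W" "s \<in> carrier (sections \<XX> W)" "t \<in> carrier (sections \<XX> W)"
    "A = germ \<XX> x W s" "B = germ \<XX> x W t"
proof -
  obtain U s where U: "open_set U" "x \<in> U" "s \<in> carrier (sections \<XX> U)" "A = germ \<XX> x U s"
    by (rule stalk_carrierE[OF A])
  obtain V t where V: "open_set V" "x \<in> V" "t \<in> carrier (sections \<XX> V)" "B = germ \<XX> x V t"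
    by (rule stalk_carrierE[OF B])
  have W: "open_set (U \<inter> V)" "x \<in> U \<inter> V" using U V by auto
  show ?thesis
    by (rule that[OF W restr_closed[OF U(1) W(1) _ U(3)] restr_closed[OF V(1) W(1) _ V(3)]])
      (use germ_restr[OF U(1) W(1) _ W(2) U(3)] germ_restr[OF V(1) W(1) _ W(2) V(3)] U(4) V(4) in auto)
qed

lemma germ_hom:
  assumes U: "open_set U" "x \<in> U"
  shows "germ \<XX> x U \<in> ring_hom (sections \<XX> U) (stalk \<XX> x)"
proof (rule ring_hom_memI)
  fix s assume "s \<in> carrier (sections \<XX> U)"
  then show "germ \<XX> x U s \<in> carrier (stalk \<XX> x)" unfolding stalk_carrier using U by blast
next
  fix s t assume st: "s \<in> carrier (sections \<XX> U)" "t \<in> carrier (sections \<XX> U)"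
  show "germ \<XX> x U (s \<otimes>\<^bsub>sections \<XX> U\<^esub> t) = germ \<XX> x U s \<otimes>\<^bsub>stalk \<XX> x\<^esub> germ \<XX> x U t"
    using stalk_mult[OF U st(1) U st(2)] restr_id[OF U(1)] st by simp
  show "germ \<XX> x U (s \<oplus>\<^bsub>sections \<XX> U\<^esub> t) = germ \<XX> x U s \<oplus>\<^bsub>stalk \<XX> x\<^esub> germ \<XX> x U t"
    using stalk_add[OF U st(1) U st(2)] restr_id[OF U(1)] st by simp
next
  let ?T = "topspace (topol \<XX>)"
  have open_T: "open_set ?T" by simp
  have sub: "U \<subseteq> ?T" using openin_subset[OF U(1)] .
  have one: "\<one>\<^bsub>sections \<XX> ?T\<^esub> \<in> carrier (sections \<XX> ?T)"
    using cring_sections[OF open_T] by (simp add: cring_def ring.ring_simprules(6))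
  have "germ \<XX> x U (restr \<XX> ?T U \<one>\<^bsub>sections \<XX> ?T\<^esub>) = germ \<XX> x ?T \<one>\<^bsub>sections \<XX> ?T\<^esub>"
    by (rule germ_restr[OF open_T U(1) sub U(2) one])
  then show "germ \<XX> x U \<one>\<^bsub>sections \<XX> U\<^esub> = \<one>\<^bsub>stalk \<XX> x\<^esub>"
    using ring_hom_one[OF restr_hom[OF open_T U(1) sub]] by (simp add: stalk_def)
qed

end

text \<open>\<^const>\<open>fraction\<close> and \<^const>\<open>localization\<close> are typed for rings without record extension.\<close>

locale plain_cring = cring R for R :: "'a ring" (structure)
begin

lemma localization_carrierE:
  assumes "x \<in> carrier (localization R P)"
  obtains a s where "a \<in> carrier R" "s \<in> carrier R - P" "x = fraction R P a s"
  using assms unfolding localization_def by auto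

lemma localization_carrierI: "\<lbrakk>a \<in> carrier R; s \<in> carrier R - P\<rbrakk> \<Longrightarrow> fraction R P a s \<in> carrier (localization R P)"
  unfolding localization_def by auto

lemma localization_one: "\<one>\<^bsub>localization R P\<^esub> = fraction R P \<one> \<one>"
  and localization_zero: "\<zero>\<^bsub>localization R P\<^esub> = fraction R P \<zero> \<one>"
  unfolding localization_def by simp_all

context
  fixes P
  assumes P: "primeideal P R"
begin

lemma prime_compl_one: "\<one> \<in> carrier R - P"
proof -
  interpret P: primeideal P R by (rule P)
  show ?thesis using P.I_notcarr P.one_imp_carrier by auto
qed

lemma prime_compl_mult: "\<lbrakk>s \<in> carrier R - P; t \<in> carrier R - P\<rbrakk> \<Longrightarrow> s \<otimes> t \<in> carrier R - P"
  using primeideal.I_prime[OF P, of s t] by auto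

lemma fraction_self:
  assumes "a \<in> carrier R" "s \<in> carrier R - P"
  shows "(a, s) \<in> fraction R P a s"
proof -
  have "\<one> \<otimes> (a \<otimes> s \<ominus> a \<otimes> s) = \<zero>" using assms by (simp add: a_minus_def r_neg)
  then show ?thesis using assms prime_compl_one unfolding fraction_def by blast
qed

lemma fraction_subset:
  assumes a: "a \<in> carrier R" "s \<in> carrier R - P" and "b \<in> carrier R" "t \<in> carrier R - P"
    and u: "u \<in> carrier R - P" "u \<otimes> (a \<otimes> t \<ominus> b \<otimes> s) = \<zero>"
  shows "fraction R P a s \<subseteq> fraction R P b t"
proof
  fix z assume "z \<in> fraction R P a s"
  then obtain c r w where z: "z = (c, r)" "c \<in> carrier R" "r \<in> carrier R - P" "w \<in> carrier R - P"
    "w \<otimes> (a \<otimes> r \<ominus> c \<otimes> s) = \<zero>" unfolding fraction_def by blast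
  have carrier: "a \<in> carrier R" "s \<in> carrier R" "b \<in> carrier R" "t \<in> carrier R" "u \<in> carrier R"
    "c \<in> carrier R" "r \<in> carrier R" "w \<in> carrier R" using assms z by auto
  have "(s \<otimes> u \<otimes> w) \<otimes> (b \<otimes> r \<ominus> c \<otimes> t) =
      (u \<otimes> t) \<otimes> (w \<otimes> (a \<otimes> r \<ominus> c \<otimes> s)) \<ominus> (w \<otimes> r) \<otimes> (u \<otimes> (a \<otimes> t \<ominus> b \<otimes> s))"
    using carrier by algebra
  also have "\<dots> = \<zero>" unfolding z(5) u(2) using carrier by algebra
  finally have "(s \<otimes> u \<otimes> w) \<otimes> (b \<otimes> r \<ominus> c \<otimes> t) = \<zero>" .
  moreover have "s \<otimes> u \<otimes> w \<in> carrier R - P" using prime_compl_mult a(2) u(1) z(4) by blast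
  ultimately show "z \<in> fraction R P b t" unfolding fraction_def z(1) using z by blast
qed

lemma fraction_eqI:
  assumes a: "a \<in> carrier R" "s \<in> carrier R - P" and b: "b \<in> carrier R" "t \<in> carrier R - P"
    and u: "u \<in> carrier R - P" "u \<otimes> (a \<otimes> t \<ominus> b \<otimes> s) = \<zero>"
  shows "fraction R P a s = fraction R P b t"
proof (rule subset_antisym)
  show "fraction R P a s \<subseteq> fraction R P b t" by (rule fraction_subset[OF assms])
  have carrier: "a \<in> carrier R" "s \<in> carrier R" "b \<in> carrier R" "t \<in> carrier R" "u \<in> carrier R"
    using assms by auto
  have "u \<otimes> (b \<otimes> s \<ominus> a \<otimes> t) = \<ominus> (u \<otimes> (a \<otimes> t \<ominus> b \<otimes> s))" using carrier by algebra
  also have "\<dots> = \<zero>" unfolding u(2) by simp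
  finally show "fraction R P b t \<subseteq> fraction R P a s" by (rule fraction_subset[OF b a u(1)])
qed

lemma fraction_eq_crossI:
  assumes a: "a \<in> carrier R" "s \<in> carrier R - P" and b: "b \<in> carrier R" "t \<in> carrier R - P"
    and "a \<otimes> t = b \<otimes> s"
  shows "fraction R P a s = fraction R P b t"
proof (rule fraction_eqI[OF a b prime_compl_one])
  show "\<one> \<otimes> (a \<otimes> t \<ominus> b \<otimes> s) = \<zero>" using assms by (simp add: a_minus_def r_neg)
qed

lemma fraction_eqD:
  assumes "fraction R P a s = fraction R P b t" "b \<in> carrier R" "t \<in> carrier R - P"
  shows "\<exists>u\<in>carrier R - P. u \<otimes> (a \<otimes> t \<ominus> b \<otimes> s) = \<zero>"
proof -
  have "(b, t) \<in> fraction R P a s" using fraction_self assms by simp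
  then show ?thesis unfolding fraction_def by simp
qed

lemma localization_mult:
  assumes a: "a \<in> carrier R" "s \<in> carrier R - P" and b: "b \<in> carrier R" "t \<in> carrier R - P"
  shows "fraction R P a s \<otimes>\<^bsub>localization R P\<^esub> fraction R P b t = fraction R P (a \<otimes> b) (s \<otimes> t)"
  unfolding localization_def monoid.simps
proof (rule UN_pairs_eqI[OF fraction_self[OF a] fraction_self[OF b]])
  fix a' s' b' t' assume "(a', s') \<in> fraction R P a s" "(b', t') \<in> fraction R P b t"
  then obtain u w where u: "a' \<in> carrier R" "s' \<in> carrier R - P" "u \<in> carrier R - P" "u \<otimes> (a \<otimes> s' \<ominus> a' \<otimes> s) = \<zero>"
    and w: "b' \<in> carrier R" "t' \<in> carrier R - P" "w \<in> carrier R - P" "w \<otimes> (b \<otimes> t' \<ominus> b' \<otimes> t) = \<zero>"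
    unfolding fraction_def by blast
  have carrier: "a \<in> carrier R" "s \<in> carrier R" "b \<in> carrier R" "t \<in> carrier R" "u \<in> carrier R" "w \<in> carrier R"
    "a' \<in> carrier R" "s' \<in> carrier R" "b' \<in> carrier R" "t' \<in> carrier R" using assms u w by auto
  have "(u \<otimes> w) \<otimes> ((a \<otimes> b) \<otimes> (s' \<otimes> t') \<ominus> (a' \<otimes> b') \<otimes> (s \<otimes> t)) =
    (w \<otimes> b \<otimes> t') \<otimes> (u \<otimes> (a \<otimes> s' \<ominus> a' \<otimes> s)) \<oplus> (u \<otimes> a' \<otimes> s) \<otimes> (w \<otimes> (b \<otimes> t' \<ominus> b' \<otimes> t))"
    using carrier by algebra
  also have "\<dots> = \<zero>" unfolding u(4) w(4) using carrier by algebra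
  finally have "fraction R P (a \<otimes> b) (s \<otimes> t) = fraction R P (a' \<otimes> b') (s' \<otimes> t')"
    by (intro fraction_eqI[where u = "u \<otimes> w"] prime_compl_mult a(2) b(2) u(2,3) w(2,3)) (use carrier in auto)
  then show "fraction R P (a' \<otimes> b') (s' \<otimes> t') = fraction R P (a \<otimes> b) (s \<otimes> t)" by simp
qed

lemma localization_add:
  assumes a: "a \<in> carrier R" "s \<in> carrier R - P" and b: "b \<in> carrier R" "t \<in> carrier R - P"
  shows "fraction R P a s \<oplus>\<^bsub>localization R P\<^esub> fraction R P b t = fraction R P (a \<otimes> t \<oplus> b \<otimes> s) (s \<otimes> t)"
  unfolding localization_def ring.simps
proof (rule UN_pairs_eqI[OF fraction_self[OF a] fraction_self[OF b]])
  fix a' s' b' t' assume "(a', s') \<in> fraction R P a s" "(b', t') \<in> fraction R P b t"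
  then obtain u w where u: "a' \<in> carrier R" "s' \<in> carrier R - P" "u \<in> carrier R - P" "u \<otimes> (a \<otimes> s' \<ominus> a' \<otimes> s) = \<zero>"
    and w: "b' \<in> carrier R" "t' \<in> carrier R - P" "w \<in> carrier R - P" "w \<otimes> (b \<otimes> t' \<ominus> b' \<otimes> t) = \<zero>"
    unfolding fraction_def by blast
  have carrier: "a \<in> carrier R" "s \<in> carrier R" "b \<in> carrier R" "t \<in> carrier R" "u \<in> carrier R" "w \<in> carrier R"
    "a' \<in> carrier R" "s' \<in> carrier R" "b' \<in> carrier R" "t' \<in> carrier R" using assms u w by auto
  have "(u \<otimes> w) \<otimes> ((a \<otimes> t \<oplus> b \<otimes> s) \<otimes> (s' \<otimes> t') \<ominus> (a' \<otimes> t' \<oplus> b' \<otimes> s') \<otimes> (s \<otimes> t)) =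
    (w \<otimes> t \<otimes> t') \<otimes> (u \<otimes> (a \<otimes> s' \<ominus> a' \<otimes> s)) \<oplus> (u \<otimes> s \<otimes> s') \<otimes> (w \<otimes> (b \<otimes> t' \<ominus> b' \<otimes> t))"
    using carrier by algebra
  also have "\<dots> = \<zero>" unfolding u(4) w(4) using carrier by algebra
  finally have "fraction R P (a \<otimes> t \<oplus> b \<otimes> s) (s \<otimes> t) = fraction R P (a' \<otimes> t' \<oplus> b' \<otimes> s') (s' \<otimes> t')"
    by (intro fraction_eqI[where u = "u \<otimes> w"] prime_compl_mult a(2) b(2) u(2,3) w(2,3)) (use carrier in auto)
  then show "fraction R P (a' \<otimes> t' \<oplus> b' \<otimes> s') (s' \<otimes> t') = fraction R P (a \<otimes> t \<oplus> b \<otimes> s) (s \<otimes> t)" by simp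
qed

lemma localization_closed_comm:
  assumes x: "x \<in> carrier (localization R P)" and y: "y \<in> carrier (localization R P)"
  shows "x \<otimes>\<^bsub>localization R P\<^esub> y \<in> carrier (localization R P)"
    and "x \<oplus>\<^bsub>localization R P\<^esub> y \<in> carrier (localization R P)"
    and "x \<otimes>\<^bsub>localization R P\<^esub> y = y \<otimes>\<^bsub>localization R P\<^esub> x"
    and "x \<oplus>\<^bsub>localization R P\<^esub> y = y \<oplus>\<^bsub>localization R P\<^esub> x"
proof -
  obtain b s where b: "b \<in> carrier R" "s \<in> carrier R - P" "x = fraction R P b s"
    by (rule localization_carrierE[OF x])
  obtain c t where c: "c \<in> carrier R" "t \<in> carrier R - P" "y = fraction R P c t"
    by (rule localization_carrierE[OF y])
  note op = localization_mult[OF b(1,2) c(1,2)] localization_add[OF b(1,2) c(1,2)]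
    localization_mult[OF c(1,2) b(1,2)] localization_add[OF c(1,2) b(1,2)]
  have "b \<in> carrier R" "c \<in> carrier R" "s \<in> carrier R" "t \<in> carrier R" using b c by auto
  then show "x \<otimes>\<^bsub>localization R P\<^esub> y \<in> carrier (localization R P)"
    "x \<oplus>\<^bsub>localization R P\<^esub> y \<in> carrier (localization R P)"
    "x \<otimes>\<^bsub>localization R P\<^esub> y = y \<otimes>\<^bsub>localization R P\<^esub> x"
    "x \<oplus>\<^bsub>localization R P\<^esub> y = y \<oplus>\<^bsub>localization R P\<^esub> x"
    unfolding b(3) c(3) op
    by (auto intro!: localization_carrierI prime_compl_mult[OF b(2) c(2)] simp: m_comm a_comm)
qed

lemma localization_assoc_distrib:
  assumes x: "x \<in> carrier (localization R P)" and y: "y \<in> carrier (localization R P)"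
    and z: "z \<in> carrier (localization R P)"
  shows "x \<otimes>\<^bsub>localization R P\<^esub> y \<otimes>\<^bsub>localization R P\<^esub> z = x \<otimes>\<^bsub>localization R P\<^esub> (y \<otimes>\<^bsub>localization R P\<^esub> z)"
    and "x \<oplus>\<^bsub>localization R P\<^esub> y \<oplus>\<^bsub>localization R P\<^esub> z = x \<oplus>\<^bsub>localization R P\<^esub> (y \<oplus>\<^bsub>localization R P\<^esub> z)"
    and "(x \<oplus>\<^bsub>localization R P\<^esub> y) \<otimes>\<^bsub>localization R P\<^esub> z =
      x \<otimes>\<^bsub>localization R P\<^esub> z \<oplus>\<^bsub>localization R P\<^esub> y \<otimes>\<^bsub>localization R P\<^esub> z"
proof -
  obtain b s where b: "b \<in> carrier R" "s \<in> carrier R - P" "x = fraction R P b s"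
    by (rule localization_carrierE[OF x])
  obtain c t where c: "c \<in> carrier R" "t \<in> carrier R - P" "y = fraction R P c t"
    by (rule localization_carrierE[OF y])
  obtain d r where d: "d \<in> carrier R" "r \<in> carrier R - P" "z = fraction R P d r"
    by (rule localization_carrierE[OF z])
  have carrier: "b \<in> carrier R" "c \<in> carrier R" "s \<in> carrier R" "t \<in> carrier R" "d \<in> carrier R" "r \<in> carrier R"
    using b c d by auto
  note compl = prime_compl_mult b(2) c(2) d(2)
  show "x \<otimes>\<^bsub>localization R P\<^esub> y \<otimes>\<^bsub>localization R P\<^esub> z = x \<otimes>\<^bsub>localization R P\<^esub> (y \<otimes>\<^bsub>localization R P\<^esub> z)"
    unfolding b(3) c(3) d(3) using carrier compl by (simp add: localization_mult m_assoc del: Diff_iff)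
  show "x \<oplus>\<^bsub>localization R P\<^esub> y \<oplus>\<^bsub>localization R P\<^esub> z = x \<oplus>\<^bsub>localization R P\<^esub> (y \<oplus>\<^bsub>localization R P\<^esub> z)"
    unfolding b(3) c(3) d(3) using carrier compl
    by (simp add: localization_add del: Diff_iff, intro fraction_eq_crossI compl) (simp, simp, algebra)
  show "(x \<oplus>\<^bsub>localization R P\<^esub> y) \<otimes>\<^bsub>localization R P\<^esub> z =
      x \<otimes>\<^bsub>localization R P\<^esub> z \<oplus>\<^bsub>localization R P\<^esub> y \<otimes>\<^bsub>localization R P\<^esub> z"
    unfolding b(3) c(3) d(3) using carrier compl
    by (simp add: localization_add localization_mult del: Diff_iff, intro fraction_eq_crossI compl)
      (simp, simp, algebra)
qed

lemma localization_neutral: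
  assumes x: "x \<in> carrier (localization R P)"
  shows "\<one>\<^bsub>localization R P\<^esub> \<otimes>\<^bsub>localization R P\<^esub> x = x" and "\<zero>\<^bsub>localization R P\<^esub> \<oplus>\<^bsub>localization R P\<^esub> x = x"
    and "\<exists>y\<in>carrier (localization R P). y \<oplus>\<^bsub>localization R P\<^esub> x = \<zero>\<^bsub>localization R P\<^esub>"
proof -
  obtain b s where b: "b \<in> carrier R" "s \<in> carrier R - P" "x = fraction R P b s"
    by (rule localization_carrierE[OF x])
  have carrier: "b \<in> carrier R" "s \<in> carrier R" "\<ominus> b \<in> carrier R" using b by auto
  show "\<one>\<^bsub>localization R P\<^esub> \<otimes>\<^bsub>localization R P\<^esub> x = x"
    unfolding localization_one b(3) localization_mult[OF one_closed prime_compl_one b(1,2)]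
    using carrier by simp
  show "\<zero>\<^bsub>localization R P\<^esub> \<oplus>\<^bsub>localization R P\<^esub> x = x"
    unfolding localization_zero b(3) localization_add[OF zero_closed prime_compl_one b(1,2)]
    using carrier by simp
  have "fraction R P (\<ominus> b) s \<oplus>\<^bsub>localization R P\<^esub> x = \<zero>\<^bsub>localization R P\<^esub>"
    unfolding localization_zero b(3) localization_add[OF carrier(3) b(2) b(1,2)]
  proof (rule fraction_eq_crossI[OF _ prime_compl_mult[OF b(2) b(2)] _ prime_compl_one])
    show "(\<ominus> b \<otimes> s \<oplus> b \<otimes> s) \<otimes> \<one> = \<zero> \<otimes> (s \<otimes> s)" using carrier by algebra
  qed (use carrier in auto)
  then show "\<exists>y\<in>carrier (localization R P). y \<oplus>\<^bsub>localization R P\<^esub> x = \<zero>\<^bsub>localization R P\<^esub>"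
    using localization_carrierI[OF carrier(3) b(2)] by blast
qed

lemma localization_cring: "cring (localization R P)"
proof (rule cringI)
  have "\<one>\<^bsub>localization R P\<^esub> \<in> carrier (localization R P)" "\<zero>\<^bsub>localization R P\<^esub> \<in> carrier (localization R P)"
    unfolding localization_one localization_zero using prime_compl_one by (auto intro!: localization_carrierI)
  note closed = this localization_closed_comm
  show "abelian_group (localization R P)"
    by (rule abelian_groupI) (use closed localization_assoc_distrib localization_neutral in auto)
  show "comm_monoid (localization R P)"
    by (rule comm_monoidI) (use closed localization_assoc_distrib localization_neutral in auto)
qed (rule localization_assoc_distrib(3))

end

end

section \<open>Affine charts\<close>

definition fraction_section :: "'a ring \<Rightarrow> 'a \<Rightarrow> 'a \<Rightarrow> 'a set set \<Rightarrow> 'a set \<Rightarrow> ('a \<times> 'a) set" where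
  "fraction_section R a b V = (\<lambda>P\<in>V. fraction R P a b)"

abbreviation const_section :: "'a ring \<Rightarrow> 'a \<Rightarrow> 'a set set \<Rightarrow> 'a set \<Rightarrow> ('a \<times> 'a) set" where
  "const_section R r \<equiv> fraction_section R r \<one>\<^bsub>R\<^esub>"

context plain_cring
begin

lemma topspace_zariski: "topspace (zariski_topology R) = prime_spectrum R"
proof (rule subset_antisym)
  have "openin (zariski_topology R) (topspace (zariski_topology R))" by simp
  then show "topspace (zariski_topology R) \<subseteq> prime_spectrum R"
    unfolding openin_zariski_topology[OF cring_axioms] by blast
  have "prime_spectrum R = {P \<in> prime_spectrum R. \<not> {\<one>} \<subseteq> P}"
    using prime_compl_one unfolding prime_spectrum_def by auto
  then have "openin (zariski_topology R) (prime_spectrum R)"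
    unfolding openin_zariski_topology[OF cring_axioms] by (intro exI[of _ "{\<one>}"]) auto
  then show "prime_spectrum R \<subseteq> topspace (zariski_topology R)" by (rule openin_subset)
qed

lemma zariski_prime:
  assumes "openin (zariski_topology R) V" "P \<in> V"
  shows "primeideal P R"
  using openin_subset[OF assms(1)] assms(2) unfolding topspace_zariski prime_spectrum_def by blast

lemma fraction_section_carrier:
  assumes V: "openin (zariski_topology R) V" and ab: "a \<in> carrier R" "b \<in> carrier R" "\<And>Q. Q \<in> V \<Longrightarrow> b \<notin> Q"
  shows "fraction_section R a b V \<in> carrier (sections (Spec R) V)"
proof -
  have "fraction_section R a b V \<in> (\<Pi>\<^sub>E P\<in>V. carrier (localization R P))"
    unfolding fraction_section_def using localization_carrierI ab by (intro restrict_PiE_iff[THEN iffD2]) auto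
  moreover have "\<exists>V' c d. openin (zariski_topology R) V' \<and> P \<in> V' \<and> V' \<subseteq> V \<and> c \<in> carrier R \<and> d \<in> carrier R \<and>
      (\<forall>Q\<in>V'. d \<notin> Q \<and> fraction_section R a b V Q = fraction R Q c d)" if "P \<in> V" for P
    using V that ab by (intro exI[of _ V] exI[of _ a] exI[of _ b]) (auto simp: fraction_section_def)
  ultimately show ?thesis by (simp add: Spec_def)
qed

lemma const_section_carrier:
  assumes V: "openin (zariski_topology R) V" and r: "r \<in> carrier R"
  shows "const_section R r V \<in> carrier (sections (Spec R) V)"
  using prime_compl_one[OF zariski_prime[OF V]] by (intro fraction_section_carrier[OF V r]) auto

lemma Spec_simps:
  "s \<otimes>\<^bsub>sections (Spec R) V\<^esub> t = (\<lambda>P\<in>V. s P \<otimes>\<^bsub>localization R P\<^esub> t P)"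
  "s \<oplus>\<^bsub>sections (Spec R) V\<^esub> t = (\<lambda>P\<in>V. s P \<oplus>\<^bsub>localization R P\<^esub> t P)"
  "\<one>\<^bsub>sections (Spec R) V\<^esub> = const_section R \<one> V" "restr (Spec R) V W s = restrict s W"
  "topol (Spec R) = zariski_topology R"
  unfolding Spec_def fraction_section_def localization_def by simp_all

lemma const_section_hom:
  assumes V: "openin (zariski_topology R) V"
  shows "(\<lambda>r. const_section R r V) \<in> ring_hom R (sections (Spec R) V)"
proof (rule ring_hom_memI)
  note P = zariski_prime[OF V] and one = prime_compl_one[OF zariski_prime[OF V]]
  show "const_section R r V \<in> carrier (sections (Spec R) V)" if "r \<in> carrier R" for r
    by (rule const_section_carrier[OF V that])
  show "const_section R \<one> V = \<one>\<^bsub>sections (Spec R) V\<^esub>" by (simp add: Spec_simps)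
  fix r s assume rs: "r \<in> carrier R" "s \<in> carrier R"
  show "const_section R (r \<otimes> s) V = const_section R r V \<otimes>\<^bsub>sections (Spec R) V\<^esub> const_section R s V"
    unfolding Spec_simps fraction_section_def
    by (rule restrict_ext) (use localization_mult[OF P rs(1) one rs(2) one] in simp)
  show "const_section R (r \<oplus> s) V = const_section R r V \<oplus>\<^bsub>sections (Spec R) V\<^esub> const_section R s V"
    unfolding Spec_simps fraction_section_def
    by (rule restrict_ext) (use localization_add[OF P rs(1) one rs(2) one] rs in simp)
qed

lemma const_section_mult_fraction_section:
  assumes V: "openin (zariski_topology R) V" and ab: "a \<in> carrier R" "b \<in> carrier R" "\<And>Q. Q \<in> V \<Longrightarrow> b \<notin> Q"
  shows "const_section R b V \<otimes>\<^bsub>sections (Spec R) V\<^esub> fraction_section R a b V = const_section R a V"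
  unfolding Spec_simps fraction_section_def
proof (rule restrict_ext)
  fix Q assume Q: "Q \<in> V"
  note P = zariski_prime[OF V Q] and b = ab(3)[OF Q]
  have "fraction R Q b \<one> \<otimes>\<^bsub>localization R Q\<^esub> fraction R Q a b = fraction R Q (b \<otimes> a) (\<one> \<otimes> b)"
    using prime_compl_one[OF P] ab b by (intro localization_mult[OF P]) auto
  also have "\<dots> = fraction R Q a \<one>"
    using prime_compl_one[OF P] ab b by (intro fraction_eq_crossI[OF P]) (auto simp: m_comm)
  finally show "(\<lambda>P\<in>V. fraction R P b \<one>) Q \<otimes>\<^bsub>localization R Q\<^esub> (\<lambda>P\<in>V. fraction R P a b) Q = fraction R Q a \<one>"
    using Q by simp
qed

lemma Spec_section_local_fraction:
  assumes V: "s \<in> carrier (sections (Spec R) V)" "P \<in> V"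
  obtains V' a b where "openin (zariski_topology R) V'" "P \<in> V'" "V' \<subseteq> V" "a \<in> carrier R" "b \<in> carrier R"
    "\<And>Q. Q \<in> V' \<Longrightarrow> b \<notin> Q" "restrict s V' = fraction_section R a b V'"
proof -
  obtain V' a b where V': "openin (zariski_topology R) V'" "P \<in> V'" "V' \<subseteq> V" "a \<in> carrier R" "b \<in> carrier R"
    "\<forall>Q\<in>V'. b \<notin> Q \<and> s Q = fraction R Q a b" using V unfolding Spec_def by auto
  then show ?thesis using that[OF V'(1-5)] unfolding fraction_section_def by (auto intro: restrict_ext)
qed

end

locale affine_chart = locally_ringed_space \<XX> + C: plain_cring R
  for \<XX> :: "('x, 'a) rspace" and U :: "'x set" and R :: "'a ring" (structure)
    and f :: "('x, 'a, 'a set, 'a set \<Rightarrow> ('a \<times> 'a) set) rmorphism" +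
  assumes openU: "openin (topol \<XX>) U"
    and iso: "lrs_isomorphism (open_subspace \<XX> U) (Spec R) f"
begin

lemma sub_simps:
  "topol (open_subspace \<XX> U) = subtopology (topol \<XX>) U"
  "sections (open_subspace \<XX> U) = sections \<XX>" "restr (open_subspace \<XX> U) = restr \<XX>"
  unfolding open_subspace_def by simp_all

lemma topspace_sub: "topspace (subtopology (topol \<XX>) U) = U"
  using openin_subset[OF openU] by (simp add: topspace_subtopology Int_absorb1)

lemma preimage_eq: "preimage (open_subspace \<XX> U) f V = {x \<in> U. pt f x \<in> V}"
  unfolding preimage_def sub_simps topspace_sub ..

lemma homeo: "homeomorphic_map (subtopology (topol \<XX>) U) (zariski_topology R) (pt f)"
  using iso unfolding lrs_isomorphism_def sub_simps C.Spec_simps by blast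

lemma pt_image: "pt f ` U = prime_spectrum R" and pt_inj: "inj_on (pt f) U"
  using homeo unfolding homeomorphic_map_def quotient_map_def topspace_sub C.topspace_zariski by auto

lemma pt_prime: "x \<in> U \<Longrightarrow> primeideal (pt f x) R"
  using pt_image unfolding prime_spectrum_def by blast

lemma open_iff:
  assumes "V \<subseteq> prime_spectrum R"
  shows "open_set {x \<in> U. pt f x \<in> V} \<longleftrightarrow> openin (zariski_topology R) V"
proof -
  have "openin (subtopology (topol \<XX>) U) {x \<in> U. pt f x \<in> V} \<longleftrightarrow> openin (zariski_topology R) V"
    using homeo assms unfolding homeomorphic_map_def quotient_map_def topspace_sub C.topspace_zariski by blast
  then show ?thesis unfolding openin_open_subtopology[OF openU] by auto
qed

lemma preimage_image:
  assumes "W \<subseteq> U"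
  shows "{x \<in> U. pt f x \<in> pt f ` W} = W"
  using assms pt_inj by (auto simp: inj_on_def)

lemma open_image:
  assumes "open_set W" "W \<subseteq> U"
  shows "openin (zariski_topology R) (pt f ` W)"
proof -
  have "pt f ` W \<subseteq> prime_spectrum R" using assms pt_image by blast
  from open_iff[OF this] show ?thesis using assms preimage_image by simp
qed

definition basic :: "'a \<Rightarrow> 'x set" where "basic r = {x \<in> U. r \<notin> pt f x}"

lemma basic_open:
  assumes "r \<in> carrier R"
  shows "open_set (basic r)"
proof -
  let ?V = "{P \<in> prime_spectrum R. \<not> {r} \<subseteq> P}"
  have "openin (zariski_topology R) ?V"
    unfolding openin_zariski_topology[OF C.cring_axioms] using assms by (intro exI[of _ "{r}"]) auto
  then have "open_set {x \<in> U. pt f x \<in> ?V}" using open_iff[of ?V] by blast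
  moreover have "{x \<in> U. pt f x \<in> ?V} = basic r" using pt_image unfolding basic_def by blast
  ultimately show ?thesis by simp
qed

lemma basic_basis:
  assumes W: "open_set W" "W \<subseteq> U" and y: "y \<in> W"
  shows "\<exists>r\<in>carrier R. y \<in> basic r \<and> basic r \<subseteq> W"
proof -
  obtain S where S: "S \<subseteq> carrier R" "pt f ` W = {P \<in> prime_spectrum R. \<not> S \<subseteq> P}"
    using open_image[OF W] unfolding openin_zariski_topology[OF C.cring_axioms] by blast
  have "pt f y \<in> pt f ` W" using y by blast
  then obtain r where r: "r \<in> S" "r \<notin> pt f y" unfolding S(2) by blast
  have "basic r \<subseteq> W"
  proof
    fix x assume "x \<in> basic r"
    then have x: "x \<in> U" "r \<notin> pt f x" unfolding basic_def by auto
    then have "pt f x \<in> {P \<in> prime_spectrum R. \<not> S \<subseteq> P}" using r pt_image by blast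
    then have "pt f x \<in> pt f ` W" unfolding S(2) .
    then show "x \<in> W" using preimage_image[OF W(2)] x by blast
  qed
  moreover have "y \<in> basic r" using r y W unfolding basic_def by blast
  ultimately show ?thesis using r S by blast
qed

lemma preimage_pt_image: "W \<subseteq> U \<Longrightarrow> preimage (open_subspace \<XX> U) f (pt f ` W) = W"
  unfolding preimage_eq by (rule preimage_image)

lemma lrs_morphism: "lrs_morphism (open_subspace \<XX> U) (Spec R) f"
  using iso unfolding lrs_isomorphism_def by blast

lemma openin_topol_Spec: "\<lbrakk>open_set W; W \<subseteq> U\<rbrakk> \<Longrightarrow> openin (topol (Spec R)) (pt f ` W)"
  using open_image by (simp add: C.Spec_simps)

lemma pull_hom:
  assumes "open_set W" "W \<subseteq> U"
  shows "pull f (pt f ` W) \<in> ring_hom (sections (Spec R) (pt f ` W)) (sections \<XX> W)"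
  using lrs_morphism openin_topol_Spec[OF assms] preimage_pt_image[OF assms(2)]
  unfolding lrs_morphism_def by (metis sub_simps(2))

lemma pull_bij_betw:
  assumes "open_set W" "W \<subseteq> U"
  shows "bij_betw (pull f (pt f ` W)) (carrier (sections (Spec R) (pt f ` W))) (carrier (sections \<XX> W))"
  using iso openin_topol_Spec[OF assms] preimage_pt_image[OF assms(2)]
  unfolding lrs_isomorphism_def by (metis sub_simps(2))

lemma pull_restr:
  assumes W: "open_set W" "W \<subseteq> U" and W': "open_set W'" "W' \<subseteq> W"
    and s: "s \<in> carrier (sections (Spec R) (pt f ` W))"
  shows "pull f (pt f ` W') (restrict s (pt f ` W')) = restr \<XX> W W' (pull f (pt f ` W) s)"
proof -
  have W'U: "W' \<subseteq> U" using W W' by blast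
  have "\<forall>V W. openin (topol (Spec R)) V \<and> openin (topol (Spec R)) W \<and> W \<subseteq> V \<longrightarrow>
      (\<forall>s\<in>carrier (sections (Spec R) V). pull f W (restr (Spec R) V W s) =
        restr \<XX> (preimage (open_subspace \<XX> U) f V) (preimage (open_subspace \<XX> U) f W) (pull f V s))"
    using lrs_morphism unfolding lrs_morphism_def sub_simps by blast
  then have "pull f (pt f ` W') (restr (Spec R) (pt f ` W) (pt f ` W') s) =
    restr \<XX> (preimage (open_subspace \<XX> U) f (pt f ` W)) (preimage (open_subspace \<XX> U) f (pt f ` W')) (pull f (pt f ` W) s)"
    using openin_topol_Spec[OF W] openin_topol_Spec[OF W'(1) W'U] s W'(2) by (simp add: image_mono)
  then show ?thesis unfolding preimage_pt_image[OF W(2)] preimage_pt_image[OF W'U] C.Spec_simps .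
qed

definition sec :: "'x set \<Rightarrow> 'a \<Rightarrow> 'a" where "sec W r = pull f (pt f ` W) (const_section R r (pt f ` W))"

lemma sec_hom:
  assumes "open_set W" "W \<subseteq> U"
  shows "sec W \<in> ring_hom R (sections \<XX> W)"
proof -
  have "pull f (pt f ` W) \<circ> (\<lambda>r. const_section R r (pt f ` W)) \<in> ring_hom R (sections \<XX> W)"
    by (rule ring_hom_trans[OF C.const_section_hom[OF open_image[OF assms]] pull_hom[OF assms]])
  moreover have "pull f (pt f ` W) \<circ> (\<lambda>r. const_section R r (pt f ` W)) = sec W" unfolding sec_def by auto
  ultimately show ?thesis by simp
qed

lemma sec_restr:
  assumes W: "open_set W" "W \<subseteq> U" and W': "open_set W'" "W' \<subseteq> W" and r: "r \<in> carrier R"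
  shows "restr \<XX> W W' (sec W r) = sec W' r"
proof -
  have "restrict (const_section R r (pt f ` W)) (pt f ` W') = const_section R r (pt f ` W')"
    unfolding fraction_section_def using W'(2) by (intro ext) (auto simp: restrict_def)
  then show ?thesis unfolding sec_def
    using pull_restr[OF W W' C.const_section_carrier[OF open_image[OF W] r]] by simp
qed

lemma sec_mult_pull_fraction_section:
  assumes W: "open_set W" "W \<subseteq> U" and ab: "a \<in> carrier R" "b \<in> carrier R" "W \<subseteq> basic b"
  shows "pull f (pt f ` W) (fraction_section R a b (pt f ` W)) \<in> carrier (sections \<XX> W)"
    and "sec W b \<otimes>\<^bsub>sections \<XX> W\<^esub> pull f (pt f ` W) (fraction_section R a b (pt f ` W)) = sec W a"
proof -
  note V = open_image[OF W]
  have b: "\<And>Q. Q \<in> pt f ` W \<Longrightarrow> b \<notin> Q" using ab(3) unfolding basic_def by blast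
  note s = C.fraction_section_carrier[OF V ab(1,2) b]
  show "pull f (pt f ` W) (fraction_section R a b (pt f ` W)) \<in> carrier (sections \<XX> W)"
    by (rule ring_hom_closed[OF pull_hom[OF W] s])
  show "sec W b \<otimes>\<^bsub>sections \<XX> W\<^esub> pull f (pt f ` W) (fraction_section R a b (pt f ` W)) = sec W a"
    unfolding sec_def
    using ring_hom_mult[OF pull_hom[OF W] C.const_section_carrier[OF V ab(2)] s]
      C.const_section_mult_fraction_section[OF V ab(1,2) b] by simp
qed

lemma sec_unit:
  assumes W: "open_set W" "W \<subseteq> basic r" and r: "r \<in> carrier R"
  shows "\<exists>t\<in>carrier (sections \<XX> W). sec W r \<otimes>\<^bsub>sections \<XX> W\<^esub> t = \<one>\<^bsub>sections \<XX> W\<^esub>"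
proof -
  have WU: "W \<subseteq> U" using W unfolding basic_def by blast
  then show ?thesis
    using sec_mult_pull_fraction_section[OF W(1) _ C.one_closed r W(2)] ring_hom_one[OF sec_hom[OF W(1) WU]]
    by auto
qed

lemma section_on_subset_local_fraction:
  assumes W: "open_set W" "W \<subseteq> U" and y: "y \<in> W" and t: "t \<in> carrier (sections \<XX> W)"
  obtains W' a b where "open_set W'" "y \<in> W'" "W' \<subseteq> W" "a \<in> carrier R" "b \<in> carrier R" "W' \<subseteq> basic b"
    "sec W' b \<otimes>\<^bsub>sections \<XX> W'\<^esub> restr \<XX> W W' t = sec W' a"
proof -
  obtain s where s: "s \<in> carrier (sections (Spec R) (pt f ` W))" "t = pull f (pt f ` W) s"
    using pull_bij_betw[OF W] t unfolding bij_betw_def by blast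
  obtain V' a b where V': "openin (zariski_topology R) V'" "pt f y \<in> V'" "V' \<subseteq> pt f ` W" "a \<in> carrier R"
    "b \<in> carrier R"
    "\<And>Q. Q \<in> V' \<Longrightarrow> b \<notin> Q" "restrict s V' = fraction_section R a b V'"
    by (rule C.Spec_section_local_fraction[OF s(1) imageI[OF y]], rule that)
  define W' where "W' = {x \<in> U. pt f x \<in> V'}"
  have V'sub: "V' \<subseteq> pt f ` U" using V'(3) W(2) by blast
  have W': "open_set W'" "W' \<subseteq> W" "W' \<subseteq> U"
    using open_iff[of V'] V'(1,3) V'sub preimage_image[OF W(2)] pt_image unfolding W'_def by auto
  have im: "pt f ` W' = V'" using V'sub unfolding W'_def by fast
  have basic: "W' \<subseteq> basic b" using V'(6) unfolding W'_def basic_def by blast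
  have "restr \<XX> W W' t = pull f (pt f ` W') (fraction_section R a b (pt f ` W'))"
    unfolding s(2) using pull_restr[OF W W'(1,2) s(1)] V'(7) unfolding im by simp
  then have "sec W' b \<otimes>\<^bsub>sections \<XX> W'\<^esub> restr \<XX> W W' t = sec W' a"
    using sec_mult_pull_fraction_section(2)[OF W'(1,3) V'(4,5) basic] by simp
  moreover have "y \<in> W'" using V'(2) y W unfolding W'_def by blast
  ultimately show ?thesis using that[OF W'(1) _ W'(2) V'(4,5) basic] by blast
qed

lemma section_local_fraction:
  assumes W: "open_set W" and y: "y \<in> W" "y \<in> U" and t: "t \<in> carrier (sections \<XX> W)"
  obtains V a b where "open_set V" "y \<in> V" "V \<subseteq> W" "a \<in> carrier R" "b \<in> carrier R" "V \<subseteq> basic b"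
    "sec V b \<otimes>\<^bsub>sections \<XX> V\<^esub> restr \<XX> W V t = sec V a"
proof -
  have open_WU: "open_set (W \<inter> U)" using W openU by blast
  obtain V a b where V: "open_set V" "y \<in> V" "V \<subseteq> W \<inter> U" "a \<in> carrier R" "b \<in> carrier R" "V \<subseteq> basic b"
    "sec V b \<otimes>\<^bsub>sections \<XX> V\<^esub> restr \<XX> (W \<inter> U) V (restr \<XX> W (W \<inter> U) t) = sec V a"
    using section_on_subset_local_fraction[OF open_WU _ _ restr_closed[OF W open_WU _ t], of y] y by blast
  then show ?thesis using that[OF V(1,2) _ V(4-6)] restr_comp[OF W open_WU V(1,3) _ t] by auto
qed

lemma sec_eq_zeroD:
  assumes W: "open_set W" "W \<subseteq> U" and y: "y \<in> W" and a: "a \<in> carrier R" "sec W a = \<zero>\<^bsub>sections \<XX> W\<^esub>"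
  shows "\<exists>u\<in>carrier R - pt f y. u \<otimes> a = \<zero>"
proof -
  let ?V = "pt f ` W" and ?q = "pt f y"
  note V = open_image[OF W]
  have P: "primeideal ?q R" using pt_prime y W by blast
  have "ring (sections \<XX> W)" using cring_sections[OF W(1)] unfolding cring_def by blast
  then have "sec W \<zero> = \<zero>\<^bsub>sections \<XX> W\<^esub>" using ring_hom_zero[OF sec_hom[OF W] C.ring_axioms] by blast
  then have "pull f ?V (const_section R a ?V) = pull f ?V (const_section R \<zero> ?V)"
    using a(2) unfolding sec_def by simp
  moreover have "inj_on (pull f ?V) (carrier (sections (Spec R) ?V))"
    using pull_bij_betw[OF W] unfolding bij_betw_def by blast
  ultimately have "const_section R a ?V = const_section R \<zero> ?V"
    using C.const_section_carrier[OF V a(1)] C.const_section_carrier[OF V C.zero_closed] by (meson inj_onD)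
  then have "const_section R a ?V ?q = const_section R \<zero> ?V ?q" by simp
  then have "fraction R ?q a \<one> = fraction R ?q \<zero> \<one>" using y by (simp add: fraction_section_def)
  from C.fraction_eqD[OF P this C.zero_closed C.prime_compl_one[OF P]]
  obtain u where u: "u \<in> carrier R - ?q" "u \<otimes> (a \<otimes> \<one> \<ominus> \<zero> \<otimes> \<one>) = \<zero>" by blast
  have "u \<in> carrier R" using u by blast
  then have "u \<otimes> a = u \<otimes> (a \<otimes> \<one> \<ominus> \<zero> \<otimes> \<one>)" using a(1) by algebra
  then show ?thesis using u by auto
qed

lemma sec_unitD:
  assumes W: "open_set W" "W \<subseteq> U" and r: "r \<in> carrier R" and y: "y \<in> W"
    and t: "t \<in> carrier (sections \<XX> W)" "sec W r \<otimes>\<^bsub>sections \<XX> W\<^esub> t = \<one>\<^bsub>sections \<XX> W\<^esub>"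
  shows "r \<notin> pt f y"
proof
  assume ry: "r \<in> pt f y"
  obtain W' a b where W': "open_set W'" "y \<in> W'" "W' \<subseteq> W" and ab: "a \<in> carrier R" "b \<in> carrier R" "W' \<subseteq> basic b"
    "sec W' b \<otimes>\<^bsub>sections \<XX> W'\<^esub> restr \<XX> W W' t = sec W' a" by (rule section_on_subset_local_fraction[OF W y t(1)])
  have W'U: "W' \<subseteq> U" using W W' by blast
  interpret S: cring "sections \<XX> W'" by (rule cring_sections[OF W'(1)])
  note sec_h = sec_hom[OF W'(1) W'U]
  let ?t = "restr \<XX> W W' t"
  note restriction = restr_hom[OF W(1) W'(1,3)]
  have t_carrier: "?t \<in> carrier (sections \<XX> W')" by (rule ring_hom_closed[OF restriction t(1)])
  have "sec W' r \<otimes>\<^bsub>sections \<XX> W'\<^esub> ?t = restr \<XX> W W' (sec W r) \<otimes>\<^bsub>sections \<XX> W'\<^esub> ?t"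
    using sec_restr[OF W W'(1,3) r] by simp
  also have "\<dots> = restr \<XX> W W' (sec W r \<otimes>\<^bsub>sections \<XX> W\<^esub> t)"
    by (rule ring_hom_mult[OF restriction ring_hom_closed[OF sec_hom[OF W] r] t(1), symmetric])
  also have "\<dots> = \<one>\<^bsub>sections \<XX> W'\<^esub>" unfolding t(2) by (rule ring_hom_one[OF restriction])
  finally have sec_inverse: "sec W' r \<otimes>\<^bsub>sections \<XX> W'\<^esub> ?t = \<one>\<^bsub>sections \<XX> W'\<^esub>" .
  have sec_carrier: "sec W' r \<in> carrier (sections \<XX> W')" "sec W' b \<in> carrier (sections \<XX> W')"
    using ring_hom_closed[OF sec_h] r ab by auto
  have "sec W' (r \<otimes> a) = sec W' r \<otimes>\<^bsub>sections \<XX> W'\<^esub> (sec W' b \<otimes>\<^bsub>sections \<XX> W'\<^esub> ?t)"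
    unfolding ab(4) by (rule ring_hom_mult[OF sec_h r ab(1)])
  also have "\<dots> = sec W' b \<otimes>\<^bsub>sections \<XX> W'\<^esub> (sec W' r \<otimes>\<^bsub>sections \<XX> W'\<^esub> ?t)"
    by (rule S.m_lcomm[OF sec_carrier t_carrier])
  also have "\<dots> = sec W' b" unfolding sec_inverse using sec_carrier by simp
  finally have "sec W' (r \<otimes> a) = sec W' b" .
  interpret H: ring_hom_cring R "sections \<XX> W'" "sec W'"
    using sec_h by (simp add: ring_hom_cring_def ring_hom_cring_axioms_def C.cring_axioms S.cring_axioms)
  have "sec W' (b \<ominus> r \<otimes> a) = \<zero>\<^bsub>sections \<XX> W'\<^esub>"
    using \<open>sec W' (r \<otimes> a) = sec W' b\<close> ab r sec_carrier by (simp add: a_minus_def S.r_neg del: H.hom_mult)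
  moreover have "b \<ominus> r \<otimes> a \<in> carrier R" using ab r by simp
  ultimately obtain u where u: "u \<in> carrier R - pt f y" "u \<otimes> (b \<ominus> r \<otimes> a) = \<zero>"
    using sec_eq_zeroD[OF W'(1) W'U W'(2)] by blast
  interpret q: primeideal "pt f y" R using pt_prime y W by blast
  have u_carrier: "u \<in> carrier R" using u by blast
  have "u \<otimes> b = (u \<otimes> a) \<otimes> r \<oplus> u \<otimes> (b \<ominus> r \<otimes> a)" using u_carrier ab(1,2) r by algebra
  also have "\<dots> = (u \<otimes> a) \<otimes> r" unfolding u(2) using u_carrier ab(1) r by simp
  finally have "u \<otimes> b \<in> pt f y" using q.I_l_closed[OF ry, of "u \<otimes> a"] u_carrier ab(1) by simp
  moreover have "b \<in> carrier R - pt f y" using ab(2,3) W'(2) unfolding basic_def by blast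
  ultimately show False using C.prime_compl_mult[OF q.primeideal_axioms u(1)] by blast
qed

end

section \<open>Generic points\<close>

context ringed_space
begin

abbreviation point_closure :: "'x \<Rightarrow> 'x set" where
  "point_closure x \<equiv> Abstract_Topology.closure_of (topol \<XX>) {x}"

lemma point_closure_open: "\<lbrakk>x \<in> point_closure y; open_set V; x \<in> V\<rbrakk> \<Longrightarrow> y \<in> V"
  unfolding in_closure_of by blast

end

context affine_chart
begin

lemma U_subset_topspace: "U \<subseteq> topspace (topol \<XX>)"
  using openin_subset[OF openU] .

lemma pt_subset_carrier: "x \<in> U \<Longrightarrow> pt f x \<subseteq> carrier R"
  using pt_prime by (meson additive_subgroup.a_subset ideal.axioms(1) primeideal.axioms(1))

lemma closure_of_point_iff:
  assumes x: "x \<in> U" and y: "y \<in> U"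
  shows "x \<in> point_closure y \<longleftrightarrow> pt f y \<subseteq> pt f x"
proof
  assume closure: "x \<in> point_closure y"
  show "pt f y \<subseteq> pt f x"
  proof (rule ccontr)
    assume "\<not> pt f y \<subseteq> pt f x"
    then obtain r where r: "r \<in> pt f y" "r \<notin> pt f x" by blast
    then have "x \<in> basic r" "r \<in> carrier R" using x pt_subset_carrier[OF y] unfolding basic_def by auto
    then have "y \<in> basic r" using point_closure_open[OF closure basic_open] by blast
    then show False using r(1) unfolding basic_def by blast
  qed
next
  assume sub: "pt f y \<subseteq> pt f x"
  have "y \<in> V" if V: "open_set V" "x \<in> V" for V
  proof -
    have "open_set (V \<inter> U)" using V(1) openU by blast
    then obtain r where r: "x \<in> basic r" "basic r \<subseteq> V \<inter> U" using basic_basis[of "V \<inter> U" x] V(2) x by blast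
    then have "y \<in> basic r" using sub y unfolding basic_def by blast
    then show ?thesis using r(2) by blast
  qed
  then show "x \<in> point_closure y" unfolding in_closure_of using x U_subset_topspace by blast
qed

lemma primeideal_of_irreducible_closed:
  assumes Z: "irreducible_closed (topol \<XX>) Z" and nonempty: "Z \<inter> U \<noteq> {}"
  shows "primeideal (\<Inter>(pt f ` (Z \<inter> U))) R"
proof (rule primeidealI[OF _ C.cring_axioms])
  show "ideal (\<Inter>(pt f ` (Z \<inter> U))) R"
    by (rule C.i_Intersect) (use nonempty pt_prime primeideal.axioms(1) in auto)
  show "carrier R \<noteq> \<Inter>(pt f ` (Z \<inter> U))" using nonempty C.prime_compl_one[OF pt_prime] by blast
next
  fix a b assume ab: "a \<in> carrier R" "b \<in> carrier R" "a \<otimes> b \<in> \<Inter>(pt f ` (Z \<inter> U))"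
  let ?X = "topspace (topol \<XX>)"
  have "Z \<subseteq> ?X" using Z closedin_subset unfolding irreducible_closed_def by blast
  moreover have "x \<notin> basic a \<or> x \<notin> basic b" if "x \<in> Z" for x
    using ab that C.prime_compl_mult[OF pt_prime, of x a b] unfolding basic_def by blast
  ultimately have "Z \<subseteq> (?X - basic a) \<union> (?X - basic b)" by blast
  moreover have "closedin (topol \<XX>) (?X - basic a)" "closedin (topol \<XX>) (?X - basic b)"
    using basic_open ab by auto
  ultimately have "Z \<subseteq> ?X - basic a \<or> Z \<subseteq> ?X - basic b" using Z unfolding irreducible_closed_def by blast
  then show "a \<in> \<Inter>(pt f ` (Z \<inter> U)) \<or> b \<in> \<Inter>(pt f ` (Z \<inter> U))"
    unfolding basic_def using ab(1,2) by blast
qed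

lemma ex_generic_point:
  assumes Z: "irreducible_closed (topol \<XX>) Z" and nonempty: "Z \<inter> U \<noteq> {}"
  obtains y where "y \<in> U" "point_closure y = Z"
proof -
  let ?X = "topspace (topol \<XX>)"
  have closed: "closedin (topol \<XX>) Z" and ZX: "Z \<subseteq> ?X"
    using Z closedin_subset unfolding irreducible_closed_def by auto
  have "\<Inter>(pt f ` (Z \<inter> U)) \<in> pt f ` U"
    using primeideal_of_irreducible_closed[OF Z nonempty] unfolding pt_image prime_spectrum_def by simp
  then obtain y where y: "y \<in> U" "pt f y = \<Inter>(pt f ` (Z \<inter> U))" by auto
  have "y \<in> Z"
  proof (rule ccontr)
    assume "y \<notin> Z"
    then have "open_set (U \<inter> (?X - Z))" "y \<in> U \<inter> (?X - Z)" using openU closed y(1) U_subset_topspace by auto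
    then obtain r where r: "y \<in> basic r" "basic r \<subseteq> U \<inter> (?X - Z)"
      using basic_basis[of "U \<inter> (?X - Z)" y] by blast
    then obtain x where "x \<in> Z \<inter> U" "r \<notin> pt f x" using y(2) unfolding basic_def by auto
    then show False using r(2) unfolding basic_def by blast
  qed
  then have "point_closure y \<subseteq> Z" by (intro closure_of_minimal) (use closed in auto)
  moreover have "Z \<subseteq> point_closure y \<union> (?X - U)"
    using closure_of_point_iff[OF _ y(1)] y(2) ZX by blast
  then have "Z \<subseteq> point_closure y"
    using Z nonempty openU unfolding irreducible_closed_def
    by (metis Diff_disjoint Int_commute closedin_closure_of closedin_def disjoint_iff double_diff
      openin_closedin openin_subset subsetD subset_refl)
  ultimately show ?thesis using that y(1) by blast
qed

end

section \<open>The function field\<close>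

locale integral_space = locally_ringed_space \<XX> for \<XX> :: "('x, 'a) rspace" +
  assumes integral: "integral_scheme \<XX>"
begin

abbreviation "points \<equiv> topspace (topol \<XX>)"

lemma sections_domain: "\<lbrakk>open_set U; U \<noteq> {}\<rbrakk> \<Longrightarrow> domain (sections \<XX> U)"
  using integral unfolding integral_scheme_def by blast

lemma points_nonempty: "points \<noteq> {}"
  using integral unfolding integral_scheme_def by blast

lemma affine_chart_of_affine_open:
  assumes "affine_open \<XX> U"
  obtains R f where "affine_chart \<XX> U R f"
proof -
  obtain R :: "'a ring" and f where Rf: "cring R" "lrs_isomorphism (open_subspace \<XX> U) (Spec R) f" "open_set U"
    using assms unfolding affine_open_def by blast
  have "affine_chart \<XX> U R f"
    using Rf locally_ringed_space_axioms
    by (simp add: affine_chart_def affine_chart_axioms_def plain_cring_def)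
  then show ?thesis by (rule that)
qed

lemma affine_chart_at:
  assumes "x \<in> points"
  obtains U R f where "x \<in> U" "affine_chart \<XX> U R f"
proof -
  obtain U where U: "x \<in> U" "affine_open \<XX> U"
    using integral assms unfolding integral_scheme_def scheme_def by blast
  obtain R f where "affine_chart \<XX> U R f" by (rule affine_chart_of_affine_open[OF U(2)])
  then show ?thesis using that U by blast
qed

lemma generic_point_unique_existence:
  assumes Z: "irreducible_closed (topol \<XX>) Z"
  shows "\<exists>!z. z \<in> points \<and> point_closure z = Z"
proof -
  obtain x where x: "x \<in> Z" "x \<in> points" using Z closedin_subset unfolding irreducible_closed_def by blast
  obtain U R f where U: "x \<in> U" and chart: "affine_chart \<XX> U R f" by (rule affine_chart_at[OF x(2)])
  interpret C: affine_chart \<XX> U R f by (rule chart)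
  obtain y where y: "y \<in> U" "point_closure y = Z" using C.ex_generic_point[OF Z] x(1) U by blast
  have mem: "z \<in> point_closure z" if "z \<in> points" for z using that by (simp add: in_closure_of)
  show ?thesis
  proof (rule ex1I[of _ y])
    show "y \<in> points \<and> point_closure y = Z" using y C.U_subset_topspace by blast
    fix z assume z: "z \<in> points \<and> point_closure z = Z"
    then have "z \<in> U" using point_closure_open[OF _ C.openU U] x(1) by blast
    then have "pt f z = pt f y"
      using C.closure_of_point_iff[of y z] C.closure_of_point_iff[of z y] mem y z C.U_subset_topspace by blast
    then show "z = y" using C.pt_inj \<open>z \<in> U\<close> y(1) unfolding inj_on_def by blast
  qed
qed

lemma generic_point:
  assumes "irreducible_closed (topol \<XX>) Z"
  shows "generic_point \<XX> Z \<in> points" "point_closure (generic_point \<XX> Z) = Z" "generic_point \<XX> Z \<in> Z"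
    "\<And>V. \<lbrakk>open_set V; V \<inter> Z \<noteq> {}\<rbrakk> \<Longrightarrow> generic_point \<XX> Z \<in> V"
    "\<And>z. \<lbrakk>z \<in> points; point_closure z = Z\<rbrakk> \<Longrightarrow> generic_point \<XX> Z = z"
proof -
  note ex = generic_point_unique_existence[OF assms]
  have g: "generic_point \<XX> Z \<in> points \<and> point_closure (generic_point \<XX> Z) = Z"
    unfolding generic_point_def by (rule theI'[OF ex])
  then show inX: "generic_point \<XX> Z \<in> points" and closure: "point_closure (generic_point \<XX> Z) = Z" by auto
  have "generic_point \<XX> Z \<in> point_closure (generic_point \<XX> Z)" using inX by (simp add: in_closure_of)
  then show "generic_point \<XX> Z \<in> Z" unfolding closure .
  show "generic_point \<XX> Z \<in> V" if "open_set V" "V \<inter> Z \<noteq> {}" for V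
  proof -
    obtain x where "x \<in> V" "x \<in> Z" using \<open>V \<inter> Z \<noteq> {}\<close> by blast
    then show ?thesis using point_closure_open[OF _ \<open>open_set V\<close>, of x] closure by simp
  qed
  show "generic_point \<XX> Z = z" if "z \<in> points" "point_closure z = Z" for z
    using ex that g by blast
qed

lemma sections_empty_eq: "\<lbrakk>s \<in> carrier (sections \<XX> {}); t \<in> carrier (sections \<XX> {})\<rbrakk> \<Longrightarrow> s = t"
  using locality[of "{}" s t] by simp

lemma restr_zero: "\<lbrakk>open_set U; open_set V; V \<subseteq> U\<rbrakk> \<Longrightarrow> restr \<XX> U V \<zero>\<^bsub>sections \<XX> U\<^esub> = \<zero>\<^bsub>sections \<XX> V\<^esub>"
  using ring_hom_zero[OF restr_hom] cring_sections by (simp add: cring_def)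

lemma glue_one_zero:
  assumes U: "open_set U" "U \<noteq> {}" and V: "open_set V" and disj: "U \<inter> V = {}"
  obtains e where "e \<in> carrier (sections \<XX> (U \<union> V))" "restr \<XX> (U \<union> V) U e = \<one>\<^bsub>sections \<XX> U\<^esub>"
    "restr \<XX> (U \<union> V) V e = \<zero>\<^bsub>sections \<XX> V\<^esub>"
proof -
  define \<sigma> where "\<sigma> W = (if W = U then \<one>\<^bsub>sections \<XX> U\<^esub> else \<zero>\<^bsub>sections \<XX> V\<^esub>)" for W
  have nonempty: "U \<noteq> V" using U disj by blast
  have "cring (sections \<XX> U)" "cring (sections \<XX> V)" using cring_sections U V by auto
  then have \<sigma>: "\<sigma> W \<in> carrier (sections \<XX> W)" if "W \<in> {U, V}" for W
    using that by (auto simp: \<sigma>_def cring_def ring.ring_simprules)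
  have open_W: "open_set W" if "W \<in> {U, V}" for W using that U V by auto
  have "\<exists>t\<in>carrier (sections \<XX> (\<Union>{U, V})). \<forall>W\<in>{U, V}. restr \<XX> (\<Union>{U, V}) W t = \<sigma> W"
  proof (rule gluing[OF open_W \<sigma>])
    fix A B assume AB: "A \<in> {U, V}" "B \<in> {U, V}"
    have "restr \<XX> A {} (\<sigma> A) = restr \<XX> B {} (\<sigma> B)"
      by (rule sections_empty_eq) (use restr_closed open_W \<sigma> AB in auto)
    then show "restr \<XX> A (A \<inter> B) (\<sigma> A) = restr \<XX> B (A \<inter> B) (\<sigma> B)" using AB disj by (auto simp: Int_commute)
  qed
  then obtain t where t: "t \<in> carrier (sections \<XX> (U \<union> V))" "restr \<XX> (U \<union> V) U t = \<sigma> U"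
    "restr \<XX> (U \<union> V) V t = \<sigma> V"
    by auto
  then show ?thesis using that nonempty by (auto simp: \<sigma>_def)
qed

lemma open_inter_nonempty:
  assumes U: "open_set U" "U \<noteq> {}" and V: "open_set V" "V \<noteq> {}"
  shows "U \<inter> V \<noteq> {}"
proof
  assume disj: "U \<inter> V = {}"
  let ?W = "U \<union> V"
  obtain e where e: "e \<in> carrier (sections \<XX> ?W)" "restr \<XX> ?W U e = \<one>\<^bsub>sections \<XX> U\<^esub>"
    "restr \<XX> ?W V e = \<zero>\<^bsub>sections \<XX> V\<^esub>"
    by (rule glue_one_zero[OF U V(1) disj])
  obtain d where d: "d \<in> carrier (sections \<XX> ?W)" "restr \<XX> ?W V d = \<one>\<^bsub>sections \<XX> V\<^esub>"
    "restr \<XX> ?W U d = \<zero>\<^bsub>sections \<XX> U\<^esub>"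
    by (rule glue_one_zero[OF V U(1)], use disj in blast, unfold Un_commute[of V U])
  have open_W: "open_set ?W" using U V by blast
  interpret W: domain "sections \<XX> ?W" by (rule sections_domain[OF open_W]) (use U in blast)
  interpret U: domain "sections \<XX> U" by (rule sections_domain[OF U])
  interpret V: domain "sections \<XX> V" by (rule sections_domain[OF V])
  note hU = restr_hom[OF open_W U(1)] and hV = restr_hom[OF open_W V(1)] and zero = restr_zero[OF open_W]
  have "e \<otimes>\<^bsub>sections \<XX> ?W\<^esub> d = \<zero>\<^bsub>sections \<XX> ?W\<^esub>"
  proof (rule locality[of "{U, V}", unfolded Union_insert Union_empty Un_empty_right])
    have "restr \<XX> ?W U (e \<otimes>\<^bsub>sections \<XX> ?W\<^esub> d) = \<zero>\<^bsub>sections \<XX> U\<^esub>"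
      using ring_hom_mult[OF hU e(1) d(1)] e(2) d(3) by simp
    moreover have "restr \<XX> ?W V (e \<otimes>\<^bsub>sections \<XX> ?W\<^esub> d) = \<zero>\<^bsub>sections \<XX> V\<^esub>"
      using ring_hom_mult[OF hV e(1) d(1)] e(3) d(2) by simp
    ultimately show "restr \<XX> ?W A (e \<otimes>\<^bsub>sections \<XX> ?W\<^esub> d) = restr \<XX> ?W A \<zero>\<^bsub>sections \<XX> ?W\<^esub>" if "A \<in> {U, V}" for A
      using that zero[OF U(1)] zero[OF V(1)] by auto
  qed (use U V e d in auto)
  then have "e = \<zero>\<^bsub>sections \<XX> ?W\<^esub> \<or> d = \<zero>\<^bsub>sections \<XX> ?W\<^esub>" using W.integral e d by blast
  then show False using e(2) d(2) zero[OF U(1)] zero[OF V(1)] U.one_not_zero V.one_not_zero by auto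
qed

lemma irreducible_points: "irreducible_closed (topol \<XX>) points"
  unfolding irreducible_closed_def
proof (intro conjI allI impI)
  show "closedin (topol \<XX>) points" "points \<noteq> {}" using points_nonempty by auto
  fix A B assume "closedin (topol \<XX>) A \<and> closedin (topol \<XX>) B \<and> points \<subseteq> A \<union> B"
  then have "open_set (points - A)" "open_set (points - B)" "(points - A) \<inter> (points - B) = {}"
    by (auto simp: closedin_def)
  then have "points - A = {} \<or> points - B = {}" using open_inter_nonempty by blast
  then show "points \<subseteq> A \<or> points \<subseteq> B" by blast
qed

definition \<eta> :: 'x where
  "\<eta> = generic_point \<XX> points"

lemma eta_open: "\<lbrakk>open_set V; V \<noteq> {}\<rbrakk> \<Longrightarrow> \<eta> \<in> V"
  using generic_point(4)[OF irreducible_points] openin_subset[of "topol \<XX>" V] unfolding \<eta>_def by blast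

lemma eta_points: "\<eta> \<in> points"
  using generic_point(1)[OF irreducible_points] unfolding \<eta>_def .

lemma eta_closure: "point_closure \<eta> = points"
  using generic_point(2)[OF irreducible_points] unfolding \<eta>_def .

end

locale integral_chart = integral_space \<XX> + affine_chart \<XX> U R f
  for \<XX> :: "('x, 'a) rspace" and U R f +
  assumes nonempty: "U \<noteq> {}"
begin

lemma eta_U: "\<eta> \<in> U"
  by (rule eta_open[OF openU nonempty])

lemma sec_eq_zero_iff:
  assumes W: "open_set W" "W \<subseteq> U" "W \<noteq> {}" and r: "r \<in> carrier R"
  shows "sec W r = \<zero>\<^bsub>sections \<XX> W\<^esub> \<longleftrightarrow> r \<in> pt f \<eta>"
proof
  interpret p: primeideal "pt f \<eta>" R by (rule pt_prime[OF eta_U])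
  assume "sec W r = \<zero>\<^bsub>sections \<XX> W\<^esub>"
  then obtain u where "u \<in> carrier R - pt f \<eta>" "u \<otimes>\<^bsub>R\<^esub> r = \<zero>\<^bsub>R\<^esub>"
    using sec_eq_zeroD[OF W(1,2) eta_open[OF W(1,3)] r] by blast
  then show "r \<in> pt f \<eta>" using p.I_prime[of u r] r p.zero_closed by auto
next
  assume r\<eta>: "r \<in> pt f \<eta>"
  interpret D: domain "sections \<XX> U" by (rule sections_domain[OF openU nonempty])
  define p where "p = {s \<in> carrier R. sec U s \<in> {\<zero>\<^bsub>sections \<XX> U\<^esub>}}"
  have "primeideal p R"
    unfolding p_def
    by (rule ring_hom_ring.primeideal_vimage[OF ring_hom_ringI2[OF C.ring_axioms D.ring_axioms
      sec_hom[OF openU subset_refl]]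
      C.cring_axioms D.zeroprimeideal])
  then have "p \<in> pt f ` U" unfolding pt_image prime_spectrum_def by simp
  then obtain y where y: "y \<in> U" "pt f y = p" by auto
  have "r \<in> p"
  proof (rule ccontr)
    assume "r \<notin> p"
    then have "y \<in> basic r" using y unfolding basic_def by simp
    then have "\<eta> \<in> basic r" using eta_open[OF basic_open[OF r]] by blast
    then show False using r\<eta> unfolding basic_def by blast
  qed
  then have "sec U r = \<zero>\<^bsub>sections \<XX> U\<^esub>" unfolding p_def by blast
  then show "sec W r = \<zero>\<^bsub>sections \<XX> W\<^esub>"
    using sec_restr[OF openU subset_refl W(1,2) r] restr_zero[OF openU W(1,2)] by simp
qed

lemma restr_eq_zero_of_sec:
  assumes V: "open_set V" "V \<subseteq> basic b" "V \<noteq> {}" and ab: "a \<in> carrier R" "b \<in> carrier R"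
    and s: "s \<in> carrier (sections \<XX> V)" "sec V b \<otimes>\<^bsub>sections \<XX> V\<^esub> s = sec V a" and a: "a \<in> pt f \<eta>"
  shows "s = \<zero>\<^bsub>sections \<XX> V\<^esub>"
proof -
  have VU: "V \<subseteq> U" using V(2) unfolding basic_def by blast
  interpret D: domain "sections \<XX> V" by (rule sections_domain[OF V(1,3)])
  have "sec V b \<otimes>\<^bsub>sections \<XX> V\<^esub> s = \<zero>\<^bsub>sections \<XX> V\<^esub>"
    unfolding s(2) using sec_eq_zero_iff[OF V(1) VU V(3) ab(1)] a by blast
  moreover have "sec V b \<noteq> \<zero>\<^bsub>sections \<XX> V\<^esub>"
    using sec_eq_zero_iff[OF V(1) VU V(3) ab(2)] eta_open[OF V(1,3)] V(2) unfolding basic_def by blast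
  ultimately show ?thesis
    using D.integral ring_hom_closed[OF sec_hom[OF V(1) VU] ab(2)] s(1) by blast
qed

end

context integral_space
begin

lemma integral_chart_of_affine_open:
  assumes "affine_open \<XX> U" "U \<noteq> {}"
  obtains R f where "integral_chart \<XX> U R f"
proof -
  obtain R f where "affine_chart \<XX> U R f" by (rule affine_chart_of_affine_open[OF assms(1)])
  then have "integral_chart \<XX> U R f"
    using integral_space_axioms assms(2) by (simp add: integral_chart_def integral_chart_axioms_def)
  then show ?thesis by (rule that)
qed

lemma integral_chart_at:
  assumes "x \<in> points"
  obtains U R f where "x \<in> U" "integral_chart \<XX> U R f"
proof -
  obtain U R f where "x \<in> U" "affine_chart \<XX> U R f" by (rule affine_chart_at[OF assms])
  then show ?thesis
    using that integral_space_axioms by (auto simp: integral_chart_def integral_chart_axioms_def)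
qed

lemma restr_eq_zero_near:
  assumes U: "open_set U" and W: "open_set W" "W \<subseteq> U" "W \<noteq> {}" and s: "s \<in> carrier (sections \<XX> U)"
    and zero: "restr \<XX> U W s = \<zero>\<^bsub>sections \<XX> W\<^esub>" and y: "y \<in> U"
  obtains V where "open_set V" "y \<in> V" "V \<subseteq> U" "restr \<XX> U V s = \<zero>\<^bsub>sections \<XX> V\<^esub>"
proof -
  have "y \<in> points" using y openin_subset[OF U] by blast
  then obtain U' R f where y': "y \<in> U'" and chart: "integral_chart \<XX> U' R f" by (rule integral_chart_at)
  interpret C: integral_chart \<XX> U' R f by (rule chart)
  obtain V a b where V: "open_set V" "y \<in> V" "V \<subseteq> U" and ab: "a \<in> carrier R" "b \<in> carrier R" "V \<subseteq> C.basic b"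
    and frac: "C.sec V b \<otimes>\<^bsub>sections \<XX> V\<^esub> restr \<XX> U V s = C.sec V a"
    by (rule C.section_local_fraction[OF U y y' s])
  have VU': "V \<subseteq> U'" using ab(3) unfolding C.basic_def by blast
  let ?Y = "V \<inter> W"
  have Y: "open_set ?Y" "?Y \<subseteq> V" "?Y \<subseteq> U'" "?Y \<noteq> {}"
    using V(1,2) W(1,3) VU' open_inter_nonempty[OF V(1) _ W(1,3)] by auto
  interpret Y: cring "sections \<XX> ?Y" by (rule cring_sections[OF Y(1)])
  note sV = restr_closed[OF U V(1,3) s] and sec = ring_hom_closed[OF C.sec_hom[OF V(1) VU']]
  have "restr \<XX> V ?Y (restr \<XX> U V s) = restr \<XX> W ?Y (restr \<XX> U W s)"
    using restr_comp[OF U V(1) Y(1) Y(2) V(3) s] restr_comp[OF U W(1) Y(1) _ W(2) s] by simp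
  also have "\<dots> = \<zero>\<^bsub>sections \<XX> ?Y\<^esub>" unfolding zero by (rule restr_zero[OF W(1) Y(1)]) blast
  finally have "restr \<XX> V ?Y (C.sec V b \<otimes>\<^bsub>sections \<XX> V\<^esub> restr \<XX> U V s) = \<zero>\<^bsub>sections \<XX> ?Y\<^esub>"
    unfolding ring_hom_mult[OF restr_hom[OF V(1) Y(1,2)] sec[OF ab(2)] sV]
    using restr_closed[OF V(1) Y(1,2) sec[OF ab(2)]] by simp
  then have "C.sec ?Y a = \<zero>\<^bsub>sections \<XX> ?Y\<^esub>"
    unfolding frac C.sec_restr[OF V(1) VU' Y(1,2) ab(1)] .
  then have "a \<in> pt f \<eta>" using C.sec_eq_zero_iff[OF Y(1,3,4) ab(1)] by blast
  then have "restr \<XX> U V s = \<zero>\<^bsub>sections \<XX> V\<^esub>"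
    using C.restr_eq_zero_of_sec[OF V(1) ab(3) _ ab(1,2) sV frac] V(2) by blast
  then show ?thesis using that V by blast
qed

lemma restr_eq_zero_imp_eq_zero:
  assumes U: "open_set U" and W: "open_set W" "W \<subseteq> U" "W \<noteq> {}" and s: "s \<in> carrier (sections \<XX> U)"
    and zero: "restr \<XX> U W s = \<zero>\<^bsub>sections \<XX> W\<^esub>"
  shows "s = \<zero>\<^bsub>sections \<XX> U\<^esub>"
proof -
  define \<V> where "\<V> = {V. open_set V \<and> V \<subseteq> U \<and> restr \<XX> U V s = \<zero>\<^bsub>sections \<XX> V\<^esub>}"
  have "y \<in> \<Union>\<V>" if y: "y \<in> U" for y
  proof -
    obtain V where "open_set V" "y \<in> V" "V \<subseteq> U" "restr \<XX> U V s = \<zero>\<^bsub>sections \<XX> V\<^esub>"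
      by (rule restr_eq_zero_near[OF U W s zero y])
    then show ?thesis unfolding \<V>_def by blast
  qed
  then have cover: "\<Union>\<V> = U" unfolding \<V>_def by blast
  have zero_carrier: "\<zero>\<^bsub>sections \<XX> U\<^esub> \<in> carrier (sections \<XX> U)"
    using cring_sections[OF U] by (simp add: cring_def ring.ring_simprules)
  show ?thesis
  proof (rule locality[of \<V>, unfolded cover])
    show "open_set V" if "V \<in> \<V>" for V using that unfolding \<V>_def by blast
    show "restr \<XX> U V s = restr \<XX> U V \<zero>\<^bsub>sections \<XX> U\<^esub>" if "V \<in> \<V>" for V
      using that restr_zero[OF U] unfolding \<V>_def by auto
  qed (use s zero_carrier in auto)
qed

lemma restr_inj:
  assumes U: "open_set U" and W: "open_set W" "W \<subseteq> U" "W \<noteq> {}"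
  shows "inj_on (restr \<XX> U W) (carrier (sections \<XX> U))"
proof -
  interpret R: ring "sections \<XX> U" using cring_sections[OF U] by (simp add: cring_def)
  interpret S: ring "sections \<XX> W" using cring_sections[OF W(1)] by (simp add: cring_def)
  interpret ring_hom_ring "sections \<XX> U" "sections \<XX> W" "restr \<XX> U W"
    by (rule ring_hom_ringI2[OF R.ring_axioms S.ring_axioms restr_hom[OF U W(1,2)]])
  have "a_kernel (sections \<XX> U) (sections \<XX> W) (restr \<XX> U W) = {\<zero>\<^bsub>sections \<XX> U\<^esub>}"
    using restr_eq_zero_imp_eq_zero[OF U W] hom_zero R.zero_closed unfolding a_kernel_def' by blast
  then show ?thesis by (rule trivial_ker_imp_inj)
qed

abbreviation "K \<equiv> function_field \<XX>"

lemma K_eq_stalk: "K = stalk \<XX> \<eta>"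
  unfolding function_field_def \<eta>_def ..

lemma section_to_K_germ: "section_to_K \<XX> U = germ \<XX> \<eta> U"
  unfolding section_to_K_def \<eta>_def by blast

lemma section_to_K_hom: "\<lbrakk>open_set U; U \<noteq> {}\<rbrakk> \<Longrightarrow> section_to_K \<XX> U \<in> ring_hom (sections \<XX> U) K"
  unfolding section_to_K_germ K_eq_stalk by (rule germ_hom[OF _ eta_open])

lemma section_to_K_inj:
  assumes U: "open_set U" "U \<noteq> {}"
  shows "inj_on (section_to_K \<XX> U) (carrier (sections \<XX> U))"
proof (rule inj_onI)
  fix s t assume st: "s \<in> carrier (sections \<XX> U)" "t \<in> carrier (sections \<XX> U)"
    "section_to_K \<XX> U s = section_to_K \<XX> U t"
  obtain W where W: "open_set W" "\<eta> \<in> W" "W \<subseteq> U" "restr \<XX> U W s = restr \<XX> U W t"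
    using germ_eqD[OF st(3)[unfolded section_to_K_germ] U(1) eta_open[OF U] st(2)] by blast
  then show "s = t" using inj_onD[OF restr_inj[OF U(1) W(1,3)] W(4)] st(1,2) by blast
qed

lemma section_to_K_restr:
  assumes "open_set U" "open_set V" "V \<subseteq> U" "V \<noteq> {}" "s \<in> carrier (sections \<XX> U)"
  shows "section_to_K \<XX> V (restr \<XX> U V s) = section_to_K \<XX> U s"
  unfolding section_to_K_germ by (rule germ_restr[OF assms(1-3) eta_open[OF assms(2,4)] assms(5)])

lemma K_cring: "cring K"
  using local_stalks[OF eta_points] unfolding K_eq_stalk local_ring_def by blast

lemma K_carrierE:
  assumes "c \<in> carrier K"
  obtains U s where "open_set U" "U \<noteq> {}" "s \<in> carrier (sections \<XX> U)" "c = section_to_K \<XX> U s"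
proof -
  obtain U s where U: "open_set U" "\<eta> \<in> U" "s \<in> carrier (sections \<XX> U)" "c = germ \<XX> \<eta> U s"
    by (rule stalk_carrierE[OF assms[unfolded K_eq_stalk]])
  then show ?thesis using that[of U s] unfolding section_to_K_germ by blast
qed

lemma nonzero_section_invertible_restr:
  assumes W: "open_set W" "W \<noteq> {}" and s: "s \<in> carrier (sections \<XX> W)" "s \<noteq> \<zero>\<^bsub>sections \<XX> W\<^esub>"
  obtains Y d where "open_set Y" "Y \<noteq> {}" "Y \<subseteq> W" "d \<in> carrier (sections \<XX> Y)"
    "restr \<XX> W Y s \<otimes>\<^bsub>sections \<XX> Y\<^esub> d = \<one>\<^bsub>sections \<XX> Y\<^esub>"
proof -
  obtain U R f where U: "\<eta> \<in> U" and chart: "integral_chart \<XX> U R f" by (rule integral_chart_at[OF eta_points])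
  interpret C: integral_chart \<XX> U R f by (rule chart)
  obtain V a b where V: "open_set V" "\<eta> \<in> V" "V \<subseteq> W" and ab: "a \<in> carrier R" "b \<in> carrier R" "V \<subseteq> C.basic b"
    and frac: "C.sec V b \<otimes>\<^bsub>sections \<XX> V\<^esub> restr \<XX> W V s = C.sec V a"
    by (rule C.section_local_fraction[OF W(1) eta_open[OF W] U s(1)])
  note sV = restr_closed[OF W(1) V(1,3) s(1)]
  have "a \<notin> pt f \<eta>"
    using C.restr_eq_zero_of_sec[OF V(1) ab(3) _ ab(1,2) sV frac] V(2)
      restr_eq_zero_imp_eq_zero[OF W(1) V(1,3) _ s(1)] s(2) by blast
  then have "\<eta> \<in> V \<inter> C.basic a" using V(2) U unfolding C.basic_def by blast
  moreover define Y where "Y = V \<inter> C.basic a"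
  ultimately have Y: "open_set Y" "Y \<noteq> {}" "Y \<subseteq> V" "Y \<subseteq> W" "Y \<subseteq> U" "Y \<subseteq> C.basic a"
    using V C.basic_open[OF ab(1)] unfolding C.basic_def by auto
  have VU: "V \<subseteq> U" using ab(3) unfolding C.basic_def by blast
  interpret Y: cring "sections \<XX> Y" by (rule cring_sections[OF Y(1)])
  obtain t where t: "t \<in> carrier (sections \<XX> Y)" "C.sec Y a \<otimes>\<^bsub>sections \<XX> Y\<^esub> t = \<one>\<^bsub>sections \<XX> Y\<^esub>"
    using C.sec_unit[OF Y(1,6) ab(1)] by blast
  note sY = restr_closed[OF W(1) Y(1,4) s(1)] and bY = ring_hom_closed[OF C.sec_hom[OF Y(1,5)] ab(2)]
  have "C.sec Y a = C.sec Y b \<otimes>\<^bsub>sections \<XX> Y\<^esub> restr \<XX> W Y s"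
    using ring_hom_mult[OF restr_hom[OF V(1) Y(1,3)] ring_hom_closed[OF C.sec_hom[OF V(1) VU] ab(2)] sV]
    unfolding frac C.sec_restr[OF V(1) VU Y(1,3) ab(1)] C.sec_restr[OF V(1) VU Y(1,3) ab(2)]
      restr_comp[OF W(1) V(1) Y(1,3) V(3) s(1)] .
  then have "restr \<XX> W Y s \<otimes>\<^bsub>sections \<XX> Y\<^esub> (C.sec Y b \<otimes>\<^bsub>sections \<XX> Y\<^esub> t) = \<one>\<^bsub>sections \<XX> Y\<^esub>"
    using t sY bY by (simp add: Y.m_ac)
  then show ?thesis using that[OF Y(1,2,4)] bY t(1) by blast
qed

lemma K_field: "field K"
proof -
  interpret K: cring K by (rule K_cring)
  show ?thesis
  proof (rule K.cring_fieldI2)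
    have T: "open_set points" "points \<noteq> {}" using points_nonempty by auto
    interpret D: domain "sections \<XX> points" by (rule sections_domain[OF T])
    show "\<zero>\<^bsub>K\<^esub> \<noteq> \<one>\<^bsub>K\<^esub>"
      using ring_hom_zero[OF section_to_K_hom[OF T] D.ring_axioms K.ring_axioms]
        ring_hom_one[OF section_to_K_hom[OF T]]
        inj_onD[OF section_to_K_inj[OF T], of "\<zero>\<^bsub>sections \<XX> points\<^esub>" "\<one>\<^bsub>sections \<XX> points\<^esub>"] by auto
  next
    fix c assume c: "c \<in> carrier K" "c \<noteq> \<zero>\<^bsub>K\<^esub>"
    obtain W s where W: "open_set W" "W \<noteq> {}" and s: "s \<in> carrier (sections \<XX> W)" "c = section_to_K \<XX> W s"
      by (rule K_carrierE[OF c(1)])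
    interpret D: domain "sections \<XX> W" by (rule sections_domain[OF W])
    have "s \<noteq> \<zero>\<^bsub>sections \<XX> W\<^esub>"
      using c(2) s(2) ring_hom_zero[OF section_to_K_hom[OF W] D.ring_axioms K.ring_axioms] by blast
    then obtain Y d where Y: "open_set Y" "Y \<noteq> {}" "Y \<subseteq> W" and d: "d \<in> carrier (sections \<XX> Y)"
      "restr \<XX> W Y s \<otimes>\<^bsub>sections \<XX> Y\<^esub> d = \<one>\<^bsub>sections \<XX> Y\<^esub>"
      by (rule nonzero_section_invertible_restr[OF W s(1)])
    note hY = section_to_K_hom[OF Y(1,2)]
    have "c \<otimes>\<^bsub>K\<^esub> section_to_K \<XX> Y d = \<one>\<^bsub>K\<^esub>"
      using ring_hom_mult[OF hY restr_closed[OF W(1) Y(1,3) s(1)] d(1)] ring_hom_one[OF hY]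
      unfolding d(2) section_to_K_restr[OF W(1) Y(1,3,2) s(1)] s(2) by simp
    then show "\<exists>b\<in>carrier K. c \<otimes>\<^bsub>K\<^esub> b = \<one>\<^bsub>K\<^esub>" using ring_hom_closed[OF hY d(1)] by blast
  qed
qed

end

section \<open>Regular functions\<close>

context integral_space
begin

sublocale K: field K
  by (rule K_field)

definition regular_on :: "'x set \<Rightarrow> ('x set \<times> 'a) set set" where
  "regular_on U = section_to_K \<XX> U ` carrier (sections \<XX> U)"

definition regular_at :: "'x \<Rightarrow> ('x set \<times> 'a) set set" where
  "regular_at x = stalk_to_K \<XX> ` carrier (stalk \<XX> x)"

abbreviation units_at :: "'x \<Rightarrow> ('x set \<times> 'a) set set" where
  "units_at x \<equiv> Units (K\<lparr>carrier := regular_at x\<rparr>)"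

lemma regular_on_subring:
  assumes U: "open_set U" "U \<noteq> {}"
  shows "subring (regular_on U) K"
proof -
  interpret R: cring "sections \<XX> U" by (rule cring_sections[OF U(1)])
  interpret ring_hom_cring "sections \<XX> U" K "section_to_K \<XX> U"
    by unfold_locales (rule section_to_K_hom[OF U])
  show ?thesis unfolding regular_on_def by (rule hom_image_subring)
qed

lemma regular_onE:
  assumes "c \<in> regular_on U"
  obtains s where "s \<in> carrier (sections \<XX> U)" "c = section_to_K \<XX> U s"
  using assms unfolding regular_on_def by blast

lemma regular_on_mono:
  assumes "open_set U" "open_set V" "V \<subseteq> U" "V \<noteq> {}"
  shows "regular_on U \<subseteq> regular_on V"
proof
  fix c assume "c \<in> regular_on U"
  then obtain s where s: "s \<in> carrier (sections \<XX> U)" "c = section_to_K \<XX> U s" by (rule regular_onE)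
  then have "c = section_to_K \<XX> V (restr \<XX> U V s)" using section_to_K_restr[OF assms s(1)] by simp
  then show "c \<in> regular_on V" unfolding regular_on_def using restr_closed[OF assms(1-3) s(1)] by blast
qed

lemma stalk_to_K_germ:
  assumes U: "open_set U" "x \<in> U" "s \<in> carrier (sections \<XX> U)"
  shows "stalk_to_K \<XX> (germ \<XX> x U s) = section_to_K \<XX> U s"
proof -
  have "section_to_K \<XX> V t = section_to_K \<XX> U s" if Vt: "(V, t) \<in> germ \<XX> x U s" for V t
  proof -
    obtain W where W: "open_set V" "x \<in> V" "t \<in> carrier (sections \<XX> V)" "open_set W" "x \<in> W" "W \<subseteq> U" "W \<subseteq> V"
      "restr \<XX> U W s = restr \<XX> V W t" by (rule germ_memE[OF Vt])
    have nonempty: "W \<noteq> {}" using W by blast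
    show ?thesis using section_to_K_restr[OF W(1,4,7) nonempty W(3)]
      section_to_K_restr[OF U(1) W(4,6) nonempty U(3)] W(8) by simp
  qed
  then show ?thesis unfolding stalk_to_K_def using germ_self[OF U] by fast
qed

lemma stalk_to_K_hom:
  assumes x: "x \<in> points"
  shows "ring_hom_cring (stalk \<XX> x) K (stalk_to_K \<XX>)"
proof -
  interpret S: cring "stalk \<XX> x" using local_stalks[OF x] unfolding local_ring_def by blast
  show ?thesis
  proof (unfold_locales, rule ring_hom_memI)
    show "stalk_to_K \<XX> A \<in> carrier K" if "A \<in> carrier (stalk \<XX> x)" for A
      using stalk_common_representatives[OF that that] stalk_to_K_germ ring_hom_closed[OF section_to_K_hom]
      by (metis empty_iff)
  next
    fix A B assume AB: "A \<in> carrier (stalk \<XX> x)" "B \<in> carrier (stalk \<XX> x)"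
    obtain W s t where W: "open_set W" "x \<in> W" and st: "s \<in> carrier (sections \<XX> W)" "t \<in> carrier (sections \<XX> W)"
      and eq: "A = germ \<XX> x W s" "B = germ \<XX> x W t" by (rule stalk_common_representatives[OF AB])
    interpret W: cring "sections \<XX> W" by (rule cring_sections[OF W(1)])
    have nonempty: "W \<noteq> {}" using W by blast
    note germ = ring_hom_mult[OF germ_hom[OF W] st] ring_hom_add[OF germ_hom[OF W] st]
      and toK = ring_hom_mult[OF section_to_K_hom[OF W(1) nonempty] st]
        ring_hom_add[OF section_to_K_hom[OF W(1) nonempty] st]
    show "stalk_to_K \<XX> (A \<otimes>\<^bsub>stalk \<XX> x\<^esub> B) = stalk_to_K \<XX> A \<otimes>\<^bsub>K\<^esub> stalk_to_K \<XX> B"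
      unfolding eq germ(1)[symmetric] using st by (simp add: stalk_to_K_germ[OF W] toK)
    show "stalk_to_K \<XX> (A \<oplus>\<^bsub>stalk \<XX> x\<^esub> B) = stalk_to_K \<XX> A \<oplus>\<^bsub>K\<^esub> stalk_to_K \<XX> B"
      unfolding eq germ(2)[symmetric] using st by (simp add: stalk_to_K_germ[OF W] toK)
  next
    have T: "open_set points" "points \<noteq> {}" using points_nonempty by auto
    interpret T: cring "sections \<XX> points" by (rule cring_sections[OF T(1)])
    show "stalk_to_K \<XX> \<one>\<^bsub>stalk \<XX> x\<^esub> = \<one>\<^bsub>K\<^esub>"
      unfolding ring_hom_one[OF germ_hom[OF T(1) x], symmetric] stalk_to_K_germ[OF T(1) x T.one_closed]
      by (rule ring_hom_one[OF section_to_K_hom[OF T]])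
  qed
qed

lemma stalk_to_K_inj: "inj_on (stalk_to_K \<XX>) (carrier (stalk \<XX> x))"
proof (rule inj_onI)
  fix A B assume AB: "A \<in> carrier (stalk \<XX> x)" "B \<in> carrier (stalk \<XX> x)"
    and eq: "stalk_to_K \<XX> A = stalk_to_K \<XX> B"
  obtain W s t where W: "open_set W" "x \<in> W" and st: "s \<in> carrier (sections \<XX> W)" "t \<in> carrier (sections \<XX> W)"
    and germs: "A = germ \<XX> x W s" "B = germ \<XX> x W t" by (rule stalk_common_representatives[OF AB])
  then have "section_to_K \<XX> W s = section_to_K \<XX> W t" using eq stalk_to_K_germ by simp
  then have "s = t" using section_to_K_inj[OF W(1)] W(2) st unfolding inj_on_def by blast
  then show "A = B" unfolding germs by simp
qed

lemma regular_at_iff: "c \<in> regular_at x \<longleftrightarrow> (\<exists>U. open_set U \<and> x \<in> U \<and> c \<in> regular_on U)"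
proof
  assume "c \<in> regular_at x"
  then obtain A where A: "A \<in> carrier (stalk \<XX> x)" "c = stalk_to_K \<XX> A" unfolding regular_at_def by blast
  obtain U s where "open_set U" "x \<in> U" "s \<in> carrier (sections \<XX> U)" "A = germ \<XX> x U s"
    by (rule stalk_carrierE[OF A(1)])
  then show "\<exists>U. open_set U \<and> x \<in> U \<and> c \<in> regular_on U"
    using stalk_to_K_germ A(2) unfolding regular_on_def by auto
next
  assume "\<exists>U. open_set U \<and> x \<in> U \<and> c \<in> regular_on U"
  then obtain U s where U: "open_set U" "x \<in> U" "s \<in> carrier (sections \<XX> U)" "c = section_to_K \<XX> U s"
    unfolding regular_on_def by blast
  then have "germ \<XX> x U s \<in> carrier (stalk \<XX> x)" unfolding stalk_carrier by blast
  then show "c \<in> regular_at x"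
    unfolding regular_at_def U(4) stalk_to_K_germ[OF U(1-3), symmetric] by (rule imageI)
qed

lemma regular_on_subset_regular_at: "\<lbrakk>open_set U; x \<in> U\<rbrakk> \<Longrightarrow> regular_on U \<subseteq> regular_at x"
  using regular_at_iff by blast

lemma regular_at_common_open:
  assumes c: "c \<in> regular_at x" and d: "d \<in> regular_at x" and V: "open_set V" "x \<in> V"
  obtains U where "open_set U" "x \<in> U" "U \<subseteq> V" "c \<in> regular_on U" "d \<in> regular_on U"
proof -
  obtain A B where A: "open_set A" "x \<in> A" "c \<in> regular_on A" and B: "open_set B" "x \<in> B" "d \<in> regular_on B"
    using c d unfolding regular_at_iff by blast
  let ?U = "A \<inter> B \<inter> V"
  have U: "open_set ?U" "x \<in> ?U" using A B V by auto
  then have "regular_on A \<subseteq> regular_on ?U" "regular_on B \<subseteq> regular_on ?U"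
    using regular_on_mono[OF A(1) U(1)] regular_on_mono[OF B(1) U(1)] by auto
  then show ?thesis using that[OF U] A B by blast
qed

lemma regular_at_subring: "x \<in> points \<Longrightarrow> subring (regular_at x) K"
  unfolding regular_at_def by (rule ring_hom_cring.hom_image_subring[OF stalk_to_K_hom])

lemma regular_at_carrier: "\<lbrakk>x \<in> points; c \<in> regular_at x\<rbrakk> \<Longrightarrow> c \<in> carrier K"
  using subringE(1)[OF regular_at_subring] by blast

lemmas units_at = K.Units_subringE[OF regular_at_subring]

lemma stalk_to_K_Units: "x \<in> points \<Longrightarrow> units_at x = stalk_to_K \<XX> ` Units (stalk \<XX> x)"
  unfolding regular_at_def by (rule ring_hom_cring.hom_image_Units[OF stalk_to_K_hom stalk_to_K_inj])

lemma stalk_to_K_max_ideal: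
  assumes x: "x \<in> points"
  shows "stalk_to_K \<XX> ` max_ideal (stalk \<XX> x) = regular_at x - units_at x"
proof -
  interpret S: cring "stalk \<XX> x" using local_stalks[OF x] unfolding local_ring_def by blast
  show ?thesis
    using inj_on_image_set_diff[OF stalk_to_K_inj, where A = "carrier (stalk \<XX> x)" and B = "Units (stalk \<XX> x)"]
    unfolding max_ideal_eq_nonunits[OF local_stalks[OF x]] stalk_to_K_Units[OF x] by (auto simp: regular_at_def)
qed

lemma nonunits_at_ideal:
  assumes x: "x \<in> points"
  shows "ideal (regular_at x - units_at x) (K\<lparr>carrier := regular_at x\<rparr>)"
  using ring_hom_cring.hom_image_ideal[OF stalk_to_K_hom[OF x]
    maximalideal.axioms(1)[OF maximalideal_max_ideal[OF local_stalks[OF x]]]]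
  unfolding stalk_to_K_max_ideal[OF x] regular_at_def .

lemma regular_at_eta: "regular_at \<eta> = carrier K"
proof -
  have "c \<in> regular_at \<eta>" if c: "c \<in> carrier K" for c
  proof -
    obtain U s where "open_set U" "U \<noteq> {}" "s \<in> carrier (sections \<XX> U)" "c = section_to_K \<XX> U s"
      by (rule K_carrierE[OF c])
    then show ?thesis using eta_open unfolding regular_at_iff regular_on_def by blast
  qed
  then show ?thesis using regular_at_carrier[OF eta_points] by blast
qed

lemma units_at_eta: "c \<in> units_at \<eta> \<longleftrightarrow> c \<in> carrier K \<and> c \<noteq> \<zero>\<^bsub>K\<^esub>"
  unfolding regular_at_eta using K.field_Units by simp

lemma regular_at_closure:
  assumes "y \<in> point_closure z"
  shows "regular_at y \<subseteq> regular_at z"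
  using point_closure_open[OF assms] unfolding regular_at_iff subset_iff by blast

lemma units_at_closure:
  assumes y: "y \<in> point_closure z" and z: "z \<in> points"
  shows "units_at y \<subseteq> units_at z"
proof -
  have "y \<in> points" using y by (simp add: in_closure_of)
  then show ?thesis
    using regular_at_closure[OF y] K.Units_subring_iff[OF regular_at_subring] z by blast
qed

definition vanishing_at :: "'x set \<Rightarrow> 'x \<Rightarrow> ('x set \<times> 'a) set set" where
  "vanishing_at U y = regular_on U - units_at y"

lemma primeideal_vanishing_at:
  assumes U: "open_set U" and y: "y \<in> U"
  shows "primeideal (vanishing_at U y) (K\<lparr>carrier := regular_on U\<rparr>)"
proof -
  have y_points: "y \<in> points" using openin_subset[OF U] y by blast
  have A: "subring (regular_on U) K" using regular_on_subring[OF U] y by blast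
  note sub = regular_on_subset_regular_at[OF U y]
  note nonunits = K.ideal_subringE[OF regular_at_subring[OF y_points] nonunits_at_ideal[OF y_points]]
  have eq: "vanishing_at U y = regular_on U \<inter> (regular_at y - units_at y)"
    unfolding vanishing_at_def using sub by blast
  have "ideal (vanishing_at U y) (K\<lparr>carrier := regular_on U\<rparr>)"
    unfolding eq using sub nonunits(3,4,5) subringE(2,6,7)[OF A]
    by (intro K.ideal_subringI[OF A]) auto
  then show ?thesis
    unfolding K.primeideal_subring_iff[OF A] using units_at(5,6)[OF y_points] subringE(6)[OF A]
    unfolding vanishing_at_def by auto
qed

end

context integral_chart
begin

definition \<phi> :: "'a \<Rightarrow> ('x set \<times> 'a) set" where
  "\<phi> r = section_to_K \<XX> U (sec U r)"

lemma phi_hom: "\<phi> \<in> ring_hom R K"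
proof -
  have "section_to_K \<XX> U \<circ> sec U \<in> ring_hom R K"
    by (rule ring_hom_trans[OF sec_hom[OF openU subset_refl] section_to_K_hom[OF openU nonempty]])
  moreover have "section_to_K \<XX> U \<circ> sec U = \<phi>" unfolding \<phi>_def by auto
  ultimately show ?thesis by simp
qed

sublocale phi: ring_hom_cring R K \<phi>
  by unfold_locales (rule phi_hom)

lemma phi_regular: "r \<in> carrier R \<Longrightarrow> \<phi> r \<in> regular_on U"
  unfolding \<phi>_def regular_on_def using ring_hom_closed[OF sec_hom[OF openU subset_refl]] by blast

lemma phi_sec:
  assumes "open_set W" "W \<subseteq> U" "W \<noteq> {}" "r \<in> carrier R"
  shows "section_to_K \<XX> W (sec W r) = \<phi> r"
  unfolding \<phi>_def sec_restr[OF openU subset_refl assms(1,2,4), symmetric]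
  by (rule section_to_K_restr[OF openU assms(1-3) ring_hom_closed[OF sec_hom[OF openU subset_refl] assms(4)]])

lemma U_points: "y \<in> U \<Longrightarrow> y \<in> points"
  using U_subset_topspace by blast

lemma phi_unitI:
  assumes y: "y \<in> U" and r: "r \<in> carrier R" "r \<notin> pt f y"
  shows "\<phi> r \<in> units_at y"
proof -
  have W: "open_set (basic r)" "basic r \<subseteq> U" "basic r \<noteq> {}" "y \<in> basic r"
    using basic_open y r unfolding basic_def by auto
  obtain t where t: "t \<in> carrier (sections \<XX> (basic r))"
    "sec (basic r) r \<otimes>\<^bsub>sections \<XX> (basic r)\<^esub> t = \<one>\<^bsub>sections \<XX> (basic r)\<^esub>"
    using sec_unit[OF W(1) subset_refl r(1)] by blast
  note h = section_to_K_hom[OF W(1,3)]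
  have "\<phi> r \<otimes>\<^bsub>K\<^esub> section_to_K \<XX> (basic r) t = \<one>\<^bsub>K\<^esub>"
    using ring_hom_mult[OF h ring_hom_closed[OF sec_hom[OF W(1,2)] r(1)] t(1)] ring_hom_one[OF h]
    unfolding t(2) phi_sec[OF W(1-3) r(1)] by simp
  moreover have "section_to_K \<XX> (basic r) t \<in> regular_at y"
    using t(1) W(1,4) unfolding regular_at_iff regular_on_def by blast
  moreover have "\<phi> r \<in> regular_at y"
    using phi_regular[OF r(1)] regular_on_subset_regular_at[OF openU y] by blast
  ultimately show ?thesis unfolding K.Units_subring_iff[OF regular_at_subring[OF U_points[OF y]]] by blast
qed

lemma phi_unitD:
  assumes y: "y \<in> U" and r: "r \<in> carrier R" and unit: "\<phi> r \<in> units_at y"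
  shows "r \<notin> pt f y"
proof -
  obtain w where w: "w \<in> regular_at y" "\<phi> r \<otimes>\<^bsub>K\<^esub> w = \<one>\<^bsub>K\<^esub>"
    using unit unfolding K.Units_subring_iff[OF regular_at_subring[OF U_points[OF y]]] by blast
  obtain W where W: "open_set W" "y \<in> W" "W \<subseteq> U" "w \<in> regular_on W"
    by (rule regular_at_common_open[OF w(1) w(1) openU y])
  obtain s where s: "s \<in> carrier (sections \<XX> W)" "w = section_to_K \<XX> W s" by (rule regular_onE[OF W(4)])
  have nonempty: "W \<noteq> {}" using W by blast
  interpret W: cring "sections \<XX> W" by (rule cring_sections[OF W(1)])
  note h = section_to_K_hom[OF W(1) nonempty] and sec = ring_hom_closed[OF sec_hom[OF W(1,3)] r]
  have "section_to_K \<XX> W (sec W r \<otimes>\<^bsub>sections \<XX> W\<^esub> s) = section_to_K \<XX> W \<one>\<^bsub>sections \<XX> W\<^esub>"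
    unfolding ring_hom_mult[OF h sec s(1)] phi_sec[OF W(1,3) nonempty r] s(2)[symmetric] w(2)
    by (rule ring_hom_one[OF h, symmetric])
  then have "sec W r \<otimes>\<^bsub>sections \<XX> W\<^esub> s = \<one>\<^bsub>sections \<XX> W\<^esub>"
    using inj_onD[OF section_to_K_inj[OF W(1) nonempty]] W.m_closed[OF sec s(1)] W.one_closed by blast
  then show ?thesis by (rule sec_unitD[OF W(1,3) r W(2) s(1)])
qed

lemma phi_unit_iff: "\<lbrakk>y \<in> U; r \<in> carrier R\<rbrakk> \<Longrightarrow> \<phi> r \<in> units_at y \<longleftrightarrow> r \<notin> pt f y"
  using phi_unitI phi_unitD by blast

lemma phi_vanishing_at_iff: "\<lbrakk>y \<in> U; r \<in> carrier R\<rbrakk> \<Longrightarrow> \<phi> r \<in> vanishing_at U y \<longleftrightarrow> r \<in> pt f y"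
  unfolding vanishing_at_def using phi_unit_iff phi_regular by blast

lemma regular_at_fraction:
  assumes y: "y \<in> U" and c: "c \<in> regular_at y"
  obtains a b where "a \<in> carrier R" "b \<in> carrier R" "b \<notin> pt f y" "\<phi> b \<otimes>\<^bsub>K\<^esub> c = \<phi> a"
proof -
  obtain W where W: "open_set W" "y \<in> W" "c \<in> regular_on W" using c unfolding regular_at_iff by blast
  obtain s where s: "s \<in> carrier (sections \<XX> W)" "c = section_to_K \<XX> W s" by (rule regular_onE[OF W(3)])
  obtain V a b where V: "open_set V" "y \<in> V" "V \<subseteq> W" and ab: "a \<in> carrier R" "b \<in> carrier R" "V \<subseteq> basic b"
      "sec V b \<otimes>\<^bsub>sections \<XX> V\<^esub> restr \<XX> W V s = sec V a" by (rule section_local_fraction[OF W(1,2) y s(1)])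
  have nonempty: "V \<noteq> {}" and VU: "V \<subseteq> U" using V(2) ab(3) unfolding basic_def by auto
  have "\<phi> b \<otimes>\<^bsub>K\<^esub> c = \<phi> a"
    using ring_hom_mult[OF section_to_K_hom[OF V(1) nonempty] ring_hom_closed[OF sec_hom[OF V(1) VU] ab(2)]
      restr_closed[OF W(1) V(1,3) s(1)]]
    unfolding ab(4) phi_sec[OF V(1) VU nonempty ab(1)] phi_sec[OF V(1) VU nonempty ab(2)]
      section_to_K_restr[OF W(1) V(1,3) nonempty s(1)] s(2) by simp
  moreover have "b \<notin> pt f y" using ab(3) V(2) unfolding basic_def by blast
  ultimately show ?thesis using that ab by blast
qed

lemma fraction_unit_iff:
  assumes y: "y \<in> U" and c: "c \<in> regular_at y"
    and ab: "a \<in> carrier R" "b \<in> carrier R" "b \<notin> pt f y" "\<phi> b \<otimes>\<^bsub>K\<^esub> c = \<phi> a"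
  shows "c \<in> units_at y \<longleftrightarrow> a \<notin> pt f y"
proof -
  note y_points = U_points[OF y]
  have b: "\<phi> b \<in> units_at y" by (rule phi_unitI[OF y ab(2,3)])
  have "c \<otimes>\<^bsub>K\<^esub> \<phi> b = \<phi> a" using ab(2,4) K.m_comm regular_at_carrier[OF y_points c] by simp
  then have "c \<in> units_at y \<longleftrightarrow> \<phi> a \<in> units_at y"
    using units_at(5)[OF y_points _ b, of c] K.Units_subring_factor[OF regular_at_subring[OF y_points] c
      units_at(1)[OF y_points b]] by auto
  then show ?thesis using phi_unit_iff[OF y ab(1)] by blast
qed

lemma vanishing_at_surj:
  assumes p: "primeideal p (K\<lparr>carrier := regular_on U\<rparr>)"
  shows "\<exists>y\<in>U. p = vanishing_at U y"
proof -
  note A = regular_on_subring[OF openU nonempty]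
  have prime: "ideal p (K\<lparr>carrier := regular_on U\<rparr>)"
      "\<And>a b. \<lbrakk>a \<in> regular_on U; b \<in> regular_on U; a \<otimes>\<^bsub>K\<^esub> b \<in> p\<rbrakk> \<Longrightarrow> a \<in> p \<or> b \<in> p"
    using p unfolding K.primeideal_subring_iff[OF A] by blast+
  note ideal = K.ideal_subringE[OF A prime(1)]
  interpret A: cring "K\<lparr>carrier := regular_on U\<rparr>" by (rule K.subring_is_cring[OF A])
  have "ring_hom_ring R (K\<lparr>carrier := regular_on U\<rparr>) \<phi>"
    by (rule ring_hom_ringI2[OF C.ring_axioms A.ring_axioms]) (use phi_regular in \<open>auto simp: ring_hom_def\<close>)
  then have "primeideal {r \<in> carrier R. \<phi> r \<in> p} R"
    by (rule ring_hom_ring.primeideal_vimage[OF _ C.cring_axioms p])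
  then have "{r \<in> carrier R. \<phi> r \<in> p} \<in> pt f ` U" unfolding pt_image prime_spectrum_def by simp
  then obtain y where y: "y \<in> U" "pt f y = {r \<in> carrier R. \<phi> r \<in> p}" by auto
  have "c \<in> p \<longleftrightarrow> c \<notin> units_at y" if c: "c \<in> regular_on U" for c
  proof -
    have cy: "c \<in> regular_at y" using c regular_on_subset_regular_at[OF openU y(1)] by blast
    obtain a b where ab: "a \<in> carrier R" "b \<in> carrier R" "b \<notin> pt f y" "\<phi> b \<otimes>\<^bsub>K\<^esub> c = \<phi> a"
      by (rule regular_at_fraction[OF y(1) cy])
    have "c \<in> p \<longleftrightarrow> \<phi> a \<in> p"
      using ideal(5)[OF phi_regular[OF ab(2)], of c] prime(2)[OF phi_regular[OF ab(2)] c] ab(2-4) y(2) by auto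
    then show ?thesis using fraction_unit_iff[OF y(1) cy ab] ab(1) y(2) by auto
  qed
  then have "p = vanishing_at U y" using ideal(1) unfolding vanishing_at_def by blast
  then show ?thesis using y(1) by blast
qed

end

context integral_space
begin

lemma affine_regular_at_fraction:
  assumes U: "affine_open \<XX> U" "y \<in> U" and c: "c \<in> regular_at y"
  shows "\<exists>b\<in>regular_on U. b \<in> units_at y \<and> b \<otimes>\<^bsub>K\<^esub> c \<in> regular_on U"
proof -
  obtain R f where "integral_chart \<XX> U R f" using integral_chart_of_affine_open[OF U(1)] U(2) by blast
  then interpret C: integral_chart \<XX> U R f .
  obtain a b where "a \<in> carrier R" "b \<in> carrier R" "b \<notin> pt f y" "C.\<phi> b \<otimes>\<^bsub>K\<^esub> c = C.\<phi> a"
    by (rule C.regular_at_fraction[OF U(2) c])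
  then show ?thesis using C.phi_regular C.phi_unitI[OF U(2)] by metis
qed

lemma affine_basis:
  assumes U: "affine_open \<XX> U" and V: "open_set V" "V \<subseteq> U" "y \<in> V"
  shows "\<exists>b\<in>regular_on U. b \<in> units_at y \<and> (\<forall>z\<in>U. b \<in> units_at z \<longrightarrow> z \<in> V)"
proof -
  obtain R f where "integral_chart \<XX> U R f" using integral_chart_of_affine_open[OF U] V by blast
  then interpret C: integral_chart \<XX> U R f .
  obtain r where r: "r \<in> carrier R" "y \<in> C.basic r" "C.basic r \<subseteq> V" using C.basic_basis[OF V] by blast
  then show ?thesis
    using C.phi_unit_iff[OF _ r(1)] C.phi_regular[OF r(1)]
    unfolding C.basic_def by (intro bexI[of _ "C.\<phi> r"]) auto
qed

lemma affine_primeideal_eq_vanishing_at: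
  assumes U: "affine_open \<XX> U" "U \<noteq> {}" and p: "primeideal p (K\<lparr>carrier := regular_on U\<rparr>)"
  obtains y where "y \<in> U" "p = vanishing_at U y"
proof -
  obtain R f where "integral_chart \<XX> U R f" by (rule integral_chart_of_affine_open[OF U])
  then interpret C: integral_chart \<XX> U R f .
  show ?thesis using C.vanishing_at_surj[OF p] that by blast
qed

lemma affine_closure_iff:
  assumes U: "affine_open \<XX> U" "y \<in> U" "z \<in> U"
  shows "y \<in> point_closure z \<longleftrightarrow> vanishing_at U z \<subseteq> vanishing_at U y"
proof -
  obtain R f where "integral_chart \<XX> U R f" using integral_chart_of_affine_open[OF U(1)] U(2) by blast
  then interpret C: integral_chart \<XX> U R f .
  show ?thesis
  proof
    assume "y \<in> point_closure z"
    then show "vanishing_at U z \<subseteq> vanishing_at U y"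
      using units_at_closure[OF _ C.U_points[OF U(3)]] unfolding vanishing_at_def by blast
  next
    assume "vanishing_at U z \<subseteq> vanishing_at U y"
    then have "pt f z \<subseteq> pt f y"
      using C.phi_vanishing_at_iff[OF U(2)] C.phi_vanishing_at_iff[OF U(3)] C.pt_subset_carrier[OF U(3)]
      by blast
    then show "y \<in> point_closure z" using C.closure_of_point_iff[OF U(2,3)] by blast
  qed
qed

lemma affine_vanishing_at_inj:
  assumes U: "affine_open \<XX> U"
  shows "inj_on (vanishing_at U) U"
proof (rule inj_onI)
  fix y z assume yz: "y \<in> U" "z \<in> U" "vanishing_at U y = vanishing_at U z"
  obtain R f where "integral_chart \<XX> U R f" using integral_chart_of_affine_open[OF U] yz(1) by blast
  then interpret C: integral_chart \<XX> U R f .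
  have "pt f y = pt f z"
    using C.phi_vanishing_at_iff[OF yz(1)] C.phi_vanishing_at_iff[OF yz(2)] C.pt_subset_carrier yz by blast
  then show "y = z" using C.pt_inj yz(1,2) unfolding inj_on_def by blast
qed

end

section \<open>Integrally closed domains and localizations inside a field\<close>

context domain
begin

lemma poly_values_sum:
  assumes B: "subring B R" and x: "x \<in> carrier R" and "p \<in> poly_values B x n"
  shows "\<exists>c\<in>{..<n} \<rightarrow> B. p = (\<Oplus>i\<in>{..<n}. c i \<otimes> x [^] i)"
  using assms(3)
proof (induction n arbitrary: p)
  case (Suc n)
  note Bc = subsetD[OF subringE(1)[OF B]]
  obtain c q where p: "p = c \<otimes> x [^] n \<oplus> q" "c \<in> B" "q \<in> poly_values B x n" using Suc.prems by auto
  obtain d where d: "d \<in> {..<n} \<rightarrow> B" "q = (\<Oplus>i\<in>{..<n}. d i \<otimes> x [^] i)" using Suc.IH[OF p(3)] by blast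
  define d' where "d' = d(n := c)"
  have d': "d' \<in> {..<Suc n} \<rightarrow> B" using d(1) p(2) by (auto simp: d'_def Pi_def less_Suc_eq)
  have "(\<Oplus>i\<in>{..<Suc n}. d' i \<otimes> x [^] i) = d' n \<otimes> x [^] n \<oplus> (\<Oplus>i\<in>{..<n}. d' i \<otimes> x [^] i)"
    unfolding lessThan_Suc by (rule finsum_insert) (use d' Bc x in \<open>auto simp: Pi_def\<close>)
  also have "(\<Oplus>i\<in>{..<n}. d' i \<otimes> x [^] i) = q"
    unfolding d(2) by (rule finsum_cong') (use d Bc x in \<open>auto simp: d'_def Pi_def\<close>)
  finally have "p = (\<Oplus>i\<in>{..<Suc n}. d' i \<otimes> x [^] i)" using p(1) by (simp add: d'_def)
  then show ?case using d' by blast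
qed simp

end

context cring
begin

lemma ideal_subring_Int:
  assumes A: "subring A R" and Q: "subring Q R" and AQ: "A \<subseteq> Q" and I: "ideal I (R\<lparr>carrier := Q\<rparr>)"
  shows "ideal (I \<inter> A) (R\<lparr>carrier := A\<rparr>)"
  by (rule ideal_subringI[OF A]) (use ideal_subringE[OF Q I] AQ subringE(2,6,7)[OF A] in auto)

lemma primeideal_subring_Int:
  assumes A: "subring A R" and Q: "subring Q R" and AQ: "A \<subseteq> Q" and p: "primeideal p (R\<lparr>carrier := Q\<rparr>)"
  shows "primeideal (p \<inter> A) (R\<lparr>carrier := A\<rparr>)"
  using p ideal_subring_Int[OF A Q AQ] AQ subringE(6)[OF A]
  unfolding primeideal_subring_iff[OF Q] primeideal_subring_iff[OF A] by blast

lemma noetherian_ring_localization: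
  assumes A: "subring A R" and Q: "subring Q R" and AQ: "A \<subseteq> Q" and N: "noetherian_ring (R\<lparr>carrier := A\<rparr>)"
    and frac: "\<And>c. c \<in> Q \<Longrightarrow> \<exists>b\<in>A. b \<in> Units (R\<lparr>carrier := Q\<rparr>) \<and> b \<otimes> c \<in> A"
  shows "noetherian_ring (R\<lparr>carrier := Q\<rparr>)"
proof -
  interpret A: cring "R\<lparr>carrier := A\<rparr>" by (rule subring_is_cring[OF A])
  interpret Q: cring "R\<lparr>carrier := Q\<rparr>" by (rule subring_is_cring[OF Q])
  show ?thesis
  proof (rule Q.noetherian_ringI)
    fix I assume I: "ideal I (R\<lparr>carrier := Q\<rparr>)"
    note I' = ideal_subringE[OF Q I]
    obtain S where S: "S \<subseteq> A" "finite S" "I \<inter> A = Idl\<^bsub>R\<lparr>carrier := A\<rparr>\<^esub> S"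
      using noetherian_ring.finetely_gen[OF N ideal_subring_Int[OF A Q AQ I]] by auto
    have SI: "S \<subseteq> I" using A.genideal_self[of S] S by auto
    have J: "ideal (Idl\<^bsub>R\<lparr>carrier := Q\<rparr>\<^esub> S) (R\<lparr>carrier := Q\<rparr>)" using Q.genideal_ideal[of S] S(1) AQ by auto
    note J' = ideal_subringE[OF Q J]
    have "S \<subseteq> Idl\<^bsub>R\<lparr>carrier := Q\<rparr>\<^esub> S" using Q.genideal_self[of S] S(1) AQ by auto
    then have IA: "I \<inter> A \<subseteq> Idl\<^bsub>R\<lparr>carrier := Q\<rparr>\<^esub> S"
      unfolding S(3) using A.genideal_minimal[OF ideal_subring_Int[OF A Q AQ J], of S] S(1) by blast
    have "c \<in> Idl\<^bsub>R\<lparr>carrier := Q\<rparr>\<^esub> S" if c: "c \<in> I" for c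
    proof -
      have cQ: "c \<in> Q" using c I'(1) by blast
      obtain b where b: "b \<in> A" "b \<in> Units (R\<lparr>carrier := Q\<rparr>)" "b \<otimes> c \<in> A" using frac[OF cQ] by blast
      then obtain w where w: "w \<in> Q" "b \<otimes> w = \<one>" unfolding Units_subring_iff[OF Q] by blast
      have "b \<otimes> c \<in> Idl\<^bsub>R\<lparr>carrier := Q\<rparr>\<^esub> S" using IA I'(5)[of b c] b AQ c by blast
      then have "w \<otimes> (b \<otimes> c) \<in> Idl\<^bsub>R\<lparr>carrier := Q\<rparr>\<^esub> S" by (rule J'(5)[OF w(1)])
      moreover have "w \<otimes> (b \<otimes> c) = (b \<otimes> w) \<otimes> c"
        using subringE(1)[OF Q] AQ b(1) w(1) cQ by (simp add: m_ac subset_iff)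
      ultimately show ?thesis using w(2) cQ subringE(1)[OF Q] by (simp add: subset_iff)
    qed
    then have "I = Idl\<^bsub>R\<lparr>carrier := Q\<rparr>\<^esub> S" using Q.genideal_minimal[OF I SI] by blast
    then show "\<exists>S\<subseteq>carrier (R\<lparr>carrier := Q\<rparr>). finite S \<and> I = Idl\<^bsub>R\<lparr>carrier := Q\<rparr>\<^esub> S" using S(1,2) AQ by auto
  qed
qed

end

locale domain_in_field = S: domain S + K: field K + ring_hom_cring S K h
  for S :: "'b ring" and K :: "'c ring" and h +
  assumes inj: "inj_on h (carrier S)"
begin

sublocale S: plain_cring S
  by unfold_locales

abbreviation "F \<equiv> fraction_field S"
abbreviation "fraction_of \<equiv> fraction S {\<zero>\<^bsub>S\<^esub>}"

lemmas zero_prime = S.zeroprimeideal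

sublocale F: cring F
  by (rule S.localization_cring[OF zero_prime])

lemma h_eq_zero_iff: "s \<in> carrier S \<Longrightarrow> h s = \<zero>\<^bsub>K\<^esub> \<longleftrightarrow> s = \<zero>\<^bsub>S\<^esub>"
  using inj_onD[OF inj, of s "\<zero>\<^bsub>S\<^esub>"] by auto

definition fraction_value :: "('b \<times> 'b) set \<Rightarrow> 'c" where
  "fraction_value z = (THE k. k \<in> carrier K \<and>
     (\<exists>a\<in>carrier S. \<exists>s\<in>carrier S - {\<zero>\<^bsub>S\<^esub>}. z = fraction_of a s \<and> h s \<otimes>\<^bsub>K\<^esub> k = h a))"

lemma fraction_value_eqI:
  assumes a: "a \<in> carrier S" "s \<in> carrier S - {\<zero>\<^bsub>S\<^esub>}" and k: "k \<in> carrier K" "h s \<otimes>\<^bsub>K\<^esub> k = h a"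
  shows "fraction_value (fraction_of a s) = k"
  unfolding fraction_value_def
proof (rule the_equality)
  fix l assume "l \<in> carrier K \<and> (\<exists>b\<in>carrier S. \<exists>t\<in>carrier S - {\<zero>\<^bsub>S\<^esub>}. fraction_of a s = fraction_of b t \<and> h t \<otimes>\<^bsub>K\<^esub> l = h b)"
  then obtain b t where l: "l \<in> carrier K" "h t \<otimes>\<^bsub>K\<^esub> l = h b" and b: "b \<in> carrier S" "t \<in> carrier S - {\<zero>\<^bsub>S\<^esub>}"
    and eq: "fraction_of a s = fraction_of b t" by blast
  obtain u where u: "u \<in> carrier S - {\<zero>\<^bsub>S\<^esub>}" "u \<otimes>\<^bsub>S\<^esub> (a \<otimes>\<^bsub>S\<^esub> t \<ominus>\<^bsub>S\<^esub> b \<otimes>\<^bsub>S\<^esub> s) = \<zero>\<^bsub>S\<^esub>"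
    using S.fraction_eqD[OF zero_prime eq b] by blast
  have st: "s \<in> carrier S" "t \<in> carrier S" using a b by auto
  have "a \<otimes>\<^bsub>S\<^esub> t \<ominus>\<^bsub>S\<^esub> b \<otimes>\<^bsub>S\<^esub> s = \<zero>\<^bsub>S\<^esub>" using S.integral[OF u(2)] u(1) st a(1) b(1) by auto
  then have cross: "a \<otimes>\<^bsub>S\<^esub> t = b \<otimes>\<^bsub>S\<^esub> s" using S.r_right_minus_eq st a(1) b(1) by auto
  have carrier: "h s \<in> carrier K" "h t \<in> carrier K" using st by auto
  have "(h s \<otimes>\<^bsub>K\<^esub> h t) \<otimes>\<^bsub>K\<^esub> l = h s \<otimes>\<^bsub>K\<^esub> (h t \<otimes>\<^bsub>K\<^esub> l)" using carrier l(1) by (simp add: K.m_assoc)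
  also have "\<dots> = h (b \<otimes>\<^bsub>S\<^esub> s)" unfolding l(2) using b(1) st by (simp add: K.m_comm)
  also have "\<dots> = (h s \<otimes>\<^bsub>K\<^esub> k) \<otimes>\<^bsub>K\<^esub> h t" unfolding cross[symmetric] k(2) using a(1) st by simp
  also have "\<dots> = (h s \<otimes>\<^bsub>K\<^esub> h t) \<otimes>\<^bsub>K\<^esub> k" using carrier k(1) by (simp add: K.m_ac)
  finally show "l = k"
    using K.m_lcancel[of "h s \<otimes>\<^bsub>K\<^esub> h t" l k] carrier k(1) l(1) a(2) b(2) h_eq_zero_iff K.integral_iff by auto
qed (use assms in blast)

lemma F_carrierE:
  assumes z: "z \<in> carrier F"
  obtains a s where "a \<in> carrier S" "s \<in> carrier S - {\<zero>\<^bsub>S\<^esub>}" "z = fraction_of a s"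
    "fraction_value z \<in> carrier K" "h s \<otimes>\<^bsub>K\<^esub> fraction_value z = h a"
proof -
  obtain a s where a: "a \<in> carrier S" "s \<in> carrier S - {\<zero>\<^bsub>S\<^esub>}" "z = fraction_of a s"
    by (rule S.localization_carrierE[OF z])
  then have "h s \<in> Units K" using h_eq_zero_iff K.field_Units by auto
  then have "inv\<^bsub>K\<^esub> (h s) \<in> carrier K" "h s \<otimes>\<^bsub>K\<^esub> (inv\<^bsub>K\<^esub> (h s) \<otimes>\<^bsub>K\<^esub> h a) = h a"
    using a by (simp_all add: K.m_assoc[symmetric] K.Units_closed)
  then have k: "inv\<^bsub>K\<^esub> (h s) \<otimes>\<^bsub>K\<^esub> h a \<in> carrier K" "h s \<otimes>\<^bsub>K\<^esub> (inv\<^bsub>K\<^esub> (h s) \<otimes>\<^bsub>K\<^esub> h a) = h a" using a(1) by auto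
  from fraction_value_eqI[OF a(1,2) k] show ?thesis using that[OF a] k a(3) by simp
qed

sublocale into_K: ring_hom_cring F K fraction_value
proof (unfold_locales, rule ring_hom_memI)
  show "fraction_value z \<in> carrier K" if "z \<in> carrier F" for z by (rule F_carrierE[OF that])
  show "fraction_value \<one>\<^bsub>F\<^esub> = \<one>\<^bsub>K\<^esub>"
    unfolding S.localization_one by (rule fraction_value_eqI) auto
next
  fix z w assume zw: "z \<in> carrier F" "w \<in> carrier F"
  obtain a s where a: "a \<in> carrier S" "s \<in> carrier S - {\<zero>\<^bsub>S\<^esub>}" "z = fraction_of a s"
    and k: "fraction_value z \<in> carrier K" "h s \<otimes>\<^bsub>K\<^esub> fraction_value z = h a" by (rule F_carrierE[OF zw(1)])
  obtain b t where b: "b \<in> carrier S" "t \<in> carrier S - {\<zero>\<^bsub>S\<^esub>}" "w = fraction_of b t"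
    and l: "fraction_value w \<in> carrier K" "h t \<otimes>\<^bsub>K\<^esub> fraction_value w = h b" by (rule F_carrierE[OF zw(2)])
  note st = S.prime_compl_mult[OF zero_prime a(2) b(2)]
  have carrier: "s \<in> carrier S" "t \<in> carrier S" "h s \<in> carrier K" "h t \<in> carrier K" using a b by auto
  have "h (s \<otimes>\<^bsub>S\<^esub> t) \<otimes>\<^bsub>K\<^esub> (fraction_value z \<otimes>\<^bsub>K\<^esub> fraction_value w) =
      (h s \<otimes>\<^bsub>K\<^esub> fraction_value z) \<otimes>\<^bsub>K\<^esub> (h t \<otimes>\<^bsub>K\<^esub> fraction_value w)"
    unfolding hom_mult[OF carrier(1,2)] using carrier(3,4) k(1) l(1) by algebra
  then have "h (s \<otimes>\<^bsub>S\<^esub> t) \<otimes>\<^bsub>K\<^esub> (fraction_value z \<otimes>\<^bsub>K\<^esub> fraction_value w) = h (a \<otimes>\<^bsub>S\<^esub> b)"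
    unfolding k(2) l(2) using a(1) b(1) by simp
  then show "fraction_value (z \<otimes>\<^bsub>F\<^esub> w) = fraction_value z \<otimes>\<^bsub>K\<^esub> fraction_value w"
    using fraction_value_eqI[OF _ st] S.localization_mult[OF zero_prime a(1,2) b(1,2)] a(1,3) b(1,3) k(1) l(1)
    by simp
  have "h (s \<otimes>\<^bsub>S\<^esub> t) \<otimes>\<^bsub>K\<^esub> (fraction_value z \<oplus>\<^bsub>K\<^esub> fraction_value w) =
      (h s \<otimes>\<^bsub>K\<^esub> fraction_value z) \<otimes>\<^bsub>K\<^esub> h t \<oplus>\<^bsub>K\<^esub> (h t \<otimes>\<^bsub>K\<^esub> fraction_value w) \<otimes>\<^bsub>K\<^esub> h s"
    unfolding hom_mult[OF carrier(1,2)] using carrier(3,4) k(1) l(1) by algebra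
  then have "h (s \<otimes>\<^bsub>S\<^esub> t) \<otimes>\<^bsub>K\<^esub> (fraction_value z \<oplus>\<^bsub>K\<^esub> fraction_value w) = h (a \<otimes>\<^bsub>S\<^esub> t \<oplus>\<^bsub>S\<^esub> b \<otimes>\<^bsub>S\<^esub> s)"
    unfolding k(2) l(2) using a(1) b(1) carrier by simp
  then show "fraction_value (z \<oplus>\<^bsub>F\<^esub> w) = fraction_value z \<oplus>\<^bsub>K\<^esub> fraction_value w"
    using fraction_value_eqI[OF _ st] S.localization_add[OF zero_prime a(1,2) b(1,2)] a(1,3) b(1,3) carrier(1,2)
      k(1) l(1) by simp
qed

lemma fraction_value_eq_zero:
  assumes "z \<in> carrier F" "fraction_value z = \<zero>\<^bsub>K\<^esub>"
  shows "z = \<zero>\<^bsub>F\<^esub>"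
proof -
  obtain a s where a: "a \<in> carrier S" "s \<in> carrier S - {\<zero>\<^bsub>S\<^esub>}" "z = fraction_of a s"
    "h s \<otimes>\<^bsub>K\<^esub> fraction_value z = h a"
    by (rule F_carrierE[OF assms(1)])
  then have "a = \<zero>\<^bsub>S\<^esub>" using assms(2) h_eq_zero_iff[of a] by auto
  then show ?thesis
    unfolding a(3) S.localization_zero
    by (intro S.fraction_eq_crossI[OF zero_prime _ a(2) _ S.prime_compl_one[OF zero_prime]]) (use a(2) in auto)
qed

lemma integrally_closed_subring_image:
  assumes S: "integrally_closed_domain S"
    and frac: "\<And>x. x \<in> carrier K \<Longrightarrow> \<exists>b\<in>carrier S. b \<noteq> \<zero>\<^bsub>S\<^esub> \<and> h b \<otimes>\<^bsub>K\<^esub> x \<in> h ` carrier S"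
  shows "K.integrally_closed_subring (h ` carrier S)"
  unfolding K.integrally_closed_subring_def
proof (intro ballI allI impI)
  fix x n assume x: "x \<in> carrier K" and int: "x [^]\<^bsub>K\<^esub> n \<in> K.poly_values (h ` carrier S) x n"
  let ?\<iota> = "\<lambda>r. fraction_of r \<one>\<^bsub>S\<^esub>"
  note one = S.prime_compl_one[OF zero_prime]
  have \<iota>: "?\<iota> r \<in> carrier F" "fraction_value (?\<iota> r) = h r" if "r \<in> carrier S" for r
    using S.localization_carrierI[OF that one] fraction_value_eqI[OF that one, of "h r"] that by auto
  obtain a b where ab: "a \<in> carrier S" "b \<in> carrier S - {\<zero>\<^bsub>S\<^esub>}" "h b \<otimes>\<^bsub>K\<^esub> x = h a" using frac[OF x] by blast
  define z where "z = fraction_of a b"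
  have z: "z \<in> carrier F" "fraction_value z = x"
    unfolding z_def using S.localization_carrierI[OF ab(1,2)] fraction_value_eqI[OF ab(1,2) x ab(3)] by auto
  have pow: "fraction_value (z [^]\<^bsub>F\<^esub> i) = x [^]\<^bsub>K\<^esub> i" for i :: nat using z by (induction i) auto
  have "\<zero>\<^bsub>K\<^esub> \<ominus>\<^bsub>K\<^esub> x [^]\<^bsub>K\<^esub> n \<in> K.poly_values (h ` carrier S) x n"
    by (rule K.poly_values_minus[OF hom_image_subring x K.poly_values_zero[OF hom_image_subring x] int])
  then obtain c where c: "c \<in> {..<n} \<rightarrow> h ` carrier S" "\<zero>\<^bsub>K\<^esub> \<ominus>\<^bsub>K\<^esub> x [^]\<^bsub>K\<^esub> n = (\<Oplus>\<^bsub>K\<^esub>i\<in>{..<n}. c i \<otimes>\<^bsub>K\<^esub> x [^]\<^bsub>K\<^esub> i)"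
    using K.poly_values_sum[OF hom_image_subring x] by blast
  have "\<forall>i\<in>{..<n}. \<exists>s. s \<in> carrier S \<and> c i = h s" using c(1) by blast
  then obtain d where d: "\<And>i. i < n \<Longrightarrow> d i \<in> carrier S \<and> c i = h (d i)" by (metis lessThan_iff)
  have terms: "(\<lambda>i. ?\<iota> (d i) \<otimes>\<^bsub>F\<^esub> z [^]\<^bsub>F\<^esub> i) \<in> {..<n} \<rightarrow> carrier F" using d \<iota> z by auto
  let ?p = "z [^]\<^bsub>F\<^esub> n \<oplus>\<^bsub>F\<^esub> (\<Oplus>\<^bsub>F\<^esub>i\<in>{..<n}. ?\<iota> (d i) \<otimes>\<^bsub>F\<^esub> z [^]\<^bsub>F\<^esub> i)"
  have "fraction_value (\<Oplus>\<^bsub>F\<^esub>i\<in>{..<n}. ?\<iota> (d i) \<otimes>\<^bsub>F\<^esub> z [^]\<^bsub>F\<^esub> i) = (\<Oplus>\<^bsub>K\<^esub>i\<in>{..<n}. c i \<otimes>\<^bsub>K\<^esub> x [^]\<^bsub>K\<^esub> i)"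
    unfolding into_K.hom_finsum[OF terms] by (rule K.finsum_cong') (use d x z pow \<iota> in auto)
  then have "fraction_value ?p = x [^]\<^bsub>K\<^esub> n \<oplus>\<^bsub>K\<^esub> (\<zero>\<^bsub>K\<^esub> \<ominus>\<^bsub>K\<^esub> x [^]\<^bsub>K\<^esub> n)"
    unfolding c(2) using z F.finsum_closed[OF terms] pow by simp
  then have "?p = \<zero>\<^bsub>F\<^esub>"
    using z F.finsum_closed[OF terms] x by (intro fraction_value_eq_zero) (simp_all add: a_minus_def K.r_neg)
  moreover have "d \<in> {..<n} \<rightarrow> carrier S" using d by auto
  ultimately have "z \<in> ?\<iota> ` carrier S" using S z(1) unfolding integrally_closed_domain_def Let_def by blast
  then show "x \<in> h ` carrier S" using \<iota>(2) z(2) by auto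
qed

end

section \<open>Prime divisors on a normal Noetherian scheme\<close>

definition irreducible_chain :: "'x topology \<Rightarrow> 'x set \<Rightarrow> nat \<Rightarrow> (nat \<Rightarrow> 'x set) \<Rightarrow> bool" where
  "irreducible_chain T Z n C \<longleftrightarrow> C 0 = Z \<and> (\<forall>i\<le>n. irreducible_closed T (C i)) \<and> (\<forall>i<n. C i \<subset> C (Suc i))"

lemma irreducible_chain_le_codim: "irreducible_chain T Z n C \<Longrightarrow> enat n \<le> codim T Z"
  unfolding codim_def irreducible_chain_def by (rule Sup_upper) blast

lemma codim_leI:
  assumes "\<And>n C. irreducible_chain T Z n C \<Longrightarrow> n \<le> m"
  shows "codim T Z \<le> enat m"
  unfolding codim_def by (rule Sup_least) (use assms in \<open>auto simp: irreducible_chain_def\<close>)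

lemma irreducible_closed_subset: "irreducible_closed T Z \<Longrightarrow> Z \<subseteq> topspace T"
  using closedin_subset unfolding irreducible_closed_def by blast

lemma codim_eq_1D:
  assumes codim: "codim T P = 1" and P: "irreducible_closed T P" and top: "irreducible_closed T (topspace T)"
  shows "P \<noteq> topspace T" and "\<And>Z. \<lbrakk>irreducible_closed T Z; P \<subseteq> Z\<rbrakk> \<Longrightarrow> Z = P \<or> Z = topspace T"
proof -
  have "n \<le> 0" if "irreducible_chain T (topspace T) n C" for n C
  proof (rule ccontr)
    assume "\<not> n \<le> 0"
    then have "topspace T \<subset> C (Suc 0)" "irreducible_closed T (C (Suc 0))"
      using that unfolding irreducible_chain_def by auto
    then show False using irreducible_closed_subset by blast
  qed
  then have "codim T (topspace T) \<le> enat 0" by (rule codim_leI)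
  then show "P \<noteq> topspace T" using codim by (auto simp: one_enat_def)
next
  fix Z assume Z: "irreducible_closed T Z" "P \<subseteq> Z"
  show "Z = P \<or> Z = topspace T"
  proof (rule ccontr)
    assume "\<not> (Z = P \<or> Z = topspace T)"
    then have "P \<subset> Z" "Z \<subset> topspace T" using Z irreducible_closed_subset by auto
    then have "irreducible_chain T P 2 (\<lambda>i. if i = 0 then P else if i = Suc 0 then Z else topspace T)"
      using P Z top by (auto simp: irreducible_chain_def less_2_cases_iff)
    then show False using irreducible_chain_le_codim[of T P 2] codim by (fastforce simp: one_enat_def)
  qed
qed

lemma codim_eq_1I:
  assumes P: "irreducible_closed T P" "P \<noteq> topspace T" and top: "irreducible_closed T (topspace T)"
    and max: "\<And>Z. \<lbrakk>irreducible_closed T Z; P \<subseteq> Z\<rbrakk> \<Longrightarrow> Z = P \<or> Z = topspace T"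
  shows "codim T P = 1"
proof (rule antisym)
  have "n \<le> 1" if chain: "irreducible_chain T P n C" for n C
  proof (rule ccontr)
    assume "\<not> n \<le> 1"
    then have C: "P \<subset> C (Suc 0)" "C (Suc 0) \<subset> C (Suc (Suc 0))" "irreducible_closed T (C (Suc 0))"
      "irreducible_closed T (C (Suc (Suc 0)))"
      using chain unfolding irreducible_chain_def by auto
    then have "C (Suc 0) = topspace T" using max by blast
    then show False using C irreducible_closed_subset by blast
  qed
  then show "codim T P \<le> 1" using codim_leI[of T P 1] by (simp add: one_enat_def)
  have "irreducible_chain T P 1 (\<lambda>i. if i = 0 then P else topspace T)"
    using P top irreducible_closed_subset[OF P(1)] by (auto simp: irreducible_chain_def)
  then show "1 \<le> codim T P" using irreducible_chain_le_codim by (fastforce simp: one_enat_def)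
qed

context integral_space
begin

lemma mem_point_closure: "z \<in> points \<Longrightarrow> z \<in> point_closure z"
  by (simp add: in_closure_of)

lemma irreducible_point_closure:
  assumes z: "z \<in> points"
  shows "irreducible_closed (topol \<XX>) (point_closure z)"
  unfolding irreducible_closed_def
proof (intro conjI allI impI)
  show "closedin (topol \<XX>) (point_closure z)" "point_closure z \<noteq> {}" using mem_point_closure[OF z] by auto
  fix A B assume AB: "closedin (topol \<XX>) A \<and> closedin (topol \<XX>) B \<and> point_closure z \<subseteq> A \<union> B"
  then have "z \<in> A \<or> z \<in> B" using mem_point_closure[OF z] by blast
  then show "point_closure z \<subseteq> A \<or> point_closure z \<subseteq> B"
    using AB closure_of_minimal[of "{z}" A] closure_of_minimal[of "{z}" B] by blast
qed

definition height_one :: "'x \<Rightarrow> bool" where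
  "height_one y \<longleftrightarrow> y \<in> points \<and> y \<noteq> \<eta> \<and> (\<forall>z\<in>points. y \<in> point_closure z \<longrightarrow> z = y \<or> z = \<eta>)"

lemma height_oneD:
  assumes "height_one y"
  shows "y \<in> points" "y \<noteq> \<eta>" "\<And>z. \<lbrakk>z \<in> points; y \<in> point_closure z\<rbrakk> \<Longrightarrow> z = y \<or> z = \<eta>"
  using assms unfolding height_one_def by blast+

lemma prime_divisor_generic_point:
  assumes P: "prime_divisor \<XX> P"
  shows "point_closure (generic_point \<XX> P) = P" "generic_point \<XX> P \<in> P" "generic_point \<XX> P \<in> points"
    "\<And>U. \<lbrakk>open_set U; P \<inter> U \<noteq> {}\<rbrakk> \<Longrightarrow> generic_point \<XX> P \<in> U"
proof -
  note gp = generic_point[of P]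
  show "point_closure (generic_point \<XX> P) = P" "generic_point \<XX> P \<in> P" "generic_point \<XX> P \<in> points"
    using P gp(1-3) unfolding prime_divisor_def by blast+
  show "generic_point \<XX> P \<in> U" if "open_set U" "P \<inter> U \<noteq> {}" for U
    using gp(4)[of U] P that unfolding prime_divisor_def by blast
qed

lemma height_one_generic_point:
  assumes P: "prime_divisor \<XX> P"
  shows "height_one (generic_point \<XX> P)"
proof -
  have irr: "irreducible_closed (topol \<XX>) P" and codim: "codim (topol \<XX>) P = 1"
    using P unfolding prime_divisor_def by auto
  note codim_1 = codim_eq_1D[OF codim irr irreducible_points]
  note gp = generic_point[OF irr]
  let ?y = "generic_point \<XX> P"
  have "?y \<noteq> \<eta>" using gp(2) eta_closure codim_1(1) by auto
  moreover have "z = ?y \<or> z = \<eta>" if z: "z \<in> points" "?y \<in> point_closure z" for z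
  proof -
    have "point_closure ?y \<subseteq> point_closure z" by (rule closure_of_minimal) (use z in auto)
    then have "P \<subseteq> point_closure z" unfolding gp(2) .
    then have "point_closure z = P \<or> point_closure z = points"
      by (rule codim_1(2)[OF irreducible_point_closure[OF z(1)]])
    then show ?thesis using gp(5)[OF z(1)] generic_point(5)[OF irreducible_points z(1)] unfolding \<eta>_def by auto
  qed
  ultimately show ?thesis unfolding height_one_def using gp(1) by blast
qed

lemma height_one_prime_divisor:
  assumes y: "height_one y"
  shows "prime_divisor \<XX> (point_closure y)" "generic_point \<XX> (point_closure y) = y"
proof -
  note h = height_oneD[OF y]
  note irr = irreducible_point_closure[OF h(1)]
  show gy: "generic_point \<XX> (point_closure y) = y" by (rule generic_point(5)[OF irr h(1) refl])
  have "codim (topol \<XX>) (point_closure y) = 1"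
  proof (rule codim_eq_1I[OF irr _ irreducible_points])
    show "point_closure y \<noteq> points" using gy h(2) unfolding \<eta>_def by auto
    fix Z assume Z: "irreducible_closed (topol \<XX>) Z" "point_closure y \<subseteq> Z"
    note gz = generic_point[OF Z(1)]
    have "y \<in> point_closure (generic_point \<XX> Z)" using gz(2) Z(2) mem_point_closure[OF h(1)] by blast
    then have "generic_point \<XX> Z = y \<or> generic_point \<XX> Z = \<eta>" by (rule h(3)[OF gz(1)])
    then show "Z = point_closure y \<or> Z = points" using gz(2) eta_closure by auto
  qed
  then show "prime_divisor \<XX> (point_closure y)" unfolding prime_divisor_def using irr by blast
qed

end

locale normal_noetherian = integral_space \<XX> for \<XX> :: "('x, 'a) rspace" +
  assumes normal: "normal_scheme \<XX>"
    and noetherian_cover: "\<exists>\<U>. finite \<U> \<and> \<Union>\<U> = topspace (topol \<XX>) \<and>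
      (\<forall>U\<in>\<U>. affine_open \<XX> U \<and> U \<noteq> {} \<and> noetherian_ring (sections \<XX> U))"
begin

definition noetherian_affine :: "'x set \<Rightarrow> bool" where
  "noetherian_affine U \<longleftrightarrow> affine_open \<XX> U \<and> U \<noteq> {} \<and> noetherian_ring (K\<lparr>carrier := regular_on U\<rparr>)"

lemma noetherian_affine_cover:
  obtains \<U> where "finite \<U>" "\<Union>\<U> = points" "\<And>U. U \<in> \<U> \<Longrightarrow> noetherian_affine U"
proof -
  obtain \<U> where U: "finite \<U>" "\<Union>\<U> = points"
    "\<And>U. U \<in> \<U> \<Longrightarrow> affine_open \<XX> U \<and> U \<noteq> {} \<and> noetherian_ring (sections \<XX> U)" using noetherian_cover by blast
  have "noetherian_affine U" if "U \<in> \<U>" for U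
  proof -
    have open_U: "open_set U" "U \<noteq> {}" using U(3)[OF that] unfolding affine_open_def by auto
    show ?thesis
      unfolding noetherian_affine_def regular_on_def
      using noetherian_ring_hom_image[OF cring_sections[OF open_U(1)] K.cring_axioms
        section_to_K_hom[OF open_U]] U(3)[OF that] by blast
  qed
  then show ?thesis using that U(1,2) by blast
qed

lemma noetherian_affine_at:
  assumes "x \<in> points"
  obtains U where "noetherian_affine U" "x \<in> U"
proof -
  obtain \<U> where "\<Union>\<U> = points" "\<And>U. U \<in> \<U> \<Longrightarrow> noetherian_affine U" by (rule noetherian_affine_cover, rule that)
  then show ?thesis using that assms by blast
qed

lemma noetherian_affineD:
  assumes "noetherian_affine U"
  shows "affine_open \<XX> U" "open_set U" "U \<noteq> {}" "U \<subseteq> points" "subring (regular_on U) K"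
    "noetherian_ring (K\<lparr>carrier := regular_on U\<rparr>)"
proof -
  show U: "affine_open \<XX> U" "U \<noteq> {}" "noetherian_ring (K\<lparr>carrier := regular_on U\<rparr>)"
    using assms unfolding noetherian_affine_def by auto
  show open_U: "open_set U" using U(1) unfolding affine_open_def by blast
  show "U \<subseteq> points" by (rule openin_subset[OF open_U])
  show "subring (regular_on U) K" by (rule regular_on_subring[OF open_U U(2)])
qed

lemma noetherian_regular_at:
  assumes y: "y \<in> points"
  shows "noetherian_ring (K\<lparr>carrier := regular_at y\<rparr>)"
proof -
  obtain U where U: "noetherian_affine U" "y \<in> U" by (rule noetherian_affine_at[OF y])
  note affine = noetherian_affineD[OF U(1)]
  show ?thesis
    by (rule K.noetherian_ring_localization[OF affine(5) regular_at_subring[OF y]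
      regular_on_subset_regular_at[OF affine(2) U(2)] affine(6)])
      (rule affine_regular_at_fraction[OF affine(1) U(2)])
qed

lemma regular_on_fractions:
  assumes U: "noetherian_affine U" and c: "c \<in> carrier K"
  shows "\<exists>b\<in>regular_on U. b \<noteq> \<zero>\<^bsub>K\<^esub> \<and> b \<otimes>\<^bsub>K\<^esub> c \<in> regular_on U"
proof -
  note affine = noetherian_affineD[OF U]
  have "c \<in> regular_at \<eta>" using c regular_at_eta by simp
  then obtain b where "b \<in> regular_on U" "b \<in> units_at \<eta>" "b \<otimes>\<^bsub>K\<^esub> c \<in> regular_on U"
    using affine_regular_at_fraction[OF affine(1) eta_open[OF affine(2,3)]] by blast
  then show ?thesis using units_at(3)[OF eta_points] by blast
qed

lemma regular_at_fractions:
  assumes y: "y \<in> points" and c: "c \<in> carrier K"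
  shows "\<exists>b\<in>regular_at y. b \<noteq> \<zero>\<^bsub>K\<^esub> \<and> b \<otimes>\<^bsub>K\<^esub> c \<in> regular_at y"
proof -
  obtain U where U: "noetherian_affine U" "y \<in> U" by (rule noetherian_affine_at[OF y])
  then show ?thesis
    using regular_on_fractions[OF U(1) c] regular_on_subset_regular_at[OF noetherian_affineD(2)] by blast
qed

lemma integrally_closed_regular_at:
  assumes y: "y \<in> points"
  shows "K.integrally_closed_subring (regular_at y)"
proof -
  interpret h: ring_hom_cring "stalk \<XX> y" K "stalk_to_K \<XX>" by (rule stalk_to_K_hom[OF y])
  have closed: "integrally_closed_domain (stalk \<XX> y)" using normal y unfolding normal_scheme_def by blast
  then interpret S: domain "stalk \<XX> y" unfolding integrally_closed_domain_def by blast
  interpret domain_in_field "stalk \<XX> y" K "stalk_to_K \<XX>"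
    by unfold_locales (rule stalk_to_K_inj)
  have "\<exists>b\<in>carrier (stalk \<XX> y). b \<noteq> \<zero>\<^bsub>stalk \<XX> y\<^esub> \<and> stalk_to_K \<XX> b \<otimes>\<^bsub>K\<^esub> c \<in> stalk_to_K \<XX> ` carrier (stalk \<XX> y)"
    if c: "c \<in> carrier K" for c
  proof -
    obtain b where b: "b \<in> regular_at y" "b \<noteq> \<zero>\<^bsub>K\<^esub>" "b \<otimes>\<^bsub>K\<^esub> c \<in> regular_at y"
      using regular_at_fractions[OF y c] by blast
    obtain b' where "b' \<in> carrier (stalk \<XX> y)" "b = stalk_to_K \<XX> b'"
      using b(1) unfolding regular_at_def by blast
    then show ?thesis using b(2,3) h.hom_zero unfolding regular_at_def by (intro bexI[of _ b']) auto
  qed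
  then show ?thesis unfolding regular_at_def by (rule integrally_closed_subring_image[OF closed])
qed

lemma vanishing_at_eta:
  assumes U: "noetherian_affine U"
  shows "vanishing_at U \<eta> = {\<zero>\<^bsub>K\<^esub>}"
  using subringE(1,2)[OF noetherian_affineD(5)[OF U]] units_at_eta unfolding vanishing_at_def by auto

lemma ex_nonzero_vanishing:
  assumes U: "noetherian_affine U" and y: "y \<in> U" "y \<noteq> \<eta>"
  shows "\<exists>b\<in>vanishing_at U y. b \<noteq> \<zero>\<^bsub>K\<^esub>"
proof (rule ccontr)
  assume none: "\<not> (\<exists>b\<in>vanishing_at U y. b \<noteq> \<zero>\<^bsub>K\<^esub>)"
  note affine = noetherian_affineD[OF U]
  have "\<zero>\<^bsub>K\<^esub> \<in> vanishing_at U y"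
    using units_at(3)[of y "\<zero>\<^bsub>K\<^esub>"] y(1) affine(4) subringE(2)[OF affine(5)] unfolding vanishing_at_def by blast
  then have "vanishing_at U y = vanishing_at U \<eta>" using none unfolding vanishing_at_eta[OF U] by blast
  then show False using inj_onD[OF affine_vanishing_at_inj[OF affine(1)] _ y(1) eta_open[OF affine(2,3)]] y(2)
    by blast
qed

lemma nonunit_times_regular:
  assumes U: "noetherian_affine U" and y: "y \<in> U" and x: "x \<in> carrier K"
    and reg: "\<And>a. a \<in> vanishing_at U y \<Longrightarrow> x \<otimes>\<^bsub>K\<^esub> a \<in> regular_at y" and a: "a \<in> regular_at y - units_at y"
  shows "x \<otimes>\<^bsub>K\<^esub> a \<in> regular_at y"
proof -
  note affine = noetherian_affineD[OF U]
  have y_points: "y \<in> points" using y affine(4) by blast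
  note sub = regular_at_subring[OF y_points]
  obtain b where b: "b \<in> regular_on U" "b \<in> units_at y" "b \<otimes>\<^bsub>K\<^esub> a \<in> regular_on U"
    using affine_regular_at_fraction[OF affine(1) y, of a] a by blast
  have carrier: "a \<in> carrier K" "b \<in> carrier K"
    using a regular_at_carrier[OF y_points] units_at(2)[OF y_points b(2)] by auto
  have "b \<otimes>\<^bsub>K\<^esub> a \<notin> units_at y"
    using K.Units_subring_factor[OF sub, of a b] a units_at(1)[OF y_points b(2)] K.m_comm[OF carrier] by auto
  then have "x \<otimes>\<^bsub>K\<^esub> (b \<otimes>\<^bsub>K\<^esub> a) \<in> regular_at y" using reg b(3) unfolding vanishing_at_def by blast
  then have "b \<otimes>\<^bsub>K\<^esub> (x \<otimes>\<^bsub>K\<^esub> a) \<in> regular_at y" using carrier x by (simp add: K.m_lcomm)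
  then show ?thesis using K.subring_div_unit[OF sub b(2)] carrier x by simp
qed

lemma discrete_valuation_at:
  assumes U: "noetherian_affine U" and y: "y \<in> U" and x: "x \<in> carrier K" "x \<notin> regular_at y"
    and reg: "\<And>a. a \<in> vanishing_at U y \<Longrightarrow> x \<otimes>\<^bsub>K\<^esub> a \<in> regular_at y"
  shows "\<exists>t. discrete_valuation_subring K (regular_at y) t"
proof -
  note affine = noetherian_affineD[OF U]
  have y_points: "y \<in> points" using y affine(4) by blast
  note sub = regular_at_subring[OF y_points]
  have "y \<noteq> \<eta>" using x regular_at_eta by blast
  then obtain b where b: "b \<in> vanishing_at U y" "b \<noteq> \<zero>\<^bsub>K\<^esub>" using ex_nonzero_vanishing[OF U y] by blast
  then have b': "b \<in> regular_at y - units_at y"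
    using regular_on_subset_regular_at[OF affine(2) y] unfolding vanishing_at_def by blast
  obtain t where t: "t \<in> regular_at y" "t \<noteq> \<zero>\<^bsub>K\<^esub>" "regular_at y - units_at y = PIdl\<^bsub>K\<lparr>carrier := regular_at y\<rparr>\<^esub> t"
    by (rule K.ex_uniformizer[OF sub noetherian_regular_at[OF y_points] integrally_closed_regular_at[OF y_points]
      nonunits_at_ideal[OF y_points] x nonunit_times_regular[OF U y x(1) reg] b' b(2)])
  then have "discrete_valuation_subring K (regular_at y) t"
    using sub noetherian_regular_at[OF y_points] regular_at_fractions[OF y_points] K.field_axioms
    by (simp add: discrete_valuation_subring_def discrete_valuation_subring_axioms_def)
  then show ?thesis ..
qed

lemma height_one_discrete_valuation:
  assumes y: "height_one y"
  shows "\<exists>t. discrete_valuation_subring K (regular_at y) t"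
proof -
  note h = height_oneD[OF y]
  note sub = regular_at_subring[OF h(1)]
  obtain U where U: "noetherian_affine U" "y \<in> U" by (rule noetherian_affine_at[OF h(1)])
  note affine = noetherian_affineD[OF U(1)]
  note regular = regular_on_subset_regular_at[OF affine(2) U(2)]
  obtain b where b: "b \<in> vanishing_at U y" "b \<noteq> \<zero>\<^bsub>K\<^esub>" using ex_nonzero_vanishing[OF U h(2)] by blast
  have bQ: "b \<in> regular_on U" "b \<in> regular_at y" "b \<notin> units_at y" "b \<in> carrier K"
    using b(1) regular subringE(1)[OF affine(5)] unfolding vanishing_at_def by auto
  have binv: "b \<otimes>\<^bsub>K\<^esub> inv\<^bsub>K\<^esub> b = \<one>\<^bsub>K\<^esub>" "inv\<^bsub>K\<^esub> b \<in> carrier K" using bQ(4) b(2) K.field_Units by auto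
  then have "inv\<^bsub>K\<^esub> b \<notin> regular_at y" using bQ(2,3) unfolding K.Units_subring_iff[OF sub] by blast
  then obtain c where c: "c \<in> regular_at y" "c \<otimes>\<^bsub>K\<^esub> inv\<^bsub>K\<^esub> b \<notin> regular_at y"
    and prime: "primeideal (K.denominators (regular_at y) (c \<otimes>\<^bsub>K\<^esub> inv\<^bsub>K\<^esub> b)) (K\<lparr>carrier := regular_at y\<rparr>)"
    using K.ex_primeideal_denominators[OF sub noetherian_regular_at[OF h(1)] binv(2)] by blast
  define x where "x = c \<otimes>\<^bsub>K\<^esub> inv\<^bsub>K\<^esub> b"
  have c_carrier: "c \<in> carrier K" by (rule regular_at_carrier[OF h(1) c(1)])
  have x: "x \<in> carrier K" "x \<notin> regular_at y" unfolding x_def using c_carrier binv(2) c(2) by auto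
  let ?q = "K.denominators (regular_at y) x"
  have "primeideal (?q \<inter> regular_on U) (K\<lparr>carrier := regular_on U\<rparr>)"
    by (rule K.primeideal_subring_Int[OF affine(5) sub regular prime[folded x_def]])
  then obtain z where z: "z \<in> U" "?q \<inter> regular_on U = vanishing_at U z"
    by (rule affine_primeideal_eq_vanishing_at[OF affine(1,3)])
  have "?q \<inter> units_at y = {}"
    using K.subring_div_unit[OF sub _ x(1)] x(2) unfolding K.denominators_def by blast
  then have "vanishing_at U z \<subseteq> vanishing_at U y" using z(2) unfolding vanishing_at_def by blast
  then have "z = y \<or> z = \<eta>" using h(3)[of z] affine_closure_iff[OF affine(1) U(2) z(1)] z(1) affine(4) by blast
  moreover have "b \<otimes>\<^bsub>K\<^esub> x = c"
    unfolding x_def using K.m_lcomm[OF bQ(4) c_carrier binv(2)] binv(1) c_carrier by simp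
  then have "b \<in> vanishing_at U z" using bQ(1,2) c(1) z(2) unfolding K.denominators_def by auto
  then have "z \<noteq> \<eta>" using vanishing_at_eta[OF U(1)] b(2) by blast
  ultimately have "vanishing_at U y \<subseteq> ?q" using z(2) by blast
  then show ?thesis
    using subringE(1)[OF sub] x(1)
    by (intro discrete_valuation_at[OF U x]) (auto simp: K.denominators_def K.m_comm subset_iff)
qed

lemma discrete_valuation_height_one:
  assumes y: "y \<in> points" "y \<noteq> \<eta>" and dvr: "discrete_valuation_subring K (regular_at y) t"
  shows "height_one y"
  unfolding height_one_def
proof (intro conjI ballI impI)
  interpret V: discrete_valuation_subring K "regular_at y" t by (rule dvr)
  obtain U where U: "noetherian_affine U" "y \<in> U" by (rule noetherian_affine_at[OF y(1)])
  note affine = noetherian_affineD[OF U(1)]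
  fix z assume z: "z \<in> points" "y \<in> point_closure z"
  have zU: "z \<in> U" by (rule point_closure_open[OF z(2) affine(2) U(2)])
  note at_closure = regular_at_closure[OF z(2)] units_at_closure[OF z(2,1)]
  show "z = y \<or> z = \<eta>"
  proof (cases "z = \<eta>")
    case False
    obtain b where b: "b \<in> vanishing_at U z" "b \<noteq> \<zero>\<^bsub>K\<^esub>" using ex_nonzero_vanishing[OF U(1) zU False] by blast
    then have bz: "b \<in> carrier K" "b \<notin> units_at z"
      using subringE(1)[OF affine(5)] unfolding vanishing_at_def by auto
    obtain u where u: "u \<in> units_at y" "b = u \<otimes>\<^bsub>K\<^esub> t [^]\<^bsub>K\<^esub> V.val b" by (rule V.val_factorization[OF bz(1) b(2)])
    have "t \<notin> units_at z"
    proof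
      assume "t \<in> units_at z"
      then have "u \<otimes>\<^bsub>K\<^esub> t [^]\<^bsub>K\<^esub> V.val b \<in> units_at z"
        using u(1) at_closure(2) units_at(7)[OF z(1)] by (intro units_at(5)[OF z(1)]) auto
      then show False using bz(2) u(2) by simp
    qed
    then have "a \<notin> units_at z" if a: "a \<in> regular_at y - units_at y" for a
    proof -
      obtain r where r: "r \<in> regular_at y" "a = t \<otimes>\<^bsub>K\<^esub> r" using a unfolding V.nonunit_iff by blast
      then show ?thesis
        using K.Units_subring_factor[OF regular_at_subring[OF z(1)], of t r] at_closure(1) V.uniformizer(1)
          \<open>t \<notin> units_at z\<close> by blast
    qed
    then have "vanishing_at U y \<subseteq> vanishing_at U z"
      using regular_on_subset_regular_at[OF affine(2) U(2)] unfolding vanishing_at_def by blast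
    moreover have "vanishing_at U z \<subseteq> vanishing_at U y"
      using affine_closure_iff[OF affine(1) U(2) zU] z(2) by blast
    ultimately show ?thesis using inj_onD[OF affine_vanishing_at_inj[OF affine(1)] _ zU U(2)] by blast
  qed simp
qed (use y in auto)

lemma hartogs:
  assumes U: "noetherian_affine U" and f: "f \<in> carrier K"
    and reg: "\<And>P. \<lbrakk>prime_divisor \<XX> P; P \<inter> U \<noteq> {}\<rbrakk> \<Longrightarrow> f \<in> regular_at (generic_point \<XX> P)"
  shows "f \<in> regular_on U"
proof (rule ccontr)
  assume "f \<notin> regular_on U"
  note affine = noetherian_affineD[OF U]
  obtain c where c: "c \<in> regular_on U" "c \<otimes>\<^bsub>K\<^esub> f \<notin> regular_on U"
    and prime: "primeideal (K.denominators (regular_on U) (c \<otimes>\<^bsub>K\<^esub> f)) (K\<lparr>carrier := regular_on U\<rparr>)"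
    by (rule K.ex_primeideal_denominators[OF affine(5,6) f \<open>f \<notin> regular_on U\<close>])
  let ?x = "c \<otimes>\<^bsub>K\<^esub> f"
  obtain y where y: "y \<in> U" "K.denominators (regular_on U) ?x = vanishing_at U y"
    by (rule affine_primeideal_eq_vanishing_at[OF affine(1,3) prime])
  have y_points: "y \<in> points" using y(1) affine(4) by blast
  note regular = regular_on_subset_regular_at[OF affine(2) y(1)]
  have x: "?x \<in> carrier K" using c(1) subringE(1)[OF affine(5)] f by auto
  have xy: "?x \<notin> regular_at y"
    using affine_regular_at_fraction[OF affine(1) y(1)] y(2)
    unfolding K.denominators_def vanishing_at_def by blast
  have "?x \<otimes>\<^bsub>K\<^esub> a \<in> regular_at y" if "a \<in> vanishing_at U y" for a
    using that x regular subringE(1)[OF affine(5)]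
    unfolding y(2)[symmetric] K.denominators_def by (auto simp: K.m_comm subset_iff)
  then obtain t where "discrete_valuation_subring K (regular_at y) t"
    using discrete_valuation_at[OF U y(1) x xy] by blast
  then have "height_one y" using discrete_valuation_height_one[OF y_points] xy x regular_at_eta by blast
  note P = height_one_prime_divisor[OF this]
  have "f \<in> regular_at y" using reg[OF P(1)] y(1) mem_point_closure[OF y_points] unfolding P(2) by blast
  then show False using xy subringE(6)[OF regular_at_subring[OF y_points]] c(1) regular by blast
qed

lemma vanishing_at_minimal_prime:
  assumes U: "noetherian_affine U" and y: "height_one y" "y \<in> U" and a: "a \<in> vanishing_at U y" "a \<noteq> \<zero>\<^bsub>K\<^esub>"
    and F: "contains_minimal_primes (K\<lparr>carrier := regular_on U\<rparr>) (PIdl\<^bsub>K\<lparr>carrier := regular_on U\<rparr>\<^esub> a) F"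
  shows "vanishing_at U y \<in> F"
proof -
  note affine = noetherian_affineD[OF U] and min = contains_minimal_primesD[OF F]
  interpret A: cring "K\<lparr>carrier := regular_on U\<rparr>" by (rule K.subring_is_cring[OF affine(5)])
  have aU: "a \<in> regular_on U" using a(1) unfolding vanishing_at_def by blast
  have prime: "primeideal (vanishing_at U y) (K\<lparr>carrier := regular_on U\<rparr>)"
    by (rule primeideal_vanishing_at[OF affine(2) y(2)])
  then have "PIdl\<^bsub>K\<lparr>carrier := regular_on U\<rparr>\<^esub> a \<subseteq> vanishing_at U y"
    by (rule A.cgenideal_minimal[OF primeideal.axioms(1) a(1)])
  then obtain p where p: "p \<in> F" "p \<subseteq> vanishing_at U y" using min(3)[OF prime] by blast
  obtain z where z: "z \<in> U" "p = vanishing_at U z"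
    by (rule affine_primeideal_eq_vanishing_at[OF affine(1,3) min(1)[OF p(1)]])
  have "z = y \<or> z = \<eta>"
    using height_oneD(3)[OF y(1), of z] affine_closure_iff[OF affine(1) y(2) z(1)] p(2) z affine(4) by blast
  moreover have "a \<in> p" using min(2)[OF p(1)] A.cgenideal_self[of a] aU by auto
  then have "z \<noteq> \<eta>" using vanishing_at_eta[OF U] a(2) z(2) by blast
  ultimately show ?thesis using p(1) z(2) by blast
qed

lemma finite_prime_divisors_on:
  assumes U: "noetherian_affine U" and a: "a \<in> regular_on U" "a \<noteq> \<zero>\<^bsub>K\<^esub>"
  shows "finite {P. prime_divisor \<XX> P \<and> P \<inter> U \<noteq> {} \<and> a \<notin> units_at (generic_point \<XX> P)}" (is "finite ?S")
proof -
  note affine = noetherian_affineD[OF U]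
  let ?A = "K\<lparr>carrier := regular_on U\<rparr>"
  interpret A: cring ?A by (rule K.subring_is_cring[OF affine(5)])
  obtain F where F: "finite F" "contains_minimal_primes ?A (PIdl\<^bsub>?A\<^esub> a) F"
    using noetherian_ring.finitely_many_minimal_primes[OF affine(6) A.cring_axioms A.cgenideal_ideal] a(1)
    by auto
  have gU: "generic_point \<XX> P \<in> U" if "P \<in> ?S" for P
    using that prime_divisor_generic_point(4) affine(2) by blast
  then have "vanishing_at U (generic_point \<XX> P) \<in> F" if "P \<in> ?S" for P
    using that a F(2) by (intro vanishing_at_minimal_prime[OF U height_one_generic_point])
      (auto simp: vanishing_at_def)
  moreover have "inj_on (\<lambda>P. vanishing_at U (generic_point \<XX> P)) ?S"
    using gU inj_onD[OF affine_vanishing_at_inj[OF affine(1)]] prime_divisor_generic_point(1)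
    by (intro inj_onI) (metis (mono_tags, lifting) mem_Collect_eq)
  ultimately show ?thesis using F(1) by (meson finite_subset image_subsetI inj_on_finite)
qed

lemma finite_prime_divisors:
  assumes f: "f \<in> carrier K" "f \<noteq> \<zero>\<^bsub>K\<^esub>"
  shows "finite {P. prime_divisor \<XX> P \<and> f \<notin> units_at (generic_point \<XX> P)}"
proof -
  obtain \<U> where cover: "finite \<U>" "\<Union>\<U> = points" "\<And>U. U \<in> \<U> \<Longrightarrow> noetherian_affine U"
    by (rule noetherian_affine_cover, rule that)
  let ?S = "\<lambda>f U. {P. prime_divisor \<XX> P \<and> P \<inter> U \<noteq> {} \<and> f \<notin> units_at (generic_point \<XX> P)}"
  have "finite (?S f U)" if "U \<in> \<U>" for U
  proof -
    note U = cover(3)[OF that] and affine = noetherian_affineD[OF cover(3)[OF that]]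
    obtain b where b: "b \<in> regular_on U" "b \<noteq> \<zero>\<^bsub>K\<^esub>" "b \<otimes>\<^bsub>K\<^esub> f \<in> regular_on U"
      using regular_on_fractions[OF U f(1)] by blast
    have bK: "b \<in> carrier K" using b(1) subringE(1)[OF affine(5)] by blast
    have "f \<in> units_at (generic_point \<XX> P)"
      if P: "prime_divisor \<XX> P" "b \<otimes>\<^bsub>K\<^esub> f \<in> units_at (generic_point \<XX> P)" "b \<in> units_at (generic_point \<XX> P)" for P
    proof -
      note gp_points = prime_divisor_generic_point(3)[OF P(1)]
      note sub = regular_at_subring[OF gp_points]
      have "f \<in> regular_at (generic_point \<XX> P)"
        by (rule K.subring_div_unit[OF sub P(3) f(1) units_at(1)[OF gp_points P(2)]])
      then show ?thesis using K.Units_subring_factor[OF sub _ units_at(1)[OF gp_points P(3)]] P(2)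
        K.m_comm[OF f(1) bK] by simp
    qed
    then have "?S f U \<subseteq> ?S (b \<otimes>\<^bsub>K\<^esub> f) U \<union> ?S b U" by blast
    moreover have "b \<otimes>\<^bsub>K\<^esub> f \<noteq> \<zero>\<^bsub>K\<^esub>" using b(2) f bK K.integral_iff by blast
    then have "finite (?S (b \<otimes>\<^bsub>K\<^esub> f) U \<union> ?S b U)"
      using finite_prime_divisors_on[OF U b(3)] finite_prime_divisors_on[OF U b(1,2)] by blast
    ultimately show ?thesis by (rule finite_subset)
  qed
  moreover have "{P. prime_divisor \<XX> P \<and> f \<notin> units_at (generic_point \<XX> P)} \<subseteq> (\<Union>U\<in>\<U>. ?S f U)"
  proof
    fix P assume P: "P \<in> {P. prime_divisor \<XX> P \<and> f \<notin> units_at (generic_point \<XX> P)}"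
    then obtain U where "U \<in> \<U>" "generic_point \<XX> P \<in> U" using prime_divisor_generic_point(3) cover(2) by blast
    then show "P \<in> (\<Union>U\<in>\<U>. ?S f U)" using P prime_divisor_generic_point(2)[of P] by blast
  qed
  ultimately show ?thesis using cover(1) by (meson finite_UN finite_subset)
qed

end

section \<open>The order along a prime divisor\<close>

context normal_noetherian
begin

abbreviation gp :: "'x set \<Rightarrow> 'x" where
  "gp P \<equiv> generic_point \<XX> P"

lemma max_ideal_stalk_principal_iff:
  assumes y: "y \<in> points" and t: "t \<in> carrier (stalk \<XX> y)"
  shows "max_ideal (stalk \<XX> y) = PIdl\<^bsub>stalk \<XX> y\<^esub> t \<longleftrightarrow>
    regular_at y - units_at y = PIdl\<^bsub>K\<lparr>carrier := regular_at y\<rparr>\<^esub> (stalk_to_K \<XX> t)"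
proof -
  interpret h: ring_hom_cring "stalk \<XX> y" K "stalk_to_K \<XX>" by (rule stalk_to_K_hom[OF y])
  have "max_ideal (stalk \<XX> y) \<subseteq> carrier (stalk \<XX> y)" "PIdl\<^bsub>stalk \<XX> y\<^esub> t \<subseteq> carrier (stalk \<XX> y)"
    using max_ideal_eq_nonunits[OF local_stalks[OF y]] t unfolding cgenideal_def by auto
  from inj_on_image_eq_iff[OF stalk_to_K_inj this] show ?thesis
    unfolding stalk_to_K_max_ideal[OF y] h.hom_image_cgenideal[OF t] regular_at_def[symmetric] by blast
qed

lemma ord_eq_discrete_valuation:
  assumes P: "prime_divisor \<XX> P" and dvr: "discrete_valuation_subring K (regular_at (gp P)) t"
    and f: "f \<in> carrier K" "f \<noteq> \<zero>\<^bsub>K\<^esub>"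
  shows "ord \<XX> P f = Fin (discrete_valuation_subring.val K (regular_at (gp P)) t f)"
proof -
  interpret V: discrete_valuation_subring K "regular_at (gp P)" t by (rule dvr)
  note y = prime_divisor_generic_point(3)[OF P]
  have "(THE n::int. \<exists>t\<in>carrier (stalk \<XX> (gp P)). \<exists>u\<in>Units (stalk \<XX> (gp P)).
      max_ideal (stalk \<XX> (gp P)) = PIdl\<^bsub>stalk \<XX> (gp P)\<^esub> t \<and>
      f = stalk_to_K \<XX> u \<otimes>\<^bsub>K\<^esub> (stalk_to_K \<XX> t) [^]\<^bsub>K\<^esub> n) = V.val f"
  proof (rule the_equality)
    obtain u where u: "u \<in> units_at (gp P)" "f = u \<otimes>\<^bsub>K\<^esub> t [^]\<^bsub>K\<^esub> V.val f" by (rule V.val_factorization[OF f])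
    obtain u' where "u' \<in> Units (stalk \<XX> (gp P))" "u = stalk_to_K \<XX> u'"
      using u(1) unfolding stalk_to_K_Units[OF y] by blast
    moreover obtain t' where t': "t' \<in> carrier (stalk \<XX> (gp P))" "t = stalk_to_K \<XX> t'"
      using V.uniformizer(1) unfolding regular_at_def by blast
    moreover have "max_ideal (stalk \<XX> (gp P)) = PIdl\<^bsub>stalk \<XX> (gp P)\<^esub> t'"
      unfolding max_ideal_stalk_principal_iff[OF y t'(1)] using V.uniformizer(3) t'(2) by simp
    ultimately show "\<exists>t\<in>carrier (stalk \<XX> (gp P)). \<exists>u\<in>Units (stalk \<XX> (gp P)).
        max_ideal (stalk \<XX> (gp P)) = PIdl\<^bsub>stalk \<XX> (gp P)\<^esub> t \<and>
        f = stalk_to_K \<XX> u \<otimes>\<^bsub>K\<^esub> (stalk_to_K \<XX> t) [^]\<^bsub>K\<^esub> V.val f"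
      using u(2) by blast
  next
    fix n :: int
    assume "\<exists>t\<in>carrier (stalk \<XX> (gp P)). \<exists>u\<in>Units (stalk \<XX> (gp P)).
        max_ideal (stalk \<XX> (gp P)) = PIdl\<^bsub>stalk \<XX> (gp P)\<^esub> t \<and> f = stalk_to_K \<XX> u \<otimes>\<^bsub>K\<^esub> (stalk_to_K \<XX> t) [^]\<^bsub>K\<^esub> n"
    then obtain t' u' where t': "t' \<in> carrier (stalk \<XX> (gp P))"
      "max_ideal (stalk \<XX> (gp P)) = PIdl\<^bsub>stalk \<XX> (gp P)\<^esub> t'"
      and u': "u' \<in> Units (stalk \<XX> (gp P))" and eq: "f = stalk_to_K \<XX> u' \<otimes>\<^bsub>K\<^esub> (stalk_to_K \<XX> t') [^]\<^bsub>K\<^esub> n" by blast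
    have "stalk_to_K \<XX> t' \<in> regular_at (gp P)" "stalk_to_K \<XX> u' \<in> units_at (gp P)"
      using t'(1) u' stalk_to_K_Units[OF y] unfolding regular_at_def by auto
    then show "n = V.val f"
      unfolding eq using V.val_uniformizer_power max_ideal_stalk_principal_iff[OF y t'(1)] t'(2) by simp
  qed
  then show ?thesis unfolding ord_def local_ring_at_def Let_def using f(2) by simp
qed

definition val :: "'x set \<Rightarrow> ('x set \<times> 'a) set \<Rightarrow> int" where
  "val P f = fin_part (ord \<XX> P f)"

lemma ord_zero: "ord \<XX> P \<zero>\<^bsub>K\<^esub> = Pinf"
  unfolding ord_def by (simp add: Let_def)

context
  fixes P assumes P: "prime_divisor \<XX> P"
begin

lemma ord_eq_val: "\<lbrakk>f \<in> carrier K; f \<noteq> \<zero>\<^bsub>K\<^esub>\<rbrakk> \<Longrightarrow> ord \<XX> P f = Fin (val P f)"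
  and val_mult: "\<lbrakk>f \<in> carrier K; f \<noteq> \<zero>\<^bsub>K\<^esub>; g \<in> carrier K; g \<noteq> \<zero>\<^bsub>K\<^esub>\<rbrakk> \<Longrightarrow> val P (f \<otimes>\<^bsub>K\<^esub> g) = val P f + val P g"
  and val_nonneg_iff: "\<lbrakk>f \<in> carrier K; f \<noteq> \<zero>\<^bsub>K\<^esub>\<rbrakk> \<Longrightarrow> 0 \<le> val P f \<longleftrightarrow> f \<in> regular_at (gp P)"
  and val_pos_iff: "\<lbrakk>f \<in> carrier K; f \<noteq> \<zero>\<^bsub>K\<^esub>\<rbrakk> \<Longrightarrow> 1 \<le> val P f \<longleftrightarrow> f \<in> regular_at (gp P) - units_at (gp P)"
  and val_add: "\<lbrakk>f \<in> carrier K; f \<noteq> \<zero>\<^bsub>K\<^esub>; g \<in> carrier K; g \<noteq> \<zero>\<^bsub>K\<^esub>; f \<oplus>\<^bsub>K\<^esub> g \<noteq> \<zero>\<^bsub>K\<^esub>; n \<le> val P f; n \<le> val P g\<rbrakk>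
    \<Longrightarrow> n \<le> val P (f \<oplus>\<^bsub>K\<^esub> g)"
proof -
  obtain t where t: "discrete_valuation_subring K (regular_at (gp P)) t"
    using height_one_discrete_valuation[OF height_one_generic_point[OF P]] by blast
  interpret V: discrete_valuation_subring K "regular_at (gp P)" t by (rule t)
  have val: "val P f = V.val f" if "f \<in> carrier K" "f \<noteq> \<zero>\<^bsub>K\<^esub>" for f
    using ord_eq_discrete_valuation[OF P t that] unfolding val_def fin_part_def by simp
  show "\<lbrakk>f \<in> carrier K; f \<noteq> \<zero>\<^bsub>K\<^esub>\<rbrakk> \<Longrightarrow> ord \<XX> P f = Fin (val P f)"
    using ord_eq_discrete_valuation[OF P t] val by simp
  show "\<lbrakk>f \<in> carrier K; f \<noteq> \<zero>\<^bsub>K\<^esub>; g \<in> carrier K; g \<noteq> \<zero>\<^bsub>K\<^esub>\<rbrakk> \<Longrightarrow> val P (f \<otimes>\<^bsub>K\<^esub> g) = val P f + val P g"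
    using V.val_mult val K.integral_iff by simp
  show "\<lbrakk>f \<in> carrier K; f \<noteq> \<zero>\<^bsub>K\<^esub>\<rbrakk> \<Longrightarrow> 0 \<le> val P f \<longleftrightarrow> f \<in> regular_at (gp P)"
    using V.val_nonneg_iff val by simp
  show "\<lbrakk>f \<in> carrier K; f \<noteq> \<zero>\<^bsub>K\<^esub>\<rbrakk> \<Longrightarrow> 1 \<le> val P f \<longleftrightarrow> f \<in> regular_at (gp P) - units_at (gp P)"
    using V.val_pos_iff val by simp
  show "\<lbrakk>f \<in> carrier K; f \<noteq> \<zero>\<^bsub>K\<^esub>; g \<in> carrier K; g \<noteq> \<zero>\<^bsub>K\<^esub>; f \<oplus>\<^bsub>K\<^esub> g \<noteq> \<zero>\<^bsub>K\<^esub>; n \<le> val P f; n \<le> val P g\<rbrakk>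
      \<Longrightarrow> n \<le> val P (f \<oplus>\<^bsub>K\<^esub> g)"
    using V.val_add val by simp
qed

end

definition ord_ge :: "'x set \<Rightarrow> int \<Rightarrow> ('x set \<times> 'a) set \<Rightarrow> bool" where
  "ord_ge P n f \<longleftrightarrow> f = \<zero>\<^bsub>K\<^esub> \<or> n \<le> val P f"

lemma ord_ge_zero [simp]: "ord_ge P n \<zero>\<^bsub>K\<^esub>"
  unfolding ord_ge_def by simp

lemma ord_ge_mono: "\<lbrakk>ord_ge P n f; m \<le> n\<rbrakk> \<Longrightarrow> ord_ge P m f"
  unfolding ord_ge_def by auto

lemma ord_ge_min_ord_iff:
  assumes P: "prime_divisor \<XX> P" and fg: "f \<in> carrier K" "g \<in> carrier K" "f \<noteq> \<zero>\<^bsub>K\<^esub> \<or> g \<noteq> \<zero>\<^bsub>K\<^esub>"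
  shows "n \<le> fin_part (min (ord \<XX> P f) (ord \<XX> P g)) \<longleftrightarrow> ord_ge P n f \<and> ord_ge P n g"
  using ord_eq_val[OF P fg(1)] ord_eq_val[OF P fg(2)] ord_zero[of P] fg(3)
  by (cases "f = \<zero>\<^bsub>K\<^esub>"; cases "g = \<zero>\<^bsub>K\<^esub>") (simp_all add: ord_ge_def fin_part_def)

context
  fixes P assumes P: "prime_divisor \<XX> P"
begin

lemma ord_ge_add:
  assumes "f \<in> carrier K" "g \<in> carrier K" "ord_ge P n f" "ord_ge P n g"
  shows "ord_ge P n (f \<oplus>\<^bsub>K\<^esub> g)"
  using assms val_add[OF P, of f g n] unfolding ord_ge_def
  by (cases "f = \<zero>\<^bsub>K\<^esub>"; cases "g = \<zero>\<^bsub>K\<^esub>") auto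

lemma ord_ge_mult:
  assumes "f \<in> carrier K" "g \<in> carrier K" "ord_ge P m f" "ord_ge P n g"
  shows "ord_ge P (m + n) (f \<otimes>\<^bsub>K\<^esub> g)"
  using assms val_mult[OF P, of f g] unfolding ord_ge_def
  by (cases "f = \<zero>\<^bsub>K\<^esub>"; cases "g = \<zero>\<^bsub>K\<^esub>") auto

lemma ord_ge_0_iff: "f \<in> carrier K \<Longrightarrow> ord_ge P 0 f \<longleftrightarrow> f \<in> regular_at (gp P)"
  using val_nonneg_iff[OF P, of f] subringE(2)[OF regular_at_subring[OF prime_divisor_generic_point(3)[OF P]]]
  unfolding ord_ge_def by auto

lemma ord_ge_1_iff: "f \<in> carrier K \<Longrightarrow> ord_ge P 1 f \<longleftrightarrow> f \<in> regular_at (gp P) - units_at (gp P)"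
  using val_pos_iff[OF P, of f] prime_divisor_generic_point(3)[OF P]
    K.ideal_subringE(3)[OF regular_at_subring nonunits_at_ideal]
  unfolding ord_ge_def by auto

lemma ord_ge_uminus:
  assumes f: "f \<in> carrier K" "ord_ge P n f"
  shows "ord_ge P n (\<ominus>\<^bsub>K\<^esub> f)"
proof -
  have "\<ominus>\<^bsub>K\<^esub> \<one>\<^bsub>K\<^esub> \<in> regular_at (gp P)"
    using subringE(3,5)[OF regular_at_subring[OF prime_divisor_generic_point(3)[OF P]]] by blast
  then have "ord_ge P (0 + n) ((\<ominus>\<^bsub>K\<^esub> \<one>\<^bsub>K\<^esub>) \<otimes>\<^bsub>K\<^esub> f)"
    by (intro ord_ge_mult f) (simp_all add: ord_ge_0_iff)
  then show ?thesis using f(1) by (simp add: K.l_minus)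
qed

lemma ord_ge_smult_iff:
  assumes "c \<in> carrier K" "c \<noteq> \<zero>\<^bsub>K\<^esub>" "f \<in> carrier K"
  shows "ord_ge P (n + val P c) (c \<otimes>\<^bsub>K\<^esub> f) \<longleftrightarrow> ord_ge P n f"
  using assms val_mult[OF P, of c f] unfolding ord_ge_def
  by (cases "f = \<zero>\<^bsub>K\<^esub>") (simp_all add: K.integral_iff)

end

end

section \<open>The decoration\<close>

context normal_noetherian
begin

lemma value_at_eq_Some_iff:
  assumes P: "prime_divisor \<XX> P" and A: "A \<in> carrier (stalk \<XX> (gp P))"
  shows "value_at \<XX> P f = Some (max_ideal (stalk \<XX> (gp P)) +>\<^bsub>stalk \<XX> (gp P)\<^esub> A) \<longleftrightarrow>
    f \<ominus>\<^bsub>K\<^esub> stalk_to_K \<XX> A \<in> regular_at (gp P) - units_at (gp P) \<and> f \<in> regular_at (gp P)"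
proof (cases "f \<in> regular_at (gp P)")
  case True
  note y = prime_divisor_generic_point(3)[OF P]
  let ?S = "stalk \<XX> (gp P)"
  interpret h: ring_hom_cring ?S K "stalk_to_K \<XX>" by (rule stalk_to_K_hom[OF y])
  note M = maximalideal.axioms(1)[OF maximalideal_max_ideal[OF local_stalks[OF y]]]
  obtain B where B: "B \<in> carrier ?S" "f = stalk_to_K \<XX> B" using True unfolding regular_at_def by blast
  have "(THE a. a \<in> carrier ?S \<and> stalk_to_K \<XX> a = f) = B"
  proof (rule the_equality)
    show "a = B" if "a \<in> carrier ?S \<and> stalk_to_K \<XX> a = f" for a
      by (rule inj_onD[OF stalk_to_K_inj]) (use that B in simp_all)
  qed (use B in simp)
  then have "value_at \<XX> P f = Some (max_ideal ?S +>\<^bsub>?S\<^esub> B)"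
    using True unfolding value_at_def local_ring_at_def Let_def regular_at_def by simp
  then have "value_at \<XX> P f = Some (max_ideal ?S +>\<^bsub>?S\<^esub> A) \<longleftrightarrow> B \<ominus>\<^bsub>?S\<^esub> A \<in> max_ideal ?S"
    using h.R.quotient_eq_iff_same_a_r_cos[OF M B(1) A] by simp
  also have "\<dots> \<longleftrightarrow> stalk_to_K \<XX> (B \<ominus>\<^bsub>?S\<^esub> A) \<in> stalk_to_K \<XX> ` max_ideal ?S"
    using inj_on_image_mem_iff[OF stalk_to_K_inj, of "B \<ominus>\<^bsub>?S\<^esub> A" "gp P" "max_ideal ?S"]
      additive_subgroup.a_subset[OF ideal.axioms(1)[OF M]] A B(1) by simp
  also have "stalk_to_K \<XX> (B \<ominus>\<^bsub>?S\<^esub> A) = f \<ominus>\<^bsub>K\<^esub> stalk_to_K \<XX> A" using A B by (simp add: a_minus_def)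
  finally show ?thesis using True unfolding stalk_to_K_max_ideal[OF y] by blast
next
  case False
  then have "value_at \<XX> P f = None" unfolding value_at_def local_ring_at_def Let_def regular_at_def by simp
  then show ?thesis using False by simp
qed

end

locale residue_decoration = normal_noetherian \<XX> for \<XX> :: "('x, 'a) rspace" +
  fixes D :: "'x set \<Rightarrow> int" and h :: "'x set \<Rightarrow> ('x set \<times> 'a) set set"
  assumes supp_finite: "finite (supp D)"
    and supp_prime: "P \<in> supp D \<Longrightarrow> prime_divisor \<XX> P"
    and h_carrier: "P \<in> supp D \<Longrightarrow> h P \<in> carrier (residue_field_at \<XX> P)"
begin

abbreviation "\<V> \<equiv> plane K"
abbreviation "\<W> \<equiv> snc_decoration \<XX> D h"

definition stalk_lift :: "'x set \<Rightarrow> ('x set \<times> 'a) set" where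
  "stalk_lift P = (SOME A. A \<in> carrier (stalk \<XX> (gp P)) \<and>
     h P = max_ideal (stalk \<XX> (gp P)) +>\<^bsub>stalk \<XX> (gp P)\<^esub> A)"

definition H :: "'x set \<Rightarrow> ('x set \<times> 'a) set" where
  "H P = (if P \<in> supp D then stalk_to_K \<XX> (stalk_lift P) else \<zero>\<^bsub>K\<^esub>)"

lemma stalk_lift:
  assumes P: "P \<in> supp D"
  shows "stalk_lift P \<in> carrier (stalk \<XX> (gp P))"
    "h P = max_ideal (stalk \<XX> (gp P)) +>\<^bsub>stalk \<XX> (gp P)\<^esub> stalk_lift P"
proof -
  have "h P \<in> a_rcosets\<^bsub>stalk \<XX> (gp P)\<^esub> (max_ideal (stalk \<XX> (gp P)))"
    using h_carrier[OF P]
    unfolding residue_field_at_def residue_ring_of_def local_ring_at_def FactRing_def by simp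
  then have "\<exists>A. A \<in> carrier (stalk \<XX> (gp P)) \<and> h P = max_ideal (stalk \<XX> (gp P)) +>\<^bsub>stalk \<XX> (gp P)\<^esub> A"
    unfolding A_RCOSETS_def' by blast
  from someI_ex[OF this] show "stalk_lift P \<in> carrier (stalk \<XX> (gp P))"
    "h P = max_ideal (stalk \<XX> (gp P)) +>\<^bsub>stalk \<XX> (gp P)\<^esub> stalk_lift P"
    unfolding stalk_lift_def by blast+
qed

lemma H_regular:
  assumes P: "prime_divisor \<XX> P"
  shows "H P \<in> regular_at (gp P)"
  using stalk_lift(1)[of P] subringE(2)[OF regular_at_subring[OF prime_divisor_generic_point(3)[OF P]]]
  unfolding H_def by (auto simp: regular_at_def)

lemma H_carrier: "prime_divisor \<XX> P \<Longrightarrow> H P \<in> carrier K"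
  using regular_at_carrier[OF prime_divisor_generic_point(3) H_regular] .

lemma value_at_eq_residue_iff:
  assumes P: "P \<in> supp D" and f: "f \<in> carrier K"
  shows "value_at \<XX> P f = Some (h P) \<longleftrightarrow> ord_ge P 1 (f \<ominus>\<^bsub>K\<^esub> H P)"
proof -
  note prime = supp_prime[OF P]
  note sub = regular_at_subring[OF prime_divisor_generic_point(3)[OF prime]]
  have HP: "H P = stalk_to_K \<XX> (stalk_lift P)" using P unfolding H_def by simp
  have "f \<in> regular_at (gp P)" if "f \<ominus>\<^bsub>K\<^esub> H P \<in> regular_at (gp P)"
  proof -
    have "(f \<ominus>\<^bsub>K\<^esub> H P) \<oplus>\<^bsub>K\<^esub> H P = f" using f H_carrier[OF prime] by algebra
    then show ?thesis using subringE(7)[OF sub that H_regular[OF prime]] by simp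
  qed
  then show ?thesis
    using value_at_eq_Some_iff[OF prime stalk_lift(1)[OF P], of f] stalk_lift(2)[OF P] ord_ge_1_iff[OF prime]
      f H_carrier[OF prime] unfolding HP by auto
qed

lemma quotient_value_at_eq_residue_iff:
  assumes P: "P \<in> supp D" and fg: "f \<in> carrier K" "g \<in> carrier K" "g \<noteq> \<zero>\<^bsub>K\<^esub>"
  shows "quotient_value_at \<XX> P f g = Some (h P) \<longleftrightarrow> ord_ge P (1 + val P g) (f \<ominus>\<^bsub>K\<^esub> H P \<otimes>\<^bsub>K\<^esub> g)"
proof -
  note prime = supp_prime[OF P] and H = H_carrier[OF supp_prime[OF P]]
  have ginv: "g \<otimes>\<^bsub>K\<^esub> inv\<^bsub>K\<^esub> g = \<one>\<^bsub>K\<^esub>" "inv\<^bsub>K\<^esub> g \<in> carrier K" using fg K.field_Units by auto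
  let ?q = "f \<otimes>\<^bsub>K\<^esub> inv\<^bsub>K\<^esub> g"
  have "g \<otimes>\<^bsub>K\<^esub> (?q \<ominus>\<^bsub>K\<^esub> H P) = (g \<otimes>\<^bsub>K\<^esub> inv\<^bsub>K\<^esub> g) \<otimes>\<^bsub>K\<^esub> f \<ominus>\<^bsub>K\<^esub> H P \<otimes>\<^bsub>K\<^esub> g" using fg H ginv(2) by algebra
  then have eq: "f \<ominus>\<^bsub>K\<^esub> H P \<otimes>\<^bsub>K\<^esub> g = g \<otimes>\<^bsub>K\<^esub> (?q \<ominus>\<^bsub>K\<^esub> H P)" unfolding ginv(1) using fg(1) by simp
  have "quotient_value_at \<XX> P f g = value_at \<XX> P ?q" using fg(3) unfolding quotient_value_at_def Let_def by simp
  then have "quotient_value_at \<XX> P f g = Some (h P) \<longleftrightarrow> ord_ge P 1 (?q \<ominus>\<^bsub>K\<^esub> H P)"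
    using value_at_eq_residue_iff[OF P] fg(1) ginv(2) by simp
  also have "\<dots> \<longleftrightarrow> ord_ge P (1 + val P g) (f \<ominus>\<^bsub>K\<^esub> H P \<otimes>\<^bsub>K\<^esub> g)"
    unfolding eq using ord_ge_smult_iff[OF prime fg(2,3)] fg(1) ginv(2) H by simp
  finally show ?thesis .
qed

text \<open>With \<open>H = 0\<close> and no shift off \<open>D\<close>, the formula \<open>min (ord g + shift) (ord (f - H g))\<close> computes the
  coefficient along every prime divisor.\<close>

definition shift :: "'x set \<Rightarrow> int" where
  "shift P = (if P \<in> supp D then 1 else 0)"

definition in_lattice :: "'x set \<Rightarrow> int \<Rightarrow> ('x set \<times> 'a) set \<times> ('x set \<times> 'a) set \<Rightarrow> bool" where
  "in_lattice P n v \<longleftrightarrow> ord_ge P (n - shift P) (snd v) \<and> ord_ge P n (fst v \<ominus>\<^bsub>K\<^esub> H P \<otimes>\<^bsub>K\<^esub> snd v)"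

definition weight :: "'x set \<Rightarrow> ('x set \<times> 'a) set \<times> ('x set \<times> 'a) set \<Rightarrow> int" where
  "weight P v = (if P \<in> supp D \<and> quotient_value_at \<XX> P (fst v) (snd v) = Some (h P)
     then fin_part (min (ord \<XX> P (fst v)) (ord \<XX> P (snd v))) + 1
     else fin_part (min (ord \<XX> P (fst v)) (ord \<XX> P (snd v))))"

lemma decoration_eq: "\<W> v = (if v = \<zero>\<^bsub>\<V>\<^esub> then Pinf else Fin (\<lambda>P. if prime_divisor \<XX> P then weight P v else 0))"
proof (cases v)
  case (Pair f g)
  show ?thesis unfolding snc_decoration_def weight_def Pair prod.case fst_conv snd_conv ..
qed

lemma ord_ge_residue_form_iff:
  assumes P: "prime_divisor \<XX> P" and fg: "f \<in> carrier K" "g \<in> carrier K" "ord_ge P n g"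
  shows "ord_ge P n (f \<ominus>\<^bsub>K\<^esub> H P \<otimes>\<^bsub>K\<^esub> g) \<longleftrightarrow> ord_ge P n f"
proof -
  note H = H_carrier[OF P]
  have Hg: "H P \<otimes>\<^bsub>K\<^esub> g \<in> carrier K" "ord_ge P n (H P \<otimes>\<^bsub>K\<^esub> g)"
    using ord_ge_mult[OF P H fg(2) _ fg(3), of 0] ord_ge_0_iff[OF P H] H_regular[OF P] H fg(2) by auto
  have "f = (f \<ominus>\<^bsub>K\<^esub> H P \<otimes>\<^bsub>K\<^esub> g) \<oplus>\<^bsub>K\<^esub> H P \<otimes>\<^bsub>K\<^esub> g" using fg(1,2) H by algebra
  then show ?thesis
    using ord_ge_add[OF P _ Hg(1) _ Hg(2), of "f \<ominus>\<^bsub>K\<^esub> H P \<otimes>\<^bsub>K\<^esub> g"] ord_ge_add[OF P fg(1) _ _ ord_ge_uminus[OF P Hg]]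
      fg(1) Hg(1) unfolding a_minus_def by auto
qed

lemma weight_ge_iff:
  assumes P: "prime_divisor \<XX> P" and v: "v \<in> carrier \<V>" "v \<noteq> \<zero>\<^bsub>\<V>\<^esub>"
  shows "n \<le> weight P v \<longleftrightarrow> in_lattice P n v"
proof -
  obtain f g where v_eq: "v = (f, g)" by (cases v)
  have fg: "f \<in> carrier K" "g \<in> carrier K" "f \<noteq> \<zero>\<^bsub>K\<^esub> \<or> g \<noteq> \<zero>\<^bsub>K\<^esub>" using v unfolding v_eq plane_simps by auto
  let ?d = "f \<ominus>\<^bsub>K\<^esub> H P \<otimes>\<^bsub>K\<^esub> g"
  note min = ord_ge_min_ord_iff[OF P fg] and form = ord_ge_residue_form_iff[OF P fg(1,2)]
  consider (off) "P \<notin> supp D" | (residue) "P \<in> supp D" "quotient_value_at \<XX> P f g = Some (h P)"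
    | (other) "P \<in> supp D" "quotient_value_at \<XX> P f g \<noteq> Some (h P)" by blast
  then show ?thesis
  proof cases
    case off
    then show ?thesis using min form unfolding weight_def in_lattice_def shift_def v_eq by auto
  next
    case residue
    then have g: "g \<noteq> \<zero>\<^bsub>K\<^esub>" unfolding quotient_value_at_def by (auto simp: Let_def)
    then have d: "ord_ge P (1 + val P g) ?d"
      using quotient_value_at_eq_residue_iff[OF residue(1) fg(1,2)] residue(2) by blast
    have "ord_ge P n ?d \<and> ord_ge P (n - 1) f" if "ord_ge P (n - 1) g"
      using that g ord_ge_mono[OF d] ord_ge_mono[OF d, of "n - 1"] form[OF that]
      unfolding ord_ge_def[of P "n - 1" g] by auto
    then show ?thesis using min[of "n - 1"] residue unfolding weight_def in_lattice_def shift_def v_eq by auto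
  next
    case other
    have "ord_ge P n g" if gd: "ord_ge P (n - 1) g" "ord_ge P n ?d"
    proof (rule ccontr)
      assume "\<not> ord_ge P n g"
      then have "g \<noteq> \<zero>\<^bsub>K\<^esub>" "val P g = n - 1" using gd(1) unfolding ord_ge_def by auto
      then show False using quotient_value_at_eq_residue_iff[OF other(1) fg(1,2)] gd(2) other(2) by simp
    qed
    then have "ord_ge P n f \<and> ord_ge P n g \<longleftrightarrow> ord_ge P (n - 1) g \<and> ord_ge P n ?d"
      using form ord_ge_mono[of P n g "n - 1"] by auto
    then show ?thesis using min other unfolding weight_def in_lattice_def shift_def v_eq by simp
  qed
qed

lemma in_lattice_zero [simp]: "prime_divisor \<XX> P \<Longrightarrow> in_lattice P n (\<zero>\<^bsub>K\<^esub>, \<zero>\<^bsub>K\<^esub>)"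
  unfolding in_lattice_def using H_carrier by (simp add: a_minus_def)

lemma in_lattice_mono: "\<lbrakk>in_lattice P n v; m \<le> n\<rbrakk> \<Longrightarrow> in_lattice P m v"
  unfolding in_lattice_def using ord_ge_mono by auto

lemma in_lattice_add:
  assumes P: "prime_divisor \<XX> P" and v: "v \<in> carrier \<V>" "w \<in> carrier \<V>" "in_lattice P n v" "in_lattice P n w"
  shows "in_lattice P n (v \<oplus>\<^bsub>\<V>\<^esub> w)"
proof -
  have carrier: "fst v \<in> carrier K" "snd v \<in> carrier K" "fst w \<in> carrier K" "snd w \<in> carrier K"
    "H P \<in> carrier K"
    using v(1,2) H_carrier[OF P] unfolding plane_simps by auto
  have "(fst v \<oplus>\<^bsub>K\<^esub> fst w) \<ominus>\<^bsub>K\<^esub> H P \<otimes>\<^bsub>K\<^esub> (snd v \<oplus>\<^bsub>K\<^esub> snd w) =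
      (fst v \<ominus>\<^bsub>K\<^esub> H P \<otimes>\<^bsub>K\<^esub> snd v) \<oplus>\<^bsub>K\<^esub> (fst w \<ominus>\<^bsub>K\<^esub> H P \<otimes>\<^bsub>K\<^esub> snd w)"
    using carrier by algebra
  then show ?thesis using v(3,4) carrier ord_ge_add[OF P] unfolding in_lattice_def plane_simps fst_conv snd_conv
    by simp
qed

lemma in_lattice_smult_iff:
  assumes P: "prime_divisor \<XX> P" and v: "v \<in> carrier \<V>" and a: "a \<in> carrier K" "a \<noteq> \<zero>\<^bsub>K\<^esub>"
  shows "in_lattice P (n + val P a) (a \<odot>\<^bsub>\<V>\<^esub> v) \<longleftrightarrow> in_lattice P n v"
proof -
  have carrier: "fst v \<in> carrier K" "snd v \<in> carrier K" "H P \<in> carrier K"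
    using v H_carrier[OF P] unfolding plane_simps by auto
  have "a \<otimes>\<^bsub>K\<^esub> fst v \<ominus>\<^bsub>K\<^esub> H P \<otimes>\<^bsub>K\<^esub> (a \<otimes>\<^bsub>K\<^esub> snd v) = a \<otimes>\<^bsub>K\<^esub> (fst v \<ominus>\<^bsub>K\<^esub> H P \<otimes>\<^bsub>K\<^esub> snd v)" using carrier a(1) by algebra
  moreover have "n + val P a - shift P = (n - shift P) + val P a" by simp
  moreover have "fst v \<ominus>\<^bsub>K\<^esub> H P \<otimes>\<^bsub>K\<^esub> snd v \<in> carrier K" using carrier by simp
  ultimately show ?thesis
    using ord_ge_smult_iff[OF P a] carrier(2) unfolding in_lattice_def plane_simps fst_conv snd_conv by metis
qed

lemma in_lattice_smult:
  assumes P: "prime_divisor \<XX> P" and v: "v \<in> carrier \<V>" "in_lattice P n v" and a: "a \<in> carrier K" "ord_ge P k a"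
  shows "in_lattice P (n + k) (a \<odot>\<^bsub>\<V>\<^esub> v)"
proof (cases "a = \<zero>\<^bsub>K\<^esub>")
  case True
  then have "a \<odot>\<^bsub>\<V>\<^esub> v = (\<zero>\<^bsub>K\<^esub>, \<zero>\<^bsub>K\<^esub>)" using v(1) unfolding plane_simps by auto
  then show ?thesis using P by simp
next
  case False
  then have "k \<le> val P a" using a(2) unfolding ord_ge_def by simp
  then show ?thesis
    using in_lattice_mono[OF in_lattice_smult_iff[OF P v(1) a(1) False, THEN iffD2, OF v(2)], of "n + k"]
    by simp
qed

lemma ord_eq_0:
  assumes P: "prime_divisor \<XX> P" and f: "f \<in> carrier K" "f \<in> units_at (gp P)"
  shows "ord \<XX> P f = Fin 0"
proof -
  have "f \<noteq> \<zero>\<^bsub>K\<^esub>" "f \<in> regular_at (gp P)"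
    using units_at(1,3)[OF prime_divisor_generic_point(3)[OF P] f(2)] by auto
  then have "val P f = 0" using val_nonneg_iff[OF P f(1)] val_pos_iff[OF P f(1)] f(2) by auto
  then show ?thesis using ord_eq_val[OF P f(1)] \<open>f \<noteq> \<zero>\<^bsub>K\<^esub>\<close> by simp
qed

lemma finite_weight_nonzero:
  assumes v: "v \<in> carrier \<V>" "v \<noteq> \<zero>\<^bsub>\<V>\<^esub>"
  shows "finite {P. prime_divisor \<XX> P \<and> weight P v \<noteq> 0}"
proof -
  obtain f g where v_eq: "v = (f, g)" by (cases v)
  have fg: "f \<in> carrier K" "g \<in> carrier K" "f \<noteq> \<zero>\<^bsub>K\<^esub> \<or> g \<noteq> \<zero>\<^bsub>K\<^esub>" using v unfolding v_eq plane_simps by auto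
  define B where "B f = {P. prime_divisor \<XX> P \<and> f \<noteq> \<zero>\<^bsub>K\<^esub> \<and> f \<notin> units_at (gp P)}" for f
  have B: "finite (B f)" if "f \<in> carrier K" for f
    using finite_prime_divisors[OF that] unfolding B_def by (cases "f = \<zero>\<^bsub>K\<^esub>") auto
  have ord: "ord \<XX> P f = (if f = \<zero>\<^bsub>K\<^esub> then Pinf else Fin 0)" if "prime_divisor \<XX> P" "P \<notin> B f" "f \<in> carrier K"
    for P f
    using that ord_zero ord_eq_0[of P f] unfolding B_def by (cases "f = \<zero>\<^bsub>K\<^esub>") simp_all
  have "weight P v = 0" if P: "prime_divisor \<XX> P" "P \<notin> supp D \<union> B f \<union> B g" for P
    using ord[of P f] ord[of P g] P fg unfolding weight_def v_eq by (auto simp: fin_part_def)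
  then have "{P. prime_divisor \<XX> P \<and> weight P v \<noteq> 0} \<subseteq> supp D \<union> B f \<union> B g" by blast
  then show ?thesis using supp_finite B fg(1,2) by (meson finite_Un finite_subset)
qed

lemma decoration_extended_divisor:
  assumes v: "v \<in> carrier \<V>"
  shows "\<W> v \<in> extended_divisors \<XX>"
proof (cases "v = \<zero>\<^bsub>\<V>\<^esub>")
  case False
  have "{P. (if prime_divisor \<XX> P then weight P v else 0) \<noteq> 0} = {P. prime_divisor \<XX> P \<and> weight P v \<noteq> 0}"
    by auto
  then have "(\<lambda>P. if prime_divisor \<XX> P then weight P v else 0) \<in> weil_divisors \<XX>"
    unfolding weil_divisors_def using finite_weight_nonzero[OF v False] by auto
  then show ?thesis unfolding extended_divisors_def decoration_eq using False by simp
qed (simp add: extended_divisors_def decoration_eq)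

lemma smult_eq_zero_iff:
  assumes v: "v \<in> carrier \<V>" and a: "a \<in> carrier K"
  shows "a \<odot>\<^bsub>\<V>\<^esub> v = \<zero>\<^bsub>\<V>\<^esub> \<longleftrightarrow> a = \<zero>\<^bsub>K\<^esub> \<or> v = \<zero>\<^bsub>\<V>\<^esub>"
proof -
  have "fst v \<in> carrier K" "snd v \<in> carrier K" using v unfolding plane_simps by auto
  then show ?thesis using K.integral_iff[OF a] unfolding plane_simps by (auto simp: prod_eq_iff)
qed

lemma decoration_smult:
  assumes a: "a \<in> carrier K" and v: "v \<in> carrier \<V>"
  shows "\<W> (a \<odot>\<^bsub>\<V>\<^esub> v) = principal_divisor \<XX> a + \<W> v"
proof (cases "a = \<zero>\<^bsub>K\<^esub> \<or> v = \<zero>\<^bsub>\<V>\<^esub>")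
  case True
  then have "a \<odot>\<^bsub>\<V>\<^esub> v = \<zero>\<^bsub>\<V>\<^esub>" using smult_eq_zero_iff[OF v a] by blast
  then show ?thesis using True unfolding decoration_eq principal_divisor_def by auto
next
  case False
  then have nonzero_av: "a \<odot>\<^bsub>\<V>\<^esub> v \<noteq> \<zero>\<^bsub>\<V>\<^esub>" using smult_eq_zero_iff[OF v a] by blast
  have av: "a \<odot>\<^bsub>\<V>\<^esub> v \<in> carrier \<V>" using a v unfolding plane_simps by auto
  have "weight P (a \<odot>\<^bsub>\<V>\<^esub> v) = val P a + weight P v" if P: "prime_divisor \<XX> P" for P
  proof -
    have "n \<le> weight P (a \<odot>\<^bsub>\<V>\<^esub> v) \<longleftrightarrow> n \<le> val P a + weight P v" for n
      using weight_ge_iff[OF P av nonzero_av, of n] in_lattice_smult_iff[OF P v a, of "n - val P a"]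
        weight_ge_iff[OF P v, of "n - val P a"] False
      by auto
    then show ?thesis by (meson order_antisym order_refl)
  qed
  then show ?thesis using False nonzero_av unfolding decoration_eq principal_divisor_def val_def[symmetric]
    by (auto simp: fun_eq_iff)
qed

lemma decoration_add:
  assumes v: "v \<in> carrier \<V>" and w: "w \<in> carrier \<V>"
  shows "inf (\<W> v) (\<W> w) \<le> \<W> (v \<oplus>\<^bsub>\<V>\<^esub> w)"
proof -
  interpret M: Module.module K \<V> by (rule plane_is_module[OF K.cring_axioms])
  consider "v = \<zero>\<^bsub>\<V>\<^esub>" | "w = \<zero>\<^bsub>\<V>\<^esub>" | "v \<oplus>\<^bsub>\<V>\<^esub> w = \<zero>\<^bsub>\<V>\<^esub>" | (nonzero) "v \<noteq> \<zero>\<^bsub>\<V>\<^esub>" "w \<noteq> \<zero>\<^bsub>\<V>\<^esub>" "v \<oplus>\<^bsub>\<V>\<^esub> w \<noteq> \<zero>\<^bsub>\<V>\<^esub>" by blast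
  then show ?thesis
  proof cases
    case nonzero
    have "min (weight P v) (weight P w) \<le> weight P (v \<oplus>\<^bsub>\<V>\<^esub> w)" if P: "prime_divisor \<XX> P" for P
    proof -
      let ?n = "min (weight P v) (weight P w)"
      have "in_lattice P ?n v" "in_lattice P ?n w"
        using weight_ge_iff[OF P v nonzero(1), of ?n] weight_ge_iff[OF P w nonzero(2), of ?n] by auto
      then have "in_lattice P ?n (v \<oplus>\<^bsub>\<V>\<^esub> w)" by (rule in_lattice_add[OF P v w])
      then show ?thesis using weight_ge_iff[OF P _ nonzero(3)] v w by simp
    qed
    then show ?thesis using nonzero unfolding decoration_eq by (auto simp: le_fun_def inf_int_def)
  qed (use v w in \<open>simp_all add: decoration_eq\<close>)
qed

lemma pre_weil_decoration: "pre_weil_decoration \<XX> \<V> \<W>"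
  unfolding pre_weil_decoration_def
  using finite_dim_vector_space_plane[OF K_field] decoration_extended_divisor decoration_smult decoration_add
  by (auto simp: decoration_eq)

lemma nonneg_on_decoration_iff:
  assumes "v \<in> carrier \<V>"
  shows "nonneg_on \<XX> U (\<W> v) \<longleftrightarrow> (\<forall>P. prime_divisor \<XX> P \<and> P \<inter> U \<noteq> {} \<longrightarrow> in_lattice P 0 v)"
proof (cases "v = \<zero>\<^bsub>\<V>\<^esub>")
  case True
  then show ?thesis unfolding decoration_eq nonneg_on_def by (simp add: plane_simps)
next
  case False
  then show ?thesis unfolding decoration_eq nonneg_on_def using weight_ge_iff[OF _ assms False, of _ 0] by auto
qed

end

section \<open>Embedded sheaves of modules\<close>

locale module_embedding =
  fixes S :: "'a ring" and R :: "'b ring" and N :: "('a, 'm) module" and M :: "('b, 'v) module"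
    and \<phi> :: "'a \<Rightarrow> 'b" and \<iota> :: "'m \<Rightarrow> 'v"
  assumes base_cring: "cring S" and target_module: "Module.module R M" and base_hom: "\<phi> \<in> ring_hom S R"
    and zero_closed: "\<zero>\<^bsub>N\<^esub> \<in> carrier N"
    and add_closed: "\<lbrakk>x \<in> carrier N; y \<in> carrier N\<rbrakk> \<Longrightarrow> x \<oplus>\<^bsub>N\<^esub> y \<in> carrier N"
    and smult_closed: "\<lbrakk>a \<in> carrier S; x \<in> carrier N\<rbrakk> \<Longrightarrow> a \<odot>\<^bsub>N\<^esub> x \<in> carrier N"
    and emb_closed: "x \<in> carrier N \<Longrightarrow> \<iota> x \<in> carrier M"
    and emb_inj: "inj_on \<iota> (carrier N)"
    and emb_zero: "\<iota> \<zero>\<^bsub>N\<^esub> = \<zero>\<^bsub>M\<^esub>"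
    and emb_add: "\<lbrakk>x \<in> carrier N; y \<in> carrier N\<rbrakk> \<Longrightarrow> \<iota> (x \<oplus>\<^bsub>N\<^esub> y) = \<iota> x \<oplus>\<^bsub>M\<^esub> \<iota> y"
    and emb_smult: "\<lbrakk>a \<in> carrier S; x \<in> carrier N\<rbrakk> \<Longrightarrow> \<iota> (a \<odot>\<^bsub>N\<^esub> x) = \<phi> a \<odot>\<^bsub>M\<^esub> \<iota> x"
begin

lemma module: "Module.module S N"
proof -
  interpret S: cring S by (rule base_cring)
  interpret M: Module.module R M by (rule target_module)
  interpret \<phi>: ring_hom_cring S R \<phi>
    using base_hom by (simp add: ring_hom_cring_def ring_hom_cring_axioms_def S.cring_axioms M.R.cring_axioms)
  note eqI = inj_onD[OF emb_inj]
  note closed = zero_closed add_closed smult_closed emb_closed and emb = emb_zero emb_add emb_smult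
  have "abelian_group N"
  proof (rule abelian_groupI)
    fix x assume x: "x \<in> carrier N"
    have "(\<ominus>\<^bsub>S\<^esub> \<one>\<^bsub>S\<^esub>) \<odot>\<^bsub>N\<^esub> x \<oplus>\<^bsub>N\<^esub> x = \<zero>\<^bsub>N\<^esub>"
      using x M.smult_l_minus[of "\<one>\<^bsub>R\<^esub>" "\<iota> x"] by (intro eqI) (simp_all add: closed emb M.M.l_neg)
    then show "\<exists>y\<in>carrier N. y \<oplus>\<^bsub>N\<^esub> x = \<zero>\<^bsub>N\<^esub>" using closed(3)[OF _ x] by blast
  qed (rule closed eqI | simp add: closed emb M.M.a_ac)+
  then show ?thesis
    by (intro moduleI[OF base_cring])
      (rule closed eqI | simp add: closed emb M.smult_l_distr M.smult_r_distr M.smult_assoc1)+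
qed

lemma emb_combination:
  assumes a: "a \<in> A \<rightarrow> carrier S" and x: "x \<in> A \<rightarrow> carrier N" and A: "finite A"
  shows "\<iota> (\<Oplus>\<^bsub>N\<^esub>j\<in>A. a j \<odot>\<^bsub>N\<^esub> x j) = (\<Oplus>\<^bsub>M\<^esub>j\<in>A. \<phi> (a j) \<odot>\<^bsub>M\<^esub> \<iota> (x j))"
proof -
  interpret N: Module.module S N by (rule module)
  interpret M: Module.module R M by (rule target_module)
  show ?thesis
    using A a x
  proof (induction A)
    case empty
    show ?case by (simp add: emb_zero)
  next
    case (insert k A)
    have summand: "a j \<odot>\<^bsub>N\<^esub> x j \<in> carrier N" if "j \<in> insert k A" for j
      using insert.prems that smult_closed by blast
    have emb_summand: "\<phi> (a j) \<odot>\<^bsub>M\<^esub> \<iota> (x j) = \<iota> (a j \<odot>\<^bsub>N\<^esub> x j)" if "j \<in> insert k A" for j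
      using insert.prems that emb_smult by (metis Pi_mem)
    let ?s = "\<Oplus>\<^bsub>N\<^esub>j\<in>A. a j \<odot>\<^bsub>N\<^esub> x j"
    have "(\<Oplus>\<^bsub>N\<^esub>j\<in>insert k A. a j \<odot>\<^bsub>N\<^esub> x j) = a k \<odot>\<^bsub>N\<^esub> x k \<oplus>\<^bsub>N\<^esub> ?s"
      by (rule N.M.finsum_insert) (use insert.hyps summand in auto)
    moreover have "?s \<in> carrier N" using summand by (intro N.M.finsum_closed) auto
    ultimately have "\<iota> (\<Oplus>\<^bsub>N\<^esub>j\<in>insert k A. a j \<odot>\<^bsub>N\<^esub> x j) = \<phi> (a k) \<odot>\<^bsub>M\<^esub> \<iota> (x k) \<oplus>\<^bsub>M\<^esub> \<iota> ?s"
      using emb_add[OF summand[of k]] emb_summand[of k] by simp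
    also have "\<iota> ?s = (\<Oplus>\<^bsub>M\<^esub>j\<in>A. \<phi> (a j) \<odot>\<^bsub>M\<^esub> \<iota> (x j))"
      by (rule insert.IH) (use insert.prems in auto)
    also have "\<phi> (a k) \<odot>\<^bsub>M\<^esub> \<iota> (x k) \<oplus>\<^bsub>M\<^esub> \<dots> = (\<Oplus>\<^bsub>M\<^esub>j\<in>insert k A. \<phi> (a j) \<odot>\<^bsub>M\<^esub> \<iota> (x j))"
      by (rule M.finsum_insert[symmetric]) (use insert.hyps emb_summand summand emb_closed in auto)
    finally show ?case .
  qed
qed

end

context normal_noetherian
begin

lemma regular_at_finite_open:
  assumes V: "open_set V" "y \<in> V" and J: "finite J" and c: "c \<in> J \<rightarrow> regular_at y"
  obtains W where "open_set W" "y \<in> W" "W \<subseteq> V" "c \<in> J \<rightarrow> regular_on W"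
  using J c V
proof (induction J arbitrary: V thesis)
  case empty
  then show ?case by blast
next
  case (insert j J)
  obtain W where W: "open_set W" "y \<in> W" "W \<subseteq> V" "c \<in> J \<rightarrow> regular_on W"
    by (rule insert.IH[OF _ _ insert.prems(3,4)]) (use insert.prems(2) in auto)
  have cj: "c j \<in> regular_at y" using insert.prems by blast
  obtain W' where W': "open_set W'" "y \<in> W'" "W' \<subseteq> W" "c j \<in> regular_on W'"
    by (rule regular_at_common_open[OF cj cj W(1,2)])
  have "regular_on W \<subseteq> regular_on W'" by (rule regular_on_mono[OF W(1) W'(1,3)]) (use W'(2) in blast)
  then have "c \<in> insert j J \<rightarrow> regular_on W'" using W(4) W'(4) by blast
  then show ?case using insert.prems(1)[OF W'(1,2)] W(3) W'(3) by blast
qed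

lemma ex_sections_near:
  assumes V: "open_set V" "y \<in> V" and J: "finite J" "c \<in> J \<rightarrow> regular_at y"
  obtains W a where "open_set W" "y \<in> W" "W \<subseteq> V" "a \<in> J \<rightarrow> carrier (sections \<XX> W)"
    "\<And>j. j \<in> J \<Longrightarrow> section_to_K \<XX> W (a j) = c j"
proof -
  obtain W where W: "open_set W" "y \<in> W" "W \<subseteq> V" "c \<in> J \<rightarrow> regular_on W"
    by (rule regular_at_finite_open[OF V J])
  then have "\<forall>j\<in>J. \<exists>a. a \<in> carrier (sections \<XX> W) \<and> section_to_K \<XX> W a = c j"
    unfolding regular_on_def by fastforce
  from bchoice[OF this] show ?thesis using that[OF W(1-3)] by blast
qed

lemma common_denominator:
  assumes U: "noetherian_affine U" "y \<in> U" and J: "finite J" "c \<in> J \<rightarrow> regular_at y"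
  shows "\<exists>b\<in>regular_on U. b \<in> units_at y \<and> (\<forall>j\<in>J. b \<otimes>\<^bsub>K\<^esub> c j \<in> regular_on U)"
proof -
  note affine = noetherian_affineD[OF U(1)]
  have y: "y \<in> points" using U(2) affine(4) by blast
  show ?thesis
    using J
  proof (induction J)
    case empty
    show ?case using subringE(3)[OF affine(5)] units_at(6)[OF y] by blast
  next
    case (insert j J)
    then obtain b where b: "b \<in> regular_on U" "b \<in> units_at y" "\<forall>j\<in>J. b \<otimes>\<^bsub>K\<^esub> c j \<in> regular_on U" by auto
    have cj: "c j \<in> regular_at y" using insert.prems by blast
    obtain d where d: "d \<in> regular_on U" "d \<in> units_at y" "d \<otimes>\<^bsub>K\<^esub> c j \<in> regular_on U"
      using affine_regular_at_fraction[OF affine(1) U(2) cj] by blast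
    have carrier: "b \<in> carrier K" "d \<in> carrier K" using units_at(2)[OF y] b(2) d(2) by blast+
    have "b \<otimes>\<^bsub>K\<^esub> d \<otimes>\<^bsub>K\<^esub> c i \<in> regular_on U" if i: "i \<in> insert j J" for i
    proof -
      have "c i \<in> carrier K" using regular_at_carrier[OF y] insert.prems i by blast
      then have "b \<otimes>\<^bsub>K\<^esub> d \<otimes>\<^bsub>K\<^esub> c i = b \<otimes>\<^bsub>K\<^esub> (d \<otimes>\<^bsub>K\<^esub> c i)" "b \<otimes>\<^bsub>K\<^esub> d \<otimes>\<^bsub>K\<^esub> c i = d \<otimes>\<^bsub>K\<^esub> (b \<otimes>\<^bsub>K\<^esub> c i)"
        using carrier by (simp_all add: K.m_assoc K.m_lcomm)
      then show ?thesis using subringE(6)[OF affine(5)] b(1,3) d(1,3) i by (metis insertE)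
    qed
    then show ?case using subringE(6)[OF affine(5) b(1) d(1)] units_at(5)[OF y b(2) d(2)] by blast
  qed
qed

end

locale embedded_sheaf = normal_noetherian \<XX> for \<XX> :: "('x, 'a) rspace" +
  fixes M :: "(('x set \<times> 'a) set, 'v) module" and F :: "('x, 'a, 'm) mod_sheaf" and \<iota> :: "'x set \<Rightarrow> 'm \<Rightarrow> 'v"
    and U :: "'x set"
  assumes open_U: "open_set U"
    and embedding: "\<lbrakk>open_set V; V \<noteq> {}; V \<subseteq> U\<rbrakk> \<Longrightarrow>
      module_embedding (sections \<XX> V) (function_field \<XX>) (msections F V) M (section_to_K \<XX> V) (\<iota> V)"
    and mrestr_closed: "\<lbrakk>open_set V; open_set W; W \<noteq> {}; W \<subseteq> V; V \<subseteq> U; t \<in> carrier (msections F V)\<rbrakk> \<Longrightarrow>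
      mrestr F V W t \<in> carrier (msections F W)"
    and emb_mrestr: "\<lbrakk>open_set V; open_set W; W \<noteq> {}; W \<subseteq> V; V \<subseteq> U; t \<in> carrier (msections F V)\<rbrakk> \<Longrightarrow>
      \<iota> W (mrestr F V W t) = \<iota> V t"
begin

lemma lin_comb_emb:
  assumes V: "open_set V" "V \<subseteq> U" and W: "open_set W" "W \<noteq> {}" "W \<subseteq> V"
    and s: "s \<in> {..<n} \<rightarrow> carrier (msections F V)" and a: "a \<in> {..<n} \<rightarrow> carrier (sections \<XX> W)"
  shows "lin_comb F V n s W a \<in> carrier (msections F W)"
    "\<iota> W (lin_comb F V n s W a) = (\<Oplus>\<^bsub>M\<^esub>j\<in>{..<n}. section_to_K \<XX> W (a j) \<odot>\<^bsub>M\<^esub> \<iota> V (s j))"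
proof -
  interpret W: module_embedding "sections \<XX> W" K "msections F W" M "section_to_K \<XX> W" "\<iota> W"
    by (rule embedding[OF W(1,2)]) (use V(2) W(3) in blast)
  interpret N: Module.module "sections \<XX> W" "msections F W" by (rule W.module)
  interpret M: Module.module K M by (rule W.target_module)
  have sW: "mrestr F V W (s j) \<in> carrier (msections F W)" "\<iota> W (mrestr F V W (s j)) = \<iota> V (s j)" if "j \<in> {..<n}"
    for j
    using mrestr_closed[OF V(1) W V(2)] emb_mrestr[OF V(1) W V(2)] s that by blast+
  show "lin_comb F V n s W a \<in> carrier (msections F W)"
    unfolding lin_comb_def using sW(1) a by (intro N.M.finsum_closed) auto
  have "\<iota> W (lin_comb F V n s W a) =
      (\<Oplus>\<^bsub>M\<^esub>j\<in>{..<n}. section_to_K \<XX> W (a j) \<odot>\<^bsub>M\<^esub> \<iota> W (mrestr F V W (s j)))"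
    unfolding lin_comb_def by (rule W.emb_combination[OF a]) (use sW(1) in auto)
  also have "\<dots> = (\<Oplus>\<^bsub>M\<^esub>j\<in>{..<n}. section_to_K \<XX> W (a j) \<odot>\<^bsub>M\<^esub> \<iota> V (s j))"
  proof (rule M.M.finsum_cong'[OF refl])
    show "(\<lambda>j. section_to_K \<XX> W (a j) \<odot>\<^bsub>M\<^esub> \<iota> V (s j)) \<in> {..<n} \<rightarrow> carrier M"
      using W.emb_closed[OF sW(1)] sW(2) ring_hom_closed[OF W.base_hom] a by (auto simp: Pi_iff)
  qed (use sW(2) in simp)
  finally show "\<iota> W (lin_comb F V n s W a) = (\<Oplus>\<^bsub>M\<^esub>j\<in>{..<n}. section_to_K \<XX> W (a j) \<odot>\<^bsub>M\<^esub> \<iota> V (s j))" .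
qed

lemma generated_over_of_combinations:
  assumes V: "open_set V" "V \<subseteq> U" and s: "s \<in> {..<n} \<rightarrow> carrier (msections F V)"
    and combination: "\<And>V' t y. \<lbrakk>open_set V'; V' \<subseteq> V; t \<in> carrier (msections F V'); y \<in> V'\<rbrakk> \<Longrightarrow>
      \<exists>c\<in>{..<n} \<rightarrow> regular_at y. \<iota> V' t = (\<Oplus>\<^bsub>M\<^esub>j\<in>{..<n}. c j \<odot>\<^bsub>M\<^esub> \<iota> V (s j))"
  shows "generated_over (open_subspace \<XX> U) F V n s"
  unfolding generated_over_def
proof (intro allI impI, elim conjE)
  have top: "openin (topol (open_subspace \<XX> U)) W \<longleftrightarrow> open_set W \<and> W \<subseteq> U" for W
    using openin_open_subtopology[OF open_U] by (simp add: open_subspace_def)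
  have sections: "sections (open_subspace \<XX> U) = sections \<XX>" by (simp add: open_subspace_def)
  fix V' t y
  assume "openin (topol (open_subspace \<XX> U)) V'" and V': "V' \<subseteq> V" and t: "t \<in> carrier (msections F V')"
    and y: "y \<in> V'"
  then have open_V': "open_set V'" and V'U: "V' \<subseteq> U" unfolding top by auto
  obtain c where c: "c \<in> {..<n} \<rightarrow> regular_at y" "\<iota> V' t = (\<Oplus>\<^bsub>M\<^esub>j\<in>{..<n}. c j \<odot>\<^bsub>M\<^esub> \<iota> V (s j))"
    using combination[OF open_V' V' t y] by blast
  obtain W a where W: "open_set W" "y \<in> W" "W \<subseteq> V'" and a: "a \<in> {..<n} \<rightarrow> carrier (sections \<XX> W)"
    and section_a: "\<And>j. j \<in> {..<n} \<Longrightarrow> section_to_K \<XX> W (a j) = c j"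
    by (rule ex_sections_near[OF open_V' y finite_lessThan c(1)], rule that)
  have WV: "W \<noteq> {}" "W \<subseteq> V" "W \<subseteq> U" using W(2,3) V' V(2) by auto
  interpret W: module_embedding "sections \<XX> W" K "msections F W" M "section_to_K \<XX> W" "\<iota> W"
    by (rule embedding[OF W(1) WV(1,3)])
  interpret V: module_embedding "sections \<XX> V" K "msections F V" M "section_to_K \<XX> V" "\<iota> V"
    by (rule embedding[OF V(1) _ V(2)]) (use WV in blast)
  interpret M: Module.module K M by (rule W.target_module)
  note comb = lin_comb_emb[OF V W(1) WV(1,2) s a]
  have "\<iota> W (lin_comb F V n s W a) = (\<Oplus>\<^bsub>M\<^esub>j\<in>{..<n}. section_to_K \<XX> W (a j) \<odot>\<^bsub>M\<^esub> \<iota> V (s j))" by (rule comb(2))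
  also have "\<dots> = (\<Oplus>\<^bsub>M\<^esub>j\<in>{..<n}. c j \<odot>\<^bsub>M\<^esub> \<iota> V (s j))"
  proof (rule M.M.finsum_cong'[OF refl])
    have "c j \<in> carrier K" if "j \<in> {..<n}" for j
      using section_a[OF that] ring_hom_closed[OF W.base_hom funcset_mem[OF a that]] by simp
    then show "(\<lambda>j. c j \<odot>\<^bsub>M\<^esub> \<iota> V (s j)) \<in> {..<n} \<rightarrow> carrier M" using V.emb_closed s by (simp add: Pi_iff)
  qed (use section_a in simp)
  also have "\<dots> = \<iota> W (mrestr F V' W t)" using emb_mrestr[OF open_V' W(1) WV(1) W(3) V'U t] c(2) by simp
  finally have "mrestr F V' W t = lin_comb F V n s W a"
    using inj_onD[OF W.emb_inj] comb(1) mrestr_closed[OF open_V' W(1) WV(1) W(3) V'U t] by simp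
  then show "\<exists>W a. openin (topol (open_subspace \<XX> U)) W \<and> y \<in> W \<and> W \<subseteq> V' \<and>
      a \<in> {..<n} \<rightarrow> carrier (sections (open_subspace \<XX> U) W) \<and> mrestr F V' W t = lin_comb F V n s W a"
    unfolding top sections using W WV(3) a by blast
qed

lemma generated_over_of_finitely_generated:
  assumes A: "noetherian_affine A" and V: "V = U \<inter> A" "V \<noteq> {}"
    and N: "N \<subseteq> \<iota> V ` carrier (msections F V)" "finitely_generated (K\<lparr>carrier := regular_on A\<rparr>) M N"
    and denominator: "\<And>V' t y. \<lbrakk>open_set V'; V' \<subseteq> V; t \<in> carrier (msections F V'); y \<in> V'\<rbrakk> \<Longrightarrow>
      \<exists>b\<in>units_at y. b \<odot>\<^bsub>M\<^esub> \<iota> V' t \<in> N"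
  obtains n s where "s \<in> {..<n} \<rightarrow> carrier (msections F V)" "generated_over (open_subspace \<XX> U) F V n s"
proof -
  note affine = noetherian_affineD[OF A]
  have open_V: "open_set V" and VU: "V \<subseteq> U" and VA: "V \<subseteq> A" using V(1) open_U affine(2) by auto
  interpret V: module_embedding "sections \<XX> V" K "msections F V" M "section_to_K \<XX> V" "\<iota> V"
    by (rule embedding[OF open_V V(2) VU])
  interpret M: Module.module K M by (rule V.target_module)
  interpret A: Module.module "K\<lparr>carrier := regular_on A\<rparr>" M by (rule M.restrict_scalars[OF affine(5)])
  have NM: "N \<subseteq> carrier M" using N(1) V.emb_closed by blast
  obtain n :: nat and g where g: "g \<in> {..<n} \<rightarrow> N"
    and gen: "\<And>v. v \<in> N \<Longrightarrow> \<exists>c\<in>{..<n} \<rightarrow> regular_on A. v = (\<Oplus>\<^bsub>M\<^esub>j\<in>{..<n}. c j \<odot>\<^bsub>M\<^esub> g j)"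
    by (rule A.finitely_generated_combinations[OF NM N(2)], rule that) simp_all
  have "\<forall>j\<in>{..<n}. \<exists>t. t \<in> carrier (msections F V) \<and> \<iota> V t = g j" using g N(1) by fastforce
  from bchoice[OF this] obtain s where s: "s \<in> {..<n} \<rightarrow> carrier (msections F V)" "\<And>j. j < n \<Longrightarrow> \<iota> V (s j) = g j"
    by auto
  have "generated_over (open_subspace \<XX> U) F V n s"
  proof (rule generated_over_of_combinations[OF open_V VU s(1)])
    fix V' t y assume V': "open_set V'" "V' \<subseteq> V" and t: "t \<in> carrier (msections F V')" and y: "y \<in> V'"
    have yA: "y \<in> A" "y \<in> points" using y V'(2) VA affine(4) by auto
    interpret V': module_embedding "sections \<XX> V'" K "msections F V'" M "section_to_K \<XX> V'" "\<iota> V'"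
      by (rule embedding[OF V'(1)]) (use y V'(2) VU in auto)
    have tM: "\<iota> V' t \<in> carrier M" by (rule V'.emb_closed[OF t])
    obtain b where b: "b \<in> units_at y" "b \<odot>\<^bsub>M\<^esub> \<iota> V' t \<in> N" using denominator[OF V' t y] by blast
    then obtain c where c: "c \<in> {..<n} \<rightarrow> regular_on A" "b \<odot>\<^bsub>M\<^esub> \<iota> V' t = (\<Oplus>\<^bsub>M\<^esub>j\<in>{..<n}. c j \<odot>\<^bsub>M\<^esub> g j)"
      using gen by blast
    have bU: "b \<in> Units K" using units_at(2,3)[OF yA(2) b(1)] K.field_Units by simp
    have c_regular: "c \<in> {..<n} \<rightarrow> regular_at y"
      using c(1) regular_on_subset_regular_at[OF affine(2) yA(1)] by blast
    then have cg: "c \<in> {..<n} \<rightarrow> carrier K" "g \<in> {..<n} \<rightarrow> carrier M"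
      using regular_at_carrier[OF yA(2)] g NM by blast+
    have "\<iota> V' t = (\<Oplus>\<^bsub>M\<^esub>j\<in>{..<n}. (inv\<^bsub>K\<^esub> b \<otimes>\<^bsub>K\<^esub> c j) \<odot>\<^bsub>M\<^esub> g j)"
      by (rule M.Units_smult_eq_combination[OF finite_lessThan bU tM cg c(2)])
    also have "\<dots> = (\<Oplus>\<^bsub>M\<^esub>j\<in>{..<n}. (inv\<^bsub>K\<^esub> b \<otimes>\<^bsub>K\<^esub> c j) \<odot>\<^bsub>M\<^esub> \<iota> V (s j))"
      by (rule M.M.finsum_cong') (use bU cg s(2) in \<open>auto simp: Pi_iff\<close>)
    finally show "\<exists>c\<in>{..<n} \<rightarrow> regular_at y. \<iota> V' t = (\<Oplus>\<^bsub>M\<^esub>j\<in>{..<n}. c j \<odot>\<^bsub>M\<^esub> \<iota> V (s j))"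
      using subringE(6)[OF regular_at_subring[OF yA(2)] units_at(1)[OF yA(2) units_at(4)[OF yA(2) b(1)]]]
        c_regular
      by (intro bexI[of _ "\<lambda>j. inv\<^bsub>K\<^esub> b \<otimes>\<^bsub>K\<^esub> c j"]) auto
  qed
  then show ?thesis using that s(1) by blast
qed

end

lemma submodule_relations:
  fixes R :: "'b ring" and M :: "('b, 'v) module"
  assumes M: "Module.module R M" and g: "g \<in> {..<n} \<rightarrow> carrier M"
  shows "submodule {c \<in> carrier (free_module R n). (\<Oplus>\<^bsub>M\<^esub>j\<in>{..<n}. c j \<odot>\<^bsub>M\<^esub> g j) = \<zero>\<^bsub>M\<^esub>} R (free_module R n)"
    (is "submodule ?L R ?F")
proof -
  interpret M: Module.module R M by (rule M)
  interpret F: Module.module R ?F by (rule free_module_is_module) (rule M.R.cring_axioms)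
  let ?comb = "\<lambda>c. \<Oplus>\<^bsub>M\<^esub>j\<in>{..<n}. c j \<odot>\<^bsub>M\<^esub> g j"
  have coeff: "c \<in> {..<n} \<rightarrow> carrier R" if "c \<in> carrier ?F" for c using that unfolding free_module_simps by blast
  have summand: "(\<lambda>j. c j \<odot>\<^bsub>M\<^esub> g j) \<in> {..<n} \<rightarrow> carrier M" if "c \<in> carrier ?F" for c using coeff[OF that] g by auto
  have smult: "a \<odot>\<^bsub>?F\<^esub> c \<in> ?L" if a: "a \<in> carrier R" and c: "c \<in> ?L" for a c
  proof -
    have free: "c \<in> carrier ?F" using c by blast
    have "?comb (a \<odot>\<^bsub>?F\<^esub> c) = (\<Oplus>\<^bsub>M\<^esub>j\<in>{..<n}. a \<odot>\<^bsub>M\<^esub> (c j \<odot>\<^bsub>M\<^esub> g j))"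
      by (rule M.M.finsum_cong') (use a coeff[OF free] g
        in \<open>auto simp: free_module_simps M.smult_assoc1 Pi_iff\<close>)
    also have "\<dots> = a \<odot>\<^bsub>M\<^esub> ?comb c" by (rule M.finsum_smult_ldistr[symmetric, OF _ a summand[OF free]]) simp
    finally show ?thesis using a c by simp
  qed
  show ?thesis
  proof (rule F.submoduleI)
    have "?comb \<zero>\<^bsub>?F\<^esub> = \<zero>\<^bsub>M\<^esub>"
      using g by (intro M.M.add.finprod_one_eqI) (auto simp: free_module_simps Pi_iff)
    then show "\<zero>\<^bsub>?F\<^esub> \<in> ?L" by simp
    show "\<ominus>\<^bsub>?F\<^esub> c \<in> ?L" if "c \<in> ?L" for c
      using smult[OF M.R.a_inv_closed[OF M.R.one_closed] that] F.smult_l_minus[of "\<one>\<^bsub>R\<^esub>" c] that by simp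
    show "c \<oplus>\<^bsub>?F\<^esub> d \<in> ?L" if "c \<in> ?L" "d \<in> ?L" for c d
    proof -
      have free: "c \<in> carrier ?F" "d \<in> carrier ?F" using that by auto
      have "?comb (c \<oplus>\<^bsub>?F\<^esub> d) = (\<Oplus>\<^bsub>M\<^esub>j\<in>{..<n}. c j \<odot>\<^bsub>M\<^esub> g j \<oplus>\<^bsub>M\<^esub> d j \<odot>\<^bsub>M\<^esub> g j)"
        by (rule M.M.finsum_cong') (use coeff[OF free(1)] coeff[OF free(2)] g
          in \<open>auto simp: free_module_simps M.smult_l_distr Pi_iff\<close>)
      also have "\<dots> = ?comb c \<oplus>\<^bsub>M\<^esub> ?comb d" by (rule M.M.finsum_addf[OF summand[OF free(1)] summand[OF free(2)]])
      finally show ?thesis using that by simp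
    qed
  qed (use smult in auto)
qed

locale embedded_sheaf_sections = embedded_sheaf \<XX> M F \<iota> U
  for \<XX> :: "('x, 'a) rspace" and M :: "(('x set \<times> 'a) set, 'v) module" and F :: "('x, 'a, 'm) mod_sheaf"
    and \<iota> U +
  fixes n :: nat and s :: "nat \<Rightarrow> 'm"
  assumes U_nonempty: "U \<noteq> {}" and sections: "s \<in> {..<n} \<rightarrow> carrier (msections F U)"
begin

abbreviation "relations_sheaf \<equiv> relation_sheaf \<XX> F U n s"

definition coordinates :: "'x set \<Rightarrow> (nat \<Rightarrow> 'a) \<Rightarrow> nat \<Rightarrow> ('x set \<times> 'a) set" where
  "coordinates V t = (\<lambda>i\<in>{..<n}. section_to_K \<XX> V (t i))"

definition relations :: "(nat \<Rightarrow> ('x set \<times> 'a) set) set" where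
  "relations = {c \<in> carrier (free_module K n). (\<Oplus>\<^bsub>M\<^esub>j\<in>{..<n}. c j \<odot>\<^bsub>M\<^esub> \<iota> U (s j)) = \<zero>\<^bsub>M\<^esub>}"

lemma relations_submodule: "submodule relations K (free_module K n)"
proof -
  interpret U: module_embedding "sections \<XX> U" K "msections F U" M "section_to_K \<XX> U" "\<iota> U"
    by (rule embedding[OF open_U U_nonempty subset_refl])
  show ?thesis
    unfolding relations_def
    by (rule submodule_relations[OF U.target_module]) (use sections U.emb_closed in auto)
qed

lemma relation_sheaf_simps:
  "\<zero>\<^bsub>msections relations_sheaf V\<^esub> = (\<lambda>i\<in>{..<n}. \<zero>\<^bsub>sections \<XX> V\<^esub>)"
  "a \<oplus>\<^bsub>msections relations_sheaf V\<^esub> b = (\<lambda>i\<in>{..<n}. a i \<oplus>\<^bsub>sections \<XX> V\<^esub> b i)"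
  "c \<odot>\<^bsub>msections relations_sheaf V\<^esub> a = (\<lambda>i\<in>{..<n}. c \<otimes>\<^bsub>sections \<XX> V\<^esub> a i)"
  "mrestr relations_sheaf V W a = (\<lambda>i\<in>{..<n}. restr \<XX> V W (a i))"
  unfolding relation_sheaf_def by simp_all

lemma relation_sheaf_carrier:
  assumes V: "open_set V" "V \<noteq> {}" "V \<subseteq> U"
  shows "carrier (msections relations_sheaf V) =
    {t \<in> {..<n} \<rightarrow>\<^sub>E carrier (sections \<XX> V). coordinates V t \<in> relations}"
proof -
  interpret V: module_embedding "sections \<XX> V" K "msections F V" M "section_to_K \<XX> V" "\<iota> V"
    by (rule embedding[OF V])
  interpret M: Module.module K M by (rule V.target_module)
  interpret U: module_embedding "sections \<XX> U" K "msections F U" M "section_to_K \<XX> U" "\<iota> U"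
    by (rule embedding[OF open_U U_nonempty subset_refl])
  have "lin_comb F U n s V t = \<zero>\<^bsub>msections F V\<^esub> \<longleftrightarrow> coordinates V t \<in> relations"
    if t: "t \<in> {..<n} \<rightarrow>\<^sub>E carrier (sections \<XX> V)" for t
  proof -
    have t': "t \<in> {..<n} \<rightarrow> carrier (sections \<XX> V)" using t by blast
    note comb = lin_comb_emb[OF open_U subset_refl V sections t']
    have tK: "coordinates V t \<in> carrier (free_module K n)"
      using t' ring_hom_closed[OF V.base_hom] unfolding coordinates_def free_module_simps by auto
    have "lin_comb F U n s V t = \<zero>\<^bsub>msections F V\<^esub> \<longleftrightarrow> \<iota> V (lin_comb F U n s V t) = \<zero>\<^bsub>M\<^esub>"
      using inj_on_eq_iff[OF V.emb_inj comb(1) V.zero_closed] V.emb_zero by simp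
    also have "\<iota> V (lin_comb F U n s V t) = (\<Oplus>\<^bsub>M\<^esub>j\<in>{..<n}. section_to_K \<XX> V (t j) \<odot>\<^bsub>M\<^esub> \<iota> U (s j))" by (rule comb(2))
    also have "\<dots> = (\<Oplus>\<^bsub>M\<^esub>j\<in>{..<n}. coordinates V t j \<odot>\<^bsub>M\<^esub> \<iota> U (s j))"
    proof (rule M.M.finsum_cong'[OF refl])
      show "(\<lambda>j. coordinates V t j \<odot>\<^bsub>M\<^esub> \<iota> U (s j)) \<in> {..<n} \<rightarrow> carrier M"
        using tK sections U.emb_closed unfolding free_module_simps by (auto simp: Pi_iff PiE_iff)
    qed (simp add: coordinates_def)
    finally show ?thesis using tK unfolding relations_def by simp
  qed
  then show ?thesis unfolding relation_sheaf_def by auto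
qed

lemma relation_sheaf_embedding:
  assumes V: "open_set V" "V \<noteq> {}" "V \<subseteq> U"
  shows "module_embedding (sections \<XX> V) K (msections relations_sheaf V) (free_module K n) (section_to_K \<XX> V) (coordinates V)"
proof -
  interpret R: cring "sections \<XX> V" by (rule cring_sections[OF V(1)])
  interpret h: ring_hom_cring "sections \<XX> V" K "section_to_K \<XX> V"
    by unfold_locales (rule section_to_K_hom[OF V(1,2)])
  interpret F: Module.module K "free_module K n" by (rule free_module_is_module) (rule K.cring_axioms)
  note submod = F.submoduleE[OF relations_submodule]
  let ?N = "msections relations_sheaf V"
  have N: "t \<in> carrier ?N \<longleftrightarrow> t \<in> {..<n} \<rightarrow>\<^sub>E carrier (sections \<XX> V) \<and> coordinates V t \<in> relations" for t
    unfolding relation_sheaf_carrier[OF V] by blast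
  have mem: "t i \<in> carrier (sections \<XX> V)" if "t \<in> carrier ?N" "i < n" for t i using that unfolding N by blast
  have zero: "coordinates V \<zero>\<^bsub>?N\<^esub> = \<zero>\<^bsub>free_module K n\<^esub>"
    unfolding coordinates_def free_module_simps relation_sheaf_simps by (intro restrict_ext) simp
  have add: "coordinates V (x \<oplus>\<^bsub>?N\<^esub> y) = coordinates V x \<oplus>\<^bsub>free_module K n\<^esub> coordinates V y"
    if "x \<in> carrier ?N" "y \<in> carrier ?N" for x y
    unfolding coordinates_def free_module_simps relation_sheaf_simps
    by (intro restrict_ext) (use mem[OF that(1)] mem[OF that(2)] in simp)
  have smult: "coordinates V (a \<odot>\<^bsub>?N\<^esub> x) = section_to_K \<XX> V a \<odot>\<^bsub>free_module K n\<^esub> coordinates V x"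
    if "a \<in> carrier (sections \<XX> V)" "x \<in> carrier ?N" for a x
    unfolding coordinates_def free_module_simps relation_sheaf_simps
    by (intro restrict_ext) (use that(1) mem[OF that(2)] in simp)
  show ?thesis
  proof (unfold_locales, unfold zero)
    show "inj_on (coordinates V) (carrier ?N)"
    proof (rule inj_onI)
      fix x y assume xy: "x \<in> carrier ?N" "y \<in> carrier ?N" "coordinates V x = coordinates V y"
      have "x i = y i" if "i < n" for i
        using fun_cong[OF xy(3), of i] that inj_onD[OF section_to_K_inj[OF V(1,2)]] mem[OF xy(1)] mem[OF xy(2)]
        unfolding coordinates_def by simp
      then show "x = y" using xy(1,2) unfolding N by (intro PiE_ext[of x "{..<n}" _ y]) auto
    qed
    show "\<zero>\<^bsub>?N\<^esub> \<in> carrier ?N"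
      unfolding N zero using F.submodule_zero[OF relations_submodule] by (simp add: relation_sheaf_simps)
    show "x \<oplus>\<^bsub>?N\<^esub> y \<in> carrier ?N" if "x \<in> carrier ?N" "y \<in> carrier ?N" for x y
      using that mem add[OF that] submod(5) unfolding N[of "x \<oplus>\<^bsub>?N\<^esub> y"] by (auto simp: relation_sheaf_simps N)
    show "a \<odot>\<^bsub>?N\<^esub> x \<in> carrier ?N" if "a \<in> carrier (sections \<XX> V)" "x \<in> carrier ?N" for a x
      using that mem smult[OF that] submod(4) unfolding N[of "a \<odot>\<^bsub>?N\<^esub> x"] by (auto simp: relation_sheaf_simps N)
    show "coordinates V x \<in> carrier (free_module K n)" if "x \<in> carrier ?N" for x
      using that submod(1) unfolding N by blast
  qed (use section_to_K_hom[OF V(1,2)] add smult in simp_all)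
qed

lemma coordinates_mrestr:
  assumes V: "open_set V" and W: "open_set W" "W \<noteq> {}" "W \<subseteq> V" and VU: "V \<subseteq> U"
    and t: "t \<in> carrier (msections relations_sheaf V)"
  shows "coordinates W (mrestr relations_sheaf V W t) = coordinates V t"
    "mrestr relations_sheaf V W t \<in> carrier (msections relations_sheaf W)"
proof -
  have t': "t \<in> {..<n} \<rightarrow>\<^sub>E carrier (sections \<XX> V)" "coordinates V t \<in> relations"
    using t W(2,3) relation_sheaf_carrier[OF V _ VU] by auto
  show coord: "coordinates W (mrestr relations_sheaf V W t) = coordinates V t"
    unfolding coordinates_def relation_sheaf_simps
    by (intro restrict_ext) (use t'(1) section_to_K_restr[OF V W(1,3,2)] in auto)
  have "mrestr relations_sheaf V W t \<in> {..<n} \<rightarrow>\<^sub>E carrier (sections \<XX> W)"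
    unfolding relation_sheaf_simps using t'(1) restr_closed[OF V W(1,3)] by auto
  then show "mrestr relations_sheaf V W t \<in> carrier (msections relations_sheaf W)"
    using relation_sheaf_carrier[OF W(1,2) subset_trans[OF W(3) VU]] t'(2) coord by simp
qed

sublocale relations_sheaf: embedded_sheaf \<XX> "free_module K n" relations_sheaf coordinates U
proof (intro embedded_sheaf.intro embedded_sheaf_axioms.intro)
  show "normal_noetherian \<XX>" by (rule normal_noetherian_axioms)
qed (fact open_U relation_sheaf_embedding coordinates_mrestr)+

lemma finitely_generated_regular_relations:
  assumes A: "noetherian_affine A"
  shows "finitely_generated (K\<lparr>carrier := regular_on A\<rparr>) (free_module K n) {c \<in> relations. \<forall>i<n. c i \<in> regular_on A}"
    (is "finitely_generated ?A ?F ?N")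
proof -
  note affine = noetherian_affineD[OF A]
  interpret F: Module.module K ?F by (rule free_module_is_module) (rule K.cring_axioms)
  interpret A: Module.module ?A ?F by (rule F.restrict_scalars[OF affine(5)])
  note submod = F.submoduleE[OF relations_submodule] and sub = subringE[OF affine(5)]
  have smult: "a \<odot>\<^bsub>?F\<^esub> c \<in> ?N" if "a \<in> regular_on A" "c \<in> ?N" for a c
    using that submod(4) sub(1,6) by (auto simp: free_module_simps)
  have "submodule ?N ?A ?F"
  proof (rule A.submoduleI)
    show "?N \<subseteq> carrier ?F" using submod(1) by blast
    show "\<zero>\<^bsub>?F\<^esub> \<in> ?N" using F.submodule_zero[OF relations_submodule] sub(2) by (simp add: free_module_simps)
    show "\<ominus>\<^bsub>?F\<^esub> c \<in> ?N" if "c \<in> ?N" for c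
      using smult[OF sub(5)[OF sub(3)] that] F.smult_l_minus[of "\<one>\<^bsub>K\<^esub>" c] that submod(1) by auto
    show "c \<oplus>\<^bsub>?F\<^esub> d \<in> ?N" if "c \<in> ?N" "d \<in> ?N" for c d
      using that submod(5) sub(7) by (auto simp: free_module_simps)
  qed (use smult in simp)
  then show ?thesis
  proof (rule A.finitely_generated_by_coordinates[OF affine(6), where n = n and \<phi> = "\<lambda>i c. c i"])
    fix c assume c: "c \<in> ?N" "\<forall>i<n. c i = \<zero>\<^bsub>?A\<^esub>"
    show "c = \<zero>\<^bsub>?F\<^esub>"
    proof (rule PiE_ext)
      show "c \<in> {..<n} \<rightarrow>\<^sub>E carrier K" "\<zero>\<^bsub>?F\<^esub> \<in> {..<n} \<rightarrow>\<^sub>E carrier K"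
        using c(1) submod(1) F.M.zero_closed unfolding free_module_simps by blast+
    qed (use c(2) in \<open>simp add: free_module_simps\<close>)
  qed (simp_all add: free_module_simps)
qed

lemma relations_denominator:
  assumes A: "noetherian_affine A" and V: "open_set V" "V \<subseteq> U \<inter> A" "y \<in> V"
    and t: "t \<in> carrier (msections relations_sheaf V)"
  shows "\<exists>b\<in>units_at y. b \<odot>\<^bsub>free_module K n\<^esub> coordinates V t \<in> {c \<in> relations. \<forall>i<n. c i \<in> regular_on A}"
proof -
  note affine = noetherian_affineD[OF A]
  interpret F: Module.module K "free_module K n" by (rule free_module_is_module) (rule K.cring_axioms)
  have yA: "y \<in> A" "y \<in> points" using V(2,3) affine(4) by auto
  have t': "t \<in> {..<n} \<rightarrow>\<^sub>E carrier (sections \<XX> V)" "coordinates V t \<in> relations"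
    using t V relation_sheaf_carrier[OF V(1)] by auto
  have "section_to_K \<XX> V (t i) \<in> regular_at y" if "i < n" for i
    using regular_on_subset_regular_at[OF V(1,3)] t'(1) that unfolding regular_on_def by blast
  then have "coordinates V t \<in> {..<n} \<rightarrow> regular_at y" unfolding coordinates_def by simp
  then obtain b where b: "b \<in> units_at y" "\<forall>i\<in>{..<n}. b \<otimes>\<^bsub>K\<^esub> coordinates V t i \<in> regular_on A"
    using common_denominator[OF A yA(1) finite_lessThan] by blast
  then have "b \<odot>\<^bsub>free_module K n\<^esub> coordinates V t \<in> relations"
    using F.submoduleE(4)[OF relations_submodule units_at(2)[OF yA(2)] t'(2)] by blast
  then show ?thesis using b by (intro bexI[of _ b]) (auto simp: free_module_simps)
qed

lemma relations_finite_type: "finite_type_sheaf (open_subspace \<XX> U) relations_sheaf"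
  unfolding finite_type_sheaf_def
proof
  fix x assume "x \<in> topspace (topol (open_subspace \<XX> U))"
  then have x: "x \<in> points" "x \<in> U" by (auto simp: open_subspace_def)
  obtain A where A: "noetherian_affine A" "x \<in> A" by (rule noetherian_affine_at[OF x(1)])
  let ?V = "U \<inter> A" and ?N = "{c \<in> relations. \<forall>i<n. c i \<in> regular_on A}"
  note affine = noetherian_affineD[OF A(1)]
  have V: "open_set ?V" "?V \<noteq> {}" using open_U affine(2) x(2) A(2) by auto
  have "?N \<subseteq> coordinates ?V ` carrier (msections relations_sheaf ?V)"
  proof
    fix c assume c: "c \<in> ?N"
    have "regular_on A \<subseteq> regular_on ?V" by (rule regular_on_mono[OF affine(2) V(1) _ V(2)]) simp
    then have "\<forall>i\<in>{..<n}. c i \<in> regular_on ?V" using c by blast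
    then have "\<forall>i\<in>{..<n}. \<exists>t. t \<in> carrier (sections \<XX> ?V) \<and> section_to_K \<XX> ?V t = c i" by (metis regular_onE)
    from bchoice[OF this] obtain t where t: "\<And>i. i < n \<Longrightarrow> t i \<in> carrier (sections \<XX> ?V)"
      "\<And>i. i < n \<Longrightarrow> section_to_K \<XX> ?V (t i) = c i" by auto
    have "c \<in> carrier (free_module K n)" using c unfolding relations_def by blast
    then have eq: "coordinates ?V (\<lambda>i\<in>{..<n}. t i) = c"
      unfolding coordinates_def free_module_simps
      by (intro PiE_ext[of _ "{..<n}" "\<lambda>_. carrier K"]) (use t(2) in auto)
    have "(\<lambda>i\<in>{..<n}. t i) \<in> carrier (msections relations_sheaf ?V)"
      unfolding relation_sheaf_carrier[OF V Int_lower1] using eq c t(1) by simp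
    then show "c \<in> coordinates ?V ` carrier (msections relations_sheaf ?V)" using eq by blast
  qed
  then obtain m r where "r \<in> {..<m} \<rightarrow> carrier (msections relations_sheaf ?V)"
    "generated_over (open_subspace \<XX> U) relations_sheaf ?V m r"
    by (rule relations_sheaf.generated_over_of_finitely_generated[OF A(1) refl V(2) _
      finitely_generated_regular_relations[OF A(1)]])
      (use relations_denominator[OF A(1)] in blast, blast)
  moreover have "openin (topol (open_subspace \<XX> U)) ?V"
    using V(1) openin_open_subtopology[OF open_U] by (simp add: open_subspace_def)
  ultimately show "\<exists>V m r. openin (topol (open_subspace \<XX> U)) V \<and> x \<in> V \<and>
      r \<in> {..<m} \<rightarrow> carrier (msections relations_sheaf V) \<and> generated_over (open_subspace \<XX> U) relations_sheaf V m r"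
    using x(2) A(2) by blast
qed

end

context embedded_sheaf
begin

lemma relation_sheaf_finite_type:
  assumes V: "open_set V" "V \<subseteq> U" and s: "s \<in> {..<n} \<rightarrow> carrier (msections F V)"
  shows "finite_type_sheaf (open_subspace \<XX> V) (relation_sheaf \<XX> F V n s)"
proof (cases "V = {}")
  case True
  then show ?thesis unfolding finite_type_sheaf_def by (simp add: open_subspace_def)
next
  case False
  have "embedded_sheaf \<XX> M F \<iota> V"
  proof (intro embedded_sheaf.intro embedded_sheaf_axioms.intro)
    note sub = subset_trans[OF _ V(2)]
    show "normal_noetherian \<XX>" by (rule normal_noetherian_axioms)
    show "open_set V" by (rule V(1))
    show "module_embedding (sections \<XX> W) K (msections F W) M (section_to_K \<XX> W) (\<iota> W)"
      if "open_set W" "W \<noteq> {}" "W \<subseteq> V" for W by (rule embedding[OF that(1,2) sub[OF that(3)]])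
    show "mrestr F W W' t \<in> carrier (msections F W')" "\<iota> W' (mrestr F W W' t) = \<iota> W t"
      if "open_set W" "open_set W'" "W' \<noteq> {}" "W' \<subseteq> W" "W \<subseteq> V" "t \<in> carrier (msections F W)" for W W' t
      by (rule mrestr_closed[OF that(1-4) sub[OF that(5)] that(6)],
        rule emb_mrestr[OF that(1-4) sub[OF that(5)] that(6)])
  qed
  then interpret embedded_sheaf_sections \<XX> M F \<iota> V n s
    by (intro embedded_sheaf_sections.intro embedded_sheaf_sections_axioms.intro) (use False s in auto)
  show ?thesis by (rule relations_finite_type)
qed

end

section \<open>Coherence\<close>

context normal_noetherian
begin

lemma ord_ge_0_regular_on:
  assumes U: "open_set U" and P: "prime_divisor \<XX> P" "P \<inter> U \<noteq> {}" and a: "a \<in> regular_on U"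
  shows "a \<in> carrier K" "ord_ge P 0 a"
proof -
  have "a \<in> regular_at (gp P)"
    using regular_on_subset_regular_at[OF U prime_divisor_generic_point(4)[OF P(1) U P(2)]] a by blast
  then show "a \<in> carrier K" "ord_ge P 0 a"
    using regular_at_carrier[OF prime_divisor_generic_point(3)[OF P(1)]] ord_ge_0_iff[OF P(1)] by blast+
qed

lemma eta_notin_prime_divisor:
  assumes P: "prime_divisor \<XX> P"
  shows "\<eta> \<notin> P"
proof
  assume "\<eta> \<in> P"
  have P': "irreducible_closed (topol \<XX>) P" "codim (topol \<XX>) P = 1" using P unfolding prime_divisor_def by auto
  then have closed: "closedin (topol \<XX>) P" and "P \<noteq> points"
    using codim_eq_1D(1)[OF P'(2,1) irreducible_points] unfolding irreducible_closed_def by auto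
  moreover have "point_closure \<eta> \<subseteq> P" by (rule closure_of_minimal) (use \<open>\<eta> \<in> P\<close> closed in auto)
  ultimately show False using closedin_subset[OF closed] unfolding eta_closure by blast
qed

lemma ex_vanishing_along:
  assumes A: "noetherian_affine A" "y \<in> A" and P: "prime_divisor \<XX> P" "P \<inter> A \<noteq> {}" "y \<notin> P"
  shows "\<exists>e\<in>regular_on A. e \<in> units_at y \<and> ord_ge P (int n) e"
proof -
  note affine = noetherian_affineD[OF A(1)]
  have y: "y \<in> points" using A(2) affine(4) by blast
  let ?V = "A \<inter> (points - P)"
  have "closedin (topol \<XX>) P" using P(1) unfolding prime_divisor_def irreducible_closed_def by blast
  then have V: "open_set ?V" "?V \<subseteq> A" "y \<in> ?V" using affine(2) A(2) y P(3) by (auto simp: closedin_def)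
  obtain e where e: "e \<in> regular_on A" "e \<in> units_at y" "\<And>z. \<lbrakk>z \<in> A; e \<in> units_at z\<rbrakk> \<Longrightarrow> z \<in> ?V"
    using affine_basis[OF affine(1) V] by blast
  have "gp P \<in> A" "gp P \<in> P" using prime_divisor_generic_point(2,4)[OF P(1)] affine(2) P(2) by auto
  then have "e \<notin> units_at (gp P)" "e \<in> regular_at (gp P)"
    using e regular_on_subset_regular_at[OF affine(2)] by blast+
  note eK = units_at(2)[OF y e(2)]
  have ord_e: "ord_ge P 1 e"
    using ord_ge_1_iff[OF P(1) eK] \<open>e \<notin> units_at (gp P)\<close> \<open>e \<in> regular_at (gp P)\<close> by simp
  have "e [^]\<^bsub>K\<^esub> n \<in> regular_on A \<and> e [^]\<^bsub>K\<^esub> n \<in> units_at y \<and> ord_ge P (int n) (e [^]\<^bsub>K\<^esub> n)"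
  proof (induction n)
    case 0
    show ?case using subringE(3)[OF affine(5)] units_at(6)[OF y] ord_ge_0_regular_on(2)[OF affine(2) P(1,2)]
      by simp
  next
    case (Suc n)
    have "ord_ge P (int n + 1) (e [^]\<^bsub>K\<^esub> n \<otimes>\<^bsub>K\<^esub> e)" using ord_ge_mult[OF P(1) _ eK _ ord_e] Suc eK by simp
    then show ?case using Suc subringE(6)[OF affine(5) _ e(1)] units_at(5)[OF y _ e(2)]
      by (simp add: add.commute)
  qed
  then show ?thesis by blast
qed

lemma ex_vanishing_along_finite:
  assumes A: "noetherian_affine A" "y \<in> A"
    and S: "finite S" "\<And>P. P \<in> S \<Longrightarrow> prime_divisor \<XX> P \<and> P \<inter> A \<noteq> {} \<and> y \<notin> P"
  shows "\<exists>b\<in>regular_on A. b \<in> units_at y \<and> (\<forall>P\<in>S. ord_ge P (int (n P)) b)"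
proof -
  note affine = noetherian_affineD[OF A(1)]
  have y: "y \<in> points" using A(2) affine(4) by blast
  show ?thesis
    using S
  proof (induction S)
    case empty
    show ?case using subringE(3)[OF affine(5)] units_at(6)[OF y] by blast
  next
    case (insert P S)
    then obtain b where b: "b \<in> regular_on A" "b \<in> units_at y" "\<And>P. P \<in> S \<Longrightarrow> ord_ge P (int (n P)) b" by auto
    have P: "prime_divisor \<XX> P" "P \<inter> A \<noteq> {}" "y \<notin> P" using insert.prems by auto
    obtain e where e: "e \<in> regular_on A" "e \<in> units_at y" "ord_ge P (int (n P)) e"
      using ex_vanishing_along[OF A P] by blast
    have "ord_ge Q (int (n Q)) (b \<otimes>\<^bsub>K\<^esub> e)" if Q: "Q \<in> insert P S" for Q
    proof -
      have Q': "prime_divisor \<XX> Q" "Q \<inter> A \<noteq> {}" using insert.prems Q by auto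
      note reg = ord_ge_0_regular_on[OF affine(2) Q']
      show ?thesis
        using ord_ge_mult[OF Q'(1) reg(1)[OF b(1)] reg(1)[OF e(1)], of 0 "int (n P)"] reg(2)[OF b(1)] e(3)
          ord_ge_mult[OF Q'(1) reg(1)[OF b(1)] reg(1)[OF e(1)], of "int (n Q)" 0] reg(2)[OF e(1)] b(3) Q by auto
    qed
    then show ?case using subringE(6)[OF affine(5) b(1) e(1)] units_at(5)[OF y b(2) e(2)] by blast
  qed
qed

end

context residue_decoration
begin

definition lattice_sections :: "'x set \<Rightarrow> (('x set \<times> 'a) set \<times> ('x set \<times> 'a) set) set" where
  "lattice_sections U = {v \<in> carrier \<V>. \<forall>P. prime_divisor \<XX> P \<and> P \<inter> U \<noteq> {} \<longrightarrow> in_lattice P 0 v}"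

abbreviation "\<F> \<equiv> decoration_sheaf \<XX> \<V> \<W>"

lemma decoration_sheaf_simps:
  "U \<noteq> {} \<Longrightarrow> carrier (msections \<F> U) = lattice_sections U" "carrier (msections \<F> {}) = {\<zero>\<^bsub>\<V>\<^esub>}"
  "\<zero>\<^bsub>msections \<F> U\<^esub> = \<zero>\<^bsub>\<V>\<^esub>" "v \<oplus>\<^bsub>msections \<F> U\<^esub> w = v \<oplus>\<^bsub>\<V>\<^esub> w"
  "U \<noteq> {} \<Longrightarrow> a \<odot>\<^bsub>msections \<F> U\<^esub> v = section_to_K \<XX> U a \<odot>\<^bsub>\<V>\<^esub> v" "a \<odot>\<^bsub>msections \<F> {}\<^esub> v = \<zero>\<^bsub>\<V>\<^esub>"
  "mrestr \<F> U V v = (if V = {} then \<zero>\<^bsub>\<V>\<^esub> else v)"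
proof -
  show "carrier (msections \<F> U) = lattice_sections U" if "U \<noteq> {}"
    using that nonneg_on_decoration_iff[of _ U]
    unfolding decoration_sheaf_def lattice_sections_def by (simp cong: conj_cong)
qed (simp_all add: decoration_sheaf_def)

sublocale \<V>: Module.module K \<V>
  by (rule plane_is_module) (rule K.cring_axioms)

lemma lattice_sections_carrier: "v \<in> lattice_sections U \<Longrightarrow> v \<in> carrier \<V>"
  unfolding lattice_sections_def by blast

lemma lattice_sections_mono: "V \<subseteq> U \<Longrightarrow> lattice_sections U \<subseteq> lattice_sections V"
  unfolding lattice_sections_def by blast

lemma lattice_sections_zero: "\<zero>\<^bsub>\<V>\<^esub> \<in> lattice_sections U"
  unfolding lattice_sections_def by (simp add: plane_simps)

lemma lattice_sections_add: "\<lbrakk>v \<in> lattice_sections U; w \<in> lattice_sections U\<rbrakk> \<Longrightarrow> v \<oplus>\<^bsub>\<V>\<^esub> w \<in> lattice_sections U"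
  unfolding lattice_sections_def using in_lattice_add by blast

lemma lattice_sections_smult:
  assumes U: "open_set U" "U \<noteq> {}" and a: "a \<in> regular_on U" and v: "v \<in> lattice_sections U"
  shows "a \<odot>\<^bsub>\<V>\<^esub> v \<in> lattice_sections U"
proof -
  have "in_lattice P 0 (a \<odot>\<^bsub>\<V>\<^esub> v)" if P: "prime_divisor \<XX> P" "P \<inter> U \<noteq> {}" for P
    using in_lattice_smult[OF P(1) lattice_sections_carrier[OF v] _ ord_ge_0_regular_on[OF U(1) P a], of 0] v P
    unfolding lattice_sections_def by auto
  moreover have "a \<in> carrier K" using subringE(1)[OF regular_on_subring[OF U]] a by blast
  ultimately show ?thesis using lattice_sections_carrier[OF v] unfolding lattice_sections_def by simp
qed

sublocale \<F>: embedded_sheaf \<XX> \<V> \<F> "\<lambda>_ v. v" points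
proof (intro embedded_sheaf.intro embedded_sheaf_axioms.intro)
  show "normal_noetherian \<XX>" by (rule normal_noetherian_axioms)
  show "open_set points" by simp
  show "module_embedding (sections \<XX> V) K (msections \<F> V) \<V> (section_to_K \<XX> V) (\<lambda>v. v)"
    if V: "open_set V" "V \<noteq> {}" for V
  proof -
    have "section_to_K \<XX> V a \<odot>\<^bsub>\<V>\<^esub> v \<in> lattice_sections V" if "a \<in> carrier (sections \<XX> V)" "v \<in> lattice_sections V"
      for a v
      using lattice_sections_smult[OF V _ that(2)] that(1) unfolding regular_on_def by blast
    then show ?thesis
      using V cring_sections[OF V(1)] section_to_K_hom[OF V] \<V>.module_axioms
      by (intro module_embedding.intro) (simp_all add: decoration_sheaf_simps lattice_sections_zero
        lattice_sections_add lattice_sections_carrier)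
  qed
  show "mrestr \<F> V W t \<in> carrier (msections \<F> W)" "mrestr \<F> V W t = t"
    if "W \<noteq> {}" "W \<subseteq> V" "t \<in> carrier (msections \<F> V)" for V W t
    using that lattice_sections_mono[OF that(2)] by (cases "V = {}"; auto simp: decoration_sheaf_simps)+
qed

lemma decoration_sheaf_module:
  assumes U: "open_set U"
  shows "Module.module (sections \<XX> U) (msections \<F> U)"
proof (cases "U = {}")
  case True
  show ?thesis
  proof (rule moduleI[OF cring_sections[OF U]])
    show "abelian_group (msections \<F> U)"
      unfolding True by (rule abelian_groupI) (simp_all add: decoration_sheaf_simps)
  qed (simp_all add: True decoration_sheaf_simps)
next
  case False
  then show ?thesis using module_embedding.module[OF \<F>.embedding[OF U]] openin_subset[OF U] by blast
qed

lemma decoration_sheaf_gluing: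
  assumes U: "\<And>U. U \<in> \<U> \<Longrightarrow> open_set U" and \<sigma>: "\<And>U. U \<in> \<U> \<Longrightarrow> \<sigma> U \<in> carrier (msections \<F> U)"
    and compatible: "\<And>U V. \<lbrakk>U \<in> \<U>; V \<in> \<U>\<rbrakk> \<Longrightarrow> mrestr \<F> U (U \<inter> V) (\<sigma> U) = mrestr \<F> V (U \<inter> V) (\<sigma> V)"
  shows "\<exists>t\<in>carrier (msections \<F> (\<Union>\<U>)). \<forall>U\<in>\<U>. mrestr \<F> (\<Union>\<U>) U t = \<sigma> U"
proof (cases "\<Union>\<U> = {}")
  case True
  then have "\<forall>U\<in>\<U>. mrestr \<F> (\<Union>\<U>) U \<zero>\<^bsub>\<V>\<^esub> = \<sigma> U" using \<sigma> by (force simp: decoration_sheaf_simps)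
  then show ?thesis unfolding True decoration_sheaf_simps by blast
next
  case False
  then obtain U0 where U0: "U0 \<in> \<U>" "U0 \<noteq> {}" by blast
  have same: "\<sigma> V = \<sigma> U0" if V: "V \<in> \<U>" "V \<noteq> {}" for V
    using compatible[OF V(1) U0(1)] open_inter_nonempty[OF U[OF V(1)] V(2) U[OF U0(1)] U0(2)]
    by (simp add: decoration_sheaf_simps)
  have "in_lattice P 0 (\<sigma> U0)" if P: "prime_divisor \<XX> P" "P \<inter> \<Union>\<U> \<noteq> {}" for P
  proof -
    obtain V where V: "V \<in> \<U>" "P \<inter> V \<noteq> {}" using P(2) by blast
    then have "V \<noteq> {}" by blast
    then have "\<sigma> U0 \<in> lattice_sections V" using \<sigma>[OF V(1)] same[OF V(1)] by (simp add: decoration_sheaf_simps)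
    then show ?thesis using P(1) V(2) unfolding lattice_sections_def by blast
  qed
  moreover have "\<sigma> U0 \<in> carrier \<V>"
    using \<sigma>[OF U0(1)] lattice_sections_carrier U0(2) by (simp add: decoration_sheaf_simps)
  ultimately have "\<sigma> U0 \<in> carrier (msections \<F> (\<Union>\<U>))"
    using False unfolding lattice_sections_def by (simp add: decoration_sheaf_simps lattice_sections_def)
  moreover have "mrestr \<F> (\<Union>\<U>) V (\<sigma> U0) = \<sigma> V" if V: "V \<in> \<U>" for V
    using same[OF V] \<sigma>[OF V] by (cases "V = {}") (auto simp: decoration_sheaf_simps)
  ultimately show ?thesis by blast
qed

lemma decoration_sheaf_of_modules: "sheaf_of_modules \<XX> \<F>"
proof (intro sheaf_of_modules.intro sheaf_of_modules_axioms.intro)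
  show "ringed_space \<XX>" by (rule ringed_space_axioms)
  show "mrestr \<F> U V s \<in> carrier (msections \<F> V)"
    if "open_set U" "open_set V" "V \<subseteq> U" "s \<in> carrier (msections \<F> U)" for U V s
    using \<F>.mrestr_closed[OF that(1,2) _ that(3) openin_subset[OF that(1)] that(4)]
    by (cases "V = {}") (simp_all add: decoration_sheaf_simps)
  show "mrestr \<F> U V (s \<oplus>\<^bsub>msections \<F> U\<^esub> t) = mrestr \<F> U V s \<oplus>\<^bsub>msections \<F> V\<^esub> mrestr \<F> U V t" for U V s t
    by (cases "V = {}") (simp_all add: decoration_sheaf_simps)
  show "mrestr \<F> U V (a \<odot>\<^bsub>msections \<F> U\<^esub> s) = restr \<XX> U V a \<odot>\<^bsub>msections \<F> V\<^esub> mrestr \<F> U V s"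
    if "open_set U" "open_set V" "V \<subseteq> U" "a \<in> carrier (sections \<XX> U)" for U V a s
  proof (cases "V = {}")
    case False
    then have "U \<noteq> {}" using that(3) by blast
    then show ?thesis using section_to_K_restr[OF that(1-3) False that(4)] False
      by (simp add: decoration_sheaf_simps)
  qed (simp add: decoration_sheaf_simps)
  show "mrestr \<F> U U s = s" if "s \<in> carrier (msections \<F> U)" for U s
    using that by (cases "U = {}") (auto simp: decoration_sheaf_simps)
  show "mrestr \<F> V W (mrestr \<F> U V s) = mrestr \<F> U W s" if "W \<subseteq> V" for U V W s
    using that by (cases "V = {}") (auto simp: decoration_sheaf_simps)
  show "s = t" if "s \<in> carrier (msections \<F> (\<Union>\<U>))" "t \<in> carrier (msections \<F> (\<Union>\<U>))"
    "\<And>U. U \<in> \<U> \<Longrightarrow> mrestr \<F> (\<Union>\<U>) U s = mrestr \<F> (\<Union>\<U>) U t" for \<U> s t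
  proof (cases "\<Union>\<U> = {}")
    case True
    show ?thesis using that(1,2) unfolding True decoration_sheaf_simps by simp
  next
    case False
    then obtain U where "U \<in> \<U>" "U \<noteq> {}" by blast
    then show ?thesis using that(3)[of U] by (simp add: decoration_sheaf_simps)
  qed
qed (fact decoration_sheaf_module decoration_sheaf_gluing)+

lemma ex_lattice_denominator:
  assumes A: "noetherian_affine A"
  obtains d where "d \<in> regular_on A" "d \<noteq> \<zero>\<^bsub>K\<^esub>"
    "\<And>v. v \<in> lattice_sections A \<Longrightarrow> d \<otimes>\<^bsub>K\<^esub> fst v \<in> regular_on A \<and> d \<otimes>\<^bsub>K\<^esub> snd v \<in> regular_on A"
proof -
  note affine = noetherian_affineD[OF A]
  let ?S = "{P \<in> supp D. P \<inter> A \<noteq> {}}"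
  have "\<exists>d\<in>regular_on A. d \<in> units_at \<eta> \<and> (\<forall>P\<in>?S. ord_ge P (int 1) d)"
    by (rule ex_vanishing_along_finite[OF A eta_open[OF affine(2,3)]])
      (use supp_finite supp_prime eta_notin_prime_divisor in auto)
  then obtain d where d: "d \<in> regular_on A" "d \<in> units_at \<eta>" "\<forall>P\<in>?S. ord_ge P 1 d" by auto
  have dK: "d \<in> carrier K" "d \<noteq> \<zero>\<^bsub>K\<^esub>" using d(2) unfolding units_at_eta by auto
  have "d \<otimes>\<^bsub>K\<^esub> fst v \<in> regular_on A \<and> d \<otimes>\<^bsub>K\<^esub> snd v \<in> regular_on A" if v: "v \<in> lattice_sections A" for v
  proof -
    have carrier: "fst v \<in> carrier K" "snd v \<in> carrier K"
      using lattice_sections_carrier[OF v] unfolding plane_simps by auto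
    have "ord_ge P 0 (d \<otimes>\<^bsub>K\<^esub> fst v) \<and> ord_ge P 0 (d \<otimes>\<^bsub>K\<^esub> snd v)" if P: "prime_divisor \<XX> P" "P \<inter> A \<noteq> {}" for P
    proof -
      have "in_lattice P 0 v" using v P unfolding lattice_sections_def by blast
      then have snd: "ord_ge P (- shift P) (snd v)" and form: "ord_ge P (- shift P) (fst v \<ominus>\<^bsub>K\<^esub> H P \<otimes>\<^bsub>K\<^esub> snd v)"
        using ord_ge_mono[of P 0 _ "- shift P"] unfolding in_lattice_def by (auto simp: shift_def)
      have fst: "ord_ge P (- shift P) (fst v)" using form ord_ge_residue_form_iff[OF P(1) carrier snd] by blast
      have "ord_ge P (shift P) d"
        using d(3) ord_ge_0_regular_on(2)[OF affine(2) P d(1)] P(2) unfolding shift_def by auto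
      then show ?thesis
        using ord_ge_mult[OF P(1) dK(1) carrier(1) _ fst, of "shift P"]
          ord_ge_mult[OF P(1) dK(1) carrier(2) _ snd, of "shift P"] by simp
    qed
    then show ?thesis
      using hartogs[OF A, of "d \<otimes>\<^bsub>K\<^esub> fst v"] hartogs[OF A, of "d \<otimes>\<^bsub>K\<^esub> snd v"] ord_ge_0_iff dK(1) carrier by auto
  qed
  then show ?thesis using that[OF d(1) dK(2)] by blast
qed

lemma finitely_generated_lattice_sections:
  assumes A: "noetherian_affine A"
  shows "finitely_generated (K\<lparr>carrier := regular_on A\<rparr>) \<V> (lattice_sections A)"
    (is "finitely_generated ?A _ ?N")
proof -
  note affine = noetherian_affineD[OF A]
  note sub = subringE[OF affine(5)] and smult = lattice_sections_smult[OF affine(2,3)]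
  interpret A: Module.module ?A \<V> by (rule \<V>.restrict_scalars[OF affine(5)])
  obtain d where d: "d \<in> regular_on A" "d \<noteq> \<zero>\<^bsub>K\<^esub>"
    "\<And>v. v \<in> ?N \<Longrightarrow> d \<otimes>\<^bsub>K\<^esub> fst v \<in> regular_on A \<and> d \<otimes>\<^bsub>K\<^esub> snd v \<in> regular_on A"
    by (rule ex_lattice_denominator[OF A], rule that)
  have dK: "d \<in> carrier K" using d(1) sub(1) by blast
  have carrier: "fst v \<in> carrier K" "snd v \<in> carrier K" if "v \<in> ?N" for v
    using lattice_sections_carrier[OF that] unfolding plane_simps by auto
  have "submodule ?N ?A \<V>"
  proof (rule A.submoduleI)
    show "\<ominus>\<^bsub>\<V>\<^esub> v \<in> ?N" if "v \<in> ?N" for v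
      using smult[OF sub(5)[OF sub(3)] that] \<V>.smult_l_minus[of "\<one>\<^bsub>K\<^esub>" v] lattice_sections_carrier[OF that]
      by simp
  qed (use lattice_sections_carrier lattice_sections_zero lattice_sections_add smult in auto)
  then show ?thesis
  proof (rule A.finitely_generated_by_coordinates[OF affine(6), where n = 2
      and \<phi> = "\<lambda>i v. d \<otimes>\<^bsub>K\<^esub> (if i = 0 then fst v else snd v)"])
    fix v assume v: "v \<in> ?N" "\<forall>i<2::nat. d \<otimes>\<^bsub>K\<^esub> (if i = 0 then fst v else snd v) = \<zero>\<^bsub>?A\<^esub>"
    have "d \<otimes>\<^bsub>K\<^esub> fst v = \<zero>\<^bsub>K\<^esub>" "d \<otimes>\<^bsub>K\<^esub> snd v = \<zero>\<^bsub>K\<^esub>" using v(2)[rule_format, of 0] v(2)[rule_format, of 1] by simp_all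
    then show "v = \<zero>\<^bsub>\<V>\<^esub>" using d(2) dK carrier[OF v(1)] K.integral_iff unfolding plane_simps by (cases v) simp
  next
    fix i :: nat and a v assume "a \<in> carrier ?A" "v \<in> ?N"
    then show "d \<otimes>\<^bsub>K\<^esub> (if i = 0 then fst (a \<odot>\<^bsub>\<V>\<^esub> v) else snd (a \<odot>\<^bsub>\<V>\<^esub> v)) =
        a \<otimes>\<^bsub>?A\<^esub> (d \<otimes>\<^bsub>K\<^esub> (if i = 0 then fst v else snd v))"
      using carrier[of v] dK subsetD[OF sub(1), of a] by (simp add: plane_simps K.m_lcomm)
  qed (use d(3) dK carrier in \<open>simp_all add: plane_simps K.r_distr\<close>)
qed

lemma lattice_sections_denominator:
  assumes A: "noetherian_affine A" and V: "open_set V" "V \<subseteq> A" "y \<in> V" and t: "t \<in> lattice_sections V"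
  shows "\<exists>b\<in>units_at y. b \<odot>\<^bsub>\<V>\<^esub> t \<in> lattice_sections A"
proof (cases "t = \<zero>\<^bsub>\<V>\<^esub>")
  case True
  have "y \<in> points" using V noetherian_affineD(4)[OF A] by blast
  then show ?thesis using True units_at(6) lattice_sections_zero by (intro bexI[of _ "\<one>\<^bsub>K\<^esub>"]) auto
next
  case False
  note affine = noetherian_affineD[OF A] and t_carrier = lattice_sections_carrier[OF t]
  have y: "y \<in> A" using V by blast
  let ?S = "{P. prime_divisor \<XX> P \<and> P \<inter> A \<noteq> {} \<and> weight P t < 0}"
  have "finite ?S" by (rule finite_subset[OF _ finite_weight_nonzero[OF t_carrier False]]) auto
  moreover have "y \<notin> P" if P: "P \<in> ?S" for P
  proof -
    have "\<not> in_lattice P 0 t" using weight_ge_iff[OF _ t_carrier False, of P 0] P by auto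
    then show ?thesis using t P V(3) unfolding lattice_sections_def by blast
  qed
  ultimately have "\<exists>b\<in>regular_on A. b \<in> units_at y \<and> (\<forall>P\<in>?S. ord_ge P (int (nat (- weight P t))) b)"
    by (intro ex_vanishing_along_finite[OF A y]) auto
  then obtain b where b: "b \<in> regular_on A" "b \<in> units_at y" "\<forall>P\<in>?S. ord_ge P (int (nat (- weight P t))) b"
    by blast
  have bK: "b \<in> carrier K" using b(1) subringE(1)[OF affine(5)] by blast
  have "in_lattice P 0 (b \<odot>\<^bsub>\<V>\<^esub> t)" if P: "prime_divisor \<XX> P" "P \<inter> A \<noteq> {}" for P
  proof -
    let ?n = "min 0 (weight P t)"
    have "ord_ge P (- ?n) b"
      using b(3) P ord_ge_0_regular_on(2)[OF affine(2) P b(1)] by (cases "weight P t < 0") (auto simp: min_def)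
    moreover have "in_lattice P ?n t" using weight_ge_iff[OF P(1) t_carrier False, of ?n] by simp
    ultimately show ?thesis using in_lattice_smult[OF P(1) t_carrier _ bK, of ?n "- ?n"] by simp
  qed
  then have "b \<odot>\<^bsub>\<V>\<^esub> t \<in> lattice_sections A" unfolding lattice_sections_def using bK t_carrier by simp
  then show ?thesis using b(2) by blast
qed

lemma decoration_sheaf_finite_type: "finite_type_sheaf \<XX> \<F>"
  unfolding finite_type_sheaf_def
proof
  fix x assume x: "x \<in> points"
  obtain A where A: "noetherian_affine A" "x \<in> A" by (rule noetherian_affine_at[OF x])
  note affine = noetherian_affineD[OF A(1)]
  have inter: "A = points \<inter> A" using affine(4) by blast
  have subset: "lattice_sections A \<subseteq> (\<lambda>v. v) ` carrier (msections \<F> A)"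
    using affine(3) by (simp add: decoration_sheaf_simps)
  have denominator: "\<exists>b\<in>units_at y. b \<odot>\<^bsub>\<V>\<^esub> t \<in> lattice_sections A"
    if "open_set V" "V \<subseteq> A" "t \<in> carrier (msections \<F> V)" "y \<in> V" for V t y
  proof (rule lattice_sections_denominator[OF A(1) that(1,2,4)])
    show "t \<in> lattice_sections V" using that(3,4) decoration_sheaf_simps(1)[of V] by blast
  qed
  obtain n s where "s \<in> {..<n} \<rightarrow> carrier (msections \<F> A)" "generated_over (open_subspace \<XX> points) \<F> A n s"
    by (rule \<F>.generated_over_of_finitely_generated[OF A(1) inter affine(3) subset
        finitely_generated_lattice_sections[OF A(1)] denominator])
  moreover have "open_subspace \<XX> points = \<XX>" by (simp add: open_subspace_def)
  ultimately show "\<exists>U n s. open_set U \<and> x \<in> U \<and> s \<in> {..<n} \<rightarrow> carrier (msections \<F> U) \<and> generated_over \<XX> \<F> U n s"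
    using affine(2) A(2) by metis
qed

lemma coherent_decoration_sheaf: "coherent \<XX> \<F>"
  unfolding coherent_def
  using decoration_sheaf_of_modules decoration_sheaf_finite_type \<F>.relation_sheaf_finite_type openin_subset
  by blast

lemma weil_decoration: "weil_decoration \<XX> \<V> \<W>"
  unfolding weil_decoration_def using pre_weil_decoration coherent_decoration_sheaf by blast

end

section \<open>Varieties\<close>

lemma scalar_map_hom:
  assumes k: "cring k" and \<XX>: "ringed_space \<XX>" and \<pi>: "lrs_morphism \<XX> (Spec k) \<pi>" and U: "openin (topol \<XX>) U"
  shows "scalar_map k \<XX> \<pi> U \<in> ring_hom k (sections \<XX> U)"
proof -
  interpret ringed_space \<XX> by (rule \<XX>)
  interpret k: plain_cring k using k by (simp add: plain_cring_def)
  let ?S = "prime_spectrum k" and ?T = "topspace (topol \<XX>)"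
  have top: "topol (Spec k) = zariski_topology k" by (simp add: Spec_def)
  have S: "openin (zariski_topology k) ?S"
    using openin_topspace[of "zariski_topology k"] unfolding k.topspace_zariski .
  have cont: "continuous_map (topol \<XX>) (zariski_topology k) (pt \<pi>)"
    and pull_hom: "openin (zariski_topology k) V \<Longrightarrow>
      pull \<pi> V \<in> ring_hom (sections (Spec k) V) (sections \<XX> (preimage \<XX> \<pi> V))" for V
    using \<pi> unfolding lrs_morphism_def top by simp_all
  have "preimage \<XX> \<pi> ?S = ?T"
    using continuous_map_image_subset_topspace[OF cont] unfolding k.topspace_zariski preimage_def by blast
  then have pull: "pull \<pi> ?S \<in> ring_hom (sections (Spec k) ?S) (sections \<XX> ?T)" using pull_hom[OF S] by simp
  have T: "open_set ?T" "U \<subseteq> ?T" using openin_subset[OF U] by simp_all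
  have "scalar_map k \<XX> \<pi> U = restr \<XX> ?T U \<circ> (pull \<pi> ?S \<circ> (\<lambda>c. const_section k c ?S))"
    unfolding scalar_map_def fraction_section_def by (intro ext) simp
  then show ?thesis
    using ring_hom_trans[OF ring_hom_trans[OF k.const_section_hom[OF S] pull] restr_hom[OF T(1) U T(2)]] by simp
qed

lemma finite_type_noetherian_cover:
  assumes k: "field k" and \<XX>: "integral_scheme \<XX>" and \<pi>: "lrs_morphism \<XX> (Spec k) \<pi>"
    and finite_type: "finite_type_over k \<XX> \<pi>"
  shows "\<exists>\<U>. finite \<U> \<and> \<Union>\<U> = topspace (topol \<XX>) \<and>
    (\<forall>U\<in>\<U>. affine_open \<XX> U \<and> U \<noteq> {} \<and> noetherian_ring (sections \<XX> U))"
proof -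
  interpret k: field k by (rule k)
  obtain \<U> where cover: "finite \<U>" "\<Union>\<U> = topspace (topol \<XX>)"
    and \<U>: "\<And>U. U \<in> \<U> \<Longrightarrow> affine_open \<XX> U \<and> (\<exists>S\<subseteq>carrier (sections \<XX> U). finite S \<and>
      generate_ring (sections \<XX> U) (scalar_map k \<XX> \<pi> U ` carrier k \<union> S) = carrier (sections \<XX> U))"
    using finite_type unfolding finite_type_over_def by blast
  have "noetherian_ring (sections \<XX> U)" if U: "U \<in> \<U>" "U \<noteq> {}" for U
  proof -
    have open_U: "openin (topol \<XX>) U" using \<U>[OF U(1)] unfolding affine_open_def by blast
    interpret R: domain "sections \<XX> U" using \<XX> open_U U(2) unfolding integral_scheme_def by blast
    have "ringed_space \<XX>" using \<XX> unfolding integral_scheme_def scheme_def locally_ringed_space_def by blast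
    then have hom: "scalar_map k \<XX> \<pi> U \<in> ring_hom k (sections \<XX> U)"
      using scalar_map_hom[OF k.cring_axioms _ \<pi> open_U] by blast
    then interpret h: ring_hom_cring k "sections \<XX> U" "scalar_map k \<XX> \<pi> U" by unfold_locales
    obtain S where S: "S \<subseteq> carrier (sections \<XX> U)" "finite S"
      "generate_ring (sections \<XX> U) (scalar_map k \<XX> \<pi> U ` carrier k \<union> S) = carrier (sections \<XX> U)"
      using \<U>[OF U(1)] by blast
    show ?thesis
      by (rule R.noetherian_ring_finite_type[OF S(2,1) h.hom_image_subring
            noetherian_ring_hom_image[OF k.cring_axioms R.cring_axioms hom k.noetherian_ring_field] S(3)])
  qed
  then show ?thesis using cover \<U> by (intro exI[of _ "\<U> - {{}}"]) auto
qed

theorem theoremC: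
  fixes k :: "'k ring"
    and \<XX> :: "('x, 'a) rspace"
    and \<pi> :: "('x, 'a, 'k set, 'k set \<Rightarrow> ('k \<times> 'k) set) rmorphism"
    and D :: "'x set \<Rightarrow> int"
    and h :: "'x set \<Rightarrow> ('x set \<times> 'a) set set"
  assumes "algebraically_closed k" and "char_zero k"
    and "normal_variety k \<XX> \<pi>"
    and "snc_divisor \<XX> D"
    and "\<And>P. P \<in> supp D \<Longrightarrow> h P \<in> Units (residue_field_at \<XX> P)"
  shows "weil_decoration \<XX> (plane (function_field \<XX>)) (snc_decoration \<XX> D h)"
proof -
  have k: "field k" by (rule algebraically_closed.axioms(1)[OF assms(1)])
  have integral: "integral_scheme \<XX>" and normal: "normal_scheme \<XX>"
    and \<pi>: "lrs_morphism \<XX> (Spec k) \<pi>" and finite_type: "finite_type_over k \<XX> \<pi>"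
    using assms(3) unfolding normal_variety_def by blast+
  interpret locally_ringed_space \<XX> using normal unfolding normal_scheme_def scheme_def by blast
  interpret integral_space \<XX> by unfold_locales (rule integral)
  interpret normal_noetherian \<XX>
    by unfold_locales (rule normal, rule finite_type_noetherian_cover[OF k integral \<pi> finite_type])
  have D: "D \<in> weil_divisors \<XX>" using assms(4) unfolding snc_divisor_def by blast
  interpret residue_decoration \<XX> D h
  proof
    show "finite (supp D)" using D unfolding weil_divisors_def supp_def by blast
    show "prime_divisor \<XX> P" if "P \<in> supp D" for P using D that unfolding weil_divisors_def supp_def by blast
    show "h P \<in> carrier (residue_field_at \<XX> P)" if "P \<in> supp D" for P
      using assms(5)[OF that] unfolding Units_def by blast
  qed
  show ?thesis by (rule weil_decoration)
qed

end
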